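(* Let $0<p,q<\infty$, $\omega\in\mathcal{D}$, and let $g$ be an analytic function on $\mathbb{D}$. (1) If $p\leq q$, then the following conditions are equivalent: (a) $J_g:AT^{\infty}_p(\omega)\to AT^{\infty}_q(\omega)$ is bounded; (b) $J_g:AT^0_p(\omega)\to AT^0_q(\omega)$ is bounded; (c) $\sup_{z\in\mathbb{D}}|g'(z)|(1-|z|)\widehat{\omega}(z)^{\frac1q-\frac1p}<\infty$. Moreover, $\|J_g\|\asymp\sup_{z\in\mathbb{D}}|g'(z)|(1-|z|)\widehat{\omega}(z)^{\frac1q-\frac1p}$. (2) If $p>q$, then the following conditions are equivalent: (a) $J_g:AT^{\infty}_p(\omega)\to AT^{\infty}_q(\omega)$ is bounded; (b) $J_g:AT^0_p(\omega)\to AT^0_q(\omega)$ is bounded; (c) $g\in AT^{\infty}_{\frac{pq}{p-q}}(\omega)$. Moreover, $\|J_g\|\asymp\|g-g(0)\|_{AT^{\infty}_{\frac{pq}{p-q}}(\omega)}$. Here $\|J_g\|$ is the operator norm of $J_g:AT^{\infty}_p(\omega)\to AT^{\infty}_q(\omega)$, and the constants implied by $\asymp$ do not depend on $g$.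
   Context: $\mathbb{D}$ is the open unit disk of $\mathbb{C}$, $dA$ is Lebesgue area measure on $\mathbb{D}$, and $\mathcal{H}(\mathbb{D})$ is the space of analytic functions on $\mathbb{D}$. Volterra operator: for $g\in\mathcal{H}(\mathbb{D})$, $J_gf(z)=\int_0^zf(\zeta)g'(\zeta)\,d\zeta$ for $z\in\mathbb{D}$, $f\in\mathcal{H}(\mathbb{D})$. Weights: a weight is a function $\omega:\mathbb{D}\to[0,\infty)$ integrable over $\mathbb{D}$ and not a.e. zero; it is radial if $\omega(z)=\omega(|z|)$ for all $z$. For a radial weight put $\widehat{\omega}(z)=\int_{|z|}^1\omega(s)\,ds$. A radial weight $\omega$ is in $\widehat{\mathcal{D}}$ if there is $C\ge1$ with $\widehat{\omega}(r)\le C\widehat{\omega}\left(\frac{1+r}{2}\right)$ for all $0\le r<1$; it is in $\check{\mathcal{D}}$ if there are $K>1$ and $C>1$ with $\widehat{\omega}(r)\ge C\widehat{\omega}\left(1-\frac{1-r}{K}\right)$ for all $0\le r<1$. $\mathcal{D}:=\widehat{\mathcal{D}}\cap\check{\mathcal{D}}$. Tent spaces: the Carleson squares are $S(0):=\mathbb{D}$ and $S(re^{i\theta}):=\{\rho e^{it}:r\le\rho<1,\ |t-\theta|\le\frac{1-r}{2}\}$ for $0<r<1$. For $0<q<\infty$, $T^{\infty}_q(\omega)$ consists of the measurable functions $f$ on $\mathbb{D}$ with $$\|f\|_{T^{\infty}_q(\omega)}:=\sup_{a\in\mathbb{D}}\left(\frac{1}{1-|a|}\int_{S(a)}|f|^q\,\omega\,dA\right)^{1/q}<\infty,$$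 and $T^0_q(\omega)$ is the subspace of those $f\in T^{\infty}_q(\omega)$ with $\lim_{|a|\to1^-}\frac{1}{1-|a|}\int_{S(a)}|f|^q\,\omega\,dA=0$. Set $AT^{\infty}_q(\omega):=T^{\infty}_q(\omega)\cap\mathcal{H}(\mathbb{D})$ and $AT^0_q(\omega):=T^0_q(\omega)\cap\mathcal{H}(\mathbb{D})$, with the inherited (quasi-)norm. $A\asymp B$ means $C^{-1}A\le B\le CA$ for a constant $C>0$ (here depending only on $p,q,\omega$). *)

theory Defs
  imports "HOL-Complex_Analysis.Complex_Analysis"
begin

text \<open>
  Functions on the unit disk are total functions on \<^typ>\<open>complex\<close>; their values
  outside the disk are never used.
\<close>

abbreviation unit_disk :: "complex set"
  where "unit_disk \<equiv> ball 0 1"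

definition volterra :: "(complex \<Rightarrow> complex) \<Rightarrow> (complex \<Rightarrow> complex) \<Rightarrow> complex \<Rightarrow> complex"
  where "volterra g f z = contour_integral (linepath 0 z) (\<lambda>\<zeta>. f \<zeta> * deriv g \<zeta>)"


subsection \<open>Radial weights\<close>

definition weight :: "(complex \<Rightarrow> real) \<Rightarrow> bool"
  where "weight \<omega> \<longleftrightarrow>
    (\<forall>z\<in>unit_disk. 0 \<le> \<omega> z) \<and>
    integrable (lebesgue_on unit_disk) \<omega> \<and>
    \<not> (AE z in lebesgue_on unit_disk. \<omega> z = 0)"

definition radial_weight :: "(complex \<Rightarrow> real) \<Rightarrow> bool"
  where "radial_weight \<omega> \<longleftrightarrow> weight \<omega> \<and> (\<forall>z\<in>unit_disk. \<omega> z = \<omega> (of_real (cmod z)))"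

text \<open>
  The tail integral is extended-valued: integrability of a radial weight over the disk
  gives finiteness for \<open>z \<noteq> 0\<close> only, and at \<open>z = 0\<close> the value may be \<open>\<infinity>\<close>
  (it is finite for weights in the upper doubling class below).
\<close>

definition omega_hat :: "(complex \<Rightarrow> real) \<Rightarrow> complex \<Rightarrow> ennreal"
  where "omega_hat \<omega> z = (\<integral>\<^sup>+ s \<in> {cmod z..<1}. ennreal (\<omega> (of_real s)) \<partial>lebesgue)"

definition D_hat :: "(complex \<Rightarrow> real) set"
  where "D_hat = {\<omega>. radial_weight \<omega> \<and>
    (\<exists>C::real. C \<ge> 1 \<and>
      (\<forall>r\<in>{0..<1::real}.
        omega_hat \<omega> (of_real r) \<le> ennreal C * omega_hat \<omega> (of_real ((1 + r) / 2))))}"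

definition D_check :: "(complex \<Rightarrow> real) set"
  where "D_check = {\<omega>. radial_weight \<omega> \<and>
    (\<exists>K C::real. K > 1 \<and> C > 1 \<and>
      (\<forall>r\<in>{0..<1::real}.
        omega_hat \<omega> (of_real r) \<ge> ennreal C * omega_hat \<omega> (of_real (1 - (1 - r) / K))))}"

definition D_class :: "(complex \<Rightarrow> real) set"
  where "D_class = D_hat \<inter> D_check"


subsection \<open>Tent spaces\<close>

text \<open>
  The angle \<open>t\<close> ranges over all reals, so the choice of the argument of \<open>a\<close> is immaterial.
\<close>

definition carleson_square :: "complex \<Rightarrow> complex set"
  where "carleson_square a =
    (if a = 0 then unit_disk
     else {rcis \<rho> t | \<rho> t. cmod a \<le> \<rho> \<and> \<rho> < 1 \<and> \<bar>t - Arg a\<bar> \<le> (1 - cmod a) / 2})"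

definition tent_mean :: "real \<Rightarrow> (complex \<Rightarrow> real) \<Rightarrow> (complex \<Rightarrow> complex) \<Rightarrow> complex \<Rightarrow> ennreal"
  where "tent_mean q \<omega> f a =
    ennreal (1 / (1 - cmod a)) *
    (\<integral>\<^sup>+ z \<in> carleson_square a. ennreal (cmod (f z) powr q * \<omega> z) \<partial>lebesgue)"

definition ennreal_powr :: "ennreal \<Rightarrow> real \<Rightarrow> ennreal"  \<comment> \<open>meant for positive exponents\<close>
  where "ennreal_powr x s = (if x = \<infinity> then \<infinity> else ennreal (enn2real x powr s))"

definition tent_norm :: "real \<Rightarrow> (complex \<Rightarrow> real) \<Rightarrow> (complex \<Rightarrow> complex) \<Rightarrow> ennreal"
  where "tent_norm q \<omega> f = (SUP a\<in>unit_disk. ennreal_powr (tent_mean q \<omega> f a) (1 / q))"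

definition T_inf :: "real \<Rightarrow> (complex \<Rightarrow> real) \<Rightarrow> (complex \<Rightarrow> complex) set"
  where "T_inf q \<omega> = {f \<in> borel_measurable (lebesgue_on unit_disk). tent_norm q \<omega> f < \<infinity>}"

definition T_zero :: "real \<Rightarrow> (complex \<Rightarrow> real) \<Rightarrow> (complex \<Rightarrow> complex) set"
  where "T_zero q \<omega> =
    {f \<in> T_inf q \<omega>. (tent_mean q \<omega> f \<longlongrightarrow> 0) (filtercomap cmod (at_left 1))}"

definition AT_inf :: "real \<Rightarrow> (complex \<Rightarrow> real) \<Rightarrow> (complex \<Rightarrow> complex) set"
  where "AT_inf q \<omega> = T_inf q \<omega> \<inter> {f. f holomorphic_on unit_disk}"

definition AT_zero :: "real \<Rightarrow> (complex \<Rightarrow> real) \<Rightarrow> (complex \<Rightarrow> complex) set"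
  where "AT_zero q \<omega> = T_zero q \<omega> \<inter> {f. f holomorphic_on unit_disk}"


subsection \<open>Bounded operators between quasi-normed function spaces\<close>

definition bounded_operator ::
  "'f set \<Rightarrow> ('f \<Rightarrow> ennreal) \<Rightarrow> 'h set \<Rightarrow> ('h \<Rightarrow> ennreal) \<Rightarrow> ('f \<Rightarrow> 'h) \<Rightarrow> bool"
  where "bounded_operator X N Y M T \<longleftrightarrow>
    (\<forall>f\<in>X. T f \<in> Y) \<and> (\<exists>C::real. \<forall>f\<in>X. M (T f) \<le> ennreal C * N f)"

definition operator_norm ::
  "'f set \<Rightarrow> ('f \<Rightarrow> ennreal) \<Rightarrow> ('h \<Rightarrow> ennreal) \<Rightarrow> ('f \<Rightarrow> 'h) \<Rightarrow> ennreal"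
  where "operator_norm X N M T = (SUP f\<in>{f\<in>X. N f \<le> 1}. M (T f))"

definition bloch_sup :: "real \<Rightarrow> real \<Rightarrow> (complex \<Rightarrow> real) \<Rightarrow> (complex \<Rightarrow> complex) \<Rightarrow> ennreal"
  where "bloch_sup p q \<omega> g =
    (SUP z\<in>unit_disk. ennreal (cmod (deriv g z) * (1 - cmod z)
                        * enn2real (omega_hat \<omega> z) powr (1 / q - 1 / p)))"

definition comparable_within :: "real \<Rightarrow> ennreal \<Rightarrow> ennreal \<Rightarrow> bool"
  where "comparable_within C A B \<longleftrightarrow> ennreal (1 / C) * A \<le> B \<and> B \<le> ennreal C * A"

end

(*
  Write k_a(z) = (1-|a|)/|1 - conj(a) z| and W(z) = omega_hat(z)/(1-|z|).  By subharmonicity of |f|^q,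
  the Carleson condition for |f|^q omega is equivalent to  int k_b^M |f|^q W <= C (1-|b|)  for all b,
  for a fixed M > 1, and the "little oh" conditions correspond as well.  The doubling conditions turn
  omega_hat into a quantity that is pinched between powers of 1-|z|, and a Schur test with an explicit
  kernel yields the Littlewood-Paley equivalence of int k_b^M |F - F(0)|^q W with
  int k_b^M |F'|^q (1-|z|)^q W.  Since (J_g f)' = f g', boundedness of J_g becomes a Carleson embedding
  for |f|^q |g'|^q (1-|z|)^q W.  Sufficiency is a pointwise bound (p <= q) or Young's inequality with a
  free parameter (p > q).  For necessity one tests with a single power of the kernel (p <= q), or with
  sums of kernel powers over a hyperbolic lattice: averaging over random signs (Luecking's argument)
  gives a discrete inequality which is self-improving and leads to the exponent pq/(p-q).  All test
  functions lie in the little tent space, so both versions of J_g are characterized at once.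
*)
theory Submission imports Defs begin

text \<open>Since p and q may be less than 1, neither duality nor Minkowski's inequality is
  available in general: sums are raised to a power through \<open>sum_powr_le\<close>, and |f|^q is
  controlled only by its sub-mean value property. The weight may vanish on annuli, so it is never
  compared pointwise with W; the passage between the two goes through averages of |f|^q.

  The estimates share one budget of exponents. If \<alpha> is the lower growth exponent of
  omega_hat, comparing omega_hat at two points gains a factor (1-|z|)^\<alpha>. Half of it pays for
  summing over scales, or over the nodes of a test function; the other half leaves the integrable
  density (1-|z|)^(\<alpha>/2 - 1). The exponent M of the kernel mean must exceed 1, so that
  Carleson squares control kernel means, and must stay below 1 + \<alpha>/2, so that k_b^M survives
  integration against that density; hence M = 1 + \<alpha>/4.

  For p > q no single kernel is a sufficient test: a bound on |f g'|^q has to become one on |g'|^s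
  with s = pq/(p-q) > q, which forces coefficients that depend on g itself.\<close>

abbreviation (input) hol :: "(complex \<Rightarrow> complex) \<Rightarrow> bool"
  where "hol f \<equiv> f holomorphic_on unit_disk"

subsection \<open>The kernel\<close>

definition kap :: "complex \<Rightarrow> complex \<Rightarrow> real"
  where "kap a z = (1 - cmod a) / cmod (1 - cnj a * z)"

lemma cmod_kernel_commute: "cmod (1 - cnj a * z) = cmod (1 - cnj z * a)"
proof -
  have "cmod (1 - cnj z * a) = cmod (cnj (1 - cnj z * a))" by (simp only: complex_mod_cnj)
  also have "cnj (1 - cnj z * a) = 1 - cnj a * z" by simp
  finally show ?thesis by simp
qed

lemma cmod_kernel_ge:
  assumes "cmod a < 1" "cmod z < 1"
  shows "1 - cmod a \<le> cmod (1 - cnj a * z)" "1 - cmod z \<le> cmod (1 - cnj a * z)"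
proof -
  have *: "1 - cmod a * cmod z \<le> cmod (1 - cnj a * z)"
    using norm_triangle_ineq2[of 1 "cnj a * z"] by (simp add: norm_mult)
  have "cmod a * cmod z \<le> cmod a" "cmod a * cmod z \<le> cmod z"
    using assms by (simp_all add: mult_left_le mult_left_le_one_le)
  with * show "1 - cmod a \<le> cmod (1 - cnj a * z)" "1 - cmod z \<le> cmod (1 - cnj a * z)" by auto
qed

lemma cmod_kernel_pos:
  assumes "cmod a < 1" "cmod z < 1"
  shows "0 < cmod (1 - cnj a * z)"
  using cmod_kernel_ge(1)[OF assms] assms by linarith

text \<open>The difference of the squares is (1-|z|^2)(1-|a|^2): the pseudohyperbolic distance of
  two points of the disk is less than 1.\<close>

lemma cmod_diff_le_kernel:
  assumes "cmod a < 1" "cmod z < 1"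
  shows "cmod (z - a) \<le> cmod (1 - cnj z * a)"
proof -
  have "cmod (1 - cnj z * a)^2 - cmod (z - a)^2 = (1 - cmod z^2) * (1 - cmod a^2)"
    by (simp only: cmod_power2) (simp add: algebra_simps power2_eq_square)
  moreover have "... \<ge> 0"
    using assms by (intro mult_nonneg_nonneg) (auto simp: power_le_one)
  ultimately have "cmod (z - a)^2 \<le> cmod (1 - cnj z * a)^2" by linarith
  thus ?thesis by (rule power2_le_imp_le) simp
qed

text \<open>Moving the argument of the kernel costs at most |z - a|, which the previous bound
  absorbs into a kernel term. So |1 - conj(a) z| obeys a triangle inequality with constant 1,
  although it does not vanish for a = z.\<close>

lemma cmod_kernel_triangle:
  assumes "cmod a < 1" "cmod b < 1" "cmod z < 1"
  shows "cmod (1 - cnj b * a) \<le> cmod (1 - cnj b * z) + cmod (1 - cnj z * a)"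
proof -
  have "1 - cnj b * a = (1 - cnj b * z) + cnj b * (z - a)" by (simp add: algebra_simps)
  hence "cmod (1 - cnj b * a) \<le> cmod (1 - cnj b * z) + cmod b * cmod (z - a)"
    by (metis norm_triangle_ineq norm_mult complex_mod_cnj)
  also have "cmod b * cmod (z - a) \<le> cmod (z - a)" using assms by (simp add: mult_left_le_one_le)
  also have "... \<le> cmod (1 - cnj z * a)" using assms by (intro cmod_diff_le_kernel)
  finally show ?thesis by simp
qed

lemma kap_pos:
  assumes "cmod a < 1" "cmod z < 1" shows "0 < kap a z"
  using cmod_kernel_pos[OF assms] assms unfolding kap_def by simp

lemma kap_le_1:
  assumes "cmod a < 1" "cmod z < 1" shows "kap a z \<le> 1"
  using cmod_kernel_ge(1)[OF assms] cmod_kernel_pos[OF assms] unfolding kap_def by simp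

text \<open>This is the device for moving a kernel from one point to another: where
  \<open>kap z a\<close> is bounded below, \<open>kap b z\<close> is at most a constant times
  \<open>kap b a\<close>. The later constants 22 and 8 are 2 * 11 and 2 * 4, from the lower bounds
  1/11 and 1/4.\<close>

lemma kap_triangle:
  assumes "cmod a < 1" "cmod b < 1" "cmod z < 1"
  shows "kap b z * kap z a \<le> 2 * kap b a"
proof -
  define X Y d where "X = cmod (1 - cnj b * z)" and "Y = cmod (1 - cnj z * a)"
    and "d = cmod (1 - cnj b * a)"
  have pos: "X > 0" "Y > 0" "d > 0" unfolding X_def Y_def d_def using assms by (intro cmod_kernel_pos; simp)+
  have XY: "1 - cmod z \<le> X" "1 - cmod z \<le> Y" unfolding X_def Y_def using assms by (auto intro: cmod_kernel_ge)
  have d: "d \<le> X + Y" unfolding d_def X_def Y_def using assms by (intro cmod_kernel_triangle)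
  have "(1 - cmod z) * d \<le> (1 - cmod z) * (X + Y)" using d assms by (intro mult_left_mono) auto
  also have "... = (1 - cmod z) * X + (1 - cmod z) * Y" by (simp add: algebra_simps)
  also have "... \<le> Y * X + X * Y" using XY pos by (intro add_mono mult_right_mono) auto
  finally have "(1 - cmod z) * d \<le> 2 * (X * Y)" by simp
  hence "(1 - cmod z) / (X * Y) \<le> 2 / d" using pos by (simp add: field_simps)
  hence "(1 - cmod b) * ((1 - cmod z) / (X * Y)) \<le> (1 - cmod b) * (2 / d)"
    using assms by (intro mult_left_mono) auto
  thus ?thesis by (simp add: kap_def X_def Y_def d_def mult_ac)
qed

lemma kap_ratio:
  assumes "cmod a < 1" "cmod z < 1"
  shows "(1 - cmod z) / (1 - cmod a) * kap a z \<le> 1"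
  using cmod_kernel_ge(2)[OF assms] cmod_kernel_pos[OF assms] assms
  unfolding kap_def by simp

lemma kap_swap:
  assumes "cmod a < 1" "cmod z < 1"
  shows "kap z a = (1 - cmod z) / (1 - cmod a) * kap a z"
  using assms unfolding kap_def cmod_kernel_commute[of z a] by simp

text \<open>The radius 3/4 (1-|z|) leaves room for a disc of radius (1-|z|)/4 around every point of
  the half-radius disc. Inside it |1 - conj(z) w| is at most (2 + 3/4)(1-|z|) and 1-|w| is at least
  (1-|z|)/4; the quotient is 1/11.\<close>

lemma kap_local:
  assumes "cmod z < 1" "cmod (z - w) \<le> 3/4 * (1 - cmod z)"
  shows "cmod w < 1" "kap z w \<ge> 1/11" "kap w z \<ge> 1/11"
    "1 - cmod w \<ge> (1 - cmod z) / 4" "1 - cmod w \<le> 7/4 * (1 - cmod z)"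
proof -
  have a: "cmod z - cmod w \<le> 3/4 * (1 - cmod z)" "cmod w - cmod z \<le> 3/4 * (1 - cmod z)"
    using norm_triangle_ineq2[of z w] norm_triangle_ineq2[of w z] assms by (simp_all add: norm_minus_commute)
  have b1: "1 - cmod w \<ge> (1 - cmod z) / 4" using a by (simp add: field_simps)
  have b2: "1 - cmod w \<le> 7/4 * (1 - cmod z)" using a by (simp add: field_simps)
  show b: "1 - cmod w \<ge> (1 - cmod z) / 4" "1 - cmod w \<le> 7/4 * (1 - cmod z)" by fact+
  show w: "cmod w < 1" using b assms by simp
  have "1 - cnj z * w = (1 - cnj z * z) + cnj z * (z - w)" by (simp add: algebra_simps)
  hence "cmod (1 - cnj z * w) \<le> cmod (1 - cnj z * z) + cmod z * cmod (z - w)"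
    by (metis norm_triangle_ineq norm_mult complex_mod_cnj)
  also have "cmod z * cmod (z - w) \<le> cmod (z - w)" using assms by (simp add: mult_left_le_one_le)
  also have "cmod (1 - cnj z * z) = 1 - cmod z^2"
  proof -
    have "1 - cnj z * z = of_real (1 - cmod z^2)" using complex_norm_square[of z] by (simp add: mult.commute)
    thus ?thesis using assms by (simp add: power_le_one del: of_real_diff)
  qed
  also have "1 - cmod z^2 \<le> 2 * (1 - cmod z)"
    using assms zero_le_power2[of "1 - cmod z"] by (simp add: power2_eq_square algebra_simps)
  finally have c: "cmod (1 - cnj z * w) \<le> 11/4 * (1 - cmod z)" using assms by simp
  have p: "0 < cmod (1 - cnj z * w)" using assms w by (intro cmod_kernel_pos)
  show "kap z w \<ge> 1/11" using c p assms unfolding kap_def by (simp add: field_simps)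
  show "kap w z \<ge> 1/11" using c p assms b unfolding kap_def cmod_kernel_commute[of w z]
    by (simp add: field_simps)
qed

lemma kap_measurable [measurable]:
  "(\<lambda>z. kap a z) \<in> borel_measurable borel" "(\<lambda>a. kap a z) \<in> borel_measurable borel"
  "case_prod kap \<in> borel_measurable (borel \<Otimes>\<^sub>M borel)"
proof -
  have [measurable]: "cnj \<in> borel_measurable borel" by (intro borel_measurable_continuous_onI continuous_intros)
  show "(\<lambda>z. kap a z) \<in> borel_measurable borel" "(\<lambda>a. kap a z) \<in> borel_measurable borel"
    "case_prod kap \<in> borel_measurable (borel \<Otimes>\<^sub>M borel)" unfolding kap_def by measurable
qed

subsection \<open>Rotation invariance and radial integration\<close>

lemma Complex_measurable [measurable (raw)]:
  assumes "f \<in> borel_measurable M" "g \<in> borel_measurable M"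
  shows "(\<lambda>x. Complex (f x) (g x)) \<in> borel_measurable M"
proof -
  have "(\<lambda>p::real \<times> real. Complex (fst p) (snd p)) \<in> borel_measurable borel"
    unfolding Complex_eq by (intro borel_measurable_continuous_onI continuous_intros)
  from measurable_compose[OF measurable_Pair[OF assms], unfolded borel_prod, OF this] show ?thesis by simp
qed

lemma lborel_complex_eq: "distr (lborel \<Otimes>\<^sub>M lborel) borel (\<lambda>(x, y). Complex x y) = lborel"
proof (rule lborel_eqI[symmetric])
  fix l u :: complex assume le: "\<And>b. b \<in> Basis \<Longrightarrow> l \<bullet> b \<le> u \<bullet> b"
  from le[of 1] le[of \<i>] have le': "Re l \<le> Re u" "Im l \<le> Im u" by (simp_all add: Basis_complex_def)
  have *: "(\<lambda>(x, y). Complex x y) -` box l u \<inter> space (lborel \<Otimes>\<^sub>M lborel) = {Re l<..<Re u} \<times> {Im l<..<Im u}"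
    by (auto simp: space_pair_measure box_def Basis_complex_def)
  have "emeasure (distr (lborel \<Otimes>\<^sub>M lborel) borel (\<lambda>(x, y). Complex x y)) (box l u) =
      emeasure (lborel \<Otimes>\<^sub>M lborel) ({Re l<..<Re u} \<times> {Im l<..<Im u})"
    by (subst emeasure_distr) (auto simp: * )
  also have "... = ennreal (Re u - Re l) * ennreal (Im u - Im l)"
    by (subst lborel.emeasure_pair_measure_Times) (auto simp: le')
  also have "... = (\<Prod>b\<in>Basis. (u - l) \<bullet> b)"
    using le' by (simp add: Basis_complex_def ennreal_mult)
  finally show "emeasure (distr (lborel \<Otimes>\<^sub>M lborel) borel (\<lambda>(x, y). Complex x y)) (box l u) = (\<Prod>b\<in>Basis. (u - l) \<bullet> b)" .
qed simp

lemma nn_integral_complex: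
  assumes [measurable]: "h \<in> borel_measurable borel"
  shows "(\<integral>\<^sup>+z. h z \<partial>lborel) = (\<integral>\<^sup>+x. \<integral>\<^sup>+y. h (Complex x y) \<partial>lborel \<partial>lborel)"
    "(\<integral>\<^sup>+z. h z \<partial>lborel) = (\<integral>\<^sup>+y. \<integral>\<^sup>+x. h (Complex x y) \<partial>lborel \<partial>lborel)"
proof -
  have "(\<integral>\<^sup>+z. h z \<partial>lborel) = (\<integral>\<^sup>+z. h z \<partial>distr (lborel \<Otimes>\<^sub>M lborel) borel (\<lambda>(x, y). Complex x y))"
    by (simp only: lborel_complex_eq)
  also have "... = (\<integral>\<^sup>+p. h (Complex (fst p) (snd p)) \<partial>(lborel \<Otimes>\<^sub>M lborel))"
    by (subst nn_integral_distr) (auto simp: case_prod_beta)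
  finally have *: "(\<integral>\<^sup>+z. h z \<partial>lborel) = (\<integral>\<^sup>+p. h (Complex (fst p) (snd p)) \<partial>(lborel \<Otimes>\<^sub>M lborel))" .
  show "(\<integral>\<^sup>+z. h z \<partial>lborel) = (\<integral>\<^sup>+x. \<integral>\<^sup>+y. h (Complex x y) \<partial>lborel \<partial>lborel)"
    unfolding * by (subst lborel.nn_integral_fst[symmetric]) auto
  show "(\<integral>\<^sup>+z. h z \<partial>lborel) = (\<integral>\<^sup>+y. \<integral>\<^sup>+x. h (Complex x y) \<partial>lborel \<partial>lborel)"
    unfolding * by (subst lborel_pair.nn_integral_snd[symmetric]) auto
qed

lemma nn_integral_shear:
  assumes [measurable]: "h \<in> borel_measurable borel"
  shows "(\<integral>\<^sup>+z. h (Complex (Re z + k * Im z) (Im z)) \<partial>lborel) = (\<integral>\<^sup>+z. h z \<partial>lborel)"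
    "(\<integral>\<^sup>+z. h (Complex (Re z) (Im z + k * Re z)) \<partial>lborel) = (\<integral>\<^sup>+z. h z \<partial>lborel)"
proof -
  have sh: "(\<integral>\<^sup>+x. f (x + c) \<partial>lborel) = (\<integral>\<^sup>+x. f x \<partial>lborel)"
    if "f \<in> borel_measurable borel" for f :: "real \<Rightarrow> ennreal" and c
    using nn_integral_real_affine[OF that, of 1 c] by (simp add: add.commute)
  show "(\<integral>\<^sup>+z. h (Complex (Re z + k * Im z) (Im z)) \<partial>lborel) = (\<integral>\<^sup>+z. h z \<partial>lborel)"
    by (subst (1 2) nn_integral_complex(2)) (auto intro!: nn_integral_cong sh[where f = "\<lambda>x. h (Complex x _)"])
  show "(\<integral>\<^sup>+z. h (Complex (Re z) (Im z + k * Re z)) \<partial>lborel) = (\<integral>\<^sup>+z. h z \<partial>lborel)"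
    by (subst (1 2) nn_integral_complex(1)) (auto intro!: nn_integral_cong sh[where f = "\<lambda>y. h (Complex _ y)"])
qed

text \<open>A rotation is a product of three shears, horizontal, vertical, horizontal, and shears
  preserve Lebesgue measure by Fubini and translation invariance on lines. The outer shears have
  parameter - tan(t/2), hence the hypothesis on cos(t/2).\<close>

lemma nn_integral_rotation_aux:
  assumes [measurable]: "h \<in> borel_measurable borel" and c: "cos (t/2) \<noteq> 0"
  shows "(\<integral>\<^sup>+z. h (cis t * z) \<partial>lborel) = (\<integral>\<^sup>+z. h z \<partial>lborel)"
proof -
  define k s where "k = - tan (t/2)" and "s = sin t"
  have s: "s = 2 * sin (t/2) * cos (t/2)" unfolding s_def using sin_double[of "t/2"] by simp
  have ks: "k * s = cos t - 1"
    unfolding k_def s tan_def using c cos_double_sin[of "t/2"]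
    by (simp add: power2_eq_square)
  have k2: "2 * k + k * (k * s) = - s"
  proof -
    have "2 * k + k * (k * s) = k * (1 + cos t)" by (simp add: ks algebra_simps)
    also have "1 + cos t = 2 * cos (t/2)^2" using cos_double_cos[of "t/2"] by simp
    also have "k * (2 * cos (t/2)^2) = - s"
      unfolding k_def s tan_def using c by (simp add: field_simps power2_eq_square)
    finally show ?thesis .
  qed
  define A where "A = (\<lambda>z. Complex (Re z + k * Im z) (Im z))"
  define B where "B = (\<lambda>z. Complex (Re z) (Im z + s * Re z))"
  have [measurable]: "A \<in> borel_measurable borel" "B \<in> borel_measurable borel"
    unfolding A_def B_def by measurable
  have "cis t * z = A (B (A z))" for z
  proof (rule complex_eqI)
    have "Re (A (B (A z))) = Re z * (1 + k * s) + Im z * (2 * k + k * (k * s))"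
      by (simp add: A_def B_def algebra_simps)
    also have "... = Re z * (1 + k * s) + Im z * (- s)" by (simp only: k2)
    also have "... = Re (cis t * z)" by (simp only: ks) (simp add: s_def algebra_simps)
    finally show "Re (cis t * z) = Re (A (B (A z)))" ..
    have "Im (A (B (A z))) = Im z * (1 + k * s) + s * Re z"
      by (simp add: A_def B_def algebra_simps)
    thus "Im (cis t * z) = Im (A (B (A z)))" by (simp only: ks) (simp add: s_def algebra_simps)
  qed
  hence "(\<integral>\<^sup>+z. h (cis t * z) \<partial>lborel) = (\<integral>\<^sup>+z. h (A (B (A z))) \<partial>lborel)" by simp
  also have "... = (\<integral>\<^sup>+z. h (A (B z)) \<partial>lborel)"
    using nn_integral_shear(1)[of "\<lambda>z. h (A (B z))" k] unfolding A_def[symmetric] by (simp add: A_def)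
  also have "... = (\<integral>\<^sup>+z. h (A z) \<partial>lborel)"
    using nn_integral_shear(2)[of "\<lambda>z. h (A z)" s] by (simp add: B_def)
  also have "... = (\<integral>\<^sup>+z. h z \<partial>lborel)"
    using nn_integral_shear(1)[of "\<lambda>z. h z" k] by (simp add: A_def)
  finally show ?thesis .
qed

lemma nn_integral_rotation:
  assumes [measurable]: "h \<in> borel_measurable borel"
  shows "(\<integral>\<^sup>+z. h (cis t * z) \<partial>lborel) = (\<integral>\<^sup>+z. h z \<partial>lborel)"
proof (cases "cos (t/2) = 0")
  case False thus ?thesis by (intro nn_integral_rotation_aux) auto
next
  case True
  \<comment> \<open>The rotation by t is done as two rotations by t/2; cos(t/4) = 0 would give
    cos(t/2) = -1.\<close>
  hence *: "cos ((t/2)/2) \<noteq> 0" using cos_double_cos[of "(t/2)/2"] by auto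
  have "(\<integral>\<^sup>+z. h (cis t * z) \<partial>lborel) = (\<integral>\<^sup>+z. h (cis (t/2) * (cis (t/2) * z)) \<partial>lborel)"
    by (simp add: cis_mult mult.assoc[symmetric])
  also have "... = (\<integral>\<^sup>+z. h (cis (t/2) * z) \<partial>lborel)"
    by (rule nn_integral_rotation_aux[where h = "\<lambda>z. h (cis (t/2) * z)"]) (use * in auto)
  also have "... = (\<integral>\<^sup>+z. h z \<partial>lborel)" by (intro nn_integral_rotation_aux) (use * in auto)
  finally show ?thesis .
qed

lemma cis_measurable [measurable]: "cis \<in> borel_measurable borel"
  by (intro borel_measurable_continuous_onI continuous_intros)

text \<open>Fubini and rotation invariance give a substitute for polar coordinates: an integral over
  the plane may be replaced by one of angular means, with any measurable choice of the
  angle.\<close>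

lemma nn_integral_rotation_average:
  assumes [measurable]: "h \<in> borel_measurable borel" "A \<in> sets borel" "\<tau> \<in> borel_measurable borel"
  shows "(\<integral>\<^sup>+z. (\<integral>\<^sup>+t\<in>A. h (cis (\<tau> t) * z) \<partial>lborel) \<partial>lborel) = emeasure lborel A * (\<integral>\<^sup>+z. h z \<partial>lborel)"
proof -
  have "(\<integral>\<^sup>+z. (\<integral>\<^sup>+t\<in>A. h (cis (\<tau> t) * z) \<partial>lborel) \<partial>lborel) = (\<integral>\<^sup>+t. (\<integral>\<^sup>+z. h (cis (\<tau> t) * z) * indicator A t \<partial>lborel) \<partial>lborel)"
    by (rule lborel_pair.Fubini') measurable
  also have "... = (\<integral>\<^sup>+t. (\<integral>\<^sup>+z. h z \<partial>lborel) * indicator A t \<partial>lborel)"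
    by (intro nn_integral_cong) (simp add: nn_integral_multc nn_integral_rotation)
  also have "... = emeasure lborel A * (\<integral>\<^sup>+z. h z \<partial>lborel)"
    by (subst nn_integral_cmult) (auto simp: mult.commute)
  finally show ?thesis .
qed

text \<open>The image of planar measure on the disk under the modulus and the measure with density 2
  pi s on (0,1) have equal mass on every half-line, as areas of discs show, and a finite measure is
  determined by these masses.\<close>

lemma nn_integral_radial:
  fixes \<psi> :: "real \<Rightarrow> ennreal"
  assumes [measurable]: "\<psi> \<in> borel_measurable borel"
  shows "(\<integral>\<^sup>+z\<in>unit_disk. \<psi> (cmod z) \<partial>lborel) = (\<integral>\<^sup>+s\<in>{0<..<1}. \<psi> s * ennreal (2 * pi * s) \<partial>lborel)"
proof -
  define M where "M = distr (density lborel (indicator unit_disk)) borel (cmod :: complex \<Rightarrow> real)"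
  define N where "N = density lborel (\<lambda>s::real. ennreal (2 * pi * s) * indicator {0<..<1} s)"
  have eb: "emeasure lborel (ball (0::complex) r) = ennreal (pi * r^2)" if "r \<ge> 0" for r
    using emeasure_ball[OF that, of "0::complex"] by (simp add: eval_unit_ball_vol)
  have ecb: "emeasure lborel (cball (0::complex) r) = ennreal (pi * r^2)" if "r \<ge> 0" for r
    using emeasure_cball[OF that, of "0::complex"] by (simp add: eval_unit_ball_vol)
  have [measurable]: "cmod -` {x<..} \<in> sets borel" for x
    by (intro borel_open open_vimage) (auto intro!: continuous_intros)
  have M: "emeasure M {x<..} = (if x < 0 then ennreal pi else if x < 1 then ennreal (pi * (1 - x^2)) else 0)" for x
  proof -
    have "emeasure M {x<..} = emeasure lborel (unit_disk \<inter> {z. x < cmod z})"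
      unfolding M_def by (subst emeasure_distr, simp, simp)
        (subst emeasure_density, measurable, auto simp: nn_integral_indicator[symmetric] simp del: nn_integral_indicator intro!: nn_integral_cong split: split_indicator)
    also have "... = (if x < 0 then ennreal pi else if x < 1 then ennreal (pi * (1 - x^2)) else 0)"
    proof -
      consider "x < 0" | "0 \<le> x" "x < 1" | "1 \<le> x" by linarith
      thus ?thesis
      proof cases
        case 1
        hence "unit_disk \<inter> {z. x < cmod z} = ball 0 1" by (auto intro: less_le_trans[OF _ norm_ge_zero])
        thus ?thesis using 1 eb[of 1] by simp
      next
        case 2
        hence "unit_disk \<inter> {z. x < cmod z} = ball 0 1 - cball 0 x" by auto
        also have "emeasure lborel (ball (0::complex) 1 - cball 0 x) = ennreal (pi * 1^2) - ennreal (pi * x^2)"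
          using 2 by (subst emeasure_Diff) (auto simp: eb ecb simp del: power_one)
        also have "... = ennreal (pi * (1 - x^2))"
          using 2 by (subst ennreal_minus) (auto simp: algebra_simps)
        finally show ?thesis using 2 by simp
      next
        case 3
        hence "unit_disk \<inter> {z. x < cmod z} = {}" by auto
        thus ?thesis using 3 by simp
      qed
    qed
    finally show ?thesis .
  qed
  have N: "emeasure N {x<..} = (if x < 0 then ennreal pi else if x < 1 then ennreal (pi * (1 - x^2)) else 0)" for x
  proof -
    have a: "(\<integral>\<^sup>+s. ennreal (2 * pi * s) * indicator {y..1} s \<partial>lborel) = ennreal (pi * 1^2 - pi * y^2)" if "0 \<le> y" "y \<le> 1" for y
      by (rule nn_integral_FTC_Icc) (use that in \<open>auto intro!: derivative_eq_intros\<close>)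
    have "emeasure N {x<..} = (\<integral>\<^sup>+s. ennreal (2 * pi * s) * indicator {0<..<1} s * indicator {x<..} s \<partial>lborel)"
      unfolding N_def by (subst emeasure_density) auto
    also have "... = (if x < 0 then ennreal pi else if x < 1 then ennreal (pi * (1 - x^2)) else 0)"
    proof -
      have ae: "AE s in lborel. s \<noteq> 0 \<and> s \<noteq> 1 \<and> s \<noteq> x"
        using AE_lborel_singleton[of 0] AE_lborel_singleton[of 1] AE_lborel_singleton[of x] by eventually_elim auto
      consider "x < 0" | "0 \<le> x" "x < 1" | "1 \<le> x" by linarith
      thus ?thesis
      proof cases
        case 1
        have "(\<integral>\<^sup>+s. ennreal (2 * pi * s) * indicator {0<..<1} s * indicator {x<..} s \<partial>lborel) = (\<integral>\<^sup>+s. ennreal (2 * pi * s) * indicator {0..1} s \<partial>lborel)"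
          by (rule nn_integral_cong_AE, use ae in eventually_elim) (use 1 in \<open>auto split: split_indicator\<close>)
        thus ?thesis using a[of 0] 1 by simp
      next
        case 2
        have "(\<integral>\<^sup>+s. ennreal (2 * pi * s) * indicator {0<..<1} s * indicator {x<..} s \<partial>lborel) = (\<integral>\<^sup>+s. ennreal (2 * pi * s) * indicator {x..1} s \<partial>lborel)"
          by (rule nn_integral_cong_AE, use ae in eventually_elim) (use 2 in \<open>auto split: split_indicator\<close>)
        thus ?thesis using a[of x] 2 by (simp add: algebra_simps)
      next
        case 3
        have "(\<integral>\<^sup>+s. ennreal (2 * pi * s) * indicator {0<..<1} s * indicator {x<..} s \<partial>lborel) = (\<integral>\<^sup>+(s::real). 0 \<partial>lborel)"
          by (intro nn_integral_cong) (use 3 in \<open>auto split: split_indicator\<close>)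
        thus ?thesis using 3 by simp
      qed
    qed
    finally show ?thesis .
  qed
  have "M = N"
    by (rule measure_eqI_lessThan) (auto simp: M N, simp_all add: M_def N_def)
  have "(\<integral>\<^sup>+z\<in>unit_disk. \<psi> (cmod z) \<partial>lborel) = (\<integral>\<^sup>+s. \<psi> s \<partial>M)"
    unfolding M_def by (subst nn_integral_distr, simp, simp, subst nn_integral_density)
      (measurable, simp_all add: mult.commute)
  also have "... = (\<integral>\<^sup>+s\<in>{0<..<1}. \<psi> s * ennreal (2 * pi * s) \<partial>lborel)"
    unfolding \<open>M = N\<close> N_def by (subst nn_integral_density) (auto simp: mult_ac)
  finally show ?thesis .
qed

subsection \<open>Sub-mean value property of powers of the modulus\<close>

text \<open>
  Dividing by Blaschke factors of the disk of radius \<open>s\<close> removes the zeros one at a time; the modulus is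
  unchanged on the circle and does not decrease inside.
\<close>

lemma remove_zeros_aux:
  fixes f :: "complex \<Rightarrow> complex"
  assumes "f holomorphic_on ball 0 R" "0 < s" "s < R" "finite {z\<in>cball 0 s. f z = 0}"
  shows "\<exists>h. h holomorphic_on ball 0 R \<and> (\<forall>z\<in>ball 0 s. h z \<noteq> 0) \<and>
    (\<forall>z. cmod z = s \<longrightarrow> cmod (h z) = cmod (f z)) \<and> (\<forall>z\<in>ball 0 s. cmod (f z) \<le> cmod (h z))"
  using assms
proof (induction "card {z\<in>ball 0 s. f z = 0}" arbitrary: f rule: less_induct)
  case less
  show ?case
  proof (cases "{z\<in>ball 0 s. f z = 0} = {}")
    case True
    thus ?thesis using less.prems by (intro exI[of _ f]) auto
  next
    case False
    then obtain a where a: "cmod a < s" "f a = 0" by auto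
    have nc: "\<not> f constant_on ball 0 R"
    proof
      assume "f constant_on ball 0 R"
      then obtain c where "\<And>z. z \<in> ball 0 R \<Longrightarrow> f z = c" unfolding constant_on_def by auto
      hence "\<And>z. z \<in> ball 0 R \<Longrightarrow> f z = 0" using a less.prems by force
      hence "{z\<in>cball 0 s. f z = 0} = cball 0 s" using less.prems by force
      moreover have "infinite (cball (0::complex) s)"
        using less.prems uncountable_cball countable_finite by blast
      ultimately show False using less.prems by simp
    qed
    have aR: "a \<in> ball 0 R" using a less.prems by auto
    obtain g0 r m where g0: "0 < m" "0 < r" "ball a r \<subseteq> ball 0 R" "g0 holomorphic_on ball a r"
        "\<And>w. w \<in> ball a r \<Longrightarrow> f w = (w - a)^m * g0 w" "\<And>w. w \<in> ball a r \<Longrightarrow> g0 w \<noteq> 0"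
      using holomorphic_factor_zero_nonconstant[OF less.prems(1) open_ball connected_ball aR a(2) nc] by metis
    define g where "g = (\<lambda>z. if z = a then g0 a else f z / (z - a)^m)"
    have gh: "g holomorphic_on ball 0 R"
    proof -
      have 1: "g holomorphic_on ball 0 R - {a}"
      proof (rule holomorphic_transform)
        show "(\<lambda>z. f z / (z - a)^m) holomorphic_on ball 0 R - {a}"
          by (intro holomorphic_intros holomorphic_on_subset[OF less.prems(1)]) auto
      qed (auto simp: g_def)
      have 2: "g holomorphic_on ball a r"
      proof (rule holomorphic_transform[OF g0(4)])
        show "g0 x = g x" if "x \<in> ball a r" for x
          using g0(5)[OF that] by (auto simp: g_def)
      qed
      have "g holomorphic_on ((ball 0 R - {a}) \<union> ball a r)"
        using 1 2 by (intro holomorphic_on_Un) (auto simp: open_Diff)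
      moreover have "(ball 0 R - {a}) \<union> ball a r = ball 0 R" using g0 by auto
      ultimately show ?thesis by simp
    qed
    have fg: "f z = (z - a)^m * g z" for z using a g0(1) by (auto simp: g_def)
    have ga: "g a \<noteq> 0" using g0 by (auto simp: g_def)
    \<comment> \<open>The zero \<open>a\<close> goes with its full multiplicity, so the number of
      distinct zeros in the open disc drops. Each factor z - a becomes (s^2 - conj(a) z)/s, which
      has no zero in the closed disc of radius s.\<close>
    define f1 where "f1 = (\<lambda>z. ((of_real (s^2) - cnj a * z) / of_real s)^m * g z)"
    have f1h: "f1 holomorphic_on ball 0 R"
      unfolding f1_def using less.prems by (intro holomorphic_intros gh) auto
    have eq: "cmod (of_real (s^2) - cnj a * z)^2 - (s * cmod (z - a))^2 = (s^2 - cmod a^2) * (s^2 - cmod z^2)" for z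
      by (simp only: power_mult_distrib cmod_power2) (simp add: algebra_simps power2_eq_square)
    have nz: "of_real (s^2) - cnj a * z \<noteq> 0" if "cmod z \<le> s" for z
    proof
      assume "of_real (s^2) - cnj a * z = 0"
      hence "cmod (of_real (s^2)) = cmod (cnj a * z)" by (metis eq_iff_diff_eq_0)
      hence "s^2 = cmod a * cmod z" by (simp add: norm_mult norm_power)
      also have "... \<le> cmod a * s" using that by (intro mult_left_mono) auto
      also have "... < s * s" using a less.prems by (intro mult_strict_right_mono) auto
      finally show False by (simp add: power2_eq_square)
    qed
    have ff: "cmod (f z) \<le> cmod (f1 z)" if "cmod z \<le> s" for z
    proof -
      have "(s * cmod (z - a))^2 \<le> cmod (of_real (s^2) - cnj a * z)^2"
      proof -
        have "(s^2 - cmod a^2) * (s^2 - cmod z^2) \<ge> 0"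
          using a that less.prems by (intro mult_nonneg_nonneg) (auto intro!: power_mono)
        thus ?thesis using eq[of z] by linarith
      qed
      hence "s * cmod (z - a) \<le> cmod (of_real (s^2) - cnj a * z)" by (rule power2_le_imp_le) simp
      hence "cmod (z - a) \<le> cmod ((of_real (s^2) - cnj a * z) / of_real s)"
        using less.prems by (simp add: norm_divide field_simps)
      hence "cmod ((z - a)^m) \<le> cmod (((of_real (s^2) - cnj a * z) / of_real s)^m)"
        by (simp add: norm_power power_mono)
      thus ?thesis unfolding f1_def fg[of z] norm_mult by (intro mult_right_mono) auto
    qed
    have ffs: "cmod (f1 z) = cmod (f z)" if "cmod z = s" for z
    proof -
      have "(s * cmod (z - a))^2 = cmod (of_real (s^2) - cnj a * z)^2" using eq[of z] that by simp
      hence "s * cmod (z - a) = cmod (of_real (s^2) - cnj a * z)"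
        using less.prems by (subst (asm) power2_eq_iff_nonneg) auto
      hence "cmod (z - a) = cmod ((of_real (s^2) - cnj a * z) / of_real s)"
        using less.prems by (simp add: norm_divide field_simps)
      thus ?thesis unfolding f1_def fg[of z] norm_mult norm_power by simp
    qed
    have zer: "{z\<in>cball 0 s. f1 z = 0} \<subseteq> {z\<in>cball 0 s. f z = 0}"
      using nz by (auto simp: f1_def fg)
    have "{z\<in>ball 0 s. f1 z = 0} \<subset> {z\<in>ball 0 s. f z = 0}"
    proof
      show "{z\<in>ball 0 s. f1 z = 0} \<subseteq> {z\<in>ball 0 s. f z = 0}"
      proof
        fix x assume "x \<in> {z\<in>ball 0 s. f1 z = 0}"
        thus "x \<in> {z\<in>ball 0 s. f z = 0}" using subsetD[OF zer, of x] by auto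
      qed
      have "f1 a \<noteq> 0" using nz[of a] ga a less.prems by (auto simp: f1_def)
      thus "{z\<in>ball 0 s. f1 z = 0} \<noteq> {z\<in>ball 0 s. f z = 0}" using a by auto
    qed
    moreover have "finite {z\<in>ball 0 s. f z = 0}" by (rule finite_subset[OF _ less.prems(4)]) auto
    ultimately have "card {z\<in>ball 0 s. f1 z = 0} < card {z\<in>ball 0 s. f z = 0}" by (rule psubset_card_mono[rotated])
    from less.hyps[OF this f1h less.prems(2,3) finite_subset[OF zer less.prems(4)]]
    obtain h where h: "h holomorphic_on ball 0 R" "\<forall>z\<in>ball 0 s. h z \<noteq> 0"
      "\<forall>z. cmod z = s \<longrightarrow> cmod (h z) = cmod (f1 z)" "\<forall>z\<in>ball 0 s. cmod (f1 z) \<le> cmod (h z)" by blast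
    show ?thesis
    proof (intro exI[of _ h] conjI)
      show "\<forall>z\<in>ball 0 s. cmod (f z) \<le> cmod (h z)"
      proof
        fix z :: complex assume z: "z \<in> ball 0 s"
        have "cmod (f z) \<le> cmod (f1 z)" using ff[of z] z by simp
        also have "... \<le> cmod (h z)" using h(4) z by blast
        finally show "cmod (f z) \<le> cmod (h z)" .
      qed
    qed (use h ffs in auto)
  qed
qed

text \<open>This is the Cauchy formula with absolute values inside. Its kernel is cruder than the
  Poisson kernel near the circle, but it is only used at a fixed relative distance from the circle
  or at the centre.\<close>

lemma Cauchy_circle_bound:
  assumes H: "H holomorphic_on ball 0 s" and zs: "cmod z < s'" "s' < s"
  shows "cmod (H z) \<le> integral {0..1} (\<lambda>t. cmod (H (of_real s' * cis (2*pi*t))) * s' / cmod (of_real s' * cis (2*pi*t) - z))"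
proof -
  have s': "0 < s'" using zs norm_ge_zero[of z] by linarith
  have "((\<lambda>u. H u / (u - z)) has_contour_integral (2 * of_real pi * \<i> * H z)) (circlepath 0 s')"
    using zs by (intro Cauchy_integral_circlepath_simple holomorphic_on_subset[OF H]) auto
  hence I: "((\<lambda>t. H (of_real s' * cis (2*pi*t)) / (of_real s' * cis (2*pi*t) - z) * (2 * of_real pi * \<i> * of_real s' * cis (2*pi*t)))
     has_integral (2 * of_real pi * \<i> * H z)) {0..1}"
    unfolding has_contour_integral_def
  proof (rule has_integral_eq[rotated])
    fix x :: real assume "x \<in> {0..1}"
    hence v: "vector_derivative (circlepath 0 s') (at x within {0..1}) = 2 * of_real pi * \<i> * of_real s' * cis (2*pi*x)"
      by (simp add: vector_derivative_circlepath01 cis_conv_exp mult_ac)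
    have c: "circlepath 0 s' x = of_real s' * cis (2*pi*x)" by (simp add: circlepath cis_conv_exp mult_ac)
    show "H (circlepath 0 s' x) / (circlepath 0 s' x - z) * vector_derivative (circlepath 0 s') (at x within {0..1}) =
      H (of_real s' * cis (2*pi*x)) / (of_real s' * cis (2*pi*x) - z) * (2 * of_real pi * \<i> * of_real s' * cis (2*pi*x))"
      unfolding v c ..
  qed
  define F where "F = (\<lambda>t. cmod (H (of_real s' * cis (2*pi*t))) * s' / cmod (of_real s' * cis (2*pi*t) - z))"
  have Fc: "continuous_on {0..1} F"
  proof -
    have "continuous_on {0..1} (\<lambda>t. H (of_real s' * cis (2*pi*t)))"
      by (rule continuous_on_compose2[OF holomorphic_on_imp_continuous_on[OF H]])
        (use zs s' in \<open>auto intro!: continuous_intros simp: norm_mult\<close>)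
    moreover have "of_real s' * cis (2*pi*t) \<noteq> z" for t using zs s' by (auto simp: norm_mult)
    ultimately show ?thesis unfolding F_def by (intro continuous_intros) auto
  qed
  hence Fi: "F integrable_on {0..1}" by (rule integrable_continuous_interval)
  have "norm (integral {0..1} (\<lambda>t. H (of_real s' * cis (2*pi*t)) / (of_real s' * cis (2*pi*t) - z) * (2 * of_real pi * \<i> * of_real s' * cis (2*pi*t))))
      \<le> integral {0..1} (\<lambda>t. 2 * pi * F t)"
  proof (rule integral_norm_bound_integral)
    show "(\<lambda>t. 2 * pi * F t) integrable_on {0..1}" by (intro integrable_on_mult_right Fi)
    show "norm (H (of_real s' * cis (2*pi*t)) / (of_real s' * cis (2*pi*t) - z) * (2 * of_real pi * \<i> * of_real s' * cis (2*pi*t)))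
      \<le> 2 * pi * F t" for t using s' by (simp add: norm_mult norm_divide F_def mult_ac)
  qed (rule has_integral_integrable[OF I])
  hence "norm (2 * of_real pi * \<i> * H z) \<le> 2 * pi * integral {0..1} F"
    using integral_unique[OF I] by simp
  thus ?thesis unfolding F_def by (simp add: norm_mult)
qed

text \<open>Once its zeros are removed, f has a holomorphic q-th power, and the Cauchy formula
  applies to this power times k. The extra factor k carries kernel decay along the circle: it is 1
  in \<open>submean_ball\<close> and a kernel atom in \<open>profile_le_weight\<close>.\<close>

lemma submean_circle:
  assumes f: "f holomorphic_on ball 0 R" and k: "k holomorphic_on ball 0 R"
    and z: "cmod z < s" "s < R" and q: "0 < q"
  shows "cmod (f z) powr q * cmod (k z) \<le> integral {0..1} (\<lambda>t. cmod (f (of_real s * cis (2*pi*t))) powr q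
    * cmod (k (of_real s * cis (2*pi*t))) * s / cmod (of_real s * cis (2*pi*t) - z))"
proof (cases "f constant_on ball 0 R \<and> f z = 0")
  case True
  hence "cmod (f z) = 0" by simp
  moreover have "s > 0" using z norm_ge_zero[of z] by linarith
  \<comment> \<open>The left side is 0; the integral on the right is 0 by convention if the
    integrand is not integrable.\<close>
  ultimately show ?thesis by (cases "(\<lambda>t. cmod (f (of_real s * cis (2*pi*t))) powr q
    * cmod (k (of_real s * cis (2*pi*t))) * s / cmod (of_real s * cis (2*pi*t) - z)) integrable_on {0..1}")
      (auto intro!: integral_nonneg simp: not_integrable_integral)
next
  case False
  have s: "0 < s" using z norm_ge_zero[of z] by linarith
  have zR: "z \<in> ball 0 R" using z by auto
  have fin: "finite {z\<in>cball 0 s. f z = 0}"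
  proof (cases "f constant_on ball 0 R")
    case True
    then obtain c where c: "\<And>w. w \<in> ball 0 R \<Longrightarrow> f w = c" unfolding constant_on_def by auto
    moreover have "c \<noteq> 0" using False True c[OF zR] by auto
    ultimately have "{z\<in>cball 0 s. f z = 0} = {}" using z by force
    thus ?thesis by (metis finite.emptyI)
  next
    case nc: False
    show ?thesis by (rule holomorphic_compact_finite_zeros[OF f open_ball connected_ball]) (use z nc in auto)
  qed
  obtain h where h: "h holomorphic_on ball 0 R" "\<And>z. z\<in>ball 0 s \<Longrightarrow> h z \<noteq> 0"
      "\<And>z. cmod z = s \<Longrightarrow> cmod (h z) = cmod (f z)" "\<And>z. z\<in>ball 0 s \<Longrightarrow> cmod (f z) \<le> cmod (h z)"
    using remove_zeros_aux[OF f s z(2) fin] by blast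
  have hs: "h holomorphic_on ball 0 s" and ks: "k holomorphic_on ball 0 s"
    using h(1) k z by (auto elim!: holomorphic_on_subset)
  have "0 \<in> ball (0::complex) s" using s by simp
  then obtain l where l: "l holomorphic_on ball 0 s" "\<And>z. z \<in> ball 0 s \<Longrightarrow> exp (l z) = h z"
    using holomorphic_logarithm_exists[OF convex_ball open_ball hs h(2)] by metis
  define H where "H = (\<lambda>w. exp (of_real q * l w) * k w)"
  have Hh: "H holomorphic_on ball 0 s" unfolding H_def by (intro holomorphic_intros l ks)
  have Hn: "cmod (H w) = cmod (h w) powr q * cmod (k w)" if "w \<in> ball 0 s" for w
    using l(2)[OF that] by (auto simp: H_def norm_mult powr_def simp flip: l(2)[OF that])
  define \<Phi> where "\<Phi> = (\<lambda>r t. cmod (h (of_real r * cis (2*pi*t))) powr q * cmod (k (of_real r * cis (2*pi*t))) * r / cmod (of_real r * cis (2*pi*t) - z))"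
  \<comment> \<open>The function h may still vanish on the circle of radius s, so its logarithm
    exists only inside. The estimate is proved for radii in [c, s) and passed to the limit.\<close>
  define c where "c = (cmod z + s) / 2"
  have c: "cmod z < c" "c < s" "0 < c" using z s unfolding c_def by (auto intro: add_nonneg_pos)
  have cont: "continuous_on {c..s} (\<lambda>r. integral (cbox 0 1) (\<Phi> r))"
  proof (rule integral_continuous_on_param)
    have 1: "continuous_on ({c..s} \<times> cbox 0 1) (\<lambda>p. of_real (fst p) * cis (2 * pi * snd p))"
      by (intro continuous_intros)
    have 2: "(\<lambda>p. of_real (fst p) * cis (2 * pi * snd p)) ` ({c..s} \<times> cbox 0 1) \<subseteq> ball 0 R"
      using c z by (auto simp: norm_mult)
    have 3: "continuous_on ({c..s} \<times> cbox 0 1) (\<lambda>p. h (of_real (fst p) * cis (2 * pi * snd p)))"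
        "continuous_on ({c..s} \<times> cbox 0 1) (\<lambda>p. k (of_real (fst p) * cis (2 * pi * snd p)))"
      using continuous_on_compose2[OF holomorphic_on_imp_continuous_on 1 2] h(1) k by auto
    have 4: "of_real (fst p) * cis (2 * pi * snd p) - z \<noteq> 0" if "p \<in> {c..s} \<times> cbox 0 1" for p
    proof
      assume "of_real (fst p) * cis (2 * pi * snd p) - z = 0"
      hence "cmod (of_real (fst p) * cis (2 * pi * snd p)) = cmod z" by simp
      thus False using that c by (auto simp: norm_mult)
    qed
    show "continuous_on ({c..s} \<times> cbox 0 1) (\<lambda>(r, t). \<Phi> r t)"
      unfolding \<Phi>_def case_prod_beta using 4 q
      by (intro continuous_intros 3 continuous_on_powr') auto
  qed
  have le: "cmod (f z) powr q * cmod (k z) \<le> integral (cbox 0 1) (\<Phi> r)" if "c \<le> r" "r < s" for r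
  proof -
    have "cmod (f z) powr q * cmod (k z) \<le> cmod (h z) powr q * cmod (k z)"
      using h(4)[of z] z q by (intro mult_right_mono powr_mono2) auto
    also have "... = cmod (H z)" using Hn[of z] z by simp
    also have "... \<le> integral {0..1} (\<lambda>t. cmod (H (of_real r * cis (2*pi*t))) * r / cmod (of_real r * cis (2*pi*t) - z))"
      using that c by (intro Cauchy_circle_bound[OF Hh]) auto
    also have "... = integral {0..1} (\<Phi> r)"
      using that c by (intro integral_cong) (auto simp: \<Phi>_def Hn norm_mult)
    finally show ?thesis by simp
  qed
  have "((\<lambda>r. integral (cbox 0 1) (\<Phi> r)) \<longlongrightarrow> integral (cbox 0 1) (\<Phi> s)) (at s within {c..s})"
    using cont c by (auto simp: continuous_on_def)
  hence "((\<lambda>r. integral (cbox 0 1) (\<Phi> r)) \<longlongrightarrow> integral (cbox 0 1) (\<Phi> s)) (at_left s)"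
    using at_within_Icc_at_left[OF c(2)] by simp
  hence "cmod (f z) powr q * cmod (k z) \<le> integral (cbox 0 1) (\<Phi> s)"
  proof (rule tendsto_lowerbound)
    show "\<forall>\<^sub>F r in at_left s. cmod (f z) powr q * cmod (k z) \<le> integral (cbox 0 1) (\<Phi> r)"
      using c(2) le by (subst eventually_at_left[OF c(2)]) (auto intro!: exI[of _ c])
  qed simp
  also have "integral (cbox 0 1) (\<Phi> s) = integral {0..1} (\<lambda>t. cmod (f (of_real s * cis (2*pi*t))) powr q
    * cmod (k (of_real s * cis (2*pi*t))) * s / cmod (of_real s * cis (2*pi*t) - z))"
    using s unfolding cbox_interval by (intro integral_cong) (auto simp: \<Phi>_def h(3) norm_mult)
  finally show ?thesis .
qed

text \<open>Starting the circle at an arbitrary point w instead of on the positive axis makes the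
  right side an angular mean of the kind in \<open>nn_integral_rotation_average\<close>. Rotating
  the variable by sgn w reduces this to \<open>submean_circle\<close>.\<close>

lemma submean_circle_nn:
  assumes f: "f holomorphic_on ball 0 R" and k: "k holomorphic_on ball 0 R"
    and z: "cmod z < cmod w" "cmod w < R" and q: "0 < q"
  shows "ennreal (cmod (f z) powr q * cmod (k z)) \<le> (\<integral>\<^sup>+t\<in>{0..1}. ennreal (cmod (f (cis (2*pi*t) * w)) powr q
    * cmod (k (cis (2*pi*t) * w)) * cmod w / cmod (cis (2*pi*t) * w - z)) \<partial>lborel)"
proof -
  define s where "s = cmod w"
  have s: "0 < s" "cmod z < s" "s < R" using z norm_ge_zero[of z] unfolding s_def by linarith+
  define u where "u = sgn w"
  have u: "cmod u = 1" "w = of_real s * u" using s unfolding u_def s_def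
    by (auto simp: norm_sgn) (simp add: sgn_div_norm scaleR_conv_of_real)
  define \<Phi> where "\<Phi> = (\<lambda>t. cmod (f (cis (2*pi*t) * w)) powr q * cmod (k (cis (2*pi*t) * w)) * cmod w / cmod (cis (2*pi*t) * w - z))"
  have rot: "(\<lambda>x. F (u * x)) holomorphic_on ball 0 R" if "F holomorphic_on ball 0 R" for F
  proof -
    have "F \<circ> (\<lambda>x. u * x) holomorphic_on ball 0 R"
      by (rule holomorphic_on_compose_gen[OF _ that]) (auto intro!: holomorphic_intros simp: norm_mult u)
    thus ?thesis by (simp add: o_def)
  qed
  have z': "u * (cnj u * z) = z" using u(1) by (metis complex_norm_square mult.assoc mult.left_neutral of_real_1 power_one)
  have "cmod (f (u * (cnj u * z))) powr q * cmod (k (u * (cnj u * z))) \<le> integral {0..1} (\<lambda>t. cmod (f (u * (of_real s * cis (2*pi*t)))) powr q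
    * cmod (k (u * (of_real s * cis (2*pi*t)))) * s / cmod (of_real s * cis (2*pi*t) - cnj u * z))"
    by (rule submean_circle[OF rot[OF f] rot[OF k] _ _ q]) (use s u in \<open>auto simp: norm_mult\<close>)
  also have "... = integral {0..1} \<Phi>"
  proof (intro integral_cong)
    fix t
    have "cmod (of_real s * cis (2*pi*t) - cnj u * z) = cmod u * cmod (of_real s * cis (2*pi*t) - cnj u * z)" using u by simp
    also have "... = cmod (u * (of_real s * cis (2*pi*t)) - u * (cnj u * z))" by (simp only: norm_mult[symmetric] right_diff_distrib)
    also have "... = cmod (cis (2*pi*t) * w - z)" by (simp only: z') (simp add: u mult_ac)
    finally show "cmod (f (u * (of_real s * cis (2*pi*t)))) powr q * cmod (k (u * (of_real s * cis (2*pi*t)))) * s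
      / cmod (of_real s * cis (2*pi*t) - cnj u * z) = \<Phi> t" by (simp add: \<Phi>_def s_def[symmetric]) (simp add: u mult_ac)
  qed
  finally have le: "cmod (f z) powr q * cmod (k z) \<le> integral {0..1} \<Phi>" by (simp add: z')
  have cont: "continuous_on {0..1} \<Phi>"
  proof -
    have 1: "continuous_on {0..1} (\<lambda>t. cis (2*pi*t) * w)" by (intro continuous_intros)
    have 2: "(\<lambda>t. cis (2*pi*t) * w) ` {0..1} \<subseteq> ball 0 R" using z by (auto simp: norm_mult)
    have 3: "continuous_on {0..1} (\<lambda>t. f (cis (2*pi*t) * w))" "continuous_on {0..1} (\<lambda>t. k (cis (2*pi*t) * w))"
      using continuous_on_compose2[OF holomorphic_on_imp_continuous_on 1 2] f k by auto
    have 4: "cis (2*pi*t) * w - z \<noteq> 0" for t using z by (auto simp: norm_mult)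
    show ?thesis unfolding \<Phi>_def using 4 q by (intro continuous_intros 3 continuous_on_powr') auto
  qed
  have "(\<Phi> has_integral integral {0..1} \<Phi>) {0..1}" using integrable_continuous_interval[OF cont] by (rule integrable_integral)
  hence "(\<integral>\<^sup>+t. ennreal (\<Phi> t) * indicator {0..1} t \<partial>lborel) = ennreal (integral {0..1} \<Phi>)"
    by (intro nn_integral_has_integral_lebesgue') (auto simp: \<Phi>_def)
  with le show ?thesis unfolding \<Phi>_def by (simp add: ennreal_leI)
qed

text \<open>At the centre the Cauchy kernel has modulus 1/|w|, so every circle gives the plain
  sub-mean value inequality; rotation averaging integrates these inequalities over the disc.\<close>

lemma submean_ball:
  assumes f: "f holomorphic_on ball c \<rho>" and [measurable]: "f \<in> borel_measurable borel"
    and q: "0 < q" and \<rho>: "0 < \<rho>"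
  shows "ennreal (cmod (f c) powr q) * ennreal (pi * \<rho>^2) \<le> (\<integral>\<^sup>+w\<in>ball c \<rho>. ennreal (cmod (f w) powr q) \<partial>lborel)"
proof -
  define F where "F = (\<lambda>x. f (c + x))"
  have [measurable]: "F \<in> borel_measurable borel" unfolding F_def by measurable
  have Fh: "F holomorphic_on ball 0 \<rho>"
  proof -
    have "f \<circ> (\<lambda>x. c + x) holomorphic_on ball 0 \<rho>"
      by (rule holomorphic_on_compose_gen[OF _ f]) (auto intro!: holomorphic_intros simp: dist_norm)
    thus ?thesis by (simp add: o_def F_def)
  qed
  define h where "h = (\<lambda>w. ennreal (cmod (F w) powr q) * indicator (ball 0 \<rho>) w)"
  have [measurable]: "ball (0::complex) \<rho> \<in> sets borel" "ball c \<rho> \<in> sets borel" by auto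
  have [measurable]: "h \<in> borel_measurable borel" unfolding h_def
    by (intro borel_measurable_times_ennreal borel_measurable_indicator) auto
  have "ennreal (cmod (f c) powr q) * ennreal (pi * \<rho>^2) = (\<integral>\<^sup>+w\<in>ball (0::complex) \<rho>. ennreal (cmod (F 0) powr q) \<partial>lborel)"
    using emeasure_ball[of \<rho> "0::complex"] \<rho> by (simp add: nn_integral_cmult eval_unit_ball_vol F_def)
  also have "... \<le> (\<integral>\<^sup>+w. (\<integral>\<^sup>+t\<in>{0..1}. h (cis (2*pi*t) * w) \<partial>lborel) \<partial>lborel)"
  proof (rule nn_integral_mono_AE, use AE_lborel_singleton[of "0::complex"] in eventually_elim)
    case (elim w)
    show "ennreal (cmod (F 0) powr q) * indicator (ball 0 \<rho>) w \<le> (\<integral>\<^sup>+t\<in>{0..1}. h (cis (2*pi*t) * w) \<partial>lborel)"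
    proof (cases "w \<in> ball 0 \<rho>")
      case True
      have "ennreal (cmod (F 0) powr q * cmod ((\<lambda>_. 1) 0)) \<le> (\<integral>\<^sup>+t\<in>{0..1}. ennreal (cmod (F (cis (2*pi*t) * w)) powr q
           * cmod ((\<lambda>_. 1) (cis (2*pi*t) * w)) * cmod w / cmod (cis (2*pi*t) * w - 0)) \<partial>lborel)"
        by (rule submean_circle_nn[OF Fh _ _ _ q]) (use True elim in auto)
      also have "... = (\<integral>\<^sup>+t\<in>{0..1}. h (cis (2*pi*t) * w) \<partial>lborel)"
        using True elim by (intro nn_integral_cong) (auto simp: h_def norm_mult)
      finally show ?thesis using True by simp
    qed auto
  qed
  also have "... = emeasure lborel {0..1::real} * (\<integral>\<^sup>+w. h w \<partial>lborel)"
    by (rule nn_integral_rotation_average) auto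
  also have "... = (\<integral>\<^sup>+w\<in>ball c \<rho>. ennreal (cmod (f w) powr q) \<partial>lborel)"
  proof -
    have "(\<integral>\<^sup>+w. ennreal (cmod (f w) powr q) * indicator (ball c \<rho>) w \<partial>lborel) =
        (\<integral>\<^sup>+w. ennreal (cmod (f w) powr q) * indicator (ball c \<rho>) w \<partial>distr lborel borel ((+) c))"
      by (simp only: lborel_distr_plus)
    also have "... = (\<integral>\<^sup>+w. ennreal (cmod (f (c + w)) powr q) * indicator (ball c \<rho>) (c + w) \<partial>lborel)"
      by (subst nn_integral_distr) auto
    also have "... = (\<integral>\<^sup>+w. h w \<partial>lborel)" unfolding h_def F_def
      by (intro nn_integral_cong) (auto simp: dist_norm split: split_indicator)
    finally show ?thesis by simp
  qed
  finally show ?thesis .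
qed

subsection \<open>Measure estimates\<close>

lemma ball_measurable [measurable]: "ball (c::complex) r \<in> sets borel"
  by simp

text \<open>Up to pi/3 the derivative cos t - 1/2 is nonnegative; beyond it sin x is at least
  sin(pi/3), which exceeds pi/4 and hence x/2.\<close>

lemma sin_ge_half:
  assumes "0 \<le> x" "x \<le> pi/2" shows "x / 2 \<le> sin x"
proof -
  have c: "(sin has_real_derivative cos t) (at t)" for t by (rule DERIV_sin)
  show ?thesis
  proof (cases "x \<le> pi/3")
    case True
    have "sin 0 - 0/2 \<le> sin x - x/2"
    proof (rule DERIV_nonneg_imp_nondecreasing[OF assms(1)])
      fix t assume t: "0 \<le> t" "t \<le> x"
      have "cos (pi/3) \<le> cos t" using t True by (intro cos_monotone_0_pi_le) auto
      hence "0 \<le> cos t - 1/2" by (simp add: cos_60)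
      moreover have "((\<lambda>t. sin t - t/2) has_real_derivative cos t - 1/2) (at t)"
        by (auto intro!: derivative_eq_intros)
      ultimately show "\<exists>y. ((\<lambda>t. sin t - t/2) has_real_derivative y) (at t) \<and> 0 \<le> y" by blast
    qed
    thus ?thesis by simp
  next
    case False
    have "x / 2 \<le> pi/4" using assms by simp
    also have "pi/4 \<le> 0.8" using pi_less_4 pi_approx by simp
    also have "0.8 \<le> sqrt 3 / 2"
    proof -
      have "1.6 \<le> sqrt 3" by (rule real_le_rsqrt) (simp add: power2_eq_square)
      thus ?thesis by simp
    qed
    also have "sqrt 3 / 2 = sin (pi/3)" by (simp add: sin_60)
    also have "sin (pi/3) \<le> sin x" using False assms by (intro sin_monotone_2pi_le) auto
    finally show ?thesis .
  qed
qed

text \<open>The chord has length 2 |sin(pi u)|. A difference of two parameters in [0,1] ranges over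
  [-1,1], where this sine vanishes at -1, 0 and 1; hence three cases.\<close>

lemma cis_diff_small:
  assumes u: "\<bar>u\<bar> \<le> 1" and d: "cmod (cis (2*pi*u) - 1) < d"
  shows "\<bar>u\<bar> < d \<or> \<bar>u - 1\<bar> < d \<or> \<bar>u + 1\<bar> < d"
proof -
  have "cmod (cis (2*pi*u) - 1) = 2 * \<bar>sin (pi*u)\<bar>"
  proof -
    have "(cmod (cis (2*pi*u) - 1))^2 = (cos (2*(pi*u)) - 1)^2 + (sin (2*(pi*u)))^2"
      by (simp only: cmod_power2) (simp add: mult_ac)
    also have "... = 2 - 2 * cos (2*(pi*u))" using sin_cos_squared_add2[of "2*(pi*u)"]
      by (simp add: power2_eq_square algebra_simps)
    also have "... = (2 * \<bar>sin (pi*u)\<bar>)^2" using cos_double_sin[of "pi*u"] by (simp add: power_mult_distrib)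
    finally show ?thesis by (subst (asm) power2_eq_iff_nonneg) auto
  qed
  hence s: "2 * \<bar>sin (pi*u)\<bar> < d" using d by simp
  have key: "\<bar>v\<bar> \<le> 2 * \<bar>sin (pi * v)\<bar>" if "\<bar>v\<bar> \<le> 1/2" for v
  proof -
    have "pi * \<bar>v\<bar> \<le> pi * (1/2)" using that by (intro mult_left_mono) auto
    hence "pi * \<bar>v\<bar> / 2 \<le> sin (pi * \<bar>v\<bar>)" by (intro sin_ge_half) auto
    moreover have "2 * \<bar>v\<bar> \<le> pi * \<bar>v\<bar>" using pi_ge_two by (intro mult_right_mono) auto
    moreover have "sin (pi * \<bar>v\<bar>) \<le> \<bar>sin (pi * v)\<bar>" by (cases "v \<ge> 0") auto
    ultimately show ?thesis by linarith
  qed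
  consider "\<bar>u\<bar> \<le> 1/2" | "u > 1/2" | "u < -1/2" by linarith
  thus ?thesis
  proof cases
    case 1 thus ?thesis using key[of u] s by linarith
  next
    case 2
    have "\<bar>u - 1\<bar> \<le> 2 * \<bar>sin (pi * (u - 1))\<bar>" using 2 u by (intro key) auto
    also have "sin (pi * (u - 1)) = - sin (pi * u)" by (simp add: right_diff_distrib)
    finally show ?thesis using s by auto
  next
    case 3
    have "\<bar>u + 1\<bar> \<le> 2 * \<bar>sin (pi * (u + 1))\<bar>" using 3 u by (intro key) auto
    also have "sin (pi * (u + 1)) = - sin (pi * u)" by (simp add: distrib_left)
    finally show ?thesis using s by auto
  qed
qed

text \<open>Up to the period, all admissible parameters are within 4d of any one of them: three
  intervals of length 8d. For d at least 1/2 the total length 1 suffices; for smaller d a nonempty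
  set forces |x| > 1/2, which makes the chord comparable to the difference of the values.\<close>

lemma angle_measure:
  fixes x :: complex
  assumes x: "cmod x \<le> 1" and d: "0 < d"
  shows "emeasure lborel {t\<in>{0..1::real}. cmod (1 - cis (2*pi*t) * x) < d} \<le> ennreal (24 * d)"
proof (cases "d \<ge> 1/2 \<or> {t\<in>{0..1::real}. cmod (1 - cis (2*pi*t) * x) < d} = {}")
  case True
  have "emeasure lborel {t\<in>{0..1::real}. cmod (1 - cis (2*pi*t) * x) < d} \<le> emeasure lborel {0..1::real}"
    by (intro emeasure_mono) auto
  also have "... = ennreal 1" by simp
  finally have *: "emeasure lborel {t\<in>{0..1::real}. cmod (1 - cis (2*pi*t) * x) < d} \<le> ennreal 1" .
  show ?thesis
  proof (cases "d \<ge> 1/2")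
    case True thus ?thesis by (intro order_trans[OF * ennreal_leI]) auto
  next
    case False
    hence "{t\<in>{0..1::real}. cmod (1 - cis (2*pi*t) * x) < d} = {}" using True by blast
    thus ?thesis by (simp only: emeasure_empty zero_le)
  qed
next
  case False
  then obtain t0 where t0: "t0 \<in> {0..1}" "cmod (1 - cis (2*pi*t0) * x) < d" by auto
  have "1 - cmod x \<le> cmod (1 - cis (2*pi*t0) * x)"
    using norm_triangle_ineq2[of 1 "cis (2*pi*t0) * x"] by (simp add: norm_mult)
  hence xh: "cmod x > 1/2" using t0 False by auto
  have "{t\<in>{0..1::real}. cmod (1 - cis (2*pi*t) * x) < d} \<subseteq> {t0-4*d..t0+4*d} \<union> {t0+1-4*d..t0+1+4*d} \<union> {t0-1-4*d..t0-1+4*d}"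
  proof
    fix t assume t: "t \<in> {t\<in>{0..1::real}. cmod (1 - cis (2*pi*t) * x) < d}"
    have "cmod x * cmod (cis (2*pi*t) - cis (2*pi*t0)) = cmod ((1 - cis (2*pi*t0) * x) - (1 - cis (2*pi*t) * x))"
      by (subst norm_mult[symmetric]) (simp add: algebra_simps)
    also have "... < d + d" using t t0 by (intro le_less_trans[OF norm_triangle_ineq4]) auto
    finally have "cmod x * cmod (cis (2*pi*t) - cis (2*pi*t0)) < 2 * d" by simp
    moreover have "1/2 * cmod (cis (2*pi*t) - cis (2*pi*t0)) \<le> cmod x * cmod (cis (2*pi*t) - cis (2*pi*t0))"
      using xh by (intro mult_right_mono) auto
    ultimately have a: "cmod (cis (2*pi*t) - cis (2*pi*t0)) < 4 * d" by simp
    have "cis (2*pi*t) - cis (2*pi*t0) = cis (2*pi*t0) * (cis (2*pi*(t - t0)) - 1)"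
      by (simp add: algebra_simps cis_mult)
    hence "cmod (cis (2*pi*(t - t0)) - 1) < 4 * d" using a by (simp add: norm_mult)
    hence "\<bar>t - t0\<bar> < 4*d \<or> \<bar>t - t0 - 1\<bar> < 4*d \<or> \<bar>t - t0 + 1\<bar> < 4*d" using t t0 by (intro cis_diff_small) auto
    thus "t \<in> {t0-4*d..t0+4*d} \<union> {t0+1-4*d..t0+1+4*d} \<union> {t0-1-4*d..t0-1+4*d}" by (auto simp: abs_if split: if_splits)
  qed
  hence "emeasure lborel {t\<in>{0..1::real}. cmod (1 - cis (2*pi*t) * x) < d} \<le>
      emeasure lborel ({t0-4*d..t0+4*d} \<union> {t0+1-4*d..t0+1+4*d} \<union> {t0-1-4*d..t0-1+4*d})"
    by (intro emeasure_mono) auto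
  also have "... \<le> emeasure lborel {t0-4*d..t0+4*d} + emeasure lborel {t0+1-4*d..t0+1+4*d} + emeasure lborel {t0-1-4*d..t0-1+4*d}"
    by (intro order_trans[OF emeasure_subadditive] add_right_mono emeasure_subadditive) auto
  also have "... = ennreal (24 * d)" using d by (simp flip: ennreal_plus)
  finally show ?thesis .
qed

text \<open>As v is radial, averaging over rotations replaces the indicator of the kernel ball by
  the measure of the angles leading into it. That measure is at most 24t, and it is zero unless
  1-|z| < t.\<close>

lemma radial_kernel_ball:
  fixes v :: "real \<Rightarrow> ennreal"
  assumes [measurable]: "v \<in> borel_measurable borel" and a: "cmod a < 1" and t: "0 < t"
  shows "(\<integral>\<^sup>+z\<in>unit_disk. v (cmod z) * indicator {z. cmod (1 - cnj a * z) < t} z \<partial>lborel)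
    \<le> ennreal (24 * t) * (\<integral>\<^sup>+z\<in>unit_disk. v (cmod z) * indicator {z. 1 - cmod z < t} z \<partial>lborel)"
proof -
  have [measurable]: "{z. cmod (1 - cnj a * z) < t} \<in> sets borel" by measurable
  define h where "h = (\<lambda>z. v (cmod z) * indicator {z. cmod (1 - cnj a * z) < t} z * indicator unit_disk z)"
  have [measurable]: "h \<in> borel_measurable borel" unfolding h_def by measurable
  have "(\<integral>\<^sup>+z. h z \<partial>lborel) = (\<integral>\<^sup>+z. (\<integral>\<^sup>+s\<in>{0..1}. h (cis (2 * pi * s) * z) \<partial>lborel) \<partial>lborel)"
    by (subst nn_integral_rotation_average) auto
  also have "... \<le> (\<integral>\<^sup>+z. ennreal (24 * t) * (v (cmod z) * indicator {z. 1 - cmod z < t} z * indicator unit_disk z) \<partial>lborel)"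
  proof (intro nn_integral_mono)
    fix z :: complex
    show "(\<integral>\<^sup>+s\<in>{0..1}. h (cis (2 * pi * s) * z) \<partial>lborel) \<le> ennreal (24 * t) * (v (cmod z) * indicator {z. 1 - cmod z < t} z * indicator unit_disk z)"
    proof (cases "cmod z < 1 \<and> 1 - cmod z < t")
      case True
      have S: "{s\<in>{0..1::real}. cmod (1 - cis (2 * pi * s) * (cnj a * z)) < t} \<in> sets lborel" by measurable
      have "(\<integral>\<^sup>+s\<in>{0..1}. h (cis (2 * pi * s) * z) \<partial>lborel) = (\<integral>\<^sup>+s. v (cmod z) * indicator {s\<in>{0..1::real}. cmod (1 - cis (2 * pi * s) * (cnj a * z)) < t} s \<partial>lborel)"
        using True by (intro nn_integral_cong) (auto simp: h_def norm_mult mult_ac split: split_indicator)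
      also have "... = v (cmod z) * emeasure lborel {s\<in>{0..1::real}. cmod (1 - cis (2 * pi * s) * (cnj a * z)) < t}"
        using S by (simp add: nn_integral_cmult)
      also have "... \<le> v (cmod z) * ennreal (24 * t)"
        using True a t by (intro mult_left_mono angle_measure) (auto simp: norm_mult intro!: mult_le_one)
      finally show ?thesis using True by (simp add: mult_ac)
    next
      case False
      have "h (cis (2 * pi * s) * z) = 0" for s
      proof -
        have "1 - cmod z \<le> cmod (1 - cnj a * (cis (2 * pi * s) * z))" if "cmod z < 1"
          using cmod_kernel_ge(2)[of a "cis (2 * pi * s) * z"] a that by (simp add: norm_mult)
        thus ?thesis using False by (auto simp: h_def norm_mult split: split_indicator)
      qed
      thus ?thesis by simp
    qed
  qed
  also have "... = ennreal (24 * t) * (\<integral>\<^sup>+z\<in>unit_disk. v (cmod z) * indicator {z. 1 - cmod z < t} z \<partial>lborel)"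
    by (rule nn_integral_cmult) measurable
  finally show ?thesis unfolding h_def .
qed

section \<open>Dyadic summation and integrals of kernel powers\<close>

lemma suminf_geometric_ennreal:
  assumes "0 \<le> K" "0 \<le> r" "r < (1::real)"
  shows "(\<Sum>k. ennreal (K * r^k)) = ennreal (K / (1 - r))"
proof -
  have "(\<lambda>k. K * r^k) sums (K * (1 / (1 - r)))" using assms by (intro sums_mult geometric_sums) auto
  thus ?thesis using assms by (subst suminf_ennreal_eq[where x = "K / (1 - r)"]) auto
qed

text \<open>On the layer where X is about 2^k \<delta> the integrand carries (2^k \<delta>)^(-N),
  against a mass of at most A (2^(k+1) \<delta>)^s. As s < N, the layers sum geometrically and the
  smallest one dominates.\<close>

lemma dyadic_up:
  fixes X :: "'a \<Rightarrow> real" and u :: "'a \<Rightarrow> ennreal"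
  assumes [measurable]: "X \<in> borel_measurable M" "u \<in> borel_measurable M"
    and \<delta>: "0 < \<delta>" and sN: "s < N" "0 \<le> N"
    and X: "\<And>x. u x \<noteq> 0 \<Longrightarrow> \<delta> \<le> X x"
    and A: "\<And>t. \<delta> < t \<Longrightarrow> (\<integral>\<^sup>+x. u x * indicator {x. X x < t} x \<partial>M) \<le> A * ennreal (t powr s)"
  shows "(\<integral>\<^sup>+x. u x * ennreal (X x powr - N) \<partial>M) \<le> ennreal (2 powr s / (1 - 2 powr (s - N))) * (A * ennreal (\<delta> powr (s - N)))"
proof -
  have p1: "u x * ennreal (X x powr - N) \<le> (\<Sum>k. ennreal ((2^k * \<delta>) powr - N) * (u x * indicator {x. X x < 2^(Suc k) * \<delta>} x))" for x
  proof (cases "u x = 0")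
    case False
    note Xx = X[OF False]
    define k where "k = nat \<lfloor>log 2 (X x / \<delta>)\<rfloor>"
    have ge: "1 \<le> X x / \<delta>" using Xx \<delta> by simp
    have "0 \<le> log 2 (X x / \<delta>)" using ge by (subst zero_le_log_cancel_iff) auto
    hence k: "real k \<le> log 2 (X x / \<delta>)" "log 2 (X x / \<delta>) < real k + 1"
      unfolding k_def by linarith+
    have "2 powr real k \<le> X x / \<delta>" "X x / \<delta> < 2 powr (real (Suc k))"
      using k ge by (simp_all add: le_log_iff log_less_iff add.commute)
    hence k2: "2^k * \<delta> \<le> X x" "X x < 2^(Suc k) * \<delta>" using \<delta> by (simp_all add: powr_realpow field_simps del: of_nat_Suc)
    have "X x powr - N \<le> (2^k * \<delta>) powr - N" using k2 sN \<delta> by (intro powr_mono2') auto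
    hence "u x * ennreal (X x powr - N) \<le> ennreal ((2^k * \<delta>) powr - N) * (u x * indicator {x. X x < 2^(Suc k) * \<delta>} x)"
      using k2 by (subst mult.commute) (auto intro!: mult_right_mono ennreal_leI)
    also have "... \<le> (\<Sum>k. ennreal ((2^k * \<delta>) powr - N) * (u x * indicator {x. X x < 2^(Suc k) * \<delta>} x))"
      using sum_le_suminf[of "\<lambda>k. ennreal ((2^k * \<delta>) powr - N) * (u x * indicator {x. X x < 2^(Suc k) * \<delta>} x)" "{k}"] by simp
    finally show ?thesis .
  qed simp
  have "(\<integral>\<^sup>+x. u x * ennreal (X x powr - N) \<partial>M) \<le> (\<integral>\<^sup>+x. (\<Sum>k. ennreal ((2^k * \<delta>) powr - N) * (u x * indicator {x. X x < 2^(Suc k) * \<delta>} x)) \<partial>M)"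
    by (intro nn_integral_mono p1)
  also have "... = (\<Sum>k. \<integral>\<^sup>+x. ennreal ((2^k * \<delta>) powr - N) * (u x * indicator {x. X x < 2^(Suc k) * \<delta>} x) \<partial>M)"
    by (intro nn_integral_suminf) measurable
  also have "... = (\<Sum>k. ennreal ((2^k * \<delta>) powr - N) * (\<integral>\<^sup>+x. u x * indicator {x. X x < 2^(Suc k) * \<delta>} x \<partial>M))"
    by (intro suminf_cong nn_integral_cmult) measurable
  also have "... \<le> (\<Sum>k. A * ennreal (2 powr s * \<delta> powr (s - N) * (2 powr (s - N))^k))"
  proof (intro suminf_le)
    fix k
    have "1 < (2::real)^Suc k" by (rule one_less_power) auto
    hence "\<delta> < 2^(Suc k) * \<delta>" using \<delta> by (metis mult_1 mult_strict_right_mono)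
    hence "ennreal ((2^k * \<delta>) powr - N) * (\<integral>\<^sup>+x. u x * indicator {x. X x < 2^(Suc k) * \<delta>} x \<partial>M)
      \<le> ennreal ((2^k * \<delta>) powr - N) * (A * ennreal ((2^(Suc k) * \<delta>) powr s))"
      by (intro mult_left_mono A) auto
    also have "... = A * ennreal ((2^k * \<delta>) powr - N * (2^(Suc k) * \<delta>) powr s)" by (simp add: ennreal_mult mult_ac)
    also have "(2^k * \<delta>) powr - N * (2^(Suc k) * \<delta>) powr s = 2 powr s * \<delta> powr (s - N) * (2 powr (s - N))^k"
      using \<delta> by (simp add: powr_mult powr_realpow[symmetric] powr_powr powr_add[symmetric] powr_diff powr_minus field_simps)
    finally show "ennreal ((2^k * \<delta>) powr - N) * (\<integral>\<^sup>+x. u x * indicator {x. X x < 2^(Suc k) * \<delta>} x \<partial>M) \<le> A * ennreal (2 powr s * \<delta> powr (s - N) * (2 powr (s - N))^k)" .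
  qed auto
  also have "... = A * ennreal (2 powr s * \<delta> powr (s - N) / (1 - 2 powr (s - N)))"
    using sN by (subst ennreal_suminf_cmult) (subst suminf_geometric_ennreal, auto simp: powr_less_one)
  also have "... = ennreal (2 powr s / (1 - 2 powr (s - N))) * (A * ennreal (\<delta> powr (s - N)))"
  proof -
    have "2 powr (s - N) < 1" using sN by (intro powr_less_one) auto
    thus ?thesis by (subst mult.left_commute) (simp add: ennreal_mult[symmetric])
  qed
  finally show ?thesis .
qed

text \<open>The opposite regime N < s: the layers at d/2^k descend towards X = 0 and the largest one
  dominates, so the singularity of X^(-N) is integrable.\<close>

lemma dyadic_down:
  fixes X :: "'a \<Rightarrow> real" and u :: "'a \<Rightarrow> ennreal"
  assumes [measurable]: "X \<in> borel_measurable M" "u \<in> borel_measurable M"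
    and d: "0 < d" and sN: "N < s" "0 \<le> N"
    and X: "\<And>x. u x \<noteq> 0 \<Longrightarrow> 0 < X x"
    and A: "\<And>t. 0 < t \<Longrightarrow> t \<le> d \<Longrightarrow> (\<integral>\<^sup>+x. u x * indicator {x. X x < t} x \<partial>M) \<le> A * ennreal (t powr s)"
  shows "(\<integral>\<^sup>+x. u x * indicator {x. X x < d} x * ennreal (X x powr - N) \<partial>M) \<le> ennreal (2 powr N / (1 - 2 powr (N - s))) * (A * ennreal (d powr (s - N)))"
proof -
  have p1: "u x * indicator {x. X x < d} x * ennreal (X x powr - N) \<le> (\<Sum>k. ennreal ((d / 2^Suc k) powr - N) * (u x * indicator {x. X x < d / 2^k} x))" for x
  proof (cases "u x = 0 \<or> X x \<ge> d")
    case False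
    note Xx = X[of x]
    \<comment> \<open>Ceiling minus one, not floor: the layer must satisfy the strict inequality X <
      d/2^k demanded by the indicator.\<close>
    define k where "k = nat (\<lceil>log 2 (d / X x)\<rceil> - 1)"
    have ge: "1 < d / X x" using Xx d False by simp
    have "0 < log 2 (d / X x)" using ge by (subst zero_less_log_cancel_iff) auto
    hence k: "real k < log 2 (d / X x)" "log 2 (d / X x) \<le> real k + 1"
      unfolding k_def by linarith+
    have "2 powr real k < d / X x" "d / X x \<le> 2 powr (real (Suc k))"
      using k ge by (simp_all add: less_log_iff log_le_iff add.commute)
    hence k2: "X x < d / 2^k" "d / 2^Suc k \<le> X x" using Xx False by (simp_all add: powr_realpow field_simps del: of_nat_Suc)
    have "X x powr - N \<le> (d / 2^Suc k) powr - N" using k2 sN d by (intro powr_mono2') auto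
    hence "u x * indicator {x. X x < d} x * ennreal (X x powr - N) \<le> ennreal ((d / 2^Suc k) powr - N) * (u x * indicator {x. X x < d / 2^k} x)"
      using k2 False by (subst mult.commute) (auto intro!: mult_right_mono ennreal_leI)
    also have "... \<le> (\<Sum>k. ennreal ((d / 2^Suc k) powr - N) * (u x * indicator {x. X x < d / 2^k} x))"
      using sum_le_suminf[of "\<lambda>k. ennreal ((d / 2^Suc k) powr - N) * (u x * indicator {x. X x < d / 2^k} x)" "{k}"] by simp
    finally show ?thesis .
  qed auto
  have "(\<integral>\<^sup>+x. u x * indicator {x. X x < d} x * ennreal (X x powr - N) \<partial>M) \<le> (\<integral>\<^sup>+x. (\<Sum>k. ennreal ((d / 2^Suc k) powr - N) * (u x * indicator {x. X x < d / 2^k} x)) \<partial>M)"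
    by (intro nn_integral_mono p1)
  also have "... = (\<Sum>k. \<integral>\<^sup>+x. ennreal ((d / 2^Suc k) powr - N) * (u x * indicator {x. X x < d / 2^k} x) \<partial>M)"
    by (intro nn_integral_suminf) measurable
  also have "... = (\<Sum>k. ennreal ((d / 2^Suc k) powr - N) * (\<integral>\<^sup>+x. u x * indicator {x. X x < d / 2^k} x \<partial>M))"
    by (intro suminf_cong nn_integral_cmult) measurable
  also have "... \<le> (\<Sum>k. A * ennreal (2 powr N * d powr (s - N) * (2 powr (N - s))^k))"
  proof (intro suminf_le)
    fix k
    have "1 \<le> (2::real)^k" by (rule one_le_power) auto
    hence "d / 2^k \<le> d" using d by (simp add: field_simps)
    hence "ennreal ((d / 2^Suc k) powr - N) * (\<integral>\<^sup>+x. u x * indicator {x. X x < d / 2^k} x \<partial>M)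
      \<le> ennreal ((d / 2^Suc k) powr - N) * (A * ennreal ((d / 2^k) powr s))"
      using d by (intro mult_left_mono A) auto
    also have "... = A * ennreal ((d / 2^Suc k) powr - N * (d / 2^k) powr s)" by (simp add: ennreal_mult mult_ac)
    also have "(d / 2^Suc k) powr - N * (d / 2^k) powr s = 2 powr N * d powr (s - N) * (2 powr (N - s))^k"
      using d by (simp add: powr_divide powr_mult powr_realpow[symmetric] powr_powr powr_add[symmetric] powr_diff powr_minus field_simps)
    finally show "ennreal ((d / 2^Suc k) powr - N) * (\<integral>\<^sup>+x. u x * indicator {x. X x < d / 2^k} x \<partial>M) \<le> A * ennreal (2 powr N * d powr (s - N) * (2 powr (N - s))^k)" .
  qed auto
  also have "... = A * ennreal (2 powr N * d powr (s - N) / (1 - 2 powr (N - s)))"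
    using sN by (subst ennreal_suminf_cmult) (subst suminf_geometric_ennreal, auto simp: powr_less_one)
  also have "... = ennreal (2 powr N / (1 - 2 powr (N - s))) * (A * ennreal (d powr (s - N)))"
  proof -
    have "2 powr (N - s) < 1" using sN by (intro powr_less_one) auto
    thus ?thesis by (subst mult.left_commute) (simp add: ennreal_mult[symmetric])
  qed
  finally show ?thesis .
qed

lemma disk_annulus:
  assumes "0 < t"
  shows "(\<integral>\<^sup>+z\<in>unit_disk. indicator {z. 1 - cmod z < t} z \<partial>lborel) \<le> ennreal (2 * pi * t)"
proof -
  have "(\<integral>\<^sup>+z\<in>unit_disk. indicator {z. 1 - cmod z < t} z \<partial>lborel) = (\<integral>\<^sup>+z\<in>unit_disk. (\<lambda>s. indicator {s. 1 - s < t} s) (cmod z) \<partial>lborel)"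
    by (intro nn_integral_cong) (auto split: split_indicator)
  also have "... = (\<integral>\<^sup>+s\<in>{0<..<1}. indicator {s. 1 - s < t} s * ennreal (2 * pi * s) \<partial>lborel)"
    by (rule nn_integral_radial) measurable
  also have "... \<le> (\<integral>\<^sup>+s. ennreal (2*pi) * indicator {1-t..1} s \<partial>lborel)"
    by (intro nn_integral_mono) (auto split: split_indicator intro!: ennreal_leI)
  also have "... = ennreal (2 * pi * t)" using assms by (simp add: nn_integral_cmult ennreal_mult)
  finally show ?thesis .
qed

lemma disk_annulus_power:
  assumes "0 < \<gamma>" "\<gamma> \<le> 1"
  obtains C where "0 < C" "\<And>t. 0 < t \<Longrightarrow> (\<integral>\<^sup>+z\<in>unit_disk. ennreal ((1 - cmod z) powr (\<gamma> - 1)) * indicator {z. 1 - cmod z < t} z \<partial>lborel) \<le> ennreal (C * t powr \<gamma>)"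
proof -
  define C where "C = 2 powr (1 - \<gamma>) / (1 - 2 powr (1 - \<gamma> - 1))"
  have "2 powr (1 - \<gamma> - 1) < 1" using assms by (intro powr_less_one) auto
  hence C: "C > 0" unfolding C_def by auto
  show ?thesis
  proof (rule that[of "C * (2 * pi)"])
    fix t :: real assume t: "0 < t"
    have "(\<integral>\<^sup>+z. indicator unit_disk z * indicator {z. 1 - cmod z < t} z * ennreal ((1 - cmod z) powr - (1 - \<gamma>)) \<partial>lborel)
      \<le> ennreal (2 powr (1 - \<gamma>) / (1 - 2 powr (1 - \<gamma> - 1))) * (ennreal (2 * pi) * ennreal (t powr (1 - (1 - \<gamma>))))"
    proof (rule dyadic_down)
      fix s :: real assume "0 < s"
      thus "(\<integral>\<^sup>+z. indicator unit_disk z * indicator {z. 1 - cmod z < s} z \<partial>lborel) \<le> ennreal (2 * pi) * ennreal (s powr 1)"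
        using disk_annulus[of s] by (simp add: mult.commute ennreal_mult)
    qed (use t assms in \<open>auto split: split_indicator_asm\<close>)
    also have "... = ennreal (C * (2 * pi) * t powr \<gamma>)" unfolding C_def[symmetric] using C by (simp add: ennreal_mult mult_ac)
    finally show "(\<integral>\<^sup>+z\<in>unit_disk. ennreal ((1 - cmod z) powr (\<gamma> - 1)) * indicator {z. 1 - cmod z < t} z \<partial>lborel) \<le> ennreal (C * (2 * pi) * t powr \<gamma>)"
      by (simp add: mult_ac)
  qed (use C in auto)
qed

lemma kernel_ball_power:
  assumes "0 < \<gamma>" "\<gamma> \<le> 1"
  obtains C where "0 < C" "\<And>a t. cmod a < 1 \<Longrightarrow> 0 < t \<Longrightarrow> (\<integral>\<^sup>+z\<in>unit_disk. ennreal ((1 - cmod z) powr (\<gamma> - 1)) * indicator {z. cmod (1 - cnj a * z) < t} z \<partial>lborel) \<le> ennreal (C * t powr (1 + \<gamma>))"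
proof -
  obtain C where C: "0 < C" "\<And>t. 0 < t \<Longrightarrow> (\<integral>\<^sup>+z\<in>unit_disk. ennreal ((1 - cmod z) powr (\<gamma> - 1)) * indicator {z. 1 - cmod z < t} z \<partial>lborel) \<le> ennreal (C * t powr \<gamma>)"
    using disk_annulus_power[OF assms] by blast
  show ?thesis
  proof (rule that[of "24 * C"])
    fix a :: complex and t :: real assume a: "cmod a < 1" and t: "0 < t"
    have "(\<integral>\<^sup>+z\<in>unit_disk. (\<lambda>s. ennreal ((1 - s) powr (\<gamma> - 1))) (cmod z) * indicator {z. cmod (1 - cnj a * z) < t} z \<partial>lborel)
      \<le> ennreal (24 * t) * (\<integral>\<^sup>+z\<in>unit_disk. (\<lambda>s. ennreal ((1 - s) powr (\<gamma> - 1))) (cmod z) * indicator {z. 1 - cmod z < t} z \<partial>lborel)"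
      by (rule radial_kernel_ball[OF _ a t]) measurable
    also have "... \<le> ennreal (24 * t) * ennreal (C * t powr \<gamma>)" using C t by (intro mult_left_mono) auto
    also have "... = ennreal (24 * C * t powr (1 + \<gamma>))" using C t by (simp add: ennreal_mult[symmetric] powr_add mult_ac)
    finally show "(\<integral>\<^sup>+z\<in>unit_disk. ennreal ((1 - cmod z) powr (\<gamma> - 1)) * indicator {z. cmod (1 - cnj a * z) < t} z \<partial>lborel) \<le> ennreal (24 * C * t powr (1 + \<gamma>))" by simp
  qed (use C in auto)
qed

text \<open>Kernel balls of radius t have mass at most a multiple of t^(1+\<gamma>). As N exceeds
  this dimension, the integral concentrates at the smallest scale 1-|a|
  (\<open>dyadic_up\<close>).\<close>

lemma kernel_integral:
  assumes "0 < \<gamma>" "\<gamma> \<le> 1" "1 + \<gamma> < N"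
  obtains C where "0 < C" "\<And>a. cmod a < 1 \<Longrightarrow> (\<integral>\<^sup>+z\<in>unit_disk. ennreal (kap a z powr N * (1 - cmod z) powr (\<gamma> - 1)) \<partial>lborel) \<le> ennreal (C * (1 - cmod a) powr (1 + \<gamma>))"
proof -
  obtain C where C: "0 < C" "\<And>a t. cmod a < 1 \<Longrightarrow> 0 < t \<Longrightarrow> (\<integral>\<^sup>+z\<in>unit_disk. ennreal ((1 - cmod z) powr (\<gamma> - 1)) * indicator {z. cmod (1 - cnj a * z) < t} z \<partial>lborel) \<le> ennreal (C * t powr (1 + \<gamma>))"
    using kernel_ball_power[OF assms(1,2)] by blast
  define C1 where "C1 = 2 powr (1 + \<gamma>) / (1 - 2 powr (1 + \<gamma> - N))"
  have "2 powr (1 + \<gamma> - N) < 1" using assms by (intro powr_less_one) auto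
  hence C1: "C1 > 0" unfolding C1_def by auto
  show ?thesis
  proof (rule that[of "C1 * C"])
    fix a :: complex assume a: "cmod a < 1"
    have "(\<integral>\<^sup>+z. (ennreal ((1 - cmod z) powr (\<gamma> - 1)) * indicator unit_disk z) * ennreal (cmod (1 - cnj a * z) powr - N) \<partial>lborel)
      \<le> ennreal (2 powr (1 + \<gamma>) / (1 - 2 powr (1 + \<gamma> - N))) * (ennreal C * ennreal ((1 - cmod a) powr (1 + \<gamma> - N)))"
    proof (rule dyadic_up)
      fix t assume "1 - cmod a < t"
      hence "0 < t" using a by simp
      from C(2)[OF a this] show "(\<integral>\<^sup>+z. ennreal ((1 - cmod z) powr (\<gamma> - 1)) * indicator unit_disk z * indicator {z. cmod (1 - cnj a * z) < t} z \<partial>lborel) \<le> ennreal C * ennreal (t powr (1 + \<gamma>))"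
        using C by (simp add: ennreal_mult mult_ac)
    next
      fix z assume "ennreal ((1 - cmod z) powr (\<gamma> - 1)) * indicator unit_disk z \<noteq> 0"
      hence "cmod z < 1" by (auto split: split_indicator_asm)
      thus "1 - cmod a \<le> cmod (1 - cnj a * z)" using a by (intro cmod_kernel_ge)
    qed (use assms a in auto)
    also have "... = ennreal (C1 * C * (1 - cmod a) powr (1 + \<gamma> - N))" unfolding C1_def[symmetric]
      using C1 C by (simp add: ennreal_mult mult_ac)
    finally have *: "(\<integral>\<^sup>+z. (ennreal ((1 - cmod z) powr (\<gamma> - 1)) * indicator unit_disk z) * ennreal (cmod (1 - cnj a * z) powr - N) \<partial>lborel) \<le> ..." .
    have "(\<integral>\<^sup>+z\<in>unit_disk. ennreal (kap a z powr N * (1 - cmod z) powr (\<gamma> - 1)) \<partial>lborel) =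
      (\<integral>\<^sup>+z. ennreal ((1 - cmod a) powr N) * ((ennreal ((1 - cmod z) powr (\<gamma> - 1)) * indicator unit_disk z) * ennreal (cmod (1 - cnj a * z) powr - N)) \<partial>lborel)"
      using a by (intro nn_integral_cong)
        (auto simp: kap_def powr_divide powr_minus_divide ennreal_mult[symmetric] mult_ac split: split_indicator)
    also have "... = ennreal ((1 - cmod a) powr N) * (\<integral>\<^sup>+z. (ennreal ((1 - cmod z) powr (\<gamma> - 1)) * indicator unit_disk z) * ennreal (cmod (1 - cnj a * z) powr - N) \<partial>lborel)"
      by (rule nn_integral_cmult) measurable
    also have "... \<le> ennreal ((1 - cmod a) powr N) * ennreal (C1 * C * (1 - cmod a) powr (1 + \<gamma> - N))"
      by (intro mult_left_mono *) auto
    also have "... = ennreal (C1 * C * (1 - cmod a) powr (1 + \<gamma>))"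
      using C C1 a by (simp add: ennreal_mult[symmetric] powr_diff)
    finally show "(\<integral>\<^sup>+z\<in>unit_disk. ennreal (kap a z powr N * (1 - cmod z) powr (\<gamma> - 1)) \<partial>lborel) \<le> ennreal (C1 * C * (1 - cmod a) powr (1 + \<gamma>))" .
  qed (use C C1 in auto)
qed

text \<open>Below the critical power 1 + \<gamma> the unnormalized kernel power is integrable over
  kernel balls uniformly in b, however close b is to the circle
  (\<open>dyadic_down\<close>).\<close>

lemma kernel_integral_local:
  assumes "0 < \<gamma>" "\<gamma> \<le> 1" "0 \<le> M" "M < 1 + \<gamma>"
  obtains C where "0 < C" "\<And>b d. cmod b < 1 \<Longrightarrow> 0 < d \<Longrightarrow> (\<integral>\<^sup>+z\<in>unit_disk. ennreal (cmod (1 - cnj b * z) powr - M * (1 - cmod z) powr (\<gamma> - 1)) * indicator {z. cmod (1 - cnj b * z) < d} z \<partial>lborel) \<le> ennreal (C * d powr (1 + \<gamma> - M))"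
proof -
  obtain C where C: "0 < C" "\<And>a t. cmod a < 1 \<Longrightarrow> 0 < t \<Longrightarrow> (\<integral>\<^sup>+z\<in>unit_disk. ennreal ((1 - cmod z) powr (\<gamma> - 1)) * indicator {z. cmod (1 - cnj a * z) < t} z \<partial>lborel) \<le> ennreal (C * t powr (1 + \<gamma>))"
    using kernel_ball_power[OF assms(1,2)] by blast
  define C1 where "C1 = 2 powr M / (1 - 2 powr (M - (1 + \<gamma>)))"
  have "2 powr (M - (1 + \<gamma>)) < 1" using assms by (intro powr_less_one) auto
  hence C1: "C1 > 0" unfolding C1_def by auto
  show ?thesis
  proof (rule that[of "C1 * C"])
    fix b :: complex and d :: real assume b: "cmod b < 1" and d: "0 < d"
    have "(\<integral>\<^sup>+z. (ennreal ((1 - cmod z) powr (\<gamma> - 1)) * indicator unit_disk z) * indicator {z. cmod (1 - cnj b * z) < d} z * ennreal (cmod (1 - cnj b * z) powr - M) \<partial>lborel)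
      \<le> ennreal (2 powr M / (1 - 2 powr (M - (1 + \<gamma>)))) * (ennreal C * ennreal (d powr (1 + \<gamma> - M)))"
    proof (rule dyadic_down)
      fix t :: real assume "0 < t"
      from C(2)[OF b this] show "(\<integral>\<^sup>+z. ennreal ((1 - cmod z) powr (\<gamma> - 1)) * indicator unit_disk z * indicator {z. cmod (1 - cnj b * z) < t} z \<partial>lborel) \<le> ennreal C * ennreal (t powr (1 + \<gamma>))"
        using C by (simp add: ennreal_mult mult_ac)
    next
      fix z assume "ennreal ((1 - cmod z) powr (\<gamma> - 1)) * indicator unit_disk z \<noteq> 0"
      hence "cmod z < 1" by (auto split: split_indicator_asm)
      thus "0 < cmod (1 - cnj b * z)" using b by (intro cmod_kernel_pos)
    qed (use assms b d in auto)
    also have "... = ennreal (C1 * C * d powr (1 + \<gamma> - M))" unfolding C1_def[symmetric]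
      using C1 C by (simp add: ennreal_mult mult_ac)
    finally show "(\<integral>\<^sup>+z\<in>unit_disk. ennreal (cmod (1 - cnj b * z) powr - M * (1 - cmod z) powr (\<gamma> - 1)) * indicator {z. cmod (1 - cnj b * z) < d} z \<partial>lborel) \<le> ennreal (C1 * C * d powr (1 + \<gamma> - M))"
      by (simp add: ennreal_mult mult_ac)
  qed (use C C1 in auto)
qed

text \<open>The disk is split at half the kernel distance d of a and b. Far from b,
  \<open>kap b z\<close> is at most 2 \<open>kap b a\<close>, and what remains is
  \<open>kernel_integral\<close>. Near b, the triangle inequality makes \<open>kap a z\<close> at
  most 2(1-|a|)/d, and the subcritical power of the kernel at b is integrated locally. So k_b^M is
  reproduced, up to a constant, by integration against the square kernel, which is what a Schur test
  asks for.\<close>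

lemma kernel_composition:
  assumes \<gamma>: "0 < \<gamma>" "\<gamma> < 1" and M: "0 \<le> M" "M < 1 + \<gamma>"
  obtains C where "0 < C" "\<And>a b. cmod a < 1 \<Longrightarrow> cmod b < 1 \<Longrightarrow>
    (\<integral>\<^sup>+z\<in>unit_disk. ennreal (kap b z powr M * kap a z ^ 2 * (1 - cmod z) powr (\<gamma> - 1)) \<partial>lborel)
      \<le> ennreal (C * ((1 - cmod a) powr (1 + \<gamma>) * kap b a powr M))"
proof -
  obtain C1 where C1: "0 < C1" "\<And>a. cmod a < 1 \<Longrightarrow> (\<integral>\<^sup>+z\<in>unit_disk. ennreal (kap a z powr 2 * (1 - cmod z) powr (\<gamma> - 1)) \<partial>lborel) \<le> ennreal (C1 * (1 - cmod a) powr (1 + \<gamma>))"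
    using kernel_integral[of \<gamma> 2] \<gamma> by auto
  obtain C2 where C2: "0 < C2" "\<And>b d. cmod b < 1 \<Longrightarrow> 0 < d \<Longrightarrow> (\<integral>\<^sup>+z\<in>unit_disk. ennreal (cmod (1 - cnj b * z) powr - M * (1 - cmod z) powr (\<gamma> - 1)) * indicator {z. cmod (1 - cnj b * z) < d} z \<partial>lborel) \<le> ennreal (C2 * d powr (1 + \<gamma> - M))"
    using kernel_integral_local[of \<gamma> M] \<gamma> M by auto
  show ?thesis
  proof (rule that[of "2 powr M * C1 + 4 * C2"])
    fix a b :: complex assume a: "cmod a < 1" and b: "cmod b < 1"
    define d where "d = cmod (1 - cnj b * a)"
    have d: "0 < d" "1 - cmod a \<le> d" unfolding d_def cmod_kernel_commute[of b a] using a b by (intro cmod_kernel_pos cmod_kernel_ge; simp)+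
    define u1 where "u1 = (\<lambda>z. ennreal (kap a z powr 2 * (1 - cmod z) powr (\<gamma> - 1)))"
    define u2 where "u2 = (\<lambda>z. ennreal (cmod (1 - cnj b * z) powr - M * (1 - cmod z) powr (\<gamma> - 1)) * indicator {z. cmod (1 - cnj b * z) < d/2} z)"
    define K1 where "K1 = ennreal (2 powr M * kap b a powr M)"
    define K2 where "K2 = ennreal (4 * (1 - cmod a)^2 * d powr -2 * (1 - cmod b) powr M)"
    have [measurable]: "u1 \<in> borel_measurable borel" "u2 \<in> borel_measurable borel"
      unfolding u1_def u2_def by measurable
    have "(\<integral>\<^sup>+z\<in>unit_disk. ennreal (kap b z powr M * kap a z ^ 2 * (1 - cmod z) powr (\<gamma> - 1)) \<partial>lborel)
      \<le> (\<integral>\<^sup>+z. K1 * (u1 z * indicator unit_disk z) + K2 * (u2 z * indicator unit_disk z) \<partial>lborel)"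
    proof (intro nn_integral_mono)
      fix z
      show "ennreal (kap b z powr M * kap a z ^ 2 * (1 - cmod z) powr (\<gamma> - 1)) * indicator unit_disk z
        \<le> K1 * (u1 z * indicator unit_disk z) + K2 * (u2 z * indicator unit_disk z)"
      proof (cases "cmod z < 1")
        case True
        note ka = kap_pos[OF a True] and kb = kap_pos[OF b True]
        define X Y where "X = cmod (1 - cnj b * z)" and "Y = cmod (1 - cnj a * z)"
        have XY: "X > 0" "Y > 0" unfolding X_def Y_def using a b True by (auto intro: cmod_kernel_pos simp del: zero_less_norm_iff)
        have tri: "d \<le> X + Y" unfolding d_def X_def Y_def cmod_kernel_commute[of a z] using a b True by (intro cmod_kernel_triangle)
        show ?thesis
        proof (cases "X < d/2")
          case False
          have "1 / X \<le> 2 / d" using False XY d by (simp add: field_simps)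
          hence "(1 - cmod b) * (1 / X) \<le> (1 - cmod b) * (2 / d)" using b by (intro mult_left_mono) auto
          hence "kap b z \<le> 2 * kap b a" unfolding kap_def X_def[symmetric] d_def[symmetric] by (simp add: mult_ac)
          hence "kap b z powr M \<le> (2 * kap b a) powr M" using kb M by (intro powr_mono2) auto
          also have "... = 2 powr M * kap b a powr M" by (simp add: powr_mult)
          finally have "kap b z powr M * kap a z ^ 2 * (1 - cmod z) powr (\<gamma> - 1) \<le> (2 powr M * kap b a powr M) * (kap a z powr 2 * (1 - cmod z) powr (\<gamma> - 1))"
            using mult_right_mono[of "kap b z powr M" "2 powr M * kap b a powr M" "kap a z powr 2 * (1 - cmod z) powr (\<gamma> - 1)"] ka
            by (simp add: mult.assoc)
          hence "ennreal (kap b z powr M * kap a z ^ 2 * (1 - cmod z) powr (\<gamma> - 1)) \<le> K1 * u1 z"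
            unfolding K1_def u1_def by (subst ennreal_mult[symmetric]) (auto intro!: ennreal_leI)
          thus ?thesis using True by (simp add: add_increasing2)
        next
          case XX: True
          have "d / 2 \<le> Y" using tri XX by simp
          hence "1 / Y \<le> 2 / d" using XY d by (simp add: field_simps)
          hence "(1 - cmod a) * (1 / Y) \<le> (1 - cmod a) * (2 / d)" using a by (intro mult_left_mono) auto
          hence "kap a z \<le> 2 * (1 - cmod a) / d" unfolding kap_def Y_def[symmetric] by (simp add: mult_ac)
          hence "kap a z ^ 2 \<le> (2 * (1 - cmod a) / d)^2" using ka by (intro power_mono) auto
          also have "... = 4 * (1 - cmod a)^2 * d powr -2"
          proof -
            have "(2 * x / d)^2 = 4 * x^2 * (1 / d^2)" for x by (simp add: power_divide power_mult_distrib)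
            moreover have "d powr -2 = 1 / d^2" using d by (simp add: powr_minus_divide)
            ultimately show ?thesis by (simp only:)
          qed
          finally have "kap b z powr M * kap a z ^ 2 * (1 - cmod z) powr (\<gamma> - 1) \<le> kap b z powr M * (4 * (1 - cmod a)^2 * d powr -2) * (1 - cmod z) powr (\<gamma> - 1)"
            by (intro mult_right_mono mult_left_mono) auto
          also have "... = (4 * (1 - cmod a)^2 * d powr -2 * (1 - cmod b) powr M) * (X powr - M * (1 - cmod z) powr (\<gamma> - 1))"
            using b XY unfolding kap_def X_def[symmetric] by (simp add: powr_divide powr_minus_divide mult_ac)
          finally have "ennreal (kap b z powr M * kap a z ^ 2 * (1 - cmod z) powr (\<gamma> - 1)) \<le> K2 * u2 z"
            using XX unfolding K2_def u2_def X_def[symmetric] by (simp add: X_def[symmetric]) (subst ennreal_mult[symmetric], auto intro!: ennreal_leI)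
          thus ?thesis using True by (simp add: add_increasing)
        qed
      qed simp
    qed
    also have "... = K1 * (\<integral>\<^sup>+z\<in>unit_disk. u1 z \<partial>lborel) + K2 * (\<integral>\<^sup>+z\<in>unit_disk. u2 z \<partial>lborel)"
    proof -
      have m: "(\<lambda>z. u1 z * indicator unit_disk z) \<in> borel_measurable lborel" "(\<lambda>z. u2 z * indicator unit_disk z) \<in> borel_measurable lborel"
        by measurable
      show ?thesis by (simp only: nn_integral_add[OF borel_measurable_times_ennreal[OF borel_measurable_const m(1)] borel_measurable_times_ennreal[OF borel_measurable_const m(2)]]
          nn_integral_cmult[OF m(1)] nn_integral_cmult[OF m(2)])
    qed
    also have "... \<le> K1 * ennreal (C1 * (1 - cmod a) powr (1 + \<gamma>)) + K2 * ennreal (C2 * (d/2) powr (1 + \<gamma> - M))"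
      using C1(2)[OF a] C2(2)[OF b, of "d/2"] d unfolding u1_def u2_def by (intro add_mono mult_left_mono) auto
    also have "... \<le> ennreal (2 powr M * C1 * ((1 - cmod a) powr (1 + \<gamma>) * kap b a powr M)) + ennreal (4 * C2 * ((1 - cmod a) powr (1 + \<gamma>) * kap b a powr M))"
    proof (intro add_mono)
      show "K1 * ennreal (C1 * (1 - cmod a) powr (1 + \<gamma>)) \<le> ennreal (2 powr M * C1 * ((1 - cmod a) powr (1 + \<gamma>) * kap b a powr M))"
        unfolding K1_def using C1 by (subst ennreal_mult[symmetric]) (auto simp: mult_ac)
      have 1: "(d/2) powr (1 + \<gamma> - M) \<le> d powr (1 + \<gamma> - M)" using d M by (intro powr_mono2) auto
      \<comment> \<open>The exponent \<gamma> - 1 is negative and d is at least 1-|a|; this is where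
        \<gamma> < 1 enters.\<close>
      have 2: "d powr (\<gamma> - 1) \<le> (1 - cmod a) powr (\<gamma> - 1)" using d a \<gamma> by (intro powr_mono2') auto
      have "4 * (1 - cmod a)^2 * d powr -2 * (1 - cmod b) powr M * (C2 * (d/2) powr (1 + \<gamma> - M))
        \<le> 4 * (1 - cmod a)^2 * d powr -2 * (1 - cmod b) powr M * (C2 * d powr (1 + \<gamma> - M))"
        using 1 C2 by (intro mult_left_mono) auto
      also have "... = 4 * C2 * ((1 - cmod a)^2 * d powr (\<gamma> - 1) * ((1 - cmod b) powr M * d powr - M))"
        using d by (simp add: powr_add[symmetric] mult_ac powr_diff powr_minus field_simps power2_eq_square powr_add)
      also have "... \<le> 4 * C2 * ((1 - cmod a)^2 * (1 - cmod a) powr (\<gamma> - 1) * ((1 - cmod b) powr M * d powr - M))"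
        using C2 2 by (intro mult_left_mono mult_right_mono) auto
      also have "... = 4 * C2 * ((1 - cmod a) powr (1 + \<gamma>) * kap b a powr M)"
        using a b d unfolding kap_def d_def[symmetric]
        by (simp add: powr_divide powr_minus_divide powr_add powr_diff power2_eq_square)
      finally have 3: "4 * (1 - cmod a)^2 * d powr -2 * (1 - cmod b) powr M * (C2 * (d/2) powr (1 + \<gamma> - M)) \<le> ..." .
      show "K2 * ennreal (C2 * (d/2) powr (1 + \<gamma> - M)) \<le> ennreal (4 * C2 * ((1 - cmod a) powr (1 + \<gamma>) * kap b a powr M))"
        unfolding K2_def using C2 3 by (subst ennreal_mult[symmetric]) (auto intro!: ennreal_leI)
    qed
    also have "... = ennreal ((2 powr M * C1 + 4 * C2) * ((1 - cmod a) powr (1 + \<gamma>) * kap b a powr M))"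
      using C1 C2 by (subst ennreal_plus[symmetric]) (auto simp: distrib_right)
    finally show "(\<integral>\<^sup>+z\<in>unit_disk. ennreal (kap b z powr M * kap a z ^ 2 * (1 - cmod z) powr (\<gamma> - 1)) \<partial>lborel)
      \<le> ennreal ((2 powr M * C1 + 4 * C2) * ((1 - cmod a) powr (1 + \<gamma>) * kap b a powr M))" .
  qed (use C1 C2 in \<open>auto intro!: add_pos_pos mult_pos_pos\<close>)
qed

subsection \<open>Kernel means\<close>

text \<open>The factor 1/(1-|a|) of a Carleson mean is kept outside, so that the Schur test concerns
  k_a^M alone.\<close>

definition kmean :: "real \<Rightarrow> (complex \<Rightarrow> ennreal) \<Rightarrow> complex \<Rightarrow> ennreal"
  where "kmean M u a = (\<integral>\<^sup>+z\<in>unit_disk. ennreal (kap a z powr M) * u z \<partial>lborel)"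

lemma kmean_mono:
  assumes "\<And>z. cmod z < 1 \<Longrightarrow> u z \<le> v z" shows "kmean M u a \<le> kmean M v a"
  unfolding kmean_def by (intro nn_integral_mono) (auto intro!: mult_left_mono assms split: split_indicator)

lemma kmean_cmult:
  assumes [measurable]: "u \<in> borel_measurable borel"
  shows "kmean M (\<lambda>z. c * u z) a = c * kmean M u a"
  unfolding kmean_def by (subst nn_integral_cmult[symmetric]) (measurable, simp add: mult_ac)

lemma kmean_add:
  assumes [measurable]: "u \<in> borel_measurable borel" "v \<in> borel_measurable borel"
  shows "kmean M (\<lambda>z. u z + v z) a = kmean M u a + kmean M v a"
  unfolding kmean_def by (subst nn_integral_add[symmetric]) (measurable, simp add: distrib_left distrib_right)

lemma kmean_sum:
  assumes [measurable]: "\<And>i. i \<in> F \<Longrightarrow> u i \<in> borel_measurable borel"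
  shows "kmean M (\<lambda>z. \<Sum>i\<in>F. u i z) a = (\<Sum>i\<in>F. kmean M (u i) a)"
  unfolding kmean_def by (subst nn_integral_sum[symmetric]) (measurable, simp add: sum_distrib_left sum_distrib_right)

text \<open>Schur test with k_a^M as test function: Tonelli moves the kernel mean to the adjoint
  side, where L has to map k_a^M to at most C k_a^M.\<close>

lemma schur_kmean:
  assumes [measurable]: "v \<in> borel_measurable borel" "case_prod L \<in> borel_measurable (borel \<Otimes>\<^sub>M borel)"
    and u: "\<And>z. cmod z < 1 \<Longrightarrow> u z \<le> (\<integral>\<^sup>+w\<in>unit_disk. L z w * v w \<partial>lborel)"
    and L: "\<And>w. cmod w < 1 \<Longrightarrow> (\<integral>\<^sup>+z\<in>unit_disk. ennreal (kap a z powr M) * L z w \<partial>lborel) \<le> C * ennreal (kap a w powr M)"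
  shows "kmean M u a \<le> C * kmean M v a"
proof -
  have [measurable (raw)]: "(\<lambda>x. L (f x) (g x)) \<in> borel_measurable N" if "f \<in> borel_measurable N" "g \<in> borel_measurable N" for f g N
    using measurable_compose[OF measurable_Pair[OF that] assms(2)] by simp
  have "kmean M u a \<le> (\<integral>\<^sup>+z. ennreal (kap a z powr M) * (\<integral>\<^sup>+w\<in>unit_disk. L z w * v w \<partial>lborel) * indicator unit_disk z \<partial>lborel)"
    unfolding kmean_def by (intro nn_integral_mono) (auto intro!: mult_left_mono u split: split_indicator)
  also have "... = (\<integral>\<^sup>+z. (\<integral>\<^sup>+w. ennreal (kap a z powr M) * indicator unit_disk z * (L z w * v w * indicator unit_disk w) \<partial>lborel) \<partial>lborel)"
    by (intro nn_integral_cong, subst nn_integral_cmult) (measurable, simp add: mult_ac)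
  also have "... = (\<integral>\<^sup>+w. (\<integral>\<^sup>+z. ennreal (kap a z powr M) * indicator unit_disk z * (L z w * v w * indicator unit_disk w) \<partial>lborel) \<partial>lborel)"
    by (rule lborel_pair.Fubini') measurable
  also have "... = (\<integral>\<^sup>+w. v w * indicator unit_disk w * (\<integral>\<^sup>+z\<in>unit_disk. ennreal (kap a z powr M) * L z w \<partial>lborel) \<partial>lborel)"
    by (intro nn_integral_cong, subst nn_integral_cmult[symmetric]) (measurable, simp add: mult_ac)
  also have "... \<le> (\<integral>\<^sup>+w. v w * indicator unit_disk w * (C * ennreal (kap a w powr M)) \<partial>lborel)"
    by (intro nn_integral_mono) (auto intro!: mult_left_mono L split: split_indicator)
  also have "... = C * kmean M v a"
    unfolding kmean_def by (subst nn_integral_cmult[symmetric]) (measurable, simp add: mult_ac)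
  finally show ?thesis .
qed

text \<open>This explicit kernel dominates averages over hyperbolic discs as well as the non-local
  chains and circles that occur later. The singular factor (1-|z|)^(\<gamma> - 1) tolerates growth
  towards the boundary; \<open>kernel_composition\<close> supplies the adjoint bound.\<close>

lemma schur_kernel:
  assumes \<gamma>: "0 < \<gamma>" "\<gamma> < 1" and M: "0 \<le> M" "M < 1 + \<gamma>"
  obtains C where "0 < C" "\<And>K u v a. v \<in> borel_measurable borel \<Longrightarrow> 0 \<le> K \<Longrightarrow>
     (\<And>z. cmod z < 1 \<Longrightarrow> u z \<le> (\<integral>\<^sup>+w\<in>unit_disk. ennreal (K * (kap w z ^ 2 * (1 - cmod z) powr (\<gamma> - 1) * (1 - cmod w) powr (- 1 - \<gamma>))) * v w \<partial>lborel)) \<Longrightarrow>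
     cmod a < 1 \<Longrightarrow> kmean M u a \<le> ennreal (C * K) * kmean M v a"
proof -
  obtain C where C: "0 < C" "\<And>a b. cmod a < 1 \<Longrightarrow> cmod b < 1 \<Longrightarrow>
    (\<integral>\<^sup>+z\<in>unit_disk. ennreal (kap b z powr M * kap a z ^ 2 * (1 - cmod z) powr (\<gamma> - 1)) \<partial>lborel)
      \<le> ennreal (C * ((1 - cmod a) powr (1 + \<gamma>) * kap b a powr M))"
    using kernel_composition[OF assms] by blast
  show ?thesis
  proof (rule that[OF C(1)])
    fix K :: real and u v :: "complex \<Rightarrow> ennreal" and a :: complex
    assume v: "v \<in> borel_measurable borel" and K: "0 \<le> K" and a: "cmod a < 1"
      and u: "\<And>z. cmod z < 1 \<Longrightarrow> u z \<le> (\<integral>\<^sup>+w\<in>unit_disk. ennreal (K * (kap w z ^ 2 * (1 - cmod z) powr (\<gamma> - 1) * (1 - cmod w) powr (- 1 - \<gamma>))) * v w \<partial>lborel)"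
    show "kmean M u a \<le> ennreal (C * K) * kmean M v a"
    proof (rule schur_kmean[OF v _ u])
      show "(\<lambda>(z, w). ennreal (K * (kap w z ^ 2 * (1 - cmod z) powr (\<gamma> - 1) * (1 - cmod w) powr (- 1 - \<gamma>)))) \<in> borel_measurable (borel \<Otimes>\<^sub>M borel)"
        by measurable
      fix w :: complex assume w: "cmod w < 1"
      have "(\<integral>\<^sup>+z\<in>unit_disk. ennreal (kap a z powr M) * ennreal (K * (kap w z ^ 2 * (1 - cmod z) powr (\<gamma> - 1) * (1 - cmod w) powr (- 1 - \<gamma>))) \<partial>lborel)
        = (\<integral>\<^sup>+z. ennreal (K * (1 - cmod w) powr (- 1 - \<gamma>)) * (ennreal (kap a z powr M * kap w z ^ 2 * (1 - cmod z) powr (\<gamma> - 1)) * indicator unit_disk z) \<partial>lborel)"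
        using K by (intro nn_integral_cong) (auto simp: ennreal_mult[symmetric] mult_ac split: split_indicator)
      also have "... = ennreal (K * (1 - cmod w) powr (- 1 - \<gamma>)) * (\<integral>\<^sup>+z\<in>unit_disk. ennreal (kap a z powr M * kap w z ^ 2 * (1 - cmod z) powr (\<gamma> - 1)) \<partial>lborel)"
        by (rule nn_integral_cmult) measurable
      also have "... \<le> ennreal (K * (1 - cmod w) powr (- 1 - \<gamma>)) * ennreal (C * ((1 - cmod w) powr (1 + \<gamma>) * kap a w powr M))"
        using C a w by (intro mult_left_mono) auto
      also have "... = ennreal (C * K) * ennreal (kap a w powr M)"
      proof -
        have "(1 - cmod w) powr (- 1 - \<gamma>) * (1 - cmod w) powr (1 + \<gamma>) = 1" using w by (simp add: powr_add[symmetric])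
        hence "K * (1 - cmod w) powr (- 1 - \<gamma>) * (C * ((1 - cmod w) powr (1 + \<gamma>) * kap a w powr M)) = C * K * kap a w powr M"
          by (metis (no_types, opaque_lifting) mult.assoc mult.commute mult.right_neutral)
        thus ?thesis using K C by (simp add: ennreal_mult[symmetric])
      qed
      finally show "(\<integral>\<^sup>+z\<in>unit_disk. ennreal (kap a z powr M) * ennreal (K * (kap w z ^ 2 * (1 - cmod z) powr (\<gamma> - 1) * (1 - cmod w) powr (- 1 - \<gamma>))) \<partial>lborel) \<le> ..." .
    qed
  qed
qed

subsection \<open>Carleson squares\<close>

definition tmean :: "(complex \<Rightarrow> ennreal) \<Rightarrow> complex \<Rightarrow> ennreal"
  where "tmean u a = ennreal (1 / (1 - cmod a)) * (\<integral>\<^sup>+z\<in>carleson_square a. u z \<partial>lborel)"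

text \<open>Written with real epsilon and delta rather than a filter, because the condition is
  transferred by pointwise inequalities that hold only in the disk.\<close>

definition vanishing :: "(complex \<Rightarrow> ennreal) \<Rightarrow> bool"
  where "vanishing F \<longleftrightarrow> (\<forall>\<epsilon>>0. \<exists>\<delta>>0. \<forall>a. 1 - \<delta> < cmod a \<longrightarrow> cmod a < 1 \<longrightarrow> F a \<le> ennreal \<epsilon>)"

lemma vanishing_mono:
  assumes "vanishing F" "\<And>a. cmod a < 1 \<Longrightarrow> G a \<le> ennreal K * F a" "0 \<le> K"
  shows "vanishing G"
  unfolding vanishing_def
proof (intro allI impI)
  fix \<epsilon> :: real assume \<epsilon>: "\<epsilon> > 0"
  hence "\<epsilon> / (K + 1) > 0" using assms by auto
  then obtain \<delta> where \<delta>: "\<delta> > 0" "\<And>a. 1 - \<delta> < cmod a \<Longrightarrow> cmod a < 1 \<Longrightarrow> F a \<le> ennreal (\<epsilon> / (K + 1))"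
    using assms(1) unfolding vanishing_def by meson
  have "G a \<le> ennreal \<epsilon>" if "1 - \<delta> < cmod a" "cmod a < 1" for a
  proof -
    have "G a \<le> ennreal K * ennreal (\<epsilon> / (K + 1))" using assms(2)[OF that(2)] \<delta>(2)[OF that]
      by (meson mult_left_mono order_trans zero_le)
    also have "... = ennreal (K * (\<epsilon> / (K + 1)))" using assms(3) by (rule ennreal_mult'[symmetric])
    also have "K * (\<epsilon> / (K + 1)) \<le> \<epsilon>" using assms(3) \<epsilon> by (simp add: field_simps)
    finally show ?thesis by (simp add: ennreal_leI)
  qed
  thus "\<exists>\<delta>>0. \<forall>a. 1 - \<delta> < cmod a \<longrightarrow> cmod a < 1 \<longrightarrow> G a \<le> ennreal \<epsilon>" using \<delta>(1) by blast
qed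

lemma vanishing_iff_tendsto: "vanishing F \<longleftrightarrow> (F \<longlongrightarrow> 0) (filtercomap cmod (at_left 1))"
proof
  assume v: "vanishing F"
  show "(F \<longlongrightarrow> 0) (filtercomap cmod (at_left 1))"
  proof (rule order_tendstoI)
    fix y :: ennreal assume "0 < y"
    then obtain \<epsilon> where \<epsilon>: "0 < \<epsilon>" "ennreal \<epsilon> < y"
    proof -
      obtain z where "0 < z" "z < y" using dense[OF \<open>0 < y\<close>] by auto
      thus ?thesis using that[of "enn2real z"] by (metis enn2real_positive_iff ennreal_enn2real less_top order_less_trans top.not_eq_extremum)
    qed
    then obtain \<delta> where \<delta>: "\<delta> > 0" "\<And>a. 1 - \<delta> < cmod a \<Longrightarrow> cmod a < 1 \<Longrightarrow> F a \<le> ennreal \<epsilon>"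
      using v unfolding vanishing_def by meson
    have "eventually (\<lambda>r. 1 - \<delta> < r \<and> r < 1) (at_left (1::real))"
      using \<delta>(1) eventually_at_left[of "1 - \<delta>" 1] by (auto intro!: exI[of _ "1 - \<delta>"])
    thus "eventually (\<lambda>a. F a < y) (filtercomap cmod (at_left 1))"
      unfolding eventually_filtercomap using \<delta> \<epsilon> by (intro exI conjI) (auto intro: le_less_trans)
  qed simp
next
  assume t: "(F \<longlongrightarrow> 0) (filtercomap cmod (at_left 1))"
  show "vanishing F" unfolding vanishing_def
  proof (intro allI impI)
    fix \<epsilon> :: real assume "\<epsilon> > 0"
    hence "eventually (\<lambda>a. F a < ennreal \<epsilon>) (filtercomap cmod (at_left 1))"
      by (intro order_tendstoD(2)[OF t]) simp
    then obtain P where P: "eventually P (at_left (1::real))" "\<And>a. P (cmod a) \<Longrightarrow> F a < ennreal \<epsilon>"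
      unfolding eventually_filtercomap by auto
    obtain b where "b < 1" "\<And>y. b < y \<Longrightarrow> y < 1 \<Longrightarrow> P y"
      using P(1) eventually_at_left[of 0 "1::real" P] by auto
    thus "\<exists>\<delta>>0. \<forall>a. 1 - \<delta> < cmod a \<longrightarrow> cmod a < 1 \<longrightarrow> F a \<le> ennreal \<epsilon>"
      using P(2) by (intro exI[of _ "1 - b"]) (auto intro: less_imp_le)
  qed
qed

text \<open>For a point of modulus rho in the square, 1 - |a| rho is at most 1-|a|^2, hence at most
  2(1-|a|), and the angle adds at most (1-|a|)/2; 3 is a round bound for the sum.\<close>

lemma carleson_square_subset:
  assumes "cmod a < 1" "z \<in> carleson_square a"
  shows "cmod z < 1" "cmod (1 - cnj a * z) \<le> 3 * (1 - cmod a)"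
proof -
  have "cmod z < 1 \<and> cmod (1 - cnj a * z) \<le> 3 * (1 - cmod a)"
  proof (cases "a = 0")
    case True thus ?thesis using assms by (simp add: carleson_square_def)
  next
    case False
    then obtain \<rho> t where z: "z = rcis \<rho> t" "cmod a \<le> \<rho>" "\<rho> < 1" "\<bar>t - Arg a\<bar> \<le> (1 - cmod a) / 2"
      using assms unfolding carleson_square_def by auto
    have \<rho>: "0 \<le> \<rho>" using z norm_ge_zero[of a] by linarith
    have cz: "cmod z = \<rho>" using z \<rho> by simp
    define \<phi> where "\<phi> = t - Arg a"
    have "cnj a * z = rcis (cmod a) (- Arg a) * rcis \<rho> t"
      using rcis_cmod_Arg[of a] z by (metis rcis_cnj)
    also have "... = rcis (cmod a * \<rho>) \<phi>" by (simp add: rcis_mult \<phi>_def)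
    finally have e: "cnj a * z = of_real (cmod a * \<rho>) * cis \<phi>" by (simp add: rcis_def)
    have "cmod (cis \<phi> - 1) \<le> \<bar>\<phi>\<bar>"
      using dist_exp_i_1[of \<phi>] abs_sin_x_le_abs_x[of "\<phi>/2"] by (simp add: cis_conv_exp)
    hence 1: "cmod (1 - cis \<phi>) \<le> (1 - cmod a) / 2" using z by (simp add: \<phi>_def norm_minus_commute)
    have "1 - cnj a * z = of_real (1 - cmod a * \<rho>) + of_real (cmod a * \<rho>) * (1 - cis \<phi>)" unfolding e by (simp add: algebra_simps)
    hence "cmod (1 - cnj a * z) \<le> \<bar>1 - cmod a * \<rho>\<bar> + \<bar>cmod a * \<rho>\<bar> * cmod (1 - cis \<phi>)"
      by (metis norm_triangle_ineq norm_mult norm_of_real)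
    also have "\<bar>1 - cmod a * \<rho>\<bar> = 1 - cmod a * \<rho>" using assms z \<rho> by (simp add: mult_le_one)
    also have "\<bar>cmod a * \<rho>\<bar> * cmod (1 - cis \<phi>) \<le> 1 * cmod (1 - cis \<phi>)"
      using assms z \<rho> by (intro mult_right_mono) (auto simp: mult_le_one)
    finally have "cmod (1 - cnj a * z) \<le> 1 - cmod a * \<rho> + 1 * cmod (1 - cis \<phi>)" by simp
    moreover have "cmod a * cmod a \<le> cmod a * \<rho>" using z by (intro mult_left_mono) auto
    moreover have "1 - cmod a * cmod a \<le> 2 * (1 - cmod a)" using zero_le_power2[of "1 - cmod a"] by (simp add: power2_eq_square algebra_simps)
    ultimately have "cmod (1 - cnj a * z) \<le> 2 * (1 - cmod a) + 1 * cmod (1 - cis \<phi>)" by linarith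
    with 1 have "cmod (1 - cnj a * z) \<le> 3 * (1 - cmod a)" using assms by simp
    thus ?thesis using cz z by simp
  qed
  thus "cmod z < 1" "cmod (1 - cnj a * z) \<le> 3 * (1 - cmod a)" by auto
qed

lemma carleson_square_measurable [measurable]: "carleson_square a \<in> sets borel"
proof (cases "a = 0 \<or> cmod a \<ge> 1")
  case True
  show ?thesis
  proof (cases "a = 0")
    case True thus ?thesis by (simp add: carleson_square_def)
  next
    case False
    hence "carleson_square a = {}" using True by (auto simp: carleson_square_def)
    thus ?thesis by simp
  qed
next
  case False
  \<comment> \<open>The square is not closed, as the modulus stays below 1. It is the intersection
    of the open disk with the compact image of a closed polar rectangle.\<close>
  define K where "K = (\<lambda>p. rcis (fst p) (snd p)) ` ({cmod a..1} \<times> {Arg a - (1 - cmod a)/2..Arg a + (1 - cmod a)/2})"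
  have "compact K" unfolding K_def rcis_def
    by (intro compact_continuous_image continuous_intros compact_Times compact_Icc)
  moreover have "carleson_square a = K \<inter> ball 0 1"
  proof (intro set_eqI iffI)
    fix z assume "z \<in> carleson_square a"
    then obtain \<rho> t where z: "z = rcis \<rho> t" "cmod a \<le> \<rho>" "\<rho> < 1" "\<bar>t - Arg a\<bar> \<le> (1 - cmod a) / 2"
      using False unfolding carleson_square_def by auto
    have "0 \<le> \<rho>" using z norm_ge_zero[of a] by linarith
    moreover have "(\<rho>, t) \<in> {cmod a..1} \<times> {Arg a - (1 - cmod a)/2..Arg a + (1 - cmod a)/2}"
    proof -
      have "t - Arg a \<le> (1 - cmod a) / 2" "- (t - Arg a) \<le> (1 - cmod a) / 2" using z(4) by linarith+
      hence "Arg a - (1 - cmod a)/2 \<le> t" "t \<le> Arg a + (1 - cmod a)/2" by linarith+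
      thus ?thesis using z by simp
    qed
    hence "z \<in> K" unfolding K_def using z by force
    ultimately show "z \<in> K \<inter> ball 0 1" using z by simp
  next
    fix z assume "z \<in> K \<inter> ball 0 1"
    then obtain \<rho> t where z: "z = rcis \<rho> t" "cmod a \<le> \<rho>" "\<rho> \<le> 1" "t \<in> {Arg a - (1 - cmod a)/2..Arg a + (1 - cmod a)/2}" "cmod z < 1"
      unfolding K_def by auto
    have "0 \<le> \<rho>" using z norm_ge_zero[of a] by linarith
    hence "\<rho> < 1" using z by simp
    moreover have "\<bar>t - Arg a\<bar> \<le> (1 - cmod a) / 2"
    proof -
      have "Arg a - (1 - cmod a)/2 \<le> t" "t \<le> Arg a + (1 - cmod a)/2" using z(4) by auto
      thus ?thesis by linarith
    qed
    ultimately show "z \<in> carleson_square a" using False z unfolding carleson_square_def by auto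
  qed
  ultimately show ?thesis by (auto intro: borel_compact)
qed

text \<open>The vertex a' lies on the ray through a with 1-|a'| = 8t, so the square has angular
  half-width 4t, while points of the kernel ball deviate from that ray by at most 16t/7 in angle.
  For t at least 1/8 the square at 0 is the whole disk; for a = 0 and smaller t the ball is
  empty.\<close>

lemma kernel_ball_in_carleson_square:
  assumes a: "cmod a < 1" and t: "0 < t"
  obtains a' where "cmod a' < 1" "1 - cmod a' \<le> 8 * t"
    "{z. cmod z < 1 \<and> cmod (1 - cnj a * z) < t} \<subseteq> carleson_square a'"
proof (cases "t < 1/8 \<and> a \<noteq> 0")
  case False
  show ?thesis
  proof (cases "t < 1/8")
    case False
    thus ?thesis by (intro that[of 0]) (auto simp: carleson_square_def)
  next
    case True
    with False have "{z. cmod z < 1 \<and> cmod (1 - cnj a * z) < t} = {}" by auto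
    thus ?thesis using True t by (intro that[of "of_real (1 - 8 * t)"]) (auto simp: norm_of_real simp del: of_real_diff)
  qed
next
  case True
  define k where "k = (1 - 8 * t) / cmod a"
  have k: "k > 0" unfolding k_def using True by simp
  define a' where "a' = of_real k * a"
  have "cmod a' = k * cmod a" unfolding a'_def using k by (simp only: norm_mult norm_of_real abs_of_pos)
  hence a': "cmod a' = 1 - 8 * t" using True by (simp add: k_def)
  have a'0: "a' \<noteq> 0" using k True unfolding a'_def by simp
  show ?thesis
  proof (rule that[of a'])
    show "{z. cmod z < 1 \<and> cmod (1 - cnj a * z) < t} \<subseteq> carleson_square a'"
    proof
      fix z assume "z \<in> {z. cmod z < 1 \<and> cmod (1 - cnj a * z) < t}"
      hence z: "cmod z < 1" "cmod (1 - cnj a * z) < t" by auto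
      define x where "x = cnj a * z"
      define y where "y = cnj a' * z"
      have y: "y = of_real k * x" unfolding y_def x_def a'_def by simp
      have "\<bar>Re (1 - x)\<bar> < t" "\<bar>Im (1 - x)\<bar> < t"
        using z abs_Re_le_cmod[of "1 - x"] abs_Im_le_cmod[of "1 - x"] unfolding x_def by linarith+
      hence x: "Re x > 1 - t" "\<bar>Im x\<bar> < t" by auto
      hence xc: "cmod x > 1 - t" using complex_Re_le_cmod[of x] by linarith
      have Rey: "Re y > 0" using x k True by (simp add: y)
      hence y0: "y \<noteq> 0" by auto
      define \<phi> where "\<phi> = Arg y"
      have yc: "y = of_real (cmod y) * cis \<phi>" using rcis_cmod_Arg[of y] by (simp add: rcis_def \<phi>_def)
      have "\<bar>\<phi>\<bar> < pi/2" using Rey Arg_Re_pos[of y] unfolding \<phi>_def by auto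
      hence "\<bar>\<phi>\<bar> / 2 \<le> sin \<bar>\<phi>\<bar>" by (intro sin_ge_half) auto
      also have "sin \<bar>\<phi>\<bar> \<le> \<bar>sin \<phi>\<bar>" by (cases "\<phi> \<ge> 0") auto
      also have "\<bar>sin \<phi>\<bar> = \<bar>Im y\<bar> / cmod y"
      proof -
        have "Im y = Im (of_real (cmod y) * cis \<phi>)" using yc by (rule arg_cong)
        hence "Im y = cmod y * sin \<phi>" by simp
        thus ?thesis using y0 by (simp add: abs_mult)
      qed
      also have "... = \<bar>Im x\<bar> / cmod x" using k by (simp add: y norm_mult abs_mult)
      also have "... \<le> t / (7/8)" using x xc True t by (intro frac_le) auto
      finally have \<phi>: "\<bar>\<phi>\<bar> \<le> 4 * t" using t by simp
      have "cmod x \<le> cmod z" unfolding x_def using a by (simp add: norm_mult mult_left_le_one_le)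
      hence cz: "cmod a' \<le> cmod z" using xc a' t by linarith
      have "z = rcis (cmod z) (\<phi> + Arg a')"
      proof -
        have "a' * cnj a' * z = a' * y" unfolding y_def by (simp add: mult.assoc)
        also have "... = (of_real (cmod a') * cis (Arg a')) * (of_real (cmod y) * cis \<phi>)"
          using yc rcis_cmod_Arg[of a'] by (simp add: rcis_def)
        also have "cmod y = cmod a' * cmod z" unfolding y_def by (simp add: norm_mult)
        finally have "of_real (cmod a'^2) * z = of_real (cmod a'^2) * (of_real (cmod z) * cis (\<phi> + Arg a'))"
          by (simp only: complex_norm_square[symmetric]) (simp add: cis_mult[symmetric] power2_eq_square mult_ac)
        thus ?thesis using a'0 by (simp add: rcis_def)
      qed
      moreover have "\<bar>(\<phi> + Arg a') - Arg a'\<bar> \<le> (1 - cmod a') / 2" using \<phi> a' by simp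
      ultimately have "\<exists>\<rho> t. z = rcis \<rho> t \<and> cmod a' \<le> \<rho> \<and> \<rho> < 1 \<and> \<bar>t - Arg a'\<bar> \<le> (1 - cmod a') / 2"
        using cz z(1) by blast
      thus "z \<in> carleson_square a'" unfolding carleson_square_def using a'0 by (simp only: if_False mem_Collect_eq)
    qed
  qed (use a' t in auto)
qed

lemma tmean_le_kmean:
  assumes [measurable]: "u \<in> borel_measurable borel" and a: "cmod a < 1" and M: "0 \<le> M"
  shows "tmean u a \<le> ennreal (3 powr M) * (ennreal (1 / (1 - cmod a)) * kmean M u a)"
proof -
  have "(\<integral>\<^sup>+z\<in>carleson_square a. u z \<partial>lborel) \<le> (\<integral>\<^sup>+z. ennreal (3 powr M) * (ennreal (kap a z powr M) * u z * indicator unit_disk z) \<partial>lborel)"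
  proof (intro nn_integral_mono)
    fix z
    show "u z * indicator (carleson_square a) z \<le> ennreal (3 powr M) * (ennreal (kap a z powr M) * u z * indicator unit_disk z)"
    proof (cases "z \<in> carleson_square a")
      case True
      note z = carleson_square_subset[OF a True]
      have "1/3 \<le> kap a z" using z cmod_kernel_pos[OF a z(1)] unfolding kap_def by (simp add: field_simps)
      hence "1 \<le> 3 * kap a z" by simp
      hence "1 \<le> (3 * kap a z) powr M" using M by (simp add: ge_one_powr_ge_zero)
      also have "... = 3 powr M * kap a z powr M" by (simp add: powr_mult)
      finally have "ennreal 1 * u z \<le> ennreal (3 powr M * kap a z powr M) * u z" by (intro mult_right_mono ennreal_leI) auto
      thus ?thesis using True z by (simp add: ennreal_mult mult.assoc)
    qed simp
  qed
  also have "... = ennreal (3 powr M) * kmean M u a" unfolding kmean_def by (rule nn_integral_cmult) measurable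
  finally show ?thesis unfolding tmean_def by (subst mult.left_commute) (intro mult_left_mono, auto)
qed

text \<open>Only squares of size at most 8t enter, and the hypothesis is restricted to them;
  \<open>kmean_vanishing\<close> depends on this restriction.\<close>

lemma kernel_ball_mass:
  assumes [measurable]: "u \<in> borel_measurable borel" and a: "cmod a < 1" and t: "0 < t"
    and B: "\<And>a'. cmod a' < 1 \<Longrightarrow> 1 - cmod a' \<le> 8 * t \<Longrightarrow> tmean u a' \<le> B"
  shows "(\<integral>\<^sup>+z. u z * indicator unit_disk z * indicator {z. cmod (1 - cnj a * z) < t} z \<partial>lborel) \<le> ennreal 8 * B * ennreal t"
proof -
  obtain a' where a': "cmod a' < 1" "1 - cmod a' \<le> 8 * t" "{z. cmod z < 1 \<and> cmod (1 - cnj a * z) < t} \<subseteq> carleson_square a'"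
    using kernel_ball_in_carleson_square[OF a t] by blast
  have "(\<integral>\<^sup>+z. u z * indicator unit_disk z * indicator {z. cmod (1 - cnj a * z) < t} z \<partial>lborel) \<le> (\<integral>\<^sup>+z\<in>carleson_square a'. u z \<partial>lborel)"
    using a'(3) by (intro nn_integral_mono) (auto split: split_indicator)
  also have "... = ennreal (1 - cmod a') * tmean u a'"
    unfolding tmean_def using a' by (subst mult.assoc[symmetric], subst ennreal_mult[symmetric]) auto
  also have "... \<le> ennreal (8 * t) * B" using a' B by (intro mult_mono ennreal_leI) auto
  finally show ?thesis using t by (simp add: ennreal_mult mult_ac)
qed

lemma kmean_eq_dyadic:
  assumes [measurable]: "u \<in> borel_measurable borel" and a: "cmod a < 1"
  shows "kmean M u a = ennreal ((1 - cmod a) powr M) * (\<integral>\<^sup>+z. u z * indicator unit_disk z * ennreal (cmod (1 - cnj a * z) powr - M) \<partial>lborel)"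
  unfolding kmean_def using a
  by (subst nn_integral_cmult[symmetric], measurable)
     (auto simp: kap_def powr_divide powr_minus_divide ennreal_mult[symmetric] mult_ac split: split_indicator intro!: nn_integral_cong;
      simp add: mult.assoc[symmetric] ennreal_mult[symmetric])

text \<open>Linear growth of the mass of kernel balls is a form of the Carleson condition; M > 1
  makes the dyadic sum over balls converge at the scale 1-|a|.\<close>

lemma kmean_le_mass:
  assumes u [measurable]: "u \<in> borel_measurable borel" and a: "cmod a < 1" and M: "1 < M"
    and B: "\<And>t. 1 - cmod a < t \<Longrightarrow> (\<integral>\<^sup>+z. u z * indicator unit_disk z * indicator {z. cmod (1 - cnj a * z) < t} z \<partial>lborel) \<le> B * ennreal t"
  shows "ennreal (1 / (1 - cmod a)) * kmean M u a \<le> ennreal (2 / (1 - 2 powr (1 - M))) * B"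
proof -
  define C where "C = 2 powr 1 / (1 - 2 powr (1 - M))"
  have r: "2 powr (1 - M) < 1" using M by (intro powr_less_one) auto
  have C: "C \<ge> 0" unfolding C_def using r by simp
  have "(\<integral>\<^sup>+z. u z * indicator unit_disk z * ennreal (cmod (1 - cnj a * z) powr - M) \<partial>lborel)
      \<le> ennreal C * (B * ennreal ((1 - cmod a) powr (1 - M)))"
    unfolding C_def
  proof (rule dyadic_up)
    show "1 - cmod a \<le> cmod (1 - cnj a * z)" if "u z * indicator unit_disk z \<noteq> 0" for z
    proof -
      have "cmod z < 1" using that by (auto split: split_indicator_asm)
      thus ?thesis using a by (intro cmod_kernel_ge)
    qed
    show "(\<integral>\<^sup>+z. u z * indicator unit_disk z * indicator {z. cmod (1 - cnj a * z) < t} z \<partial>lborel) \<le> B * ennreal (t powr 1)"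
      if "1 - cmod a < t" for t using B[OF that] that a by simp
  qed (use a M in auto)
  hence "kmean M u a \<le> ennreal ((1 - cmod a) powr M) * (ennreal C * (B * ennreal ((1 - cmod a) powr (1 - M))))"
    unfolding kmean_eq_dyadic[OF u a] by (rule mult_left_mono) simp
  also have "... = ennreal (C * (1 - cmod a)) * B"
  proof -
    have "(1 - cmod a) powr M * (1 - cmod a) powr (1 - M) = 1 - cmod a" using a by (simp add: powr_add[symmetric])
    hence "ennreal (C * (1 - cmod a)) = ennreal ((1 - cmod a) powr M) * ennreal C * ennreal ((1 - cmod a) powr (1 - M))"
      using C by (simp add: ennreal_mult[symmetric] mult_ac)
    thus ?thesis by (simp add: mult_ac)
  qed
  finally have "ennreal (1 / (1 - cmod a)) * kmean M u a \<le> ennreal (1 / (1 - cmod a)) * (ennreal (C * (1 - cmod a)) * B)"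
    by (rule mult_left_mono) simp
  also have "... = ennreal C * B" using a C by (subst mult.assoc[symmetric], subst ennreal_mult[symmetric]) auto
  finally show ?thesis unfolding C_def by simp
qed

lemma kmean_le_tmean:
  assumes M: "1 < M"
  obtains C where "0 < C" "\<And>u a B. u \<in> borel_measurable borel \<Longrightarrow> (\<And>a. cmod a < 1 \<Longrightarrow> tmean u a \<le> B) \<Longrightarrow> cmod a < 1 \<Longrightarrow>
     ennreal (1 / (1 - cmod a)) * kmean M u a \<le> ennreal C * B"
proof
  have r: "2 powr (1 - M) < 1" using M by (intro powr_less_one) auto
  show "0 < 2 / (1 - 2 powr (1 - M)) * 8" using r by simp
  fix u :: "complex \<Rightarrow> ennreal" and a B
  assume u: "u \<in> borel_measurable borel" and B: "\<And>a. cmod a < 1 \<Longrightarrow> tmean u a \<le> B" and a: "cmod a < 1"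
  have "ennreal (1 / (1 - cmod a)) * kmean M u a \<le> ennreal (2 / (1 - 2 powr (1 - M))) * (ennreal 8 * B)"
    using a by (intro kmean_le_mass[OF u a M] kernel_ball_mass[OF u a _ B]) auto
  also have "... = ennreal (2 / (1 - 2 powr (1 - M)) * 8) * B" using r by (subst ennreal_mult') (simp_all add: mult.assoc)
  finally show "ennreal (1 / (1 - cmod a)) * kmean M u a \<le> ennreal (2 / (1 - 2 powr (1 - M)) * 8) * B" .
qed

text \<open>The density is split at kernel distance t0 from a. The near part meets only small
  squares, whose means are already small; the far part is bounded by the total mass times
  (1-|a|)^(M-1) t0^(-M), which tends to 0 as |a| tends to 1.\<close>

lemma kmean_vanishing:
  assumes M: "1 < M" and u [measurable]: "u \<in> borel_measurable borel"
    and fin: "(\<integral>\<^sup>+z\<in>unit_disk. u z \<partial>lborel) < \<infinity>" and v: "vanishing (tmean u)"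
  shows "vanishing (\<lambda>a. ennreal (1 / (1 - cmod a)) * kmean M u a)"
  unfolding vanishing_def
proof (intro allI impI)
  fix \<epsilon> :: real assume \<epsilon>: "0 < \<epsilon>"
  have r: "2 powr (1 - M) < 1" using M by (intro powr_less_one) auto
  define C where "C = 2 / (1 - 2 powr (1 - M)) * 8"
  have C: "C > 0" unfolding C_def using r by simp
  define \<eta> where "\<eta> = \<epsilon> / (2 * C)"
  have "\<eta> > 0" unfolding \<eta>_def using \<epsilon> C by simp
  then obtain \<delta> where \<delta>: "\<delta> > 0" "\<And>a. 1 - \<delta> < cmod a \<Longrightarrow> cmod a < 1 \<Longrightarrow> tmean u a \<le> ennreal \<eta>"
    using v unfolding vanishing_def by meson
  \<comment> \<open>Kernel balls of radius t0 then lie in squares of size at most 8 t0 =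
    \<delta>/2.\<close>
  define t0 where "t0 = \<delta> / 16"
  have t0: "0 < t0" unfolding t0_def using \<delta> by simp
  define I where "I = enn2real (\<integral>\<^sup>+z\<in>unit_disk. u z \<partial>lborel)"
  have I: "(\<integral>\<^sup>+z\<in>unit_disk. u z \<partial>lborel) = ennreal I" "I \<ge> 0" unfolding I_def using fin by (simp_all add: less_top)
  have "((\<lambda>x. x powr (M - 1) * (t0 powr - M * I)) \<longlongrightarrow> 0 * (t0 powr - M * I)) (at_right 0)"
    by (intro tendsto_mult tendsto_const tendsto_zero_powrI[where b = "M - 1"])
      (use M in \<open>auto intro!: tendsto_eq_intros simp: eventually_at_right_less eventually_at_filter\<close>)
  hence "eventually (\<lambda>x. x powr (M - 1) * (t0 powr - M * I) < \<epsilon> / 2) (at_right 0)"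
    by (rule order_tendstoD) (use \<epsilon> in simp)
  then obtain \<delta>1 where \<delta>1: "\<delta>1 > 0" "\<And>x. 0 < x \<Longrightarrow> x < \<delta>1 \<Longrightarrow> x powr (M - 1) * (t0 powr - M * I) < \<epsilon> / 2"
    by (auto simp: eventually_at_right[of 0 1])
  show "\<exists>\<delta>>0. \<forall>a. 1 - \<delta> < cmod a \<longrightarrow> cmod a < 1 \<longrightarrow> ennreal (1 / (1 - cmod a)) * kmean M u a \<le> ennreal \<epsilon>"
  proof (intro exI[of _ \<delta>1] conjI allI impI \<delta>1(1))
    fix a assume aa: "1 - \<delta>1 < cmod a" and a: "cmod a < 1"
    define u1 where "u1 = (\<lambda>z. u z * indicator {z. cmod (1 - cnj a * z) < t0} z)"
    define u2 where "u2 = (\<lambda>z. u z * indicator {z. cmod (1 - cnj a * z) \<ge> t0} z)"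
    have [measurable]: "u1 \<in> borel_measurable borel" "u2 \<in> borel_measurable borel" unfolding u1_def u2_def by measurable
    have "u = (\<lambda>z. u1 z + u2 z)" by (auto simp: u1_def u2_def fun_eq_iff split: split_indicator)
    hence sp: "kmean M u a = kmean M u1 a + kmean M u2 a" using kmean_add[of u1 u2 M a] by simp
    have "ennreal (1 / (1 - cmod a)) * kmean M u1 a \<le> ennreal (2 / (1 - 2 powr (1 - M))) * (ennreal 8 * ennreal \<eta>)"
    proof (intro kmean_le_mass a M)
      \<comment> \<open>The ball of radius t meets the near part in the ball of radius min(t, t0),
        so a large t never calls for a large square.\<close>
      fix t assume t: "1 - cmod a < t"
      hence tp: "0 < t" using a by simp
      have "(\<integral>\<^sup>+z. u1 z * indicator unit_disk z * indicator {z. cmod (1 - cnj a * z) < t} z \<partial>lborel)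
        \<le> (\<integral>\<^sup>+z. u z * indicator unit_disk z * indicator {z. cmod (1 - cnj a * z) < min t t0} z \<partial>lborel)"
        by (intro nn_integral_mono) (auto simp: u1_def split: split_indicator)
      also have "... \<le> ennreal 8 * ennreal \<eta> * ennreal (min t t0)"
        using t0 tp \<delta> by (intro kernel_ball_mass u a) (auto simp: t0_def min_def split: if_splits)
      also have "... \<le> ennreal 8 * ennreal \<eta> * ennreal t" by (intro mult_left_mono ennreal_leI) auto
      finally show "(\<integral>\<^sup>+z. u1 z * indicator unit_disk z * indicator {z. cmod (1 - cnj a * z) < t} z \<partial>lborel) \<le> ..." .
    qed auto
    also have "... = ennreal (C * \<eta>)" unfolding C_def using r \<open>\<eta> > 0\<close>
      by (simp only: ennreal_mult'[of 8 \<eta>, symmetric] mult.assoc) (subst ennreal_mult', auto)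
    finally have b1: "ennreal (1 / (1 - cmod a)) * kmean M u1 a \<le> ennreal (\<epsilon> / 2)" using C by (simp add: \<eta>_def)
    have "kmean M u2 a \<le> (\<integral>\<^sup>+z. ennreal (((1 - cmod a) / t0) powr M) * (u z * indicator unit_disk z) \<partial>lborel)"
      unfolding kmean_def
    proof (intro nn_integral_mono)
      fix z
      show "ennreal (kap a z powr M) * u2 z * indicator unit_disk z \<le> ennreal (((1 - cmod a) / t0) powr M) * (u z * indicator unit_disk z)"
      proof (cases "cmod z < 1 \<and> cmod (1 - cnj a * z) \<ge> t0")
        case True
        have "kap a z \<le> (1 - cmod a) / t0" unfolding kap_def using True t0 a by (intro divide_left_mono mult_pos_pos) linarith+
        hence "kap a z powr M \<le> ((1 - cmod a) / t0) powr M" using kap_pos[OF a, of z] True M by (intro powr_mono2) auto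
        thus ?thesis using True by (auto simp: u2_def intro!: mult_right_mono ennreal_leI)
      qed (auto simp: u2_def split: split_indicator)
    qed
    also have "... = ennreal (((1 - cmod a) / t0) powr M) * ennreal I" by (subst nn_integral_cmult) (auto simp: I)
    finally have "ennreal (1 / (1 - cmod a)) * kmean M u2 a \<le> ennreal (1 / (1 - cmod a)) * (ennreal (((1 - cmod a) / t0) powr M) * ennreal I)"
      by (rule mult_left_mono) simp
    also have "... = ennreal ((1 - cmod a) powr (M - 1) * (t0 powr - M * I))"
      using a I t0 by (simp add: ennreal_mult[symmetric] powr_diff powr_divide powr_minus_divide)
    also have "... \<le> ennreal (\<epsilon> / 2)" using \<delta>1(2)[of "1 - cmod a"] a aa by (intro ennreal_leI) auto
    finally have b2: "ennreal (1 / (1 - cmod a)) * kmean M u2 a \<le> ennreal (\<epsilon> / 2)" .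
    have "ennreal (1 / (1 - cmod a)) * kmean M u a \<le> ennreal (\<epsilon> / 2) + ennreal (\<epsilon> / 2)"
      unfolding sp distrib_left by (intro add_mono b1 b2)
    also have "... = ennreal \<epsilon>" using \<epsilon> by (subst ennreal_plus[symmetric]) auto
    finally show "ennreal (1 / (1 - cmod a)) * kmean M u a \<le> ennreal \<epsilon>" .
  qed
qed

lemma powr_log_swap:
  fixes x y b :: real
  assumes "0 < x" "0 < y"
  shows "x powr log b y = y powr log b x"
  using assms by (simp add: powr_def log_def)

subsection \<open>Radial weights\<close>

text \<open>The positive axis is a null set of the plane, so a Borel version of \<omega> says
  nothing directly about the values on it. But \<omega> is constant on circles, and by Fubini almost
  every circle meets the exceptional null set in a null set of angles; on such circles the angular
  mean of the Borel version recovers \<omega>.\<close>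

lemma radial_weight_profile:
  assumes "radial_weight \<omega>"
  obtains \<phi> :: "real \<Rightarrow> real" where "\<phi> \<in> borel_measurable borel" "\<And>s. 0 \<le> \<phi> s"
    "AE z in lborel. z \<in> unit_disk \<longrightarrow> \<omega> z = \<phi> (cmod z)"
    "AE s in lborel. s \<in> {0<..<1} \<longrightarrow> \<omega> (of_real s) = \<phi> s"
proof -
  have \<omega>: "\<And>z. z \<in> unit_disk \<Longrightarrow> 0 \<le> \<omega> z" "integrable (lebesgue_on unit_disk) \<omega>"
    "\<And>z. z \<in> unit_disk \<Longrightarrow> \<omega> z = \<omega> (of_real (cmod z))"
    using assms unfolding radial_weight_def weight_def by blast+
  have "(\<lambda>z. (if z \<in> unit_disk then \<omega> z else 0)) \<in> borel_measurable lebesgue"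
    using borel_measurable_integrable[OF \<omega>(2)] by (rule borel_measurable_if_I) simp
  then obtain \<omega>' where \<omega>' [measurable]: "\<omega>' \<in> borel_measurable borel" and "AE z in lborel. (if z \<in> unit_disk then \<omega> z else 0) = \<omega>' z"
    using completion_ex_borel_measurable_real[of _ lborel] by auto
  then obtain N where N: "{z. (if z \<in> unit_disk then \<omega> z else 0) \<noteq> \<omega>' z} \<subseteq> N" "emeasure lborel N = 0" and [measurable]: "N \<in> sets borel"
    by (elim AE_E) auto
  \<comment> \<open>The angle runs over the whole line, so that rotation invariance of
    \<open>Bad\<close> reduces to translation invariance. Its value is 0 or infinite, and only its
    vanishing matters.\<close>
  define Bad where "Bad = (\<lambda>s::real. \<integral>\<^sup>+t. indicator N (cis t * of_real s) \<partial>lborel)"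
  have [measurable]: "Bad \<in> borel_measurable borel" unfolding Bad_def by measurable
  have "(\<integral>\<^sup>+z. (\<integral>\<^sup>+t\<in>UNIV. indicator N (cis t * z) \<partial>lborel) \<partial>lborel) = 0"
    by (subst nn_integral_rotation_average) (auto simp: N)
  hence ae: "AE z in lborel. (\<integral>\<^sup>+t. indicator N (cis t * z) \<partial>lborel) = 0"
    by (subst (asm) nn_integral_0_iff_AE) auto
  have bad: "(\<integral>\<^sup>+t. indicator N (cis t * z) \<partial>lborel) = Bad (cmod z)" for z
  proof -
    have "Bad (cmod z) = (\<integral>\<^sup>+t. indicator N (cis (Arg z + 1 * t) * of_real (cmod z)) \<partial>lborel)"
      unfolding Bad_def using nn_integral_real_affine[of "\<lambda>t. indicator N (cis t * of_real (cmod z))" 1 "Arg z"] by simp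
    also have "(\<lambda>t. cis (Arg z + 1 * t) * of_real (cmod z)) = (\<lambda>t. cis t * z)"
    proof
      show "cis (Arg z + 1 * t) * of_real (cmod z) = cis t * z" for t
        using rcis_cmod_Arg[of z] by (simp add: cis_mult[symmetric] rcis_def mult_ac)
    qed
    finally show ?thesis by (simp add: fun_eq_iff)
  qed
  have ae1: "AE z in lborel. Bad (cmod z) = 0" using ae unfolding bad .
  have "(\<integral>\<^sup>+z\<in>unit_disk. (\<lambda>s. indicator {s. Bad s \<noteq> 0} s) (cmod z) \<partial>lborel) = 0"
    using ae1 by (subst nn_integral_0_iff_AE) (auto elim: eventually_mono)
  hence "(\<integral>\<^sup>+s\<in>{0<..<1}. indicator {s. Bad s \<noteq> 0} s * ennreal (2 * pi * s) \<partial>lborel) = 0"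
    by (subst (asm) nn_integral_radial) auto
  hence ae2: "AE s in lborel. indicator {s. Bad s \<noteq> 0} s * ennreal (2 * pi * s) * indicator {0<..<1} s = 0"
    by (subst (asm) nn_integral_0_iff_AE) auto
  define \<phi> where "\<phi> = (\<lambda>s::real. enn2real (\<integral>\<^sup>+t\<in>{0..1}. ennreal (\<omega>' (cis t * of_real s)) \<partial>lborel))"
  have key: "\<omega> (of_real s) = \<phi> s" if "0 < s" "s < 1" "Bad s = 0" for s
  proof -
    have "AE t in lborel. indicator N (cis t * of_real s) = (0::ennreal)"
      using that(3) unfolding Bad_def by (subst (asm) nn_integral_0_iff_AE) auto
    hence "AE t in lborel. \<omega>' (cis t * of_real s) = \<omega> (of_real s)"
    proof eventually_elim
      case (elim t)
      have d: "cis t * of_real s \<in> unit_disk" using that by (simp add: norm_mult)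
      have "cis t * of_real s \<notin> N" using elim by (auto split: split_indicator_asm)
      hence "(if cis t * of_real s \<in> unit_disk then \<omega> (cis t * of_real s) else 0) = \<omega>' (cis t * of_real s)" using N(1) by blast
      moreover have "\<omega> (cis t * of_real s) = \<omega> (of_real s)" using \<omega>(3)[OF d] that by (simp add: norm_mult)
      ultimately show ?case using d by simp
    qed
    hence "(\<integral>\<^sup>+t\<in>{0..1}. ennreal (\<omega>' (cis t * of_real s)) \<partial>lborel) = (\<integral>\<^sup>+t\<in>{0..1::real}. ennreal (\<omega> (of_real s)) \<partial>lborel)"
      by (intro nn_integral_cong_AE) (auto elim: eventually_mono)
    also have "... = ennreal (\<omega> (of_real s))" by (simp add: nn_integral_cmult)
    finally show ?thesis unfolding \<phi>_def using \<omega>(1)[of "of_real s"] that by simp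
  qed
  show ?thesis
  proof (rule that[of \<phi>])
    show "\<phi> \<in> borel_measurable borel" unfolding \<phi>_def by measurable
    show "0 \<le> \<phi> s" for s unfolding \<phi>_def by simp
    show "AE z in lborel. z \<in> unit_disk \<longrightarrow> \<omega> z = \<phi> (cmod z)"
      using ae1 AE_lborel_singleton[of "0::complex"]
    proof eventually_elim
      case (elim z)
      thus ?case using key[of "cmod z"] \<omega>(3)[of z] by auto
    qed
    show "AE s in lborel. s \<in> {0<..<1} \<longrightarrow> \<omega> (of_real s) = \<phi> s"
      using ae2
    proof eventually_elim
      case (elim s)
      thus ?case using key[of s] pi_gt_zero by (auto split: split_indicator_asm simp: ennreal_eq_0_iff mult_le_0_iff)
    qed
  qed
qed

text \<open>The condition is iterated until 1 - (1-r)/2^n passes t. With x = (1-r)/(1-t) this takes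
  about log_2 x steps, and C^(log_2 x) = x^(log_2 C). The spare factor C pays for rounding n
  up.\<close>

lemma doubling_upper_power:
  fixes w :: "real \<Rightarrow> real"
  assumes anti: "\<And>r t. 0 \<le> r \<Longrightarrow> r \<le> t \<Longrightarrow> t < 1 \<Longrightarrow> w t \<le> w r" and C: "1 \<le> C"
    and nonneg: "\<And>r. 0 \<le> w r"
    and d: "\<And>r. 0 \<le> r \<Longrightarrow> r < 1 \<Longrightarrow> w r \<le> C * w ((1 + r) / 2)"
    and rt: "0 \<le> r" "r \<le> t" "t < 1"
  shows "w r \<le> C * ((1 - r) / (1 - t)) powr log 2 C * w t"
proof -
  have it: "w r \<le> C^n * w (1 - (1 - r) / 2^n)" for n
  proof (induction n)
    case (Suc n)
    define s where "s = 1 - (1 - r) / 2^n"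
    have "(1 - r) / 2^n \<le> 1 - r" using rt by (simp add: divide_le_eq mult_left_le)
    hence "0 \<le> s" using rt unfolding s_def by linarith
    moreover have "s < 1" unfolding s_def using rt by simp
    ultimately have s: "0 \<le> s" "s < 1" .
    have "w r \<le> C^n * w s" using Suc unfolding s_def .
    also have "... \<le> C^n * (C * w ((1 + s) / 2))" using d[OF s] C by (intro mult_left_mono) auto
    also have "(1 + s) / 2 = 1 - (1 - r) / 2^Suc n" unfolding s_def by (simp add: field_simps)
    finally show ?case by (simp add: mult_ac)
  qed simp
  define x where "x = (1 - r) / (1 - t)"
  have x: "x \<ge> 1" unfolding x_def using rt by simp
  define n where "n = nat \<lceil>log 2 x\<rceil>"
  have "log 2 x \<ge> 0" using x by simp
  hence n: "log 2 x \<le> n" "n \<le> log 2 x + 1" unfolding n_def by linarith+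
  have "x \<le> 2 powr n" using n(1) x by (subst (asm) log_le_iff) auto
  hence "x \<le> 2^n" by (simp add: powr_realpow)
  hence "t \<le> 1 - (1 - r) / 2^n" unfolding x_def using rt by (simp add: field_simps)
  moreover have "1 - (1 - r) / 2^n < 1" using rt by simp
  ultimately have "w (1 - (1 - r) / 2^n) \<le> w t" using rt by (intro anti) auto
  with it[of n] have "w r \<le> C^n * w t" using C by (meson mult_left_mono order_trans zero_le_power zero_le_one)
  also have "C^n = C powr n" using C by (simp add: powr_realpow)
  also have "C powr n \<le> C powr (log 2 x + 1)" using n C by (intro powr_mono) auto
  also have "... = C * x powr log 2 C" using C x by (simp add: powr_add powr_log_swap[of C x])
  finally show ?thesis unfolding x_def using nonneg by (simp add: mult_right_mono)
qed

text \<open>The reverse condition is iterated in steps of ratio K and stopped before t is passed; n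
  is rounded down, and the spare factor C pays for that.\<close>

lemma doubling_lower_power:
  fixes w :: "real \<Rightarrow> real"
  assumes anti: "\<And>r t. 0 \<le> r \<Longrightarrow> r \<le> t \<Longrightarrow> t < 1 \<Longrightarrow> w t \<le> w r" and C: "1 < C" and K: "1 < K"
    and nonneg: "\<And>r. 0 \<le> w r"
    and d: "\<And>r. 0 \<le> r \<Longrightarrow> r < 1 \<Longrightarrow> C * w (1 - (1 - r) / K) \<le> w r"
    and rt: "0 \<le> r" "r \<le> t" "t < 1"
  shows "w t \<le> C * ((1 - t) / (1 - r)) powr log K C * w r"
proof -
  have it: "C^n * w (1 - (1 - r) / K^n) \<le> w r" for n
  proof (induction n)
    case (Suc n)
    define s where "s = 1 - (1 - r) / K^n"
    have "1 \<le> K^n" using K by simp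
    hence "(1 - r) / K^n \<le> 1 - r" using rt by (simp add: divide_le_eq mult_left_le)
    hence "0 \<le> s" using rt unfolding s_def by linarith
    moreover have "s < 1" unfolding s_def using rt K by simp
    ultimately have s: "0 \<le> s" "s < 1" .
    have e: "1 - (1 - s) / K = 1 - (1 - r) / K^Suc n" unfolding s_def by simp
    have "C^n * (C * w (1 - (1 - s) / K)) \<le> C^n * w s" using d[OF s] C by (intro mult_left_mono) auto
    also have "... \<le> w r" using Suc unfolding s_def .
    finally show ?case unfolding e by (simp add: mult_ac)
  qed simp
  define x where "x = (1 - r) / (1 - t)"
  have x: "x \<ge> 1" unfolding x_def using rt by simp
  define n where "n = nat \<lfloor>log K x\<rfloor>"
  have "log K x \<ge> 0" using x K by simp
  hence n: "n \<le> log K x" "log K x \<le> n + 1" unfolding n_def by linarith+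
  have "K powr n \<le> x" using n(1) x K by (subst (asm) le_log_iff) auto
  hence Kn: "K^n \<le> x" using K by (simp add: powr_realpow)
  have K1: "1 \<le> K^n" using K by simp
  have "K^n * (1 - t) \<le> 1 - r" using Kn unfolding x_def using rt by (simp add: pos_le_divide_eq)
  hence "1 - t \<le> (1 - r) / K^n" using K1 by (subst pos_le_divide_eq) (auto simp: mult.commute)
  hence "1 - (1 - r) / K^n \<le> t" by linarith
  moreover have "(1 - r) / K^n \<le> 1 - r" using rt K1 by (simp add: divide_le_eq mult_left_le)
  ultimately have "w t \<le> w (1 - (1 - r) / K^n)" using rt by (intro anti) auto
  hence "C^n * w t \<le> w r" using it[of n] C by (meson mult_left_mono order_trans zero_le_power zero_le_one less_imp_le)
  moreover have "x powr log K C \<le> C * C^n"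
  proof -
    have "x powr log K C = C powr log K x" using x C K by (simp add: powr_log_swap[of x C])
    also have "... \<le> C powr (n + 1)" using n C by (intro powr_mono) auto
    also have "... = C * C^n" using C by (simp add: powr_add powr_realpow)
    finally show ?thesis .
  qed
  ultimately have "x powr log K C * w t \<le> C * w r"
    using nonneg C by (meson mult_left_mono mult_right_mono order_trans less_imp_le zero_le_one mult.assoc[THEN eq_refl])
  moreover have "((1 - t) / (1 - r)) powr log K C = 1 / x powr log K C"
    unfolding x_def using rt by (simp add: powr_divide)
  moreover have "0 < x powr log K C" using x by simp
  ultimately show ?thesis by (simp only:) (simp add: pos_le_divide_eq mult_ac)
qed

subsection \<open>Doubling radial profiles\<close>

text \<open>One estimate for all p > 0, in place of Holder for p >= 1 and subadditivity for p < 1: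
  if m is the largest ratio x_i/l_i, the sum is at most L m, and m^p is one of the terms on the
  right. The weights l_i are free; later they are a geometric sequence or kernel weights.\<close>

lemma sum_powr_le:
  fixes x l :: "'i \<Rightarrow> real"
  assumes "finite F" "0 < p" "\<And>i. i \<in> F \<Longrightarrow> 0 \<le> x i" "\<And>i. i \<in> F \<Longrightarrow> 0 < l i" "sum l F \<le> L"
  shows "(sum x F) powr p \<le> L powr p * (\<Sum>i\<in>F. (l i) powr - p * x i powr p)"
proof (cases "F = {}")
  case False
  define m where "m = Max ((\<lambda>i. x i / l i) ` F)"
  have "m \<in> (\<lambda>i. x i / l i) ` F" unfolding m_def using assms False by (intro Max_in) auto
  then obtain j where j: "j \<in> F" "m = x j / l j" by auto
  have le: "x i \<le> l i * m" if "i \<in> F" for i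
  proof -
    have "x i / l i \<le> m" unfolding m_def using assms that by (intro Max_ge) auto
    thus ?thesis using assms(4)[OF that] by (simp add: field_simps)
  qed
  have m0: "0 \<le> m" unfolding j(2) using assms(3,4)[OF j(1)] by simp
  have "sum x F \<le> (\<Sum>i\<in>F. l i * m)" by (intro sum_mono le)
  also have "... = sum l F * m" by (simp add: sum_distrib_right)
  also have "... \<le> L * m" using assms m0 by (intro mult_right_mono) auto
  finally have "(sum x F) powr p \<le> (L * m) powr p"
    using assms by (intro powr_mono2) (auto intro: sum_nonneg)
  also have "... = L powr p * m powr p"
  proof -
    have "0 \<le> L" using assms(4,5) by (meson order_trans sum_nonneg less_imp_le)
    thus ?thesis using m0 by (simp add: powr_mult)
  qed
  also have "m powr p = l j powr - p * x j powr p"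
    using assms(3,4)[OF j(1)] by (simp add: j powr_divide powr_minus_divide)
  also have "... \<le> (\<Sum>i\<in>F. (l i) powr - p * x i powr p)"
    by (rule member_le_sum[OF j(1)]) (use assms in auto)
  finally show ?thesis by (simp add: mult_left_mono)
qed auto

text \<open>Used to count overlaps: levels whose scales differ by a factor of at most 2^m lie in a
  window of m + 1 consecutive integers.\<close>

lemma card_dyadic_le:
  assumes "finite J" "\<And>i j. i \<in> J \<Longrightarrow> j \<in> J \<Longrightarrow> (2::real)^j \<le> 2^m * 2^i"
  shows "card (J :: nat set) \<le> m + 1"
proof (cases "J = {}")
  case False
  define i where "i = Min J"
  have i: "i \<in> J" unfolding i_def using assms False by (intro Min_in) auto
  have "J \<subseteq> {i..i+m}"
  proof
    fix j assume j: "j \<in> J"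
    have "i \<le> j" unfolding i_def using assms j by (intro Min_le) auto
    moreover have "(2::real)^j \<le> 2^(m + i)" using assms(2)[OF i j] by (simp add: power_add)
    hence "j \<le> m + i" by (simp add: power_increasing_iff)
    ultimately show "j \<in> {i..i+m}" by simp
  qed
  hence "card J \<le> card {i..i+m}" by (intro card_mono) auto
  thus ?thesis by simp
qed simp

text \<open>Here w stands for the tail integral of the weight as a function of the radius, and the
  two growth conditions are the power forms of upper and lower doubling. The bound \<alpha> < 1 is
  no restriction, since the exponent in \<open>w_lower\<close> may be decreased, and it keeps
  \<alpha>/2 within the range of \<open>schur_kernel\<close>.\<close>

locale doubling =
  fixes w :: "real \<Rightarrow> real" and C0 \<alpha> \<beta> :: real
  assumes w_borel [measurable]: "w \<in> borel_measurable borel"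
    and w_pos: "\<And>r. 0 \<le> r \<Longrightarrow> r < 1 \<Longrightarrow> 0 < w r"
    and C0: "1 \<le> C0" and alpha: "0 < \<alpha>" "\<alpha> < 1" "\<alpha> \<le> \<beta>"
    and w_upper: "\<And>r t. 0 \<le> r \<Longrightarrow> r \<le> t \<Longrightarrow> t < 1 \<Longrightarrow> w r \<le> C0 * ((1 - r) / (1 - t)) powr \<beta> * w t"
    and w_lower: "\<And>r t. 0 \<le> r \<Longrightarrow> r \<le> t \<Longrightarrow> t < 1 \<Longrightarrow> w t \<le> C0 * ((1 - t) / (1 - r)) powr \<alpha> * w r"
begin

definition W :: "complex \<Rightarrow> real"
  where "W z = w (cmod z) / (1 - cmod z)"

definition En :: "real \<Rightarrow> (complex \<Rightarrow> complex) \<Rightarrow> complex \<Rightarrow> ennreal"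
  where "En q f z = ennreal (cmod (f z) powr q * W z)"

text \<open>The Littlewood-Paley density: F stands for a derivative, whose natural size at z is
  (1-|z|) |F(z)|.\<close>

definition Dn :: "real \<Rightarrow> (complex \<Rightarrow> complex) \<Rightarrow> complex \<Rightarrow> ennreal"
  where "Dn q F z = ennreal (cmod (F z) powr q * (1 - cmod z) powr q * W z)"

abbreviation (input) node_mass :: "complex \<Rightarrow> complex \<Rightarrow> real"
  where "node_mass b x \<equiv> w (cmod x) * (1 - cmod x) * kap b x powr (1 + \<alpha>/4)"

abbreviation "km \<equiv> kmean (1 + \<alpha> / 4)"

lemma W_measurable [measurable]: "W \<in> borel_measurable borel"
  unfolding W_def by measurable

lemma En_measurable [measurable]:
  assumes [measurable]: "f \<in> borel_measurable borel" shows "En q f \<in> borel_measurable borel"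
  unfolding En_def by measurable

lemma Dn_measurable [measurable]:
  assumes [measurable]: "f \<in> borel_measurable borel" shows "Dn q f \<in> borel_measurable borel"
  unfolding Dn_def by measurable

lemma W_pos: "cmod z < 1 \<Longrightarrow> 0 < W z"
  unfolding W_def using w_pos[of "cmod z"] by simp

text \<open>For |a| at most |z| this is the lower growth condition. Otherwise x = (1-|z|)/(1-|a|)
  exceeds 1 but is at most 1/\<open>kap a z\<close>, so the upper growth x^\<beta> is absorbed by
  the kernel while a factor x^\<alpha> is kept. One formula thus serves all pairs of points, at the
  price of \<beta> powers of the kernel.\<close>

lemma w_compare:
  assumes a: "cmod a < 1" and z: "cmod z < 1"
  shows "w (cmod z) \<le> C0 * ((1 - cmod z) / (1 - cmod a)) powr \<alpha> * kap a z powr - \<beta> * w (cmod a)"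
proof -
  define x where "x = (1 - cmod z) / (1 - cmod a)"
  have x: "x > 0" unfolding x_def using a z by simp
  have k: "0 < kap a z" "kap a z \<le> 1" using kap_pos[OF a z] kap_le_1[OF a z] by auto
  have wp: "w (cmod a) > 0" using w_pos a by simp
  show ?thesis
  proof (cases "cmod a \<le> cmod z")
    case True
    have "w (cmod z) \<le> C0 * x powr \<alpha> * 1 * w (cmod a)" using w_lower[OF _ True z] by (simp add: x_def)
    also have "... \<le> C0 * x powr \<alpha> * kap a z powr - \<beta> * w (cmod a)"
    proof (intro mult_right_mono mult_left_mono)
      show "1 \<le> kap a z powr - \<beta>" using k alpha by (simp add: powr_minus_divide powr_le1)
    qed (use C0 wp in auto)
    finally show ?thesis unfolding x_def .
  next
    case False
    hence x1: "x \<ge> 1" unfolding x_def using a by simp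
    have xk: "x * kap a z \<le> 1" unfolding x_def using kap_ratio[OF a z] .
    have "w (cmod z) \<le> C0 * x powr \<beta> * w (cmod a)" using w_upper[of "cmod z" "cmod a"] False a by (simp add: x_def)
    also have "x powr \<beta> = x powr \<alpha> * x powr (\<beta> - \<alpha>)" using x by (simp add: powr_add[symmetric])
    also have "C0 * (x powr \<alpha> * x powr (\<beta> - \<alpha>)) * w (cmod a) \<le> C0 * (x powr \<alpha> * kap a z powr - \<beta>) * w (cmod a)"
    proof (intro mult_right_mono mult_left_mono)
      have "x powr (\<beta> - \<alpha>) \<le> x powr \<beta>" using x1 alpha by (intro powr_mono) auto
      also have "x \<le> 1 / kap a z" using xk k by (simp add: field_simps)
      hence "x powr \<beta> \<le> (1 / kap a z) powr \<beta>" using x alpha by (intro powr_mono2) auto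
      also have "... = kap a z powr - \<beta>" using k by (simp add: powr_divide powr_minus_divide)
      finally show "x powr (\<beta> - \<alpha>) \<le> kap a z powr - \<beta>" .
    qed (use C0 wp in auto)
    finally show ?thesis unfolding x_def by (simp add: mult_ac)
  qed
qed

lemma w_compare_kap:
  assumes a: "cmod a < 1" and z: "cmod z < 1" and k: "1 / c \<le> kap a z" "0 < c"
  shows "w (cmod z) \<le> C0 * c powr \<beta> * ((1 - cmod z) / (1 - cmod a)) powr \<alpha> * w (cmod a)"
proof -
  have "kap a z powr - \<beta> \<le> (1 / c) powr - \<beta>" using k alpha by (intro powr_mono2') auto
  also have "... = c powr \<beta>" using k by (simp add: powr_divide powr_minus_divide)
  finally have "C0 * ((1 - cmod z) / (1 - cmod a)) powr \<alpha> * kap a z powr - \<beta> * w (cmod a)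
      \<le> C0 * ((1 - cmod z) / (1 - cmod a)) powr \<alpha> * c powr \<beta> * w (cmod a)"
    using C0 w_pos[of "cmod a"] a by (intro mult_right_mono mult_left_mono) auto
  with w_compare[OF a z] show ?thesis by (simp add: mult_ac)
qed

section \<open>Local averages and the Littlewood-Paley estimates\<close>

definition "KW = C0 * 11 powr \<beta> * 8"

lemma KW_pos: "0 < KW" unfolding KW_def using C0 by simp

text \<open>In \<open>KW\<close> the factor 11^\<beta> comes from \<open>kap x z\<close> being at
  least 1/11; 8 is 4, from the ratio of the boundary distances, times 2, from replacing 1-|z| by
  (1-|x|)/2.\<close>

lemma W_local:
  assumes z: "cmod z < 1" and zw: "cmod (z - x) \<le> 3/4 * (1 - cmod z)"
  shows "W z \<le> KW * W x"
proof -
  note l = kap_local[OF z zw]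
  have r: "((1 - cmod z) / (1 - cmod x)) powr \<alpha> \<le> 4"
  proof -
    have q: "(1 - cmod z) / (1 - cmod x) \<le> 4" "0 < (1 - cmod z) / (1 - cmod x)" using l z by (simp_all add: field_simps)
    have "((1 - cmod z) / (1 - cmod x)) powr \<alpha> \<le> 4 powr \<alpha>" using q alpha by (intro powr_mono2) auto
    also have "... \<le> 4 powr 1" using alpha by (intro powr_mono) auto
    finally show ?thesis by simp
  qed
  have "w (cmod z) \<le> C0 * 11 powr \<beta> * ((1 - cmod z) / (1 - cmod x)) powr \<alpha> * w (cmod x)"
    using l z by (intro w_compare_kap) auto
  also have "... \<le> C0 * 11 powr \<beta> * 4 * w (cmod x)"
    using C0 w_pos[of "cmod x"] l r by (intro mult_right_mono mult_left_mono) auto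
  finally have 1: "w (cmod z) \<le> C0 * 11 powr \<beta> * 4 * w (cmod x)" .
  have "W z \<le> C0 * 11 powr \<beta> * 4 * w (cmod x) / (1 - cmod z)"
    unfolding W_def using 1 z by (intro divide_right_mono) auto
  also have "... \<le> C0 * 11 powr \<beta> * 4 * w (cmod x) / ((1 - cmod x) / 2)"
    using l z C0 w_pos[of "cmod x"] by (intro divide_left_mono) auto
  finally show ?thesis unfolding W_def KW_def by (simp add: mult_ac)
qed

text \<open>The integral runs over the disc of radius 3/4 (1-|z|), but the normalization is by the
  area of a disc of radius (1-|z|)/4. Such a disc around any point of the half-radius disc lies
  inside, so this quantity bounds |f|^q on the whole half-radius disc.\<close>

definition avg :: "real \<Rightarrow> (complex \<Rightarrow> complex) \<Rightarrow> complex \<Rightarrow> ennreal"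
  where "avg q f z = ennreal (16 / (pi * (1 - cmod z)^2)) * (\<integral>\<^sup>+x\<in>ball z (3/4 * (1 - cmod z)). ennreal (cmod (f x) powr q) \<partial>lborel)"

lemma local_sup:
  assumes f: "hol f" and [measurable]: "f \<in> borel_measurable borel" and q: "0 < q"
    and z: "cmod z < 1" and \<zeta>: "cmod (\<zeta> - z) \<le> (1 - cmod z) / 2"
  shows "ennreal (cmod (f \<zeta>) powr q) \<le> avg q f z"
proof -
  define \<rho> where "\<rho> = (1 - cmod z) / 4"
  have \<rho>: "\<rho> > 0" unfolding \<rho>_def using z by simp
  have sub: "ball \<zeta> \<rho> \<subseteq> ball z (3/4 * (1 - cmod z))"
  proof
    fix x assume "x \<in> ball \<zeta> \<rho>"
    hence "dist \<zeta> x < \<rho>" by simp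
    moreover have "dist z \<zeta> \<le> (1 - cmod z) / 2" using \<zeta> by (simp add: dist_norm norm_minus_commute)
    ultimately have "dist z x < (1 - cmod z) / 2 + \<rho>" using dist_triangle[of z x \<zeta>] by linarith
    thus "x \<in> ball z (3/4 * (1 - cmod z))" unfolding \<rho>_def by simp
  qed
  have sub2: "ball z (3/4 * (1 - cmod z)) \<subseteq> ball 0 1"
    using kap_local(1)[OF z] by (auto simp: dist_norm)
  have "ennreal (cmod (f \<zeta>) powr q) * ennreal (pi * \<rho>^2) \<le> (\<integral>\<^sup>+x\<in>ball \<zeta> \<rho>. ennreal (cmod (f x) powr q) \<partial>lborel)"
    using sub sub2 by (intro submean_ball q \<rho> holomorphic_on_subset[OF f]) auto
  also have "... \<le> (\<integral>\<^sup>+x\<in>ball z (3/4 * (1 - cmod z)). ennreal (cmod (f x) powr q) \<partial>lborel)"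
    using sub by (intro nn_integral_mono) (auto split: split_indicator)
  finally have "ennreal (1 / (pi * \<rho>^2)) * (ennreal (cmod (f \<zeta>) powr q) * ennreal (pi * \<rho>^2)) \<le> ennreal (1 / (pi * \<rho>^2)) * ..."
    by (rule mult_left_mono) simp
  moreover have "ennreal (1 / (pi * \<rho>^2)) * (ennreal (cmod (f \<zeta>) powr q) * ennreal (pi * \<rho>^2)) = ennreal (cmod (f \<zeta>) powr q)"
    using \<rho> by (simp add: ennreal_mult[symmetric])
  moreover have "1 / (pi * \<rho>^2) = 16 / (pi * (1 - cmod z)^2)" unfolding \<rho>_def by (simp add: power_divide)
  ultimately show ?thesis unfolding avg_def by simp
qed

text \<open>On the disc of integration 1-|x| is comparable to 1-|z| and \<open>kap x z\<close> is at
  least 1/11, so the normalized indicator is at most a multiple of the kernel of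
  \<open>schur_kernel\<close>; 7744 = 16 * 4 * 121.\<close>

lemma avg_pointwise:
  assumes [measurable]: "f \<in> borel_measurable borel" and z: "cmod z < 1" and \<gamma>: "0 < \<gamma>" "\<gamma> < 1"
    and K: "0 \<le> K" and v: "\<And>x. cmod (z - x) \<le> 3/4 * (1 - cmod z) \<Longrightarrow> cmod x < 1 \<Longrightarrow> A * cmod (f x) powr q * W z \<le> K * v x"
    and A: "0 \<le> A"
  shows "avg q f z * ennreal (A * W z) \<le> (\<integral>\<^sup>+x\<in>unit_disk. ennreal (7744 * K * (kap x z ^ 2 * (1 - cmod z) powr (\<gamma> - 1) * (1 - cmod x) powr (- 1 - \<gamma>))) * ennreal (v x) \<partial>lborel)"
proof -
  have "avg q f z * ennreal (A * W z) = ennreal (16 / (pi * (1 - cmod z)^2) * (A * W z)) * (\<integral>\<^sup>+x\<in>ball z (3/4 * (1 - cmod z)). ennreal (cmod (f x) powr q) \<partial>lborel)"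
    unfolding avg_def using z W_pos[OF z] A by (subst ennreal_mult) (auto simp: mult_ac)
  also have "... = (\<integral>\<^sup>+x\<in>ball z (3/4 * (1 - cmod z)). ennreal (16 / (pi * (1 - cmod z)^2) * (A * W z)) * ennreal (cmod (f x) powr q) \<partial>lborel)"
    by (subst nn_integral_cmult[symmetric]) (auto simp: mult.assoc)
  also have "... \<le> (\<integral>\<^sup>+x\<in>unit_disk. ennreal (7744 * K * (kap x z ^ 2 * (1 - cmod z) powr (\<gamma> - 1) * (1 - cmod x) powr (- 1 - \<gamma>))) * ennreal (v x) \<partial>lborel)"
  proof (intro nn_integral_mono)
    fix x
    show "ennreal (16 / (pi * (1 - cmod z)^2) * (A * W z)) * ennreal (cmod (f x) powr q) * indicator (ball z (3/4 * (1 - cmod z))) x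
      \<le> ennreal (7744 * K * (kap x z ^ 2 * (1 - cmod z) powr (\<gamma> - 1) * (1 - cmod x) powr (- 1 - \<gamma>))) * ennreal (v x) * indicator unit_disk x"
    proof (cases "x \<in> ball z (3/4 * (1 - cmod z))")
      case True
      hence zx: "cmod (z - x) \<le> 3/4 * (1 - cmod z)" by (simp add: dist_norm)
      note l = kap_local[OF z zx]
      have k2: "1 \<le> 121 * kap x z ^ 2" using l(3) power_mono[of "1/11" "kap x z" 2] by (simp add: power_divide)
      have e: "1 / (1 - cmod z)^2 = (1 - cmod z) powr (\<gamma> - 1) * (1 - cmod z) powr (- 1 - \<gamma>)"
        using z by (simp add: powr_add[symmetric] powr_minus_divide)
      have "(1 - cmod z) powr (- 1 - \<gamma>) \<le> ((1 - cmod x) / 2) powr (- 1 - \<gamma>)"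
        using l z \<gamma> by (intro powr_mono2') auto
      also have "... = (1 - cmod x) powr (- 1 - \<gamma>) * 2 powr (1 + \<gamma>)"
        using l by (simp add: powr_divide powr_minus_divide powr_diff powr_add)
      also have "... \<le> (1 - cmod x) powr (- 1 - \<gamma>) * 2 powr 2" using \<gamma> by (intro mult_left_mono powr_mono) auto
      finally have "1 / (1 - cmod z)^2 \<le> (1 - cmod z) powr (\<gamma> - 1) * (4 * (1 - cmod x) powr (- 1 - \<gamma>))"
        unfolding e by (intro mult_left_mono) auto
      also have "... \<le> (1 - cmod z) powr (\<gamma> - 1) * (4 * (1 - cmod x) powr (- 1 - \<gamma>)) * (121 * kap x z ^ 2)"
        using k2 mult_left_mono[OF k2, of "(1 - cmod z) powr (\<gamma> - 1) * (4 * (1 - cmod x) powr (- 1 - \<gamma>))"] by simp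
      finally have 1: "1 / (1 - cmod z)^2 \<le> 484 * (kap x z ^ 2 * (1 - cmod z) powr (\<gamma> - 1) * (1 - cmod x) powr (- 1 - \<gamma>))"
        (is "_ \<le> 484 * ?L") by (simp add: mult_ac)
      have "16 / (pi * (1 - cmod z)^2) \<le> 16 * (1 / (1 - cmod z)^2)"
        using pi_ge_two z by (simp add: field_simps)
      also have "... \<le> 16 * (484 * ?L)" by (rule mult_left_mono[OF 1]) simp
      finally have 2: "16 / (pi * (1 - cmod z)^2) \<le> 7744 * ?L" by simp
      have v0: "0 \<le> A * cmod (f x) powr q * W z" using A W_pos[OF z] by simp
      have "16 / (pi * (1 - cmod z)^2) * (A * cmod (f x) powr q * W z) \<le> 7744 * ?L * (K * v x)"
        by (rule mult_mono[OF 2 v[OF zx l(1)]]) (use v0 in auto)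
      hence "16 / (pi * (1 - cmod z)^2) * (A * W z) * (cmod (f x) powr q) \<le> (7744 * K * ?L) * v x" by (simp add: mult_ac)
      hence "ennreal (16 / (pi * (1 - cmod z)^2) * (A * W z)) * ennreal (cmod (f x) powr q) \<le> ennreal (7744 * K * ?L) * ennreal (v x)"
        using A W_pos[OF z] K by (simp add: ennreal_mult[symmetric] ennreal_mult'[symmetric] ennreal_leI)
      thus ?thesis using l True by simp
    qed simp
  qed
  finally show ?thesis .
qed

text \<open>Cauchy's estimate on the circle of radius (1-|z|)/4, where \<open>local_sup\<close>
  bounds |f| by the q-th root of the average. Taking the root of a supremum bound works for every q
  > 0.\<close>

lemma derivative_bound:
  assumes f: "hol f" and [measurable]: "f \<in> borel_measurable borel" and q: "0 < q" and z: "cmod z < 1"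
  shows "ennreal (cmod (deriv f z) powr q * (1 - cmod z) powr q) \<le> ennreal (4 powr q) * avg q f z"
proof (cases "avg q f z = \<infinity>")
  case True thus ?thesis by (simp add: ennreal_mult_top)
next
  case False
  then obtain A where A: "avg q f z = ennreal A" "0 \<le> A" by (cases "avg q f z") auto
  define B where "B = A powr (1 / q)"
  define \<rho> where "\<rho> = (1 - cmod z) / 4"
  have \<rho>: "\<rho> > 0" unfolding \<rho>_def using z by simp
  have sub: "cball z \<rho> \<subseteq> ball 0 1"
    using kap_local(1)[OF z] z unfolding \<rho>_def by (auto simp: dist_norm)
  have "norm ((deriv ^^ 1) f z) \<le> fact 1 * B / \<rho> ^ 1"
  proof (rule Cauchy_inequality)
    show "f holomorphic_on ball z \<rho>" using sub by (intro holomorphic_on_subset[OF f]) auto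
    show "continuous_on (cball z \<rho>) f" using sub by (intro continuous_on_subset[OF holomorphic_on_imp_continuous_on[OF f]]) auto
    fix x assume x: "norm (z - x) = \<rho>"
    have "ennreal (cmod (f x) powr q) \<le> ennreal A" unfolding A(1)[symmetric]
      using x z by (intro local_sup f q) (auto simp: norm_minus_commute \<rho>_def)
    hence "cmod (f x) powr q \<le> A" using A by (simp add: ennreal_le_iff)
    hence "(cmod (f x) powr q) powr (1/q) \<le> B" unfolding B_def using q by (intro powr_mono2) auto
    thus "norm (f x) \<le> B" using q by (simp add: powr_powr)
  qed (use \<rho> in auto)
  hence "cmod (deriv f z) * \<rho> \<le> B" using \<rho> by (simp add: field_simps)
  hence "(cmod (deriv f z) * \<rho>) powr q \<le> B powr q" using q \<rho> by (intro powr_mono2) auto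
  also have "B powr q = A" unfolding B_def using q A by (simp add: powr_powr)
  finally have "cmod (deriv f z) powr q * (\<rho> powr q) \<le> A" using \<rho> by (simp add: powr_mult)
  moreover have "(1 - cmod z) powr q = 4 powr q * \<rho> powr q" unfolding \<rho>_def using z by (simp add: powr_divide)
  ultimately have "cmod (deriv f z) powr q * (1 - cmod z) powr q \<le> 4 powr q * A"
    by (simp add: mult.left_commute)
  thus ?thesis unfolding A(1) by (simp add: ennreal_mult'[symmetric] ennreal_leI)
qed

lemma schur_instance:
  obtains C where "0 < C" "\<And>K u v a. v \<in> borel_measurable borel \<Longrightarrow> 0 \<le> K \<Longrightarrow>
     (\<And>z. cmod z < 1 \<Longrightarrow> u z \<le> (\<integral>\<^sup>+x\<in>unit_disk. ennreal (K * (kap x z ^ 2 * (1 - cmod z) powr (\<alpha>/2 - 1) * (1 - cmod x) powr (- 1 - \<alpha>/2))) * v x \<partial>lborel)) \<Longrightarrow>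
     cmod a < 1 \<Longrightarrow> km u a \<le> ennreal (C * K) * km v a"
  using schur_kernel[of "\<alpha>/2" "1 + \<alpha>/4"] alpha by auto

text \<open>The comparison is local: a pointwise bound by an average, then the Schur test. F is any
  function equal to the derivative in the disk, so that a Borel version may be inserted.\<close>

lemma derivative_energy:
  assumes q: "0 < q"
  obtains C where "0 < C" "\<And>f F a. hol f \<Longrightarrow> f \<in> borel_measurable borel \<Longrightarrow>
    (\<And>z. cmod z < 1 \<Longrightarrow> F z = deriv f z) \<Longrightarrow> cmod a < 1 \<Longrightarrow> km (Dn q F) a \<le> ennreal C * km (En q f) a"
proof -
  obtain C where C: "0 < C" "\<And>K u v a. v \<in> borel_measurable borel \<Longrightarrow> 0 \<le> K \<Longrightarrow>
     (\<And>z. cmod z < 1 \<Longrightarrow> u z \<le> (\<integral>\<^sup>+x\<in>unit_disk. ennreal (K * (kap x z ^ 2 * (1 - cmod z) powr (\<alpha>/2 - 1) * (1 - cmod x) powr (- 1 - \<alpha>/2))) * v x \<partial>lborel)) \<Longrightarrow>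
     cmod a < 1 \<Longrightarrow> km u a \<le> ennreal (C * K) * km v a" using schur_instance by blast
  define K where "K = 7744 * (4 powr q * KW)"
  have K: "K > 0" unfolding K_def using KW_pos by simp
  show ?thesis
  proof (rule that[of "C * K"])
    fix f F a assume f: "hol f" and [measurable]: "f \<in> borel_measurable borel"
      and F: "\<And>z. cmod z < 1 \<Longrightarrow> F z = deriv f z" and a: "cmod a < 1"
    show "km (Dn q F) a \<le> ennreal (C * K) * km (En q f) a"
    proof (rule C(2)[OF _ _ _ a])
      fix z :: complex assume z: "cmod z < 1"
      have "Dn q F z = ennreal (cmod (deriv f z) powr q * (1 - cmod z) powr q) * ennreal (W z)"
        unfolding Dn_def F[OF z] using W_pos[OF z] by (simp add: ennreal_mult)
      also have "... \<le> ennreal (4 powr q) * avg q f z * ennreal (W z)"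
        by (intro mult_right_mono derivative_bound f q z) auto
      also have "... = avg q f z * ennreal (4 powr q * W z)" using W_pos[OF z] by (simp add: ennreal_mult mult_ac)
      also have "... \<le> (\<integral>\<^sup>+x\<in>unit_disk. ennreal (7744 * (4 powr q * KW) * (kap x z ^ 2 * (1 - cmod z) powr (\<alpha>/2 - 1) * (1 - cmod x) powr (- 1 - \<alpha>/2))) * ennreal (cmod (f x) powr q * W x) \<partial>lborel)"
      proof (rule avg_pointwise)
        fix x assume "cmod (z - x) \<le> 3/4 * (1 - cmod z)" "cmod x < 1"
        from mult_left_mono[OF W_local[OF z this(1)], of "4 powr q * cmod (f x) powr q"]
        show "4 powr q * cmod (f x) powr q * W z \<le> 4 powr q * KW * (cmod (f x) powr q * W x)"
          by (simp add: mult_ac)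
      qed (use z alpha KW_pos in auto)
      finally show "Dn q F z \<le> (\<integral>\<^sup>+x\<in>unit_disk. ennreal (K * (kap x z ^ 2 * (1 - cmod z) powr (\<alpha>/2 - 1) * (1 - cmod x) powr (- 1 - \<alpha>/2))) * En q f x \<partial>lborel)"
        unfolding K_def En_def .
    qed (use K in auto)
  qed (use C K in auto)
qed

lemma increment_bound:
  assumes f: "hol f" and F: "\<And>z. cmod z < 1 \<Longrightarrow> F z = deriv f z" and [measurable]: "F \<in> borel_measurable borel"
    and q: "0 < q" and p: "cmod p < 1" and y: "cmod (y - p) \<le> (1 - cmod p) / 2"
  shows "ennreal (cmod (f y - f p) powr q) \<le> ennreal ((1 - cmod p) powr q) * avg q F p"
proof (cases "avg q F p = \<infinity>")
  case True thus ?thesis using p by (simp add: ennreal_mult_top)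
next
  case False
  then obtain A where A: "avg q F p = ennreal A" "0 \<le> A" by (cases "avg q F p") auto
  have Fh: "hol F"
    by (rule holomorphic_transform[OF holomorphic_deriv[OF f open_ball]]) (simp add: F)
  define S where "S = cball p ((1 - cmod p) / 2)"
  have S: "S \<subseteq> ball 0 1" using kap_local(1)[OF p] p unfolding S_def by (auto simp: dist_norm)
  have "cmod (f y - f p) \<le> A powr (1/q) * cmod (y - p)"
  proof (rule field_differentiable_bound[of S])
    show "convex S" unfolding S_def by simp
    fix x assume x: "x \<in> S"
    show "(f has_field_derivative deriv f x) (at x within S)"
      using S x holomorphic_derivI[OF f open_ball] by (auto intro: has_field_derivative_at_within)
    have "ennreal (cmod (F x) powr q) \<le> ennreal A" unfolding A(1)[symmetric]
      using x p by (intro local_sup Fh q) (auto simp: S_def dist_norm norm_minus_commute)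
    hence "cmod (F x) powr q \<le> A" using A by (simp add: ennreal_le_iff)
    hence "(cmod (F x) powr q) powr (1/q) \<le> A powr (1/q)" using q by (intro powr_mono2) auto
    thus "norm (deriv f x) \<le> A powr (1/q)" using q F[of x] S x by (auto simp: powr_powr)
  qed (use y p in \<open>auto simp: S_def dist_norm norm_minus_commute\<close>)
  also have "... \<le> A powr (1/q) * (1 - cmod p)" using y p by (intro mult_left_mono) auto
  finally have "cmod (f y - f p) powr q \<le> (A powr (1/q) * (1 - cmod p)) powr q" using q by (intro powr_mono2) auto
  also have "... = (1 - cmod p) powr q * A" using A p q by (simp add: powr_mult powr_powr)
  finally show ?thesis unfolding A(1) by (simp add: ennreal_mult'[symmetric] ennreal_leI)
qed

text \<open>The difference f(z) - f(0) is telescoped along the radius through points p_j whose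
  distance from the circle is about 2^(-j), down to the scale of z. The increments get the weights
  l_j = 2^(\<epsilon>(j - n)) with \<epsilon> = \<alpha>/(2q), so that \<open>sum_powr_le\<close>
  costs only the power \<alpha>/2 of the ratio of scales.\<close>

lemma chain_bound:
  assumes q: "0 < q" and z: "cmod z < 1"
    and f: "hol f" and F: "\<And>z. cmod z < 1 \<Longrightarrow> F z = deriv f z" and [measurable]: "F \<in> borel_measurable borel"
    and p_def: "p = (\<lambda>j::nat. of_real (1 - 1 / 2^j) * z)"
  obtains n where
    "ennreal (cmod (f z - f 0) powr q) \<le> (\<Sum>j\<le>n. ennreal ((1 / (1 - 2 powr - (\<alpha>/(2*q)))) powr q * ((4 * (1 - cmod (p j)) / (1 - cmod z)) powr (\<alpha>/2)) * (1 - cmod (p j)) powr q) * avg q F (p j))"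
    "\<And>j. j \<le> n \<Longrightarrow> cmod (p j) < 1 \<and> 1 / 2^j \<le> 1 - cmod (p j) \<and> 1 - cmod (p j) \<le> 5 / 2^j \<and> kap (p j) z \<ge> 1/2 \<and> 1 - cmod z \<le> 1 - cmod (p j)"
proof -
  define r where "r = cmod z"
  have r: "0 \<le> r" "r < 1" unfolding r_def using z by auto
  \<comment> \<open>The last point p_n is within (1-|z|)/2 of z, so one local increment reaches z;
    conversely 2^n < 4/(1-|z|) keeps every p_j at a scale comparable to 2^(-j).\<close>
  define n where "n = nat \<lceil>log 2 (2 / (1 - r))\<rceil>"
  have "1 \<le> 2 / (1 - r)" using r by (simp add: field_simps)
  hence l0: "log 2 (2 / (1 - r)) \<ge> 0" using r by (subst zero_le_log_cancel_iff) auto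
  hence n: "log 2 (2 / (1 - r)) \<le> n" "real n < log 2 (2 / (1 - r)) + 1" unfolding n_def by linarith+
  have n1: "2 / (1 - r) \<le> 2^n"
  proof -
    have "2 / (1 - r) \<le> 2 powr n" using n(1) r by (subst (asm) log_le_iff) auto
    thus ?thesis by (simp add: powr_realpow)
  qed
  have n2: "2^n < 4 / (1 - r)"
  proof -
    have "2 powr n < 2 powr (log 2 (2 / (1 - r)) + 1)" using n(2) by simp
    also have "... = 4 / (1 - r)" using r by (simp add: powr_add)
    finally show ?thesis by (simp add: powr_realpow)
  qed
  define \<delta> where "\<delta> = (\<lambda>j. 1 - cmod (p j))"
  have cp: "cmod (p j) = (1 - 1 / 2^j) * r" for j
  proof -
    have "1 / 2^j \<le> (1::real)" by (simp add: divide_le_eq)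
    thus ?thesis unfolding p_def r_def by (simp only: norm_mult norm_of_real; simp?)
  qed
  have \<delta>: "\<delta> j = (1 - r) + r / 2^j" for j unfolding \<delta>_def cp by (simp add: algebra_simps)
  have pj: "cmod (p j) < 1 \<and> 1 / 2^j \<le> \<delta> j \<and> \<delta> j \<le> 5 / 2^j \<and> kap (p j) z \<ge> 1/2 \<and> 1 - r \<le> \<delta> j" if j: "j \<le> n" for j
  proof -
    have d1: "1 - r \<le> \<delta> j" unfolding \<delta> using r by simp
    have p1: "cmod (p j) < 1" using d1 r unfolding \<delta>_def by linarith
    have "(1 - r) * (1 / 2^j) \<le> (1 - r) * 1" using r by (intro mult_left_mono) (auto simp: divide_le_eq)
    hence d2: "1 / 2^j \<le> \<delta> j" unfolding \<delta> by (simp add: algebra_simps diff_divide_distrib)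
    have "1 - r \<le> 4 / 2^n" using n2 r by (simp add: field_simps)
    also have "... \<le> 4 / 2^j" using j by (intro divide_left_mono power_increasing) auto
    finally have "1 - r \<le> 4 / 2^j" .
    hence d3: "\<delta> j \<le> 5 / 2^j"
    proof -
      have "r / 2^j \<le> 1 / 2^j" using r by (intro divide_right_mono) auto
      with \<open>1 - r \<le> 4 / 2^j\<close> show ?thesis unfolding \<delta> by simp
    qed
    have e: "1 - cnj (p j) * z = of_real (1 - (1 - 1/2^j) * r^2)"
    proof -
      have "cnj (p j) * z = of_real (1 - 1/2^j) * (z * cnj z)" unfolding p_def by (simp add: mult_ac)
      also have "z * cnj z = of_real (r^2)" unfolding r_def by (rule complex_norm_square[symmetric])
      finally show ?thesis by simp
    qed
    have "cmod (1 - cnj (p j) * z) = \<bar>1 - (1 - 1/2^j) * r^2\<bar>" unfolding e by (rule norm_of_real)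
    also have "... = 1 - (1 - 1/2^j) * r^2"
    proof -
      have "(1 - 1/2^j) * r^2 \<le> 1 * 1" using r by (intro mult_mono) (auto simp: power_le_one divide_le_eq)
      thus ?thesis by simp
    qed
    also have "... = \<delta> j + cmod (p j) * (1 - r)" unfolding \<delta>_def cp by (simp add: field_simps power2_eq_square)
    also have "cmod (p j) * (1 - r) \<le> 1 * (1 - r)" using p1 r by (intro mult_right_mono) auto
    finally have "cmod (1 - cnj (p j) * z) \<le> 2 * \<delta> j" using d1 by simp
    moreover have "0 < cmod (1 - cnj (p j) * z)" using p1 z by (rule cmod_kernel_pos)
    ultimately have "kap (p j) z \<ge> 1/2" unfolding kap_def \<delta>_def by (simp add: field_simps)
    with d1 d2 d3 p1 show ?thesis by simp
  qed
  define x where "x = (\<lambda>j. if j < n then cmod (f (p (Suc j)) - f (p j)) else cmod (f z - f (p j)))"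
  define \<epsilon> where "\<epsilon> = \<alpha> / (2 * q)"
  have \<epsilon>: "\<epsilon> > 0" unfolding \<epsilon>_def using alpha q by simp
  define l where "l = (\<lambda>j. 2 powr (\<epsilon> * (real j - real n)))"
  define L where "L = 1 / (1 - 2 powr - \<epsilon>)"
  have e1: "2 powr - \<epsilon> < 1" using \<epsilon> by (intro powr_less_one) auto
  have suml: "sum l {..n} \<le> L"
  proof -
    have "sum l {..n} = (\<Sum>j\<le>n. (2 powr - \<epsilon>) ^ (n - j))"
    proof (intro sum.cong refl)
      fix j assume "j \<in> {..n}"
      hence "real (n - j) = real n - real j" by (simp add: of_nat_diff)
      thus "l j = (2 powr - \<epsilon>) ^ (n - j)" unfolding l_def
        by (simp add: powr_realpow[symmetric] powr_powr algebra_simps)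
    qed
    also have "... = (\<Sum>k\<le>n. (2 powr - \<epsilon>) ^ k)" by (rule sum.reindex_bij_witness[of _ "\<lambda>k. n - k" "\<lambda>k. n - k"]) auto
    also have "... \<le> (\<Sum>k. (2 powr - \<epsilon>) ^ k)" using e1 by (intro sum_le_suminf summable_geometric) auto
    also have "... = L" unfolding L_def using e1 by (subst suminf_geometric) auto
    finally show ?thesis .
  qed
  have "f z - f 0 = (\<Sum>j<n. f (p (Suc j)) - f (p j)) + (f z - f (p n))"
  proof -
    have "(\<Sum>j<n. f (p (Suc j)) - f (p j)) = f (p n) - f (p 0)" by (rule sum_lessThan_telescope)
    thus ?thesis by (simp add: p_def)
  qed
  hence "cmod (f z - f 0) \<le> cmod (\<Sum>j<n. f (p (Suc j)) - f (p j)) + cmod (f z - f (p n))" by (simp only: norm_triangle_ineq)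
  also have "... \<le> (\<Sum>j<n. x j) + x n" unfolding x_def by (intro add_mono order_trans[OF norm_sum] sum_mono) auto
  also have "... = sum x {..n}" by (simp add: lessThan_Suc_atMost[symmetric])
  finally have "cmod (f z - f 0) powr q \<le> (sum x {..n}) powr q" using q by (intro powr_mono2) auto
  also have "... \<le> L powr q * (\<Sum>j\<le>n. l j powr - q * x j powr q)"
    by (rule sum_powr_le) (use q suml in \<open>auto simp: x_def l_def\<close>)
  also have "... \<le> L powr q * (\<Sum>j\<le>n. (4 * \<delta> j / (1 - r)) powr (\<alpha>/2) * x j powr q)"
  proof (intro mult_left_mono sum_mono mult_right_mono)
    fix j assume "j \<in> {..n}"
    hence j: "j \<le> n" by simp
    have "l j powr - q = (2^n / 2^j) powr (\<alpha>/2)"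
    proof -
      have "l j powr - q = 2 powr (- q * (\<epsilon> * (real j - real n)))" unfolding l_def by (simp add: powr_powr mult_ac)
      also have "- q * (\<epsilon> * (real j - real n)) = (real n - real j) * (\<alpha> / 2)" unfolding \<epsilon>_def using q by (simp add: field_simps)
      also have "2 powr ((real n - real j) * (\<alpha> / 2)) = (2 powr (real n - real j)) powr (\<alpha>/2)" by (simp add: powr_powr)
      also have "2 powr (real n - real j) = 2^n / 2^j" by (simp add: powr_diff powr_realpow)
      finally show ?thesis .
    qed
    also have "... \<le> (4 * \<delta> j / (1 - r)) powr (\<alpha>/2)"
    proof (intro powr_mono2)
      have "2^n / 2^j \<le> 4 / (1 - r) * (1 / 2^j)" using divide_right_mono[OF less_imp_le[OF n2], of "2^j"] by simp
      also have "... \<le> 4 / (1 - r) * \<delta> j" using pj[OF j] r by (intro mult_left_mono) auto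
      finally show "2^n / 2^j \<le> 4 * \<delta> j / (1 - r)" by simp
    qed (use alpha in auto)
    finally show "l j powr - q \<le> (4 * \<delta> j / (1 - r)) powr (\<alpha>/2)" .
  qed auto
  finally have main: "cmod (f z - f 0) powr q \<le> L powr q * (\<Sum>j\<le>n. (4 * \<delta> j / (1 - r)) powr (\<alpha>/2) * x j powr q)" .
  have half: "r / 2^Suc j \<le> (1 - cmod (p j)) / 2" and half': "(1 - r) / 2 \<le> (1 - cmod (p j)) / 2" for j
  proof -
    have "0 \<le> r / 2^j" using r by simp
    moreover have "1 - cmod (p j) = 1 - r + r / 2^j" using \<delta>[of j] unfolding \<delta>_def .
    note * = calculation this r
    have "t / 2 \<le> (1 - c) / 2" if "1 - c = 1 - r + t" for t c using that r by simp
    from this[OF *(2)] have "(r / 2^j) / 2 \<le> (1 - cmod (p j)) / 2" .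
    moreover have "(1 - r) / 2 \<le> (1 - c) / 2" if "1 - c = 1 - r + t" "0 \<le> t" for t c using that by simp
    from this[OF *(2,1)] have "(1 - r) / 2 \<le> (1 - cmod (p j)) / 2" .
    moreover have "r / 2^Suc j = (r / 2^j) / 2" by simp
    ultimately show "r / 2^Suc j \<le> (1 - cmod (p j)) / 2" "(1 - r) / 2 \<le> (1 - cmod (p j)) / 2" by (simp_all only:)
  qed
  have xj: "ennreal (x j powr q) \<le> ennreal ((1 - cmod (p j)) powr q) * avg q F (p j)" if j: "j \<le> n" for j
  proof (cases "j < n")
    case True
    have "cmod (p (Suc j) - p j) = r / 2^Suc j"
    proof -
      have "p (Suc j) - p j = of_real (1 / 2^Suc j) * z" unfolding p_def by (simp add: algebra_simps)
      thus ?thesis unfolding r_def by (simp only: norm_mult norm_of_real; simp?)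
    qed
    also have "... \<le> (1 - cmod (p j)) / 2" by (rule half)
    finally show ?thesis using pj[OF j] True unfolding x_def by (simp add: increment_bound[OF f F _ q])
  next
    case False
    have "z - p j = of_real (1 / 2^j) * z" unfolding p_def by (simp add: algebra_simps)
    hence "cmod (z - p j) = r / 2^j" unfolding r_def by (simp only: norm_mult norm_of_real; simp?)
    also have "... \<le> 1 / 2^n" using False j r by (simp add: divide_right_mono)
    also have "... \<le> (1 - r) / 2" using n1 r by (simp add: field_simps)
    also have "... \<le> (1 - cmod (p j)) / 2" by (rule half')
    finally show ?thesis using pj[OF j] False unfolding x_def by (simp add: increment_bound[OF f F _ q])
  qed
  have "ennreal (cmod (f z - f 0) powr q) \<le> ennreal (L powr q * (\<Sum>j\<le>n. (4 * \<delta> j / (1 - r)) powr (\<alpha>/2) * x j powr q))"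
    by (rule ennreal_leI[OF main])
  also have "... = (\<Sum>j\<le>n. ennreal (L powr q * (4 * \<delta> j / (1 - r)) powr (\<alpha>/2)) * ennreal (x j powr q))"
    by (subst sum_distrib_left, subst sum_ennreal[symmetric]) (auto simp: ennreal_mult'[symmetric] mult_ac)
  also have "... \<le> (\<Sum>j\<le>n. ennreal (L powr q * (4 * \<delta> j / (1 - r)) powr (\<alpha>/2)) * (ennreal ((1 - cmod (p j)) powr q) * avg q F (p j)))"
    by (intro sum_mono mult_left_mono xj) auto
  also have "... = (\<Sum>j\<le>n. ennreal (L powr q * (4 * \<delta> j / (1 - r)) powr (\<alpha>/2) * (1 - cmod (p j)) powr q) * avg q F (p j))"
    by (simp add: ennreal_mult mult.assoc)
  finally have fin: "ennreal (cmod (f z - f 0) powr q) \<le> ..." .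
  show ?thesis by (rule that[of n]) (use fin pj in \<open>auto simp: L_def \<epsilon>_def \<delta>_def r_def\<close>)
qed

text \<open>Each increment in \<open>chain_bound\<close> is controlled by an average of F over a
  disc around p_j, and for x in that disc \<open>kap x z\<close> is bounded below. Comparing W(z)
  with W(x) yields (1-|z|)^(\<alpha> - 1), the chain has spent (1-|z|)^(-\<alpha>/2), and the
  product (1-|z|)^(\<alpha>/2 - 1) is exactly the singularity that the Schur kernel allows.\<close>

lemma increment_energy:
  assumes q: "0 < q"
  obtains C where "0 < C" "\<And>f F a. hol f \<Longrightarrow> f \<in> borel_measurable borel \<Longrightarrow>
    (\<And>z. cmod z < 1 \<Longrightarrow> F z = deriv f z) \<Longrightarrow> F \<in> borel_measurable borel \<Longrightarrow> cmod a < 1 \<Longrightarrow> km (En q (\<lambda>z. f z - f 0)) a \<le> ennreal C * km (Dn q F) a"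
proof -
  obtain C where C: "0 < C" "\<And>K u v a. v \<in> borel_measurable borel \<Longrightarrow> 0 \<le> K \<Longrightarrow>
     (\<And>z. cmod z < 1 \<Longrightarrow> u z \<le> (\<integral>\<^sup>+x\<in>unit_disk. ennreal (K * (kap x z ^ 2 * (1 - cmod z) powr (\<alpha>/2 - 1) * (1 - cmod x) powr (- 1 - \<alpha>/2))) * v x \<partial>lborel)) \<Longrightarrow>
     cmod a < 1 \<Longrightarrow> km u a \<le> ennreal (C * K) * km v a" using schur_instance by blast
  define L where "L = (1 / (1 - 2 powr - (\<alpha>/(2*q)))) powr q"
  have "2 powr - (\<alpha>/(2*q)) < 1" using alpha q by (intro powr_less_one) auto
  hence L: "L > 0" unfolding L_def by (intro powr_gt_zero[THEN iffD2]) auto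
  \<comment> \<open>The factors are those of the bounds below: 16 * 4 from \<open>t3\<close>, 44^2
    from \<open>t5\<close>, 16 from \<open>t1\<close>, 4^q from \<open>t2\<close> and C0 44^\<beta>
    from \<open>t4\<close>. The 7 in K counts overlapping discs.\<close>
  define K1 where "K1 = 16 * 4 * 44^2 * L * 16 * 4 powr q * (C0 * 44 powr \<beta>)"
  have K1: "K1 > 0" unfolding K1_def using L C0 by simp
  define K where "K = 7 * K1"
  show ?thesis
  proof (rule that[of "C * K"])
    fix f F a assume f: "hol f" and [measurable]: "f \<in> borel_measurable borel" "F \<in> borel_measurable borel"
      and F: "\<And>z. cmod z < 1 \<Longrightarrow> F z = deriv f z" and a: "cmod a < 1"
    show "km (En q (\<lambda>z. f z - f 0)) a \<le> ennreal (C * K) * km (Dn q F) a"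
    proof (rule C(2)[OF _ _ _ a])
      fix z :: complex assume z: "cmod z < 1"
      define p where "p = (\<lambda>j::nat. of_real (1 - 1 / 2^j) * z)"
      obtain n where n: "ennreal (cmod (f z - f 0) powr q) \<le> (\<Sum>j\<le>n. ennreal (L * ((4 * (1 - cmod (p j)) / (1 - cmod z)) powr (\<alpha>/2)) * (1 - cmod (p j)) powr q) * avg q F (p j))"
        "\<And>j. j \<le> n \<Longrightarrow> cmod (p j) < 1 \<and> 1 / 2^j \<le> 1 - cmod (p j) \<and> 1 - cmod (p j) \<le> 5 / 2^j \<and> kap (p j) z \<ge> 1/2 \<and> 1 - cmod z \<le> 1 - cmod (p j)"
        by (rule chain_bound[OF q z f F \<open>F \<in> borel_measurable borel\<close> p_def, folded L_def]; simp)
      define B where "B = (\<lambda>j. ball (p j) (3/4 * (1 - cmod (p j))))"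
      have [measurable]: "B j \<in> sets borel" for j unfolding B_def by measurable
      define V where "V = (\<lambda>x. ennreal (K1 * (kap x z ^ 2 * (1 - cmod z) powr (\<alpha>/2 - 1) * (1 - cmod x) powr (- 1 - \<alpha>/2))) * Dn q F x * indicator unit_disk x)"
      have [measurable]: "V \<in> borel_measurable borel" unfolding V_def by measurable
      have trm: "ennreal (L * ((4 * (1 - cmod (p j)) / (1 - cmod z)) powr (\<alpha>/2)) * (1 - cmod (p j)) powr q) * avg q F (p j) * ennreal (W z)
        \<le> (\<integral>\<^sup>+x. V x * indicator (B j) x \<partial>lborel)" if j: "j \<le> n" for j
      proof -
        define d where "d = 1 - cmod (p j)"
        have d: "d > 0" "1 - cmod z \<le> d" "cmod (p j) < 1" "kap (p j) z \<ge> 1/2" using n(2)[OF j] unfolding d_def by auto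
        have "ennreal (L * ((4 * d / (1 - cmod z)) powr (\<alpha>/2)) * d powr q) * avg q F (p j) * ennreal (W z)
          = ennreal (L * ((4 * d / (1 - cmod z)) powr (\<alpha>/2)) * d powr q * (16 / (pi * d^2)) * W z) * (\<integral>\<^sup>+x\<in>B j. ennreal (cmod (F x) powr q) \<partial>lborel)"
        proof -
          have e: "ennreal X * (ennreal Y * I) * ennreal Z = ennreal (X * Y * Z) * I" if "0 \<le> X" "0 \<le> Y" "0 \<le> Z" for X Y Z I
            using that by (simp add: ennreal_mult mult_ac)
          show ?thesis unfolding avg_def d_def[symmetric] B_def by (rule e) (use L W_pos[OF z] d in auto)
        qed
        also have "... = (\<integral>\<^sup>+x\<in>B j. ennreal (L * ((4 * d / (1 - cmod z)) powr (\<alpha>/2)) * d powr q * (16 / (pi * d^2)) * W z) * ennreal (cmod (F x) powr q) \<partial>lborel)"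
          by (subst nn_integral_cmult[symmetric]) (auto simp: mult.assoc)
        also have "... \<le> (\<integral>\<^sup>+x. V x * indicator (B j) x \<partial>lborel)"
        proof (intro nn_integral_mono)
          fix x
          show "ennreal (L * ((4 * d / (1 - cmod z)) powr (\<alpha>/2)) * d powr q * (16 / (pi * d^2)) * W z) * ennreal (cmod (F x) powr q) * indicator (B j) x \<le> V x * indicator (B j) x"
          proof (cases "x \<in> B j")
            case True
            hence px: "cmod (p j - x) \<le> 3/4 * (1 - cmod (p j))" unfolding B_def by (simp add: dist_norm)
            note l = kap_local[OF d(3) px]
            define y where "y = 1 - cmod x"
            have y: "y > 0" "d \<le> 4 * y" "y \<le> 2 * d" using l d unfolding y_def d_def by auto
            \<comment> \<open>44 = 11 * 2 * 2: x is in the disc around p_j, p_j is on the radius of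
              z, and \<open>kap_triangle\<close> costs 2.\<close>
            have "1/11 * (1/2) \<le> kap x (p j) * kap (p j) z" using l d by (intro mult_mono) auto
            also have "... \<le> 2 * kap x z" using l d z by (intro kap_triangle)
            finally have k: "1/44 \<le> kap x z" by simp
            have t1: "(4 * d / (1 - cmod z)) powr (\<alpha>/2) \<le> 16 * (y powr (\<alpha>/2) * (1 - cmod z) powr - (\<alpha>/2))"
            proof -
              have "(4 * d / (1 - cmod z)) powr (\<alpha>/2) \<le> (16 * y / (1 - cmod z)) powr (\<alpha>/2)"
                using y z alpha d by (intro powr_mono2 divide_right_mono) auto
              also have "... = 16 powr (\<alpha>/2) * (y powr (\<alpha>/2) * (1 - cmod z) powr - (\<alpha>/2))"
                using y z by (simp add: powr_mult powr_divide powr_minus_divide)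
              also have "... \<le> 16 powr 1 * (y powr (\<alpha>/2) * (1 - cmod z) powr - (\<alpha>/2))" using alpha by (intro mult_right_mono powr_mono) auto
              finally show ?thesis by simp
            qed
            have t2: "d powr q \<le> 4 powr q * y powr q"
              using powr_mono2[of q d "4 * y"] q d y by (simp add: powr_mult)
            have t3: "16 / (pi * d^2) \<le> 16 * 4 * y powr - 2"
            proof -
              have "(y / 2)^2 \<le> d^2" using y by (intro power_mono) auto
              hence "y^2 / 4 \<le> d^2" by (simp add: power_divide)
              moreover have "1 * d^2 \<le> pi * d^2" using pi_ge_two by (intro mult_right_mono) auto
              ultimately have "y^2 / 4 \<le> pi * d^2" by simp
              hence "16 / (pi * d^2) \<le> 16 / (y^2 / 4)" using y d by (intro divide_left_mono) auto
              also have "... = 16 * 4 * y powr - 2" using y by (simp add: powr_minus_divide)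
              finally show ?thesis .
            qed
            have t4: "W z \<le> C0 * 44 powr \<beta> * ((1 - cmod z) powr (\<alpha> - 1) * y powr (1 - \<alpha>)) * W x"
            proof -
              have "w (cmod z) \<le> C0 * 44 powr \<beta> * ((1 - cmod z) / (1 - cmod x)) powr \<alpha> * w (cmod x)"
                using l z k by (intro w_compare_kap) auto
              hence "W z \<le> C0 * 44 powr \<beta> * ((1 - cmod z) / y) powr \<alpha> * (W x * y) / (1 - cmod z)"
                unfolding W_def y_def using z l by (simp add: divide_right_mono)
              also have "... = C0 * 44 powr \<beta> * ((1 - cmod z) powr (\<alpha> - 1) * y powr (1 - \<alpha>)) * W x"
                using z y by (simp add: powr_divide powr_diff mult_ac)
              finally show ?thesis .
            qed
            have t5: "1 \<le> 44^2 * kap x z ^ 2" using k power_mono[of "1/44" "kap x z" 2] by (simp add: power_divide)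
            define Z where "Z = 1 - cmod z"
            have Z: "Z > 0" unfolding Z_def using z by simp
            have "L * ((4 * d / Z) powr (\<alpha>/2)) * d powr q * (16 / (pi * d^2)) * W z
              \<le> L * (16 * (y powr (\<alpha>/2) * Z powr - (\<alpha>/2))) * (4 powr q * y powr q) * (16 * 4 * y powr - 2) *
                (C0 * 44 powr \<beta> * (Z powr (\<alpha> - 1) * y powr (1 - \<alpha>)) * W x)"
              using L t1 t2 t3 t4 W_pos[OF z] unfolding Z_def by (intro mult_mono) (auto intro!: mult_nonneg_nonneg)
            also have "... = (16 * 4 * L * 16 * 4 powr q * (C0 * 44 powr \<beta>)) * ((Z powr - (\<alpha>/2) * Z powr (\<alpha> - 1)) * (y powr (\<alpha>/2) * y powr - 2 * y powr (1 - \<alpha>))) * (y powr q * W x)"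
              by (simp add: mult_ac)
            also have "Z powr - (\<alpha>/2) * Z powr (\<alpha> - 1) = Z powr (\<alpha>/2 - 1)" by (simp add: powr_add[symmetric])
            also have "y powr (\<alpha>/2) * y powr - 2 * y powr (1 - \<alpha>) = y powr (- 1 - \<alpha>/2)" by (simp add: powr_add[symmetric])
            also have "(16 * 4 * L * 16 * 4 powr q * (C0 * 44 powr \<beta>)) * (Z powr (\<alpha>/2 - 1) * y powr (- 1 - \<alpha>/2)) * (y powr q * W x)
              \<le> (16 * 4 * L * 16 * 4 powr q * (C0 * 44 powr \<beta>)) * (Z powr (\<alpha>/2 - 1) * y powr (- 1 - \<alpha>/2)) * (y powr q * W x) * (44^2 * kap x z ^ 2)"
            proof -
              have g: "A \<le> A * B" if "0 \<le> A" "1 \<le> B" for A B :: real using mult_left_mono[OF that(2,1)] by simp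
              show ?thesis by (rule g[OF _ t5]) (use L C0 W_pos[OF l(1)] in auto)
            qed
            also have "... = K1 * (kap x z ^ 2 * Z powr (\<alpha>/2 - 1) * y powr (- 1 - \<alpha>/2)) * (y powr q * W x)"
              unfolding K1_def by (simp add: mult_ac)
            finally have le: "L * ((4 * d / Z) powr (\<alpha>/2)) * d powr q * (16 / (pi * d^2)) * W z \<le> ..." .
            have "L * ((4 * d / Z) powr (\<alpha>/2)) * d powr q * (16 / (pi * d^2)) * W z * cmod (F x) powr q
              \<le> K1 * (kap x z ^ 2 * Z powr (\<alpha>/2 - 1) * y powr (- 1 - \<alpha>/2)) * (cmod (F x) powr q * y powr q * W x)"
              using mult_right_mono[OF le, of "cmod (F x) powr q"] by (simp add: mult_ac)
            hence "ennreal (L * ((4 * d / Z) powr (\<alpha>/2)) * d powr q * (16 / (pi * d^2)) * W z) * ennreal (cmod (F x) powr q)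
               \<le> ennreal (K1 * (kap x z ^ 2 * Z powr (\<alpha>/2 - 1) * y powr (- 1 - \<alpha>/2))) * ennreal (cmod (F x) powr q * y powr q * W x)"
              using L W_pos[OF z] K1 by (subst (1 2) ennreal_mult'[symmetric]) (auto intro!: ennreal_leI mult_nonneg_nonneg)
            thus ?thesis using True l(1) unfolding V_def Dn_def y_def Z_def by simp
          qed simp
        qed
        finally show ?thesis unfolding d_def .
      qed
      \<comment> \<open>If the discs around p_i and p_j share a point, their scales satisfy 2^(-i)
        <= 35 * 2^(-j), where 35 is 4 times 7/4 times 5. Since 35 is below 2^6, at most 7 discs
        overlap.\<close>
      have count: "(\<Sum>j\<le>n. indicator (B j) x) \<le> (7::ennreal)" for x
      proof -
        define J where "J = {j\<in>{..n}. x \<in> B j}"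
        have "(\<Sum>j\<le>n. indicator (B j) x) = (\<Sum>j\<in>J. (1::ennreal))"
          unfolding J_def by (subst sum.inter_filter) (auto intro!: sum.cong simp del: sum_constant)
        also have "... = of_nat (card J)" by simp
        also have "card J \<le> 6 + 1"
        proof (rule card_dyadic_le)
          fix i j assume "i \<in> J" "j \<in> J"
          hence ij: "i \<le> n" "j \<le> n" "x \<in> B i" "x \<in> B j" unfolding J_def by auto
          have li: "cmod (p i - x) \<le> 3/4 * (1 - cmod (p i))" and lj: "cmod (p j - x) \<le> 3/4 * (1 - cmod (p j))"
            using ij unfolding B_def by (auto simp: dist_norm)
          have "(1 - cmod (p i)) / 4 \<le> 1 - cmod x" using kap_local(4)[OF _ li] n(2)[OF ij(1)] by simp
          moreover have "1 - cmod x \<le> 7/4 * (1 - cmod (p j))" using kap_local(5)[OF _ lj] n(2)[OF ij(2)] by simp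
          moreover have "1 / 2^i \<le> 1 - cmod (p i)" "1 - cmod (p j) \<le> 5 / 2^j" using n(2)[OF ij(1)] n(2)[OF ij(2)] by auto
          ultimately have "1 / 2^i \<le> 35 * (1 / (2::real)^j)" by argo
          hence "(2::real)^j \<le> 35 * 2^i" by (simp add: field_simps)
          also have "... \<le> 2^6 * 2^i" by simp
          finally show "(2::real)^j \<le> 2^6 * 2^i" .
        qed (auto simp: J_def)
        hence "(of_nat (card J) :: ennreal) \<le> of_nat 7" by (subst of_nat_le_iff) auto
        finally show ?thesis by simp
      qed
      have "En q (\<lambda>z. f z - f 0) z = ennreal (cmod (f z - f 0) powr q) * ennreal (W z)"
        unfolding En_def using W_pos[OF z] by (simp add: ennreal_mult)
      also have "... \<le> (\<Sum>j\<le>n. ennreal (L * ((4 * (1 - cmod (p j)) / (1 - cmod z)) powr (\<alpha>/2)) * (1 - cmod (p j)) powr q) * avg q F (p j)) * ennreal (W z)"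
        by (intro mult_right_mono n) auto
      also have "... = (\<Sum>j\<le>n. ennreal (L * ((4 * (1 - cmod (p j)) / (1 - cmod z)) powr (\<alpha>/2)) * (1 - cmod (p j)) powr q) * avg q F (p j) * ennreal (W z))"
        by (simp add: sum_distrib_right)
      also have "... \<le> (\<Sum>j\<le>n. \<integral>\<^sup>+x. V x * indicator (B j) x \<partial>lborel)" by (intro sum_mono trm) auto
      also have "... = (\<integral>\<^sup>+x. (\<Sum>j\<le>n. V x * indicator (B j) x) \<partial>lborel)"
        by (rule nn_integral_sum[symmetric]) measurable
      also have "... = (\<integral>\<^sup>+x. V x * (\<Sum>j\<le>n. indicator (B j) x) \<partial>lborel)"
        by (simp only: sum_distrib_left)
      also have "... \<le> (\<integral>\<^sup>+x. V x * 7 \<partial>lborel)" by (intro nn_integral_mono mult_left_mono count) auto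
      also have "... = (\<integral>\<^sup>+x\<in>unit_disk. ennreal (K * (kap x z ^ 2 * (1 - cmod z) powr (\<alpha>/2 - 1) * (1 - cmod x) powr (- 1 - \<alpha>/2))) * Dn q F x \<partial>lborel)"
      proof (intro nn_integral_cong)
        fix x
        have "ennreal (K * (kap x z ^ 2 * (1 - cmod z) powr (\<alpha>/2 - 1) * (1 - cmod x) powr (- 1 - \<alpha>/2))) =
          ennreal 7 * ennreal (K1 * (kap x z ^ 2 * (1 - cmod z) powr (\<alpha>/2 - 1) * (1 - cmod x) powr (- 1 - \<alpha>/2)))"
          unfolding K_def by (subst ennreal_mult'[symmetric]) (auto simp: mult.assoc)
        thus "V x * 7 = ennreal (K * (kap x z ^ 2 * (1 - cmod z) powr (\<alpha>/2 - 1) * (1 - cmod x) powr (- 1 - \<alpha>/2))) * Dn q F x * indicator unit_disk x"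
          unfolding V_def by (simp add: mult_ac)
      qed
      finally show "En q (\<lambda>z. f z - f 0) z \<le> ..." .
    qed (use K1 in \<open>auto simp: K_def\<close>)
  qed (use C K1 in \<open>auto simp: K_def\<close>)
qed

end

subsection \<open>Dyadic cells\<close>

definition level :: "complex \<Rightarrow> nat"
  where "level z = nat \<lfloor>- log 2 (1 - cmod z)\<rfloor>"

text \<open>A Whitney decomposition: dyadic annuli, cut by a Cartesian grid of side 2^(-n-1) on
  level n. A finite set on which \<open>cell\<close> is injective serves as a hyperbolic lattice.
  Two of its points may be close across a common edge; what counts is that their discs have bounded
  overlap.\<close>

definition cell :: "complex \<Rightarrow> nat \<times> int \<times> int"
  where "cell z = (level z, \<lfloor>2 ^ (level z + 1) * Re z\<rfloor>, \<lfloor>2 ^ (level z + 1) * Im z\<rfloor>)"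

lemma level_bounds:
  assumes "cmod z < 1"
  shows "1 - cmod z \<le> 1 / 2 ^ level z" "1 / 2 ^ (level z + 1) < 1 - cmod z"
proof -
  define y where "y = 1 - cmod z"
  have y: "0 < y" "y \<le> 1" unfolding y_def using assms by auto
  have "log 2 y \<le> 0" using y by simp
  hence "0 \<le> - log 2 y" by simp
  hence n: "real (level z) \<le> - log 2 y" "- log 2 y < real (level z) + 1"
    unfolding level_def y_def[symmetric] by linarith+
  have "y = 2 powr (log 2 y)" using y by simp
  also have "... \<le> 2 powr (- real (level z))" using n by (intro powr_mono) auto
  also have "... = 1 / 2 ^ level z" by (simp add: powr_minus_divide powr_realpow)
  finally show "1 - cmod z \<le> 1 / 2 ^ level z" unfolding y_def .
  have "1 / 2 ^ (level z + 1) = 2 powr (- real (level z + 1))" by (simp only: powr_minus_divide powr_realpow[OF zero_less_numeral])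
  also have "... < 2 powr (log 2 y)" using n by (intro powr_less_mono) auto
  also have "... = y" using y by simp
  finally show "1 / 2 ^ (level z + 1) < 1 - cmod z" unfolding y_def .
qed

lemma floor_eq_diff:
  fixes a b :: real assumes "\<lfloor>a\<rfloor> = \<lfloor>b\<rfloor>" shows "\<bar>a - b\<bar> \<le> 1"
  using assms by linarith

lemma same_cell:
  assumes z: "cmod z < 1" and x: "cmod x < 1" and c: "cell z = cell x"
  shows "1 - cmod z \<le> 2 * (1 - cmod x)" "cmod (z - x) < 2 * (1 - cmod x)" "1/4 \<le> kap x z"
proof -
  have l: "level z = level x" and
    fl: "\<lfloor>2 ^ (level x + 1) * Re z\<rfloor> = \<lfloor>2 ^ (level x + 1) * Re x\<rfloor>" "\<lfloor>2 ^ (level x + 1) * Im z\<rfloor> = \<lfloor>2 ^ (level x + 1) * Im x\<rfloor>"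
    using c unfolding cell_def by auto
  define P where "P = (2::real) ^ (level x + 1)"
  have P: "P > 0" unfolding P_def by simp
  have lx: "1 / P < 1 - cmod x" using level_bounds(2)[OF x] unfolding P_def .
  have lz: "1 - cmod z \<le> 2 / P" using level_bounds(1)[OF z] unfolding P_def l by simp
  show a: "1 - cmod z \<le> 2 * (1 - cmod x)" using lx lz by argo
  have "\<bar>P * Re z - P * Re x\<bar> \<le> 1" "\<bar>P * Im z - P * Im x\<bar> \<le> 1"
    using fl unfolding P_def by (blast intro: floor_eq_diff)+
  hence "P * \<bar>Re (z - x)\<bar> \<le> 1" "P * \<bar>Im (z - x)\<bar> \<le> 1" using P by (simp_all add: abs_mult right_diff_distrib[symmetric])
  hence r: "\<bar>Re (z - x)\<bar> \<le> 1 / P" "\<bar>Im (z - x)\<bar> \<le> 1 / P" using P by (simp_all add: field_simps)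
  have "cmod (z - x) \<le> \<bar>Re (z - x)\<bar> + \<bar>Im (z - x)\<bar>" by (rule cmod_le)
  also have "... \<le> 1 / P + 1 / P" using r by (rule add_mono)
  also have "... < 2 * (1 - cmod x)" using lx by argo
  finally show d: "cmod (z - x) < 2 * (1 - cmod x)" .
  have "1 - cnj x * z = (1 - cnj x * x) + cnj x * (x - z)" by (simp add: algebra_simps)
  hence "cmod (1 - cnj x * z) \<le> cmod (1 - cnj x * x) + cmod x * cmod (x - z)"
    by (metis norm_triangle_ineq norm_mult complex_mod_cnj)
  also have "cmod x * cmod (x - z) \<le> cmod (x - z)" using x by (simp add: mult_left_le_one_le)
  also have "cmod (1 - cnj x * x) = 1 - cmod x^2"
  proof -
    have "1 - cnj x * x = of_real (1 - cmod x^2)" using complex_norm_square[of x] by (simp add: mult.commute)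
    thus ?thesis using x by (simp add: power_le_one del: of_real_diff)
  qed
  also have "1 - cmod x^2 \<le> 2 * (1 - cmod x)"
    using x zero_le_power2[of "1 - cmod x"] by (simp add: power2_eq_square algebra_simps)
  finally have "cmod (1 - cnj x * z) \<le> 4 * (1 - cmod x)" using d by (simp add: norm_minus_commute)
  thus "1/4 \<le> kap x z" using cmod_kernel_pos[OF x z] x unfolding kap_def by (simp add: field_simps)
qed

definition nball :: "complex \<Rightarrow> complex set"
  where "nball x = ball x (3/4 * (1 - cmod x))"

lemma nball_measurable [measurable]: "nball x \<in> sets borel"
  unfolding nball_def by simp

lemma nball_kap:
  assumes "cmod x < 1" "z \<in> nball x"
  shows "cmod z < 1" "kap x z \<ge> 1/11" "kap z x \<ge> 1/11" "1 - cmod z \<ge> (1 - cmod x) / 4" "1 - cmod z \<le> 7/4 * (1 - cmod x)"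
  using kap_local[of x z] assms unfolding nball_def by (auto simp: dist_norm)

text \<open>A point lies in discs from at most 5 levels, as seen by comparing boundary distances,
  and on each level at most 5 * 5 grid squares come close enough. Injectivity on cells turns this
  into the count 125.\<close>

lemma nball_overlap:
  assumes I: "finite I" "inj_on cell I" "\<And>x. x \<in> I \<Longrightarrow> cmod x < 1"
  shows "(\<Sum>x\<in>I. indicator (nball x) z) \<le> (125::ennreal)"
proof -
  define J where "J = {x\<in>I. z \<in> nball x}"
  have fJ: "finite J" unfolding J_def using I by simp
  define T where "T = level ` J"
  have J: "cmod x < 1" "z \<in> nball x" if "x \<in> J" for x using that I unfolding J_def by auto
  have cT: "card T \<le> 4 + 1"
  proof (rule card_dyadic_le)
    fix i j assume "i \<in> T" "j \<in> T"
    then obtain x y where xy: "x \<in> J" "y \<in> J" "i = level x" "j = level y" unfolding T_def by auto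
    note nx = nball_kap[OF J[OF xy(1)]] and ny = nball_kap[OF J[OF xy(2)]]
    have "1 / (2 * 2^i) < 1 - cmod x" using level_bounds(2)[OF J(1)[OF xy(1)]] xy by simp
    moreover have "1 - cmod y \<le> 1 / 2^j" using level_bounds(1)[OF J(1)[OF xy(2)]] xy by simp
    ultimately have "1 / (2 * 2^i) < 7 * (1 / (2::real)^j)" using nx ny by argo
    hence "(2::real)^j \<le> 14 * 2^i" by (simp add: field_simps)
    thus "(2::real)^j \<le> 2^4 * 2^i" by (rule order_trans) simp
  qed (use fJ in \<open>auto simp: T_def\<close>)
  define S where "S = Sigma T (\<lambda>n. {\<lfloor>2^(n+1) * Re z\<rfloor> - 2..\<lfloor>2^(n+1) * Re z\<rfloor> + 2} \<times> {\<lfloor>2^(n+1) * Im z\<rfloor> - 2..\<lfloor>2^(n+1) * Im z\<rfloor> + 2})"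
  have "cell ` J \<subseteq> S"
  proof
    fix c assume "c \<in> cell ` J"
    then obtain x where x: "x \<in> J" "c = cell x" by auto
    define n where "n = level x"
    define P where "P = (2::real)^(n+1)"
    have P: "P > 0" unfolding P_def by simp
    have d: "cmod (x - z) < 3/4 * (1 - cmod x)" using J(2)[OF x(1)] unfolding nball_def by (simp add: dist_norm)
    also have "... \<le> 3/4 * (1 / 2^n)" using level_bounds(1)[OF J(1)[OF x(1)]] unfolding n_def by simp
    also have "... = 3/2 / P" unfolding P_def by simp
    finally have d: "cmod (x - z) < 3/2 / P" .
    hence "\<bar>Re (x - z)\<bar> < 3/2 / P" "\<bar>Im (x - z)\<bar> < 3/2 / P"
      using abs_Re_le_cmod[of "x - z"] abs_Im_le_cmod[of "x - z"] by linarith+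
    hence "P * \<bar>Re (x - z)\<bar> < 3/2" "P * \<bar>Im (x - z)\<bar> < 3/2" using P by (simp_all add: field_simps)
    hence "\<bar>P * Re x - P * Re z\<bar> < 2" "\<bar>P * Im x - P * Im z\<bar> < 2"
      using P by (simp_all add: abs_mult right_diff_distrib[symmetric])
    hence "\<lfloor>P * Re x\<rfloor> \<in> {\<lfloor>P * Re z\<rfloor> - 2..\<lfloor>P * Re z\<rfloor> + 2}" "\<lfloor>P * Im x\<rfloor> \<in> {\<lfloor>P * Im z\<rfloor> - 2..\<lfloor>P * Im z\<rfloor> + 2}"
      unfolding atLeastAtMost_iff by linarith+
    thus "c \<in> S" using x unfolding S_def cell_def T_def n_def P_def by auto
  qed
  moreover have fS: "finite S" unfolding S_def T_def using fJ by auto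
  ultimately have "card (cell ` J) \<le> card S" by (intro card_mono)
  also have "card S = (\<Sum>n\<in>T. 25)" unfolding S_def using fJ by (subst card_SigmaI) (auto simp: T_def card_cartesian_product)
  also have "... \<le> 125" using cT by simp
  also have "card (cell ` J) = card J" using I(2) unfolding J_def by (intro card_image) (auto simp: inj_on_def)
  finally have "(of_nat (card J) :: ennreal) \<le> of_nat 125" by (subst of_nat_le_iff) auto
  moreover have "(\<Sum>x\<in>I. indicator (nball x) z) = (\<Sum>x\<in>J. (1::ennreal))"
    unfolding J_def using I(1) by (subst sum.inter_filter) (auto intro!: sum.cong simp del: sum_constant)
  ultimately show ?thesis by simp
qed

text \<open>The disc has hyperbolic area at least (9/16) pi (16/49) = 9 pi/49 > 1/2. This allows a
  term of a discrete sum to be replaced by an integral over its disc.\<close>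

lemma nball_area:
  assumes x: "cmod x < 1"
  shows "1 \<le> ennreal 2 * (\<integral>\<^sup>+z\<in>nball x. ennreal ((1 - cmod z) powr - 2) \<partial>lborel)"
proof -
  define d where "d = 1 - cmod x"
  have d: "d > 0" unfolding d_def using x by simp
  have "ennreal 1 \<le> ennreal (2 * (16 / (49 * d^2)) * (pi * (3/4 * d)^2))"
    using d pi_gt3 by (intro ennreal_leI) (simp add: power_mult_distrib power_divide)
  also have "... = ennreal 2 * (ennreal (16 / (49 * d^2)) * emeasure lborel (nball x))"
    using emeasure_ball[of "3/4 * d" x] d unfolding nball_def d_def[symmetric]
    by (simp add: ennreal_mult[symmetric] eval_unit_ball_vol mult.assoc del: ennreal_numeral)
  also have "ennreal (16 / (49 * d^2)) * emeasure lborel (nball x) = (\<integral>\<^sup>+z\<in>nball x. ennreal (16 / (49 * d^2)) \<partial>lborel)"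
    by (simp add: nn_integral_cmult_indicator)
  also have "... \<le> (\<integral>\<^sup>+z\<in>nball x. ennreal ((1 - cmod z) powr - 2) \<partial>lborel)"
  proof (intro nn_integral_mono)
    fix z
    show "ennreal (16 / (49 * d^2)) * indicator (nball x) z \<le> ennreal ((1 - cmod z) powr - 2) * indicator (nball x) z"
    proof (cases "z \<in> nball x")
      case True
      note l = nball_kap[OF x True]
      have "(1 - cmod z)^2 \<le> (7/4 * d)^2" using l x unfolding d_def by (intro power_mono) auto
      hence "1 / (7/4 * d)^2 \<le> 1 / (1 - cmod z)^2" using l d by (intro divide_left_mono) auto
      hence "16 / (49 * d^2) \<le> (1 - cmod z) powr - 2" using l by (simp add: powr_minus_divide power_mult_distrib power_divide)
      thus ?thesis using True by (simp add: ennreal_leI)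
    qed simp
  qed
  finally show ?thesis by (simp add: mult_left_mono)
qed

text \<open>Each term is at most a multiple of its integral over \<open>nball x\<close> against
  hyperbolic area, the discs overlap at most 125 times, and the resulting integral is
  \<open>kernel_integral\<close> with N = 2 and 1 - \<delta> for \<gamma>: it converges at the
  boundary because \<delta> < 1, and 2 exceeds the critical power because \<delta> > 0. The terms
  are the weights later used in \<open>sum_powr_le\<close>.\<close>

lemma cell_sum_bound:
  assumes \<delta>: "0 < \<delta>" "\<delta> < 1"
  obtains L where "1 \<le> L" "\<And>I z. finite I \<Longrightarrow> inj_on cell I \<Longrightarrow> (\<And>x. x \<in> I \<Longrightarrow> cmod x < 1) \<Longrightarrow> cmod z < 1 \<Longrightarrow>
    (\<Sum>x\<in>I. kap x z ^ 2 * ((1 - cmod z) / (1 - cmod x)) powr \<delta>) \<le> L"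
proof -
  obtain C where C: "0 < C" "\<And>a. cmod a < 1 \<Longrightarrow> (\<integral>\<^sup>+z\<in>unit_disk. ennreal (kap a z powr 2 * (1 - cmod z) powr ((1 - \<delta>) - 1)) \<partial>lborel) \<le> ennreal (C * (1 - cmod a) powr (1 + (1 - \<delta>)))"
    using kernel_integral[of "1 - \<delta>" 2] \<delta> by auto
  define L where "L = 1 + 2 * 968 * 125 * C"
  show ?thesis
  proof (rule that[of L])
    show "1 \<le> L" unfolding L_def using C by simp
    fix I :: "complex set" and z :: complex
    assume I: "finite I" "inj_on cell I" "\<And>x. x \<in> I \<Longrightarrow> cmod x < 1" and z: "cmod z < 1"
    define V where "V = (\<lambda>x. ennreal ((1 - cmod z) powr (\<delta> - 2)) * (ennreal (kap z x powr 2 * (1 - cmod x) powr ((1 - \<delta>) - 1)) * indicator unit_disk x))"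
    have [measurable]: "V \<in> borel_measurable borel" unfolding V_def by measurable
    have one: "ennreal (kap x z ^ 2 * ((1 - cmod z) / (1 - cmod x)) powr \<delta>) \<le> ennreal (2 * 968) * (\<integral>\<^sup>+y. V y * indicator (nball x) y \<partial>lborel)" if x: "x \<in> I" for x
    proof -
      note x1 = I(3)[OF x]
      define A where "A = kap x z ^ 2 * ((1 - cmod z) / (1 - cmod x)) powr \<delta>"
      have A: "0 \<le> A" unfolding A_def by simp
      have "ennreal A * 1 \<le> ennreal A * (ennreal 2 * (\<integral>\<^sup>+y\<in>nball x. ennreal ((1 - cmod y) powr - 2) \<partial>lborel))"
        by (intro mult_left_mono nball_area x1) auto
      also have "... = ennreal 2 * (\<integral>\<^sup>+y. ennreal A * (ennreal ((1 - cmod y) powr - 2) * indicator (nball x) y) \<partial>lborel)"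
        by (subst nn_integral_cmult) (auto simp: mult_ac)
      also have "... \<le> ennreal 2 * (\<integral>\<^sup>+y. ennreal 968 * (V y * indicator (nball x) y) \<partial>lborel)"
      proof (intro mult_left_mono nn_integral_mono)
        fix y
        show "ennreal A * (ennreal ((1 - cmod y) powr - 2) * indicator (nball x) y) \<le> ennreal 968 * (V y * indicator (nball x) y)"
        proof (cases "y \<in> nball x")
          case True
          note l = nball_kap[OF x1 True]
          have "1/11 * kap x z \<le> kap y x * kap x z" using l kap_pos[OF x1 z] by (intro mult_right_mono) auto
          also have "... \<le> 2 * kap y z" by (intro kap_triangle z l x1)
          finally have "kap x z \<le> 22 * kap y z" by simp
          hence "kap x z ^ 2 \<le> (22 * kap y z)^2" using kap_pos[OF x1 z] by (intro power_mono) auto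
          hence k: "kap x z ^ 2 \<le> 484 * kap y z ^ 2" by (simp add: power_mult_distrib)
          have "1 / (1 - cmod x) \<le> 2 / (1 - cmod y)" using l x1 by (simp add: field_simps)
          hence "(1 - cmod z) * (1 / (1 - cmod x)) \<le> (1 - cmod z) * (2 / (1 - cmod y))" using z by (intro mult_left_mono) auto
          hence "((1 - cmod z) / (1 - cmod x)) powr \<delta> \<le> (2 * ((1 - cmod z) / (1 - cmod y))) powr \<delta>"
            using z x1 \<delta> by (intro powr_mono2) (auto simp: mult_ac)
          also have "... = 2 powr \<delta> * ((1 - cmod z) / (1 - cmod y)) powr \<delta>" by (subst powr_mult) (use z l in auto)
          also have "... \<le> 2 powr 1 * ((1 - cmod z) / (1 - cmod y)) powr \<delta>" using \<delta> by (intro mult_right_mono powr_mono) auto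
          finally have "A \<le> (484 * kap y z ^ 2) * (2 * ((1 - cmod z) / (1 - cmod y)) powr \<delta>)"
            unfolding A_def using k by (intro mult_mono) auto
          hence "A * (1 - cmod y) powr - 2 \<le> (484 * kap y z ^ 2) * (2 * ((1 - cmod z) / (1 - cmod y)) powr \<delta>) * (1 - cmod y) powr - 2"
            by (rule mult_right_mono) simp
          also have "... = 968 * ((1 - cmod z) powr (\<delta> - 2) * (kap z y powr 2 * (1 - cmod y) powr ((1 - \<delta>) - 1)))"
          proof -
            have s: "kap y z = (1 - cmod y) / (1 - cmod z) * kap z y" by (rule kap_swap[OF z l(1)])
            have "kap y z ^ 2 * ((1 - cmod z) / (1 - cmod y)) powr \<delta> * (1 - cmod y) powr - 2 = (1 - cmod z) powr (\<delta> - 2) * (kap z y powr 2 * (1 - cmod y) powr ((1 - \<delta>) - 1))"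
              unfolding s using z l kap_pos[OF z l(1)]
              by (simp add: powr_divide powr_minus_divide powr_diff power_mult_distrib power_divide)
            thus ?thesis by (simp add: mult_ac)
          qed
          finally have "ennreal (A * (1 - cmod y) powr - 2) \<le> ennreal (968 * ((1 - cmod z) powr (\<delta> - 2) * (kap z y powr 2 * (1 - cmod y) powr ((1 - \<delta>) - 1))))"
            by (rule ennreal_leI)
          thus ?thesis using True A l(1) unfolding V_def by (simp add: ennreal_mult[symmetric] ennreal_mult'[symmetric] del: ennreal_numeral)
        qed simp
      qed auto
      also have "... = ennreal (2 * 968) * (\<integral>\<^sup>+y. V y * indicator (nball x) y \<partial>lborel)"
        by (subst nn_integral_cmult) (auto simp: ennreal_mult' mult.assoc)
      finally show ?thesis unfolding A_def by simp
    qed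
    have "ennreal (\<Sum>x\<in>I. kap x z ^ 2 * ((1 - cmod z) / (1 - cmod x)) powr \<delta>) = (\<Sum>x\<in>I. ennreal (kap x z ^ 2 * ((1 - cmod z) / (1 - cmod x)) powr \<delta>))"
      by (rule sum_ennreal[symmetric]) auto
    also have "... \<le> (\<Sum>x\<in>I. ennreal (2 * 968) * (\<integral>\<^sup>+y. V y * indicator (nball x) y \<partial>lborel))" by (intro sum_mono one)
    also have "... = ennreal (2 * 968) * (\<integral>\<^sup>+y. (\<Sum>x\<in>I. V y * indicator (nball x) y) \<partial>lborel)"
      by (subst nn_integral_sum) (auto simp: sum_distrib_left)
    also have "... \<le> ennreal (2 * 968) * (\<integral>\<^sup>+y. 125 * V y \<partial>lborel)"
    proof (intro mult_left_mono nn_integral_mono)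
      fix y
      have "(\<Sum>x\<in>I. V y * indicator (nball x) y) = V y * (\<Sum>x\<in>I. indicator (nball x) y)" by (simp only: sum_distrib_left)
      also have "... \<le> V y * 125" by (intro mult_left_mono nball_overlap I) auto
      finally show "(\<Sum>x\<in>I. V y * indicator (nball x) y) \<le> 125 * V y" by (simp add: mult.commute)
    qed auto
    also have "(\<integral>\<^sup>+y. 125 * V y \<partial>lborel) = 125 * (ennreal ((1 - cmod z) powr (\<delta> - 2)) * (\<integral>\<^sup>+y\<in>unit_disk. ennreal (kap z y powr 2 * (1 - cmod y) powr ((1 - \<delta>) - 1)) \<partial>lborel))"
      unfolding V_def by (subst nn_integral_cmult, measurable, subst nn_integral_cmult, measurable)
    also have "ennreal (2 * 968) * ... \<le> ennreal (2 * 968) * (125 * (ennreal ((1 - cmod z) powr (\<delta> - 2)) * ennreal (C * (1 - cmod z) powr (1 + (1 - \<delta>)))))"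
      by (intro mult_left_mono C z) auto
    also have "... = ennreal (2 * 968 * 125 * C)"
    proof -
      have "(1 - cmod z) powr (\<delta> - 2) * (C * (1 - cmod z) powr (1 + (1 - \<delta>))) = C"
        using z by (simp add: powr_add[symmetric])
      hence "ennreal ((1 - cmod z) powr (\<delta> - 2)) * ennreal (C * (1 - cmod z) powr (1 + (1 - \<delta>))) = ennreal C"
        using C by (simp add: ennreal_mult[symmetric])
      thus ?thesis using C by (simp add: ennreal_mult' mult.assoc)
    qed
    finally have "(\<Sum>x\<in>I. kap x z ^ 2 * ((1 - cmod z) / (1 - cmod x)) powr \<delta>) \<le> 2 * 968 * 125 * C"
      using C by (subst (asm) ennreal_le_iff) auto
    thus "(\<Sum>x\<in>I. kap x z ^ 2 * ((1 - cmod z) / (1 - cmod x)) powr \<delta>) \<le> L" unfolding L_def by simp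
  qed
qed

subsection \<open>Test functions\<close>

definition atom :: "nat \<Rightarrow> complex \<Rightarrow> complex \<Rightarrow> complex"
  where "atom N x z = (of_real (1 - cmod x) / (1 - cnj x * z)) ^ N"

lemma cmod_atom: "cmod x < 1 \<Longrightarrow> cmod (atom N x z) = kap x z ^ N"
  unfolding atom_def kap_def norm_power norm_divide norm_of_real by simp

lemma atom_holomorphic [holomorphic_intros]:
  assumes "cmod x < 1" shows "atom N x holomorphic_on unit_disk"
proof -
  have "1 - cnj x * z \<noteq> 0" if "z \<in> unit_disk" for z
    using cmod_kernel_pos[OF assms, of z] that by auto
  thus ?thesis unfolding atom_def by (intro holomorphic_intros) auto
qed

lemma atom_measurable [measurable]: "atom N x \<in> borel_measurable borel"
  unfolding atom_def by measurable

context doubling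
begin

text \<open>This passes from a point value, times the area of its disc, to an integral over the
  disc. The density A only has to be nearly constant there, so it can be W or (1-|z|)^q W; the
  kernel at b is moved from z to x with the constant 22.\<close>

lemma local_mean:
  assumes F: "hol F" and [measurable]: "F \<in> borel_measurable borel" and q: "0 < q"
    and z: "cmod z < 1" and b: "cmod b < 1" and K: "0 < K" and A0: "0 \<le> A z" and [measurable]: "A \<in> borel_measurable borel"
    and A: "\<And>x. x \<in> nball z \<Longrightarrow> A z \<le> K * A x"
  shows "ennreal (kap b z powr (1 + \<alpha>/4) * cmod (F z) powr q * A z * (1 - cmod z)^2)
    \<le> ennreal (16 * 22 powr (1 + \<alpha>/4) * K) * (\<integral>\<^sup>+x\<in>nball z. ennreal (kap b x powr (1 + \<alpha>/4)) * ennreal (cmod (F x) powr q * A x) \<partial>lborel)"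
proof -
  define M where "M = 1 + \<alpha>/4"
  define d where "d = 1 - cmod z"
  have M: "M > 0" unfolding M_def using alpha by simp
  have d: "d > 0" unfolding d_def using z by simp
  have k0: "kap b z powr M * A z * d^2 \<ge> 0" using A0 by simp
  have "ennreal (kap b z powr M * cmod (F z) powr q * A z * d^2) = ennreal (kap b z powr M * A z * d^2) * ennreal (cmod (F z) powr q)"
    by (subst ennreal_mult'[OF k0, symmetric]) (simp add: mult_ac)
  also have "... \<le> ennreal (kap b z powr M * A z * d^2) * avg q F z"
    using z by (intro mult_left_mono local_sup F q) auto
  also have "... = ennreal (kap b z powr M * A z * d^2 * (16 / (pi * d^2))) * (\<integral>\<^sup>+x\<in>nball z. ennreal (cmod (F x) powr q) \<partial>lborel)"
    unfolding avg_def d_def[symmetric] nball_def by (subst mult.assoc[symmetric], subst ennreal_mult'[OF k0]) simp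
  also have "... = (\<integral>\<^sup>+x. ennreal (kap b z powr M * A z * d^2 * (16 / (pi * d^2))) * (ennreal (cmod (F x) powr q) * indicator (nball z) x) \<partial>lborel)"
    by (rule nn_integral_cmult[symmetric]) measurable
  also have "... \<le> (\<integral>\<^sup>+x. ennreal (16 * 22 powr M * K) * (ennreal (kap b x powr M) * ennreal (cmod (F x) powr q * A x) * indicator (nball z) x) \<partial>lborel)"
  proof (intro nn_integral_mono)
    fix x
    show "ennreal (kap b z powr M * A z * d^2 * (16 / (pi * d^2))) * (ennreal (cmod (F x) powr q) * indicator (nball z) x)
      \<le> ennreal (16 * 22 powr M * K) * (ennreal (kap b x powr M) * ennreal (cmod (F x) powr q * A x) * indicator (nball z) x)"
    proof (cases "x \<in> nball z")
      case True
      note l = nball_kap[OF z True]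
      have Ax: "A x \<ge> 0" using A[OF True] A0 K by (meson dual_order.trans zero_le_mult_iff not_less order_less_imp_not_less mult_pos_neg less_le_trans linorder_not_le)
      have "kap b z * (1/11) \<le> kap b z * kap z x" using l kap_pos[OF b z] by (intro mult_left_mono) auto
      also have "... \<le> 2 * kap b x" by (intro kap_triangle l b z)
      finally have "kap b z \<le> 22 * kap b x" by simp
      hence "kap b z powr M \<le> (22 * kap b x) powr M" using M kap_pos[OF b z] by (intro powr_mono2) auto
      also have "... = 22 powr M * kap b x powr M" using kap_pos[OF b l(1)] by (simp add: powr_mult)
      finally have k: "kap b z powr M \<le> 22 powr M * kap b x powr M" .
      have "d^2 * (16 / (pi * d^2)) = 16 / pi" using d by simp
      also have "... \<le> 16" using pi_gt3 by (simp add: divide_le_eq)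
      finally have e: "d^2 * (16 / (pi * d^2)) \<le> 16" .
      have "kap b z powr M * A z * (d^2 * (16 / (pi * d^2))) \<le> (22 powr M * kap b x powr M) * (K * A x) * 16"
        using k e A[OF True] A0 by (intro mult_mono) auto
      hence "kap b z powr M * A z * d^2 * (16 / (pi * d^2)) * cmod (F x) powr q \<le> (22 powr M * kap b x powr M) * (K * A x) * 16 * cmod (F x) powr q"
        by (intro mult_right_mono) (auto simp: mult.assoc)
      also have "... = 16 * 22 powr M * K * (kap b x powr M * (cmod (F x) powr q * A x))" by (simp add: mult_ac)
      finally have "ennreal (kap b z powr M * A z * d^2 * (16 / (pi * d^2)) * cmod (F x) powr q) \<le> ennreal ..." by (rule ennreal_leI)
      moreover have "ennreal (kap b z powr M * A z * d^2 * (16 / (pi * d^2))) * ennreal (cmod (F x) powr q)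
          = ennreal (kap b z powr M * A z * d^2 * (16 / (pi * d^2)) * cmod (F x) powr q)"
        by (rule ennreal_mult'[OF mult_nonneg_nonneg[OF k0], symmetric]) simp
      moreover have "ennreal (16 * 22 powr M * K) * (ennreal (kap b x powr M) * ennreal (cmod (F x) powr q * A x))
          = ennreal (16 * 22 powr M * K * (kap b x powr M * (cmod (F x) powr q * A x)))"
        using K by (simp add: ennreal_mult')
      moreover have "indicator (nball z) x = (1::ennreal)" using True by simp
      ultimately show ?thesis by (simp only: mult_1_right)
    qed simp
  qed
  also have "... = ennreal (16 * 22 powr M * K) * (\<integral>\<^sup>+x\<in>nball z. ennreal (kap b x powr M) * ennreal (cmod (F x) powr q * A x) \<partial>lborel)"
    by (rule nn_integral_cmult) measurable
  finally show ?thesis unfolding M_def d_def .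
qed

lemma W_nball: "cmod z < 1 \<Longrightarrow> x \<in> nball z \<Longrightarrow> W z \<le> KW * W x"
  using W_local[of z x] unfolding nball_def by (auto simp: dist_norm)

lemma W_nball_power:
  assumes q: "0 < q" and z: "cmod z < 1" and x: "x \<in> nball z"
  shows "(1 - cmod z) powr q * W z \<le> (4 powr q * KW) * ((1 - cmod x) powr q * W x)"
proof -
  note l = nball_kap[OF z x]
  have "(1 - cmod z) powr q \<le> (4 * (1 - cmod x)) powr q" using l z q by (intro powr_mono2) auto
  also have "... = 4 powr q * (1 - cmod x) powr q" by (subst powr_mult) (use l in auto)
  finally have "(1 - cmod z) powr q * W z \<le> (4 powr q * (1 - cmod x) powr q) * (KW * W x)"
    using W_nball[OF z x] W_pos[OF z] by (intro mult_mono) auto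
  thus ?thesis by (simp add: mult_ac)
qed

text \<open>The mean is taken at b = z, where the kernel is at least 1/2 at its own pole, and the
  sub-mean value property over \<open>nball z\<close> extracts the value of f.\<close>

lemma pointwise_bound:
  assumes p: "0 < p"
  obtains C where "0 < C" "\<And>f A z. hol f \<Longrightarrow> f \<in> borel_measurable borel \<Longrightarrow> cmod z < 1 \<Longrightarrow> 0 \<le> A \<Longrightarrow>
    km (En p f) z \<le> ennreal (A * (1 - cmod z)) \<Longrightarrow> cmod (f z) powr p * w (cmod z) \<le> C * A"
proof -
  define C where "C = 2 powr (1 + \<alpha>/4) * (16 * 22 powr (1 + \<alpha>/4) * KW)"
  have C: "C > 0" unfolding C_def using KW_pos by simp
  show ?thesis
  proof (rule that[OF C])
    fix f A z assume f: "hol f" and [measurable]: "f \<in> borel_measurable borel" and z: "cmod z < 1" and A: "0 \<le> A"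
      and le: "km (En p f) z \<le> ennreal (A * (1 - cmod z))"
    have "ennreal (kap z z powr (1 + \<alpha>/4) * cmod (f z) powr p * W z * (1 - cmod z)^2)
     \<le> ennreal (16 * 22 powr (1 + \<alpha>/4) * KW) * (\<integral>\<^sup>+x\<in>nball z. ennreal (kap z x powr (1 + \<alpha>/4)) * ennreal (cmod (f x) powr p * W x) \<partial>lborel)"
      by (rule local_mean) (use f p z KW_pos W_pos[OF z] W_nball[OF z] in auto)
    also have "... \<le> ennreal (16 * 22 powr (1 + \<alpha>/4) * KW) * km (En p f) z"
      unfolding kmean_def En_def using nball_kap(1)[OF z]
      by (intro mult_left_mono nn_integral_mono) (auto split: split_indicator)
    also have "... \<le> ennreal (16 * 22 powr (1 + \<alpha>/4) * KW) * ennreal (A * (1 - cmod z))"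
      by (intro mult_left_mono le) auto
    also have "... = ennreal (16 * 22 powr (1 + \<alpha>/4) * KW * (A * (1 - cmod z)))"
      using KW_pos A z by (intro ennreal_mult[symmetric]) auto
    finally have "kap z z powr (1 + \<alpha>/4) * cmod (f z) powr p * W z * (1 - cmod z)^2 \<le> 16 * 22 powr (1 + \<alpha>/4) * KW * (A * (1 - cmod z))"
      using KW_pos A z by (subst (asm) ennreal_le_iff) auto
    also have "W z * (1 - cmod z)^2 = w (cmod z) * (1 - cmod z)" unfolding W_def using z by (simp add: power2_eq_square)
    hence "kap z z powr (1 + \<alpha>/4) * cmod (f z) powr p * W z * (1 - cmod z)^2 = kap z z powr (1 + \<alpha>/4) * cmod (f z) powr p * w (cmod z) * (1 - cmod z)"
      by (simp add: mult.assoc)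
    finally have "kap z z powr (1 + \<alpha>/4) * (cmod (f z) powr p * w (cmod z)) \<le> 16 * 22 powr (1 + \<alpha>/4) * KW * A"
      using z by (simp add: mult.assoc[symmetric])
    moreover have "(1/2) powr (1 + \<alpha>/4) \<le> kap z z powr (1 + \<alpha>/4)"
    proof (intro powr_mono2)
      have "cmod (1 - cnj z * z) \<le> 1 - cmod z^2"
      proof -
        have "1 - cnj z * z = of_real (1 - cmod z^2)" using complex_norm_square[of z] by (simp add: mult.commute)
        thus ?thesis using z by (simp add: power_le_one del: of_real_diff)
      qed
      also have "... \<le> 2 * (1 - cmod z)" using zero_le_power2[of "1 - cmod z"] by (simp add: power2_eq_square algebra_simps)
      finally show "1/2 \<le> kap z z" unfolding kap_def using cmod_kernel_pos[OF z z] by (simp add: field_simps)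
    qed (use alpha in auto)
    hence "(1/2) powr (1 + \<alpha>/4) * (cmod (f z) powr p * w (cmod z)) \<le> kap z z powr (1 + \<alpha>/4) * (cmod (f z) powr p * w (cmod z))"
      using w_pos[of "cmod z"] z by (intro mult_right_mono) auto
    ultimately have "(1/2) powr (1 + \<alpha>/4) * (cmod (f z) powr p * w (cmod z)) \<le> 16 * 22 powr (1 + \<alpha>/4) * KW * A" by linarith
    hence "2 powr (1 + \<alpha>/4) * ((1/2) powr (1 + \<alpha>/4) * (cmod (f z) powr p * w (cmod z))) \<le> 2 powr (1 + \<alpha>/4) * (16 * 22 powr (1 + \<alpha>/4) * KW * A)"
      by (rule mult_left_mono) simp
    moreover have "2 powr (1 + \<alpha>/4) * (1/2) powr (1 + \<alpha>/4) = (1::real)" by (simp add: powr_mult[symmetric])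
    ultimately show "cmod (f z) powr p * w (cmod z) \<le> C * A" unfolding C_def by (simp add: mult.assoc[symmetric])
  qed
qed

abbreviation (input) atom_sum :: "nat \<Rightarrow> complex set \<Rightarrow> (complex \<Rightarrow> complex) \<Rightarrow> complex \<Rightarrow> complex"
  where "atom_sum N I c \<equiv> \<lambda>z. \<Sum>x\<in>I. c x * atom N x z"

text \<open>Not a condition on pairs of points: it is the hypothesis of \<open>sum_powr_le\<close>
  for the weights kap^2 times a small power of the ratio of boundary distances. A single point
  satisfies it with L = 1, a set with one point per cell with the constant of
  \<open>cell_sum_bound\<close>.\<close>

abbreviation (input) separated :: "real \<Rightarrow> real \<Rightarrow> complex set \<Rightarrow> bool"
  where "separated \<delta> L I \<equiv> \<forall>z. cmod z < 1 \<longrightarrow> (\<Sum>x\<in>I. kap x z ^ 2 * ((1 - cmod z) / (1 - cmod x)) powr \<delta>) \<le> L"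

text \<open>With these weights \<open>sum_powr_le\<close> reduces the p-th power of the sum to
  single atoms, for every p > 0. N is so large that the kernel power left after paying for the
  weights and for the comparison of W still contains the square kernel, and
  \<open>kernel_composition\<close> integrates it against k_b^M. \<delta> and N are fixed before L,
  because the L available for a set of nodes depends on \<delta>.\<close>

lemma synthesis:
  assumes p: "0 < p"
  obtains \<delta> N where "0 < \<delta>" "\<delta> < 1" "\<And>L. 1 \<le> L \<Longrightarrow> \<exists>C>0. \<forall>I c b. finite I \<longrightarrow> (\<forall>x\<in>I. cmod x < 1) \<longrightarrow>
     separated \<delta> L I \<longrightarrow> cmod b < 1 \<longrightarrow>
     km (En p (atom_sum N I c)) b \<le> ennreal (C * (\<Sum>x\<in>I. cmod (c x) powr p * node_mass b x))"
proof -
  \<comment> \<open>Of the kernel power Np, 2p goes to the weights l^(-p), \<beta> to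
    \<open>w_compare\<close>, 1 to the bound for y^e below, and at least 2 must remain.\<close>
  define N where "N = nat \<lceil>(2*p + \<beta> + 3) / p\<rceil>"
  have N: "real N * p - 2*p - \<beta> - 1 \<ge> 2"
  proof -
    have "(2*p + \<beta> + 3) / p \<le> real N" unfolding N_def by (rule real_nat_ceiling_ge)
    thus ?thesis using p by (simp add: field_simps)
  qed
  \<comment> \<open>The weights cost the power \<delta> p of the ratio of boundary distances, and at
    most half of the gain \<alpha> may be spent on that.\<close>
  define \<delta> where "\<delta> = min (1/2) (\<alpha> / (2*p))"
  have \<delta>: "0 < \<delta>" "\<delta> < 1" "\<delta> * p \<le> \<alpha> / 2"
  proof -
    show "0 < \<delta>" "\<delta> < 1" unfolding \<delta>_def using alpha p by auto
    have "\<delta> \<le> \<alpha> / (2*p)" unfolding \<delta>_def by simp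
    hence "\<delta> * p \<le> \<alpha> / (2*p) * p" using p by (intro mult_right_mono) auto
    thus "\<delta> * p \<le> \<alpha> / 2" using p by simp
  qed
  obtain C1 where C1: "0 < C1" "\<And>a b. cmod a < 1 \<Longrightarrow> cmod b < 1 \<Longrightarrow>
    (\<integral>\<^sup>+z\<in>unit_disk. ennreal (kap b z powr (1 + \<alpha>/4) * kap a z ^ 2 * (1 - cmod z) powr (\<alpha>/2 - 1)) \<partial>lborel)
      \<le> ennreal (C1 * ((1 - cmod a) powr (1 + \<alpha>/2) * kap b a powr (1 + \<alpha>/4)))"
    using kernel_composition[of "\<alpha>/2" "1 + \<alpha>/4"] alpha by auto
  show ?thesis
  proof (rule that[OF \<delta>(1,2), of N])
    fix L :: real assume L: "1 \<le> L"
    show "\<exists>C>0. \<forall>I c b. finite I \<longrightarrow> (\<forall>x\<in>I. cmod x < 1) \<longrightarrow>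
     separated \<delta> L I \<longrightarrow> cmod b < 1 \<longrightarrow>
     km (En p (atom_sum N I c)) b \<le> ennreal (C * (\<Sum>x\<in>I. cmod (c x) powr p * node_mass b x))"
    proof (intro exI[of _ "L powr p * C0 * C1"] conjI allI impI)
      show "0 < L powr p * C0 * C1" using L C0 C1 by simp
      fix I :: "complex set" and c :: "complex \<Rightarrow> complex" and b :: complex
      assume I: "finite I" "\<forall>x\<in>I. cmod x < 1" and sp: "\<forall>z. cmod z < 1 \<longrightarrow> (\<Sum>x\<in>I. kap x z ^ 2 * ((1 - cmod z) / (1 - cmod x)) powr \<delta>) \<le> L"
        and b: "cmod b < 1"
      define K where "K = (\<lambda>x. L powr p * C0 * cmod (c x) powr p * w (cmod x) * (1 - cmod x) powr - (\<alpha>/2))"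
      have K0: "K x \<ge> 0" if "x \<in> I" for x unfolding K_def using C0 w_pos[of "cmod x"] I that by auto
      have pt: "En p (atom_sum N I c) z \<le> (\<Sum>x\<in>I. ennreal (K x) * ennreal (kap x z ^ 2 * (1 - cmod z) powr (\<alpha>/2 - 1)))" if z: "cmod z < 1" for z
      proof -
        define l where "l = (\<lambda>x. kap x z ^ 2 * ((1 - cmod z) / (1 - cmod x)) powr \<delta>)"
        have "cmod (\<Sum>x\<in>I. c x * atom N x z) \<le> (\<Sum>x\<in>I. cmod (c x) * kap x z ^ N)"
          using I by (intro order_trans[OF norm_sum] sum_mono) (simp add: norm_mult cmod_atom)
        hence "cmod (\<Sum>x\<in>I. c x * atom N x z) powr p \<le> (\<Sum>x\<in>I. cmod (c x) * kap x z ^ N) powr p" using p by (intro powr_mono2) auto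
        also have "... \<le> L powr p * (\<Sum>x\<in>I. l x powr - p * (cmod (c x) * kap x z ^ N) powr p)"
        proof (rule sum_powr_le)
          fix x assume "x \<in> I"
          hence x: "cmod x < 1" using I by auto
          show "0 \<le> cmod (c x) * kap x z ^ N" using kap_pos[OF x z] by simp
          show "0 < l x" unfolding l_def using kap_pos[OF x z] x z by simp
        qed (use I p sp z in \<open>auto simp: l_def\<close>)
        finally have "cmod (\<Sum>x\<in>I. c x * atom N x z) powr p * W z \<le> L powr p * (\<Sum>x\<in>I. l x powr - p * (cmod (c x) * kap x z ^ N) powr p) * W z"
          using W_pos[OF z] by (intro mult_right_mono) auto
        also have "... = (\<Sum>x\<in>I. L powr p * (l x powr - p * (cmod (c x) * kap x z ^ N) powr p) * W z)"
          by (simp add: sum_distrib_left sum_distrib_right mult.assoc)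
        also have "... \<le> (\<Sum>x\<in>I. K x * (kap x z ^ 2 * (1 - cmod z) powr (\<alpha>/2 - 1)))"
        proof (rule sum_mono)
          fix x assume "x \<in> I"
          hence x: "cmod x < 1" using I by auto
          define k y where "k = kap x z" and "y = (1 - cmod z) / (1 - cmod x)"
          have k: "0 < k" "k \<le> 1" unfolding k_def using kap_pos[OF x z] kap_le_1[OF x z] by auto
          have y: "0 < y" "y * k \<le> 1" unfolding y_def k_def using x z kap_ratio[OF x z] by auto
          have e1: "l x powr - p * (cmod (c x) * k ^ N) powr p = cmod (c x) powr p * (k powr (real N * p - 2*p) * y powr (- (\<delta> * p)))"
          proof -
            have "l x = k powr 2 * y powr \<delta>" unfolding l_def k_def[symmetric] y_def[symmetric] using k by simp
            hence "l x powr - p = (k powr 2) powr - p * (y powr \<delta>) powr - p" by (simp only: powr_mult powr_ge_zero)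
            hence "l x powr - p = k powr (- (2 * p)) * y powr (- (\<delta> * p))" by (simp only: powr_powr mult_minus_right)
            moreover have "(cmod (c x) * k ^ N) powr p = cmod (c x) powr p * k powr (real N * p)"
            proof -
              have "k ^ N = k powr real N" using k by (simp only: powr_realpow)
              hence "(cmod (c x) * k ^ N) powr p = cmod (c x) powr p * (k powr real N) powr p"
                by (simp only: powr_mult powr_ge_zero norm_ge_zero)
              thus ?thesis by (simp only: powr_powr)
            qed
            moreover have "k powr (real N * p - 2*p) = k powr (real N * p) * k powr (- (2 * p))" by (simp add: powr_add[symmetric])
            ultimately show ?thesis by (simp add: mult_ac)
          qed
          have "w (cmod z) \<le> C0 * y powr \<alpha> * k powr - \<beta> * w (cmod x)" unfolding y_def k_def by (rule w_compare[OF x z])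
          hence e2: "W z \<le> C0 * y powr \<alpha> * k powr - \<beta> * w (cmod x) / (1 - cmod z)" unfolding W_def using z by (intro divide_right_mono) auto
          \<comment> \<open>Once y^(\<alpha>/2) is set aside, the surplus y^e has exponent between 0
            and 1, and y is at most 1/k; so it costs at most one kernel factor.\<close>
          have e3: "k powr (real N * p - 2*p) * y powr (- (\<delta> * p)) * (y powr \<alpha> * k powr - \<beta>) \<le> k^2 * y powr (\<alpha>/2)"
          proof -
            define e where "e = \<alpha>/2 - \<delta> * p"
            have "0 \<le> \<delta> * p" using \<delta> p by simp
            hence e: "0 \<le> e" "e \<le> 1" unfolding e_def using \<delta>(3) alpha by (simp_all only: diff_ge_0_iff_ge)
            have "y \<le> 1 / k" using y k by (simp add: field_simps)
            hence "y powr e \<le> (1 / k) powr e" using y e by (intro powr_mono2) auto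
            also have "... \<le> (1 / k) powr 1" using k e by (intro powr_mono) auto
            finally have ye: "y powr e \<le> k powr - 1" using k by (simp add: powr_minus_divide)
            have "k powr (real N * p - 2*p) * y powr (- (\<delta> * p)) * (y powr \<alpha> * k powr - \<beta>) = k powr (real N * p - 2*p - \<beta>) * (y powr (\<alpha>/2) * y powr e)"
            proof -
              have "y powr (- (\<delta> * p)) * y powr \<alpha> = y powr (\<alpha>/2) * y powr e" unfolding powr_add[symmetric] e_def by (simp add: algebra_simps)
              moreover have "k powr (real N * p - 2*p) * k powr - \<beta> = k powr (real N * p - 2*p - \<beta>)" unfolding powr_add[symmetric] by simp
              moreover have "k1 * y1 * (y2 * k2) = (k1 * k2) * (y1 * y2)" for k1 k2 y1 y2 :: real by (simp only: mult_ac)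
              ultimately show ?thesis by (simp only:)
            qed
            also have "... \<le> k powr (real N * p - 2*p - \<beta>) * (y powr (\<alpha>/2) * k powr - 1)" using ye by (intro mult_left_mono) auto
            also have "... = k powr (real N * p - 2*p - \<beta> - 1) * y powr (\<alpha>/2)"
            proof -
              have "k powr (real N * p - 2*p - \<beta>) * k powr - 1 = k powr (real N * p - 2*p - \<beta> - 1)" unfolding powr_add[symmetric] by simp
              moreover have "k1 * (y1 * k2) = (k1 * k2) * y1" for k1 k2 y1 :: real by (simp only: mult_ac)
              ultimately show ?thesis by (simp only:)
            qed
            also have "... \<le> k powr 2 * y powr (\<alpha>/2)" using k N by (intro mult_right_mono powr_mono') auto
            finally show ?thesis using k by simp
          qed
          have "L powr p * (l x powr - p * (cmod (c x) * kap x z ^ N) powr p) * W z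
            \<le> L powr p * (cmod (c x) powr p * (k powr (real N * p - 2*p) * y powr (- (\<delta> * p)))) * (C0 * y powr \<alpha> * k powr - \<beta> * w (cmod x) / (1 - cmod z))"
            unfolding k_def[symmetric] e1 by (intro mult_left_mono e2) auto
          also have "... = (L powr p * C0 * cmod (c x) powr p * w (cmod x) / (1 - cmod z)) * (k powr (real N * p - 2*p) * y powr (- (\<delta> * p)) * (y powr \<alpha> * k powr - \<beta>))"
            by (simp add: mult_ac)
          also have "... \<le> (L powr p * C0 * cmod (c x) powr p * w (cmod x) / (1 - cmod z)) * (k^2 * y powr (\<alpha>/2))"
            using C0 w_pos[of "cmod x"] x z by (intro mult_left_mono e3) auto
          also have "... = K x * (k^2 * (1 - cmod z) powr (\<alpha>/2 - 1))"
            unfolding K_def y_def using x z by (simp add: powr_divide powr_minus_divide powr_diff)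
          finally show "L powr p * (l x powr - p * (cmod (c x) * kap x z ^ N) powr p) * W z \<le> K x * (kap x z ^ 2 * (1 - cmod z) powr (\<alpha>/2 - 1))" unfolding k_def .
        qed
        finally have "En p (atom_sum N I c) z \<le> ennreal (\<Sum>x\<in>I. K x * (kap x z ^ 2 * (1 - cmod z) powr (\<alpha>/2 - 1)))"
          unfolding En_def by (rule ennreal_leI)
        also have "... = (\<Sum>x\<in>I. ennreal (K x * (kap x z ^ 2 * (1 - cmod z) powr (\<alpha>/2 - 1))))"
          using K0 by (intro sum_ennreal[symmetric]) auto
        also have "... = (\<Sum>x\<in>I. ennreal (K x) * ennreal (kap x z ^ 2 * (1 - cmod z) powr (\<alpha>/2 - 1)))"
          using K0 by (intro sum.cong refl ennreal_mult') auto
        finally show ?thesis .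
      qed
      have "km (En p (atom_sum N I c)) b \<le> km (\<lambda>z. \<Sum>x\<in>I. ennreal (K x) * ennreal (kap x z ^ 2 * (1 - cmod z) powr (\<alpha>/2 - 1))) b"
        by (intro kmean_mono pt)
      also have "... = (\<Sum>x\<in>I. km (\<lambda>z. ennreal (K x) * ennreal (kap x z ^ 2 * (1 - cmod z) powr (\<alpha>/2 - 1))) b)"
        by (rule kmean_sum) measurable
      also have "... = (\<Sum>x\<in>I. ennreal (K x) * km (\<lambda>z. ennreal (kap x z ^ 2 * (1 - cmod z) powr (\<alpha>/2 - 1))) b)"
        by (intro sum.cong refl kmean_cmult) measurable
      also have "... \<le> (\<Sum>x\<in>I. ennreal (K x) * ennreal (C1 * ((1 - cmod x) powr (1 + \<alpha>/2) * kap b x powr (1 + \<alpha>/4))))"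
      proof (intro sum_mono mult_left_mono)
        fix x assume "x \<in> I"
        hence x: "cmod x < 1" using I by auto
        have "km (\<lambda>z. ennreal (kap x z ^ 2 * (1 - cmod z) powr (\<alpha>/2 - 1))) b = (\<integral>\<^sup>+z\<in>unit_disk. ennreal (kap b z powr (1 + \<alpha>/4) * kap x z ^ 2 * (1 - cmod z) powr (\<alpha>/2 - 1)) \<partial>lborel)"
          unfolding kmean_def by (intro nn_integral_cong) (simp add: ennreal_mult'[symmetric] mult.assoc)
        also have "... \<le> ennreal (C1 * ((1 - cmod x) powr (1 + \<alpha>/2) * kap b x powr (1 + \<alpha>/4)))" by (rule C1(2)[OF x b])
        finally show "km (\<lambda>z. ennreal (kap x z ^ 2 * (1 - cmod z) powr (\<alpha>/2 - 1))) b \<le> ..." .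
      qed auto
      also have "... = (\<Sum>x\<in>I. ennreal (L powr p * C0 * C1 * (cmod (c x) powr p * node_mass b x)))"
      proof (intro sum.cong refl)
        fix x assume xI: "x \<in> I"
        hence x: "cmod x < 1" using I by auto
        have "(1 - cmod x) powr - (\<alpha>/2) * (1 - cmod x) powr (1 + \<alpha>/2) = 1 - cmod x" using x by (simp add: powr_add[symmetric])
        hence "K x * (C1 * ((1 - cmod x) powr (1 + \<alpha>/2) * kap b x powr (1 + \<alpha>/4))) = L powr p * C0 * C1 * (cmod (c x) powr p * node_mass b x)"
        proof -
          assume e: "(1 - cmod x) powr - (\<alpha>/2) * (1 - cmod x) powr (1 + \<alpha>/2) = 1 - cmod x"
          have "L powr p * C0 * cc * ww * y1 * (C1 * (y2 * kk)) = L powr p * C0 * C1 * (cc * (ww * (y1 * y2) * kk))" for cc ww y1 y2 kk :: real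
            by (simp only: mult_ac)
          thus ?thesis unfolding K_def by (simp only: e)
        qed
        thus "ennreal (K x) * ennreal (C1 * ((1 - cmod x) powr (1 + \<alpha>/2) * kap b x powr (1 + \<alpha>/4))) = ennreal (L powr p * C0 * C1 * (cmod (c x) powr p * node_mass b x))"
          by (simp only: ennreal_mult'[OF K0[OF xI], symmetric])
      qed
      also have "... = ennreal (\<Sum>x\<in>I. L powr p * C0 * C1 * (cmod (c x) powr p * node_mass b x))"
      proof (rule sum_ennreal)
        fix x assume "x \<in> I"
        hence "cmod x < 1" using I by auto
        thus "0 \<le> L powr p * C0 * C1 * (cmod (c x) powr p * node_mass b x)"
          using C0 C1 w_pos[of "cmod x"] by (intro mult_nonneg_nonneg) auto
      qed
      also have "... = ennreal (L powr p * C0 * C1 * (\<Sum>x\<in>I. cmod (c x) powr p * node_mass b x))"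
        by (simp only: sum_distrib_left)
      finally show "km (En p (atom_sum N I c)) b \<le> ..." .
    qed
  qed
qed

end

lemma kap_self:
  assumes z: "cmod z < 1" shows "1/2 \<le> kap z z"
proof -
  have "1 - cnj z * z = of_real (1 - cmod z^2)" using complex_norm_square[of z] by (simp add: mult.commute)
  hence "cmod (1 - cnj z * z) = 1 - cmod z^2" using z by (simp add: power_le_one del: of_real_diff)
  also have "... \<le> 2 * (1 - cmod z)" using zero_le_power2[of "1 - cmod z"] by (simp add: power2_eq_square algebra_simps)
  finally show ?thesis unfolding kap_def using cmod_kernel_pos[OF z z] by (simp add: field_simps)
qed

text \<open>A substitute for Khinchine's inequality: each choice of signs is paired with the one
  that differs at x. The two sums are R - v(x) and R + v(x), and one of them has modulus at least
  |v(x)|. So the average dominates every single term up to the factor 2, which suffices because only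
  boundedly many terms count at each point.\<close>

lemma sign_average:
  fixes v :: "'i \<Rightarrow> complex"
  assumes I: "finite I" "x \<in> I" and q: "0 < q"
  shows "2 ^ card I * (cmod (v x) powr q) \<le> 2 * (\<Sum>T\<in>Pow I. cmod (\<Sum>y\<in>I. if y \<in> T then v y else - v y) powr q)"
proof -
  define J where "J = I - {x}"
  have J: "I = insert x J" "x \<notin> J" "finite J" using I unfolding J_def by auto
  define g where "g = (\<lambda>T. cmod (\<Sum>y\<in>I. if y \<in> T then v y else - v y) powr q)"
  have pair: "cmod (v x) powr q \<le> g T + g (insert x T)" if "T \<in> Pow J" for T
  proof -
    define R where "R = (\<Sum>y\<in>J. if y \<in> T then v y else - v y)"
    have "(\<Sum>y\<in>I. if y \<in> T then v y else - v y) = - v x + R" unfolding J(1) R_def using J that by (subst sum.insert) auto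
    hence a: "g T = cmod (R - v x) powr q" unfolding g_def by simp
    have "(\<Sum>y\<in>J. if y \<in> insert x T then v y else - v y) = R" unfolding R_def using J by (intro sum.cong) auto
    hence "(\<Sum>y\<in>I. if y \<in> insert x T then v y else - v y) = v x + R" unfolding J(1) using J by (subst sum.insert) auto
    hence b: "g (insert x T) = cmod (R + v x) powr q" unfolding g_def by (simp add: add.commute)
    have "2 * cmod (v x) = cmod ((R + v x) - (R - v x))" by (simp add: norm_mult[symmetric])
    also have "... \<le> cmod (R + v x) + cmod (R - v x)" by (rule norm_triangle_ineq4)
    finally have "cmod (v x) \<le> cmod (R + v x) \<or> cmod (v x) \<le> cmod (R - v x)" by linarith
    thus ?thesis
    proof
      assume "cmod (v x) \<le> cmod (R + v x)"
      hence "cmod (v x) powr q \<le> g (insert x T)" unfolding b using q by (intro powr_mono2) auto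
      thus ?thesis using a by (simp add: add_increasing)
    next
      assume "cmod (v x) \<le> cmod (R - v x)"
      hence "cmod (v x) powr q \<le> g T" unfolding a using q by (intro powr_mono2) auto
      thus ?thesis using b by (simp add: add_increasing2)
    qed
  qed
  have "2 ^ card I * (cmod (v x) powr q) = 2 * (\<Sum>T\<in>Pow J. cmod (v x) powr q)"
    using J by (simp add: card_Pow)
  also have "... \<le> 2 * (\<Sum>T\<in>Pow J. g T + g (insert x T))" by (intro mult_left_mono sum_mono pair) auto
  also have "(\<Sum>T\<in>Pow J. g T + g (insert x T)) = sum g (Pow I)"
  proof -
    have "sum g (Pow I) = sum g (Pow J \<union> insert x ` Pow J)" by (simp only: J(1) Pow_insert)
    also have "... = sum g (Pow J) + sum g (insert x ` Pow J)" using J by (intro sum.union_disjoint) auto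
    also have "sum g (insert x ` Pow J) = (\<Sum>T\<in>Pow J. g (insert x T))"
    proof (subst sum.reindex)
      show "inj_on (insert x) (Pow J)" using J(2) by (intro inj_onI) (metis PowD insert_ident subsetD)
    qed simp
    finally show ?thesis by (simp add: sum.distrib)
  qed
  finally show ?thesis unfolding g_def .
qed

section \<open>The embedding of |f|^q |G|^q (1-|z|)^q W: necessary and sufficient conditions\<close>

context doubling
begin

text \<open>Functions are normalized by their kernel energies instead of their tent norms; the two
  differ by constants. B bounds the q-th power of the image, so it scales like the q-th power of an
  operator norm.\<close>

definition embeds :: "real \<Rightarrow> real \<Rightarrow> (complex \<Rightarrow> complex) \<Rightarrow> real \<Rightarrow> bool"
  where "embeds p q G B \<longleftrightarrow> (\<forall>f. hol f \<longrightarrow> f \<in> borel_measurable borel \<longrightarrow>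
    vanishing (\<lambda>b. ennreal (1 / (1 - cmod b)) * km (En p f) b) \<longrightarrow>
    (\<forall>b. cmod b < 1 \<longrightarrow> km (En p f) b \<le> ennreal (1 - cmod b)) \<longrightarrow>
    (\<forall>b. cmod b < 1 \<longrightarrow> km (Dn q (\<lambda>z. f z * G z)) b \<le> ennreal (B * (1 - cmod b))))"

lemma vanishing_power:
  assumes C: "0 < C" and le: "\<And>b. cmod b < 1 \<Longrightarrow> km u b \<le> ennreal (C * (1 - cmod b) powr (1 + \<alpha>/4))"
  shows "vanishing (\<lambda>b. ennreal (1 / (1 - cmod b)) * km u b)"
  unfolding vanishing_def
proof (intro allI impI)
  fix \<epsilon> :: real assume \<epsilon>: "\<epsilon> > 0"
  define \<delta> where "\<delta> = (\<epsilon> / C) powr (4 / \<alpha>)"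
  show "\<exists>\<delta>>0. \<forall>b. 1 - \<delta> < cmod b \<longrightarrow> cmod b < 1 \<longrightarrow> ennreal (1 / (1 - cmod b)) * km u b \<le> ennreal \<epsilon>"
  proof (intro exI[of _ \<delta>] conjI allI impI)
    show "\<delta> > 0" unfolding \<delta>_def using C \<epsilon> by simp
    fix b assume b: "1 - \<delta> < cmod b" "cmod b < 1"
    have "ennreal (1 / (1 - cmod b)) * km u b \<le> ennreal (1 / (1 - cmod b)) * ennreal (C * (1 - cmod b) powr (1 + \<alpha>/4))"
      by (intro mult_left_mono le b) auto
    also have "... = ennreal (C * (1 - cmod b) powr (\<alpha>/4))" using b C by (simp add: ennreal_mult[symmetric] powr_add)
    also have "... \<le> ennreal \<epsilon>"
    proof (rule ennreal_leI)
      have "(1 - cmod b) powr (\<alpha>/4) \<le> \<delta> powr (\<alpha>/4)" using b alpha by (intro powr_mono2) auto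
      also have "... = \<epsilon> / C" unfolding \<delta>_def using alpha C \<epsilon> by (simp add: powr_powr)
      finally show "C * (1 - cmod b) powr (\<alpha>/4) \<le> \<epsilon>" using C by (simp add: field_simps)
    qed
    finally show "ennreal (1 / (1 - cmod b)) * km u b \<le> ennreal \<epsilon>" .
  qed
qed

text \<open>The first bound keeps the full power of 1-|b| and yields the little-oh condition for
  fixed nodes. The second keeps only one power but is uniform in the node, as the normalization of
  test functions requires.\<close>

lemma kap_power_le:
  assumes "cmod b < 1" "cmod x < 1"
  shows "kap b x powr (1 + \<alpha>/4) \<le> ((1 - cmod b) / (1 - cmod x)) powr (1 + \<alpha>/4)"
    "kap b x powr (1 + \<alpha>/4) * (1 - cmod x) \<le> 1 - cmod b"
proof -
  have k: "0 < kap b x" "kap b x \<le> 1" using assms kap_pos kap_le_1 by auto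
  have le: "kap b x \<le> (1 - cmod b) / (1 - cmod x)"
    unfolding kap_def using assms cmod_kernel_ge(2)[OF assms] cmod_kernel_pos[OF assms] by (intro divide_left_mono) auto
  show "kap b x powr (1 + \<alpha>/4) \<le> ((1 - cmod b) / (1 - cmod x)) powr (1 + \<alpha>/4)"
    using k le alpha by (intro powr_mono2) auto
  have "kap b x powr (1 + \<alpha>/4) \<le> kap b x powr 1" using k alpha by (intro powr_mono') auto
  also have "... \<le> (1 - cmod b) / (1 - cmod x)" using k le by simp
  finally show "kap b x powr (1 + \<alpha>/4) * (1 - cmod x) \<le> 1 - cmod b" using assms by (simp add: field_simps)
qed

text \<open>For finitely many fixed nodes the mean is of order (1-|b|)^(1+\<alpha>/4), which beats
  1-|b|. The constant depends on the nodes; only the limit is at stake here.\<close>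

lemma synthesis_vanishing:
  assumes "\<And>b. cmod b < 1 \<Longrightarrow> km u b \<le> ennreal (C * (\<Sum>x\<in>I. d x * node_mass b x))"
    and "0 < C" "finite I" "\<And>x. x \<in> I \<Longrightarrow> cmod x < 1" "\<And>x. 0 \<le> d x"
  shows "vanishing (\<lambda>b. ennreal (1 / (1 - cmod b)) * km u b)"
proof -
  define S where "S = (\<Sum>x\<in>I. d x * (w (cmod x) * (1 - cmod x) * (1 / (1 - cmod x)) powr (1 + \<alpha>/4)))"
  have S: "S \<ge> 0" unfolding S_def
  proof (rule sum_nonneg)
    fix x assume "x \<in> I"
    thus "0 \<le> d x * (w (cmod x) * (1 - cmod x) * (1 / (1 - cmod x)) powr (1 + \<alpha>/4))"
      using assms(4,5)[of x] w_pos[of "cmod x"] by (intro mult_nonneg_nonneg) auto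
  qed
  show ?thesis
  proof (rule vanishing_power[of "C * S + 1"])
    show "0 < C * S + 1" using assms(2) S by (simp add: add_nonneg_pos)
    fix b :: complex assume b: "cmod b < 1"
    have "(\<Sum>x\<in>I. d x * node_mass b x) \<le> (\<Sum>x\<in>I. d x * (w (cmod x) * (1 - cmod x) * (1 / (1 - cmod x)) powr (1 + \<alpha>/4)) * (1 - cmod b) powr (1 + \<alpha>/4))"
    proof (rule sum_mono)
      fix x assume "x \<in> I"
      note x = assms(4)[OF this]
      have "kap b x powr (1 + \<alpha>/4) \<le> (1 / (1 - cmod x)) powr (1 + \<alpha>/4) * (1 - cmod b) powr (1 + \<alpha>/4)"
        using kap_power_le(1)[OF b x] by (simp add: powr_mult[symmetric])
      hence "d x * node_mass b x \<le> d x * (w (cmod x) * (1 - cmod x) * ((1 / (1 - cmod x)) powr (1 + \<alpha>/4) * (1 - cmod b) powr (1 + \<alpha>/4)))"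
        using assms(5)[of x] w_pos[of "cmod x"] x by (intro mult_left_mono) auto
      thus "d x * node_mass b x \<le> d x * (w (cmod x) * (1 - cmod x) * (1 / (1 - cmod x)) powr (1 + \<alpha>/4)) * (1 - cmod b) powr (1 + \<alpha>/4)"
        by (simp add: mult.assoc)
    qed
    also have "... = S * (1 - cmod b) powr (1 + \<alpha>/4)" unfolding S_def by (simp only: sum_distrib_right)
    finally have "C * (\<Sum>x\<in>I. d x * node_mass b x) \<le> C * (S * (1 - cmod b) powr (1 + \<alpha>/4))"
      using assms(2) by (intro mult_left_mono) auto
    also have "... \<le> (C * S + 1) * (1 - cmod b) powr (1 + \<alpha>/4)" by (simp add: distrib_right)
    finally show "km u b \<le> ennreal ((C * S + 1) * (1 - cmod b) powr (1 + \<alpha>/4))"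
      using assms(1)[OF b] by (meson ennreal_leI order_trans)
  qed
qed

lemma sum_atom_holomorphic:
  "\<lbrakk>\<And>x. x \<in> I \<Longrightarrow> cmod x < 1\<rbrakk> \<Longrightarrow> (atom_sum N I c) holomorphic_on unit_disk"
  by (intro holomorphic_intros) auto

text \<open>A single atom at a, scaled to unit energy, is tested at b = a, and
  \<open>local_mean\<close> isolates the value of G at a. The scaling t^p = 1/(C w(a)) is the source
  of the exponent 1 - q/p of w.\<close>

lemma necessity_bloch:
  assumes p: "0 < p" and q: "0 < q"
  obtains C where "0 < C" "\<And>G B a. hol G \<Longrightarrow> G \<in> borel_measurable borel \<Longrightarrow> 0 \<le> B \<Longrightarrow> embeds p q G B \<Longrightarrow> cmod a < 1 \<Longrightarrow>
    (cmod (G a) * (1 - cmod a)) powr q * w (cmod a) powr (1 - q / p) \<le> C * B"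
proof -
  obtain N \<delta> where \<delta>: "0 < \<delta>" "\<delta> < 1" and syn: "\<And>L. 1 \<le> L \<Longrightarrow> \<exists>C>0. \<forall>I c b. finite I \<longrightarrow> (\<forall>x\<in>I. cmod x < 1) \<longrightarrow>
     separated \<delta> L I \<longrightarrow> cmod b < 1 \<longrightarrow>
     km (En p (atom_sum N I c)) b \<le> ennreal (C * (\<Sum>x\<in>I. cmod (c x) powr p * node_mass b x))"
    by (fact synthesis[OF p])
  obtain C where C: "C > 0" and syn1: "\<And>I c b. finite I \<Longrightarrow> (\<forall>x\<in>I. cmod x < 1) \<Longrightarrow>
     (\<forall>z. cmod z < 1 \<longrightarrow> (\<Sum>x\<in>I. kap x z ^ 2 * ((1 - cmod z) / (1 - cmod x)) powr \<delta>) \<le> 1) \<Longrightarrow> cmod b < 1 \<Longrightarrow>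
     km (En p (atom_sum N I c)) b \<le> ennreal (C * (\<Sum>x\<in>I. cmod (c x) powr p * node_mass b x))"
    using syn[of 1] by auto
  define K where "K = 16 * 22 powr (1 + \<alpha>/4) * (4 powr q * KW)"
  have K: "K > 0" unfolding K_def using KW_pos by simp
  define C' where "C' = 2 powr (1 + \<alpha>/4) * 2 powr (real N * q) * C powr (q/p) * K"
  have C': "C' > 0" unfolding C'_def using K C by simp
  show ?thesis
  proof (rule that[OF C'])
    fix G B a assume G: "hol G" and [measurable]: "G \<in> borel_measurable borel" and B: "0 \<le> B"
      and emb: "embeds p q G B" and a: "cmod a < 1"
    have wa: "w (cmod a) > 0" using a w_pos by simp
    define t where "t = (C * w (cmod a)) powr (- 1 / p)"
    have t: "t > 0" unfolding t_def using C wa by simp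
    define f where "f = (\<lambda>z. \<Sum>x\<in>{a}. of_real t * atom N x z)"
    have fh: "hol f" unfolding f_def using a by (intro sum_atom_holomorphic) auto
    have [measurable]: "f \<in> borel_measurable borel" unfolding f_def by measurable
    \<comment> \<open>By \<open>kap_ratio\<close> the ratio of boundary distances is at most
      1/\<open>kap a z\<close>, so its \<delta>-th power uses up at most one of the two kernel
      factors.\<close>
    have fin: "(\<Sum>x\<in>{a}. kap x z ^ 2 * ((1 - cmod z) / (1 - cmod x)) powr \<delta>) \<le> 1" if z: "cmod z < 1" for z
    proof -
      have k: "0 < kap a z" "kap a z \<le> 1" using kap_pos[OF a z] kap_le_1[OF a z] by auto
      have "(1 - cmod z) / (1 - cmod a) \<le> 1 / kap a z" using kap_ratio[OF a z] k by (simp add: pos_le_divide_eq)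
      hence "((1 - cmod z) / (1 - cmod a)) powr \<delta> \<le> (1 / kap a z) powr \<delta>" using a z \<delta> by (intro powr_mono2) auto
      also have "... \<le> (1 / kap a z) powr 1" using k \<delta> by (intro powr_mono) auto
      finally have "kap a z ^ 2 * ((1 - cmod z) / (1 - cmod a)) powr \<delta> \<le> kap a z ^ 2 * (1 / kap a z) powr 1"
        by (rule mult_left_mono) simp
      also have "kap a z ^ 2 * (1 / kap a z) powr 1 = kap a z" using k by (simp add: power2_eq_square)
      also have "... \<le> 1" by (rule k(2))
      finally show ?thesis by simp
    qed
    have S: "km (En p f) b \<le> ennreal (C * (\<Sum>x\<in>{a}. t powr p * node_mass b x))" if b: "cmod b < 1" for b
      using syn1[of "{a}" b "\<lambda>_. of_real t"] a fin b t unfolding f_def by simp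
    have tp: "C * (t powr p * w (cmod a)) = 1"
    proof -
      have "t powr p = (C * w (cmod a)) powr (- 1)" unfolding t_def powr_powr using p by simp
      hence "t powr p = 1 / (C * w (cmod a))" using C wa by (simp add: powr_minus_divide)
      thus ?thesis using C wa by simp
    qed
    have v: "vanishing (\<lambda>b. ennreal (1 / (1 - cmod b)) * km (En p f) b)"
      by (rule synthesis_vanishing[OF S C]) (use a in auto)
    have le: "km (En p f) b \<le> ennreal (1 - cmod b)" if b: "cmod b < 1" for b
    proof -
      have "C * (\<Sum>x\<in>{a}. t powr p * node_mass b x) = C * (t powr p * w (cmod a)) * (kap b a powr (1 + \<alpha>/4) * (1 - cmod a))"
        by (simp add: mult_ac)
      also have "... \<le> 1 - cmod b" unfolding tp using kap_power_le(2)[OF b a] by simp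
      finally show ?thesis using S[OF b] by (meson ennreal_leI order_trans)
    qed
    have D: "km (Dn q (\<lambda>z. f z * G z)) a \<le> ennreal (B * (1 - cmod a))"
      using emb fh v le a \<open>f \<in> borel_measurable borel\<close> unfolding embeds_def by blast
    have Ah: "(\<lambda>z. f z * G z) holomorphic_on unit_disk" by (intro holomorphic_intros fh G)
    have "ennreal (kap a a powr (1 + \<alpha>/4) * cmod (f a * G a) powr q * ((1 - cmod a) powr q * W a) * (1 - cmod a)^2)
      \<le> ennreal K * (\<integral>\<^sup>+x\<in>nball a. ennreal (kap a x powr (1 + \<alpha>/4)) * ennreal (cmod (f x * G x) powr q * ((1 - cmod x) powr q * W x)) \<partial>lborel)"
      unfolding K_def by (rule local_mean[OF Ah _ q a a]) (use KW_pos W_pos[OF a] W_nball_power[OF q a] in auto)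
    also have "... \<le> ennreal K * km (Dn q (\<lambda>z. f z * G z)) a"
      unfolding kmean_def Dn_def using nball_kap(1)[OF a]
      by (intro mult_left_mono nn_integral_mono) (auto simp: mult.assoc split: split_indicator)
    also have "... \<le> ennreal K * ennreal (B * (1 - cmod a))" by (intro mult_left_mono D) auto
    also have "... = ennreal (K * (B * (1 - cmod a)))" using K B a by (intro ennreal_mult[symmetric]) auto
    finally have le1: "kap a a powr (1 + \<alpha>/4) * cmod (f a * G a) powr q * ((1 - cmod a) powr q * W a) * (1 - cmod a)^2 \<le> K * (B * (1 - cmod a))"
      using K B a by (subst (asm) ennreal_le_iff) auto
    have eq1: "kap a a powr (1 + \<alpha>/4) * cmod (f a * G a) powr q * ((1 - cmod a) powr q * W a) * (1 - cmod a)^2 =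
       kap a a powr (1 + \<alpha>/4) * (cmod (f a) powr q * (cmod (G a) * (1 - cmod a)) powr q) * w (cmod a) * (1 - cmod a)"
      unfolding W_def using a by (simp add: norm_mult powr_mult power2_eq_square)
    have "kap a a powr (1 + \<alpha>/4) * (cmod (f a) powr q * (cmod (G a) * (1 - cmod a)) powr q) * w (cmod a) * (1 - cmod a) \<le> K * B * (1 - cmod a)"
      using le1 unfolding eq1 by (simp only: mult.assoc)
    hence 1: "kap a a powr (1 + \<alpha>/4) * (cmod (f a) powr q * (cmod (G a) * (1 - cmod a)) powr q) * w (cmod a) \<le> K * B"
      using a by (simp add: mult_le_cancel_right)
    have fa: "t / 2^N \<le> cmod (f a)"
    proof -
      have "(1/2)^N \<le> kap a a ^ N" using kap_self[OF a] by (intro power_mono) auto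
      hence "t * (1/2)^N \<le> t * kap a a ^ N" using t by (intro mult_left_mono) auto
      thus ?thesis unfolding f_def using t by (simp add: norm_mult cmod_atom[OF a] power_divide)
    qed
    have 2: "(1/2) powr (1 + \<alpha>/4) * ((t / 2^N) powr q * (cmod (G a) * (1 - cmod a)) powr q) * w (cmod a)
      \<le> kap a a powr (1 + \<alpha>/4) * (cmod (f a) powr q * (cmod (G a) * (1 - cmod a)) powr q) * w (cmod a)"
      using kap_self[OF a] fa alpha q t wa by (intro mult_right_mono mult_mono powr_mono2) auto
    have 3: "(1/2) powr (1 + \<alpha>/4) * ((t / 2^N) powr q * (cmod (G a) * (1 - cmod a)) powr q) * w (cmod a) \<le> K * B"
      using 1 2 by linarith
    have e: "C' / K * ((1/2) powr (1 + \<alpha>/4) * ((t / 2^N) powr q * (cmod (G a) * (1 - cmod a)) powr q) * w (cmod a))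
       = (cmod (G a) * (1 - cmod a)) powr q * w (cmod a) powr (1 - q / p)"
    proof -
      have t1: "(t / 2^N) powr q = t powr q * (1 / 2 powr (real N * q))"
        by (simp add: powr_divide powr_realpow[symmetric] powr_powr)
      have t2: "t powr q = 1 / (C powr (q/p) * w (cmod a) powr (q/p))"
        unfolding t_def powr_powr by (simp add: powr_minus_divide powr_mult)
      have t3: "C' / K * (1/2) powr (1 + \<alpha>/4) = 2 powr (real N * q) * C powr (q/p)"
        unfolding C'_def using K by (simp add: powr_divide)
      have t4: "w (cmod a) powr (1 - q / p) = w (cmod a) / w (cmod a) powr (q/p)" using wa by (simp add: powr_diff)
      have "C' / K * ((1/2) powr (1 + \<alpha>/4) * ((t / 2^N) powr q * g) * w (cmod a)) = (C' / K * (1/2) powr (1 + \<alpha>/4)) * (t / 2^N) powr q * g * w (cmod a)" for g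
        by (simp only: mult_ac times_divide_eq_right)
      also have "... g = g * w (cmod a) powr (1 - q / p)" for g
        unfolding t1 t2 t3 t4 using C wa by simp
      finally show ?thesis .
    qed
    have "C' / K * ((1/2) powr (1 + \<alpha>/4) * ((t / 2^N) powr q * (cmod (G a) * (1 - cmod a)) powr q) * w (cmod a)) \<le> C' / K * (K * B)"
      using 3 C' K by (intro mult_left_mono) auto
    thus "(cmod (G a) * (1 - cmod a)) powr q * w (cmod a) powr (1 - q / p) \<le> C' * B"
      unfolding e using K by simp
  qed
qed

text \<open>|f|^q is split as |f|^p |f|^(q-p). Since q >= p, the growth estimate
  \<open>pointwise_bound\<close> controls the second factor, and its power of w cancels the one in
  the condition on G. The result is relative to the energy of f at the same b, so it also transports
  the little-oh condition.\<close>

lemma sufficiency_bloch: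
  assumes p: "0 < p" and pq: "p \<le> q"
  obtains C where "0 < C" "\<And>f G A B. hol f \<Longrightarrow> f \<in> borel_measurable borel \<Longrightarrow> 0 \<le> A \<Longrightarrow> 0 \<le> B \<Longrightarrow>
    (\<And>z. cmod z < 1 \<Longrightarrow> cmod (G z) * (1 - cmod z) * w (cmod z) powr (1/q - 1/p) \<le> B) \<Longrightarrow>
    (\<And>b. cmod b < 1 \<Longrightarrow> km (En p f) b \<le> ennreal (A * (1 - cmod b))) \<Longrightarrow>
    (\<And>b. cmod b < 1 \<Longrightarrow> km (Dn q (\<lambda>z. f z * G z)) b \<le> ennreal (C * B powr q * A powr (q/p - 1)) * km (En p f) b)"
proof -
  have q: "0 < q" using p pq by simp
  obtain C where C: "0 < C" "\<And>f A z. hol f \<Longrightarrow> f \<in> borel_measurable borel \<Longrightarrow> cmod z < 1 \<Longrightarrow> 0 \<le> A \<Longrightarrow>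
    km (En p f) z \<le> ennreal (A * (1 - cmod z)) \<Longrightarrow> cmod (f z) powr p * w (cmod z) \<le> C * A"
    by (fact pointwise_bound[OF p])
  have e0: "q/p - 1 \<ge> 0" using p pq by simp
  show ?thesis
  proof (rule that[of "C powr (q/p - 1)"])
    show "0 < C powr (q/p - 1)" using C by simp
    fix f G A B b assume f: "hol f" and [measurable]: "f \<in> borel_measurable borel" and A: "0 \<le> A" and B: "0 \<le> B"
      and G: "\<And>z. cmod z < 1 \<Longrightarrow> cmod (G z) * (1 - cmod z) * w (cmod z) powr (1/q - 1/p) \<le> B"
      and E: "\<And>b. cmod b < 1 \<Longrightarrow> km (En p f) b \<le> ennreal (A * (1 - cmod b))" and b: "cmod b < 1"
    define K where "K = C powr (q/p - 1) * B powr q * A powr (q/p - 1)"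
    have K: "K \<ge> 0" unfolding K_def by simp
    have "Dn q (\<lambda>z. f z * G z) z \<le> ennreal K * En p f z" if z: "cmod z < 1" for z
    proof (cases "f z = 0")
      case True
      thus ?thesis unfolding Dn_def using q by simp
    next
      case False
      have wz: "w (cmod z) > 0" using w_pos z by simp
      define F g v where "F = cmod (f z)" and "g = cmod (G z) * (1 - cmod z)" and "v = w (cmod z)"
      have F: "F > 0" unfolding F_def using False by simp
      have g: "g \<ge> 0" unfolding g_def using z by simp
      have v: "v > 0" unfolding v_def by (rule wz)
      have "F powr p * v \<le> C * A" unfolding F_def v_def by (rule C(2)[OF f _ z A E[OF z]]) measurable
      hence "(F powr p * v) powr (q/p - 1) \<le> (C * A) powr (q/p - 1)" using F v e0 by (intro powr_mono2) auto
      hence 1: "F powr (q - p) * v powr (q/p - 1) \<le> C powr (q/p - 1) * A powr (q/p - 1)"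
        using p by (simp add: powr_mult powr_powr right_diff_distrib)
      have "(g * v powr (1/q - 1/p)) powr q \<le> B powr q" using G[OF z] g v q unfolding g_def[symmetric] v_def[symmetric] by (intro powr_mono2) auto
      hence 2: "g powr q * v powr (1 - q/p) \<le> B powr q" using q by (simp add: powr_mult powr_powr left_diff_distrib)
      have "F powr q * g powr q = F powr p * ((F powr (q - p) * v powr (q/p - 1)) * (g powr q * v powr (1 - q/p)))"
      proof -
        have "F powr q = F powr p * F powr (q - p)" by (simp add: powr_add[symmetric])
        moreover have "v powr (q/p - 1) * v powr (1 - q/p) = 1" using v by (simp add: powr_add[symmetric])
        moreover have "x * ((y * v1) * (u * v2)) = (x * y) * u * (v1 * v2)" for x y v1 u v2 :: real by (simp only: mult_ac)
        ultimately show ?thesis by (simp only: mult_1_right)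
      qed
      also have "... \<le> F powr p * ((C powr (q/p - 1) * A powr (q/p - 1)) * B powr q)"
        by (intro mult_left_mono mult_mono[OF 1 2]) auto
      finally have 3: "F powr q * g powr q \<le> K * F powr p" unfolding K_def by (simp add: mult_ac)
      have "cmod (f z * G z) powr q * (1 - cmod z) powr q * W z = F powr q * g powr q * W z"
        unfolding F_def g_def by (simp add: norm_mult powr_mult)
      also have "... \<le> K * F powr p * W z" using W_pos[OF z] by (intro mult_right_mono 3) auto
      finally show ?thesis unfolding Dn_def En_def F_def using K by (simp add: ennreal_mult'[symmetric] ennreal_leI mult.assoc)
    qed
    hence "km (Dn q (\<lambda>z. f z * G z)) b \<le> km (\<lambda>z. ennreal K * En p f z) b" by (rule kmean_mono)
    also have "... = ennreal K * km (En p f) b" by (rule kmean_cmult) measurable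
    finally show "km (Dn q (\<lambda>z. f z * G z)) b \<le> ennreal (C powr (q/p - 1) * B powr q * A powr (q/p - 1)) * km (En p f) b" unfolding K_def .
  qed
qed

text \<open>As q/p + q/s = 1, the product X^(q/p) Y^(q/s) is at most max(X, Y). The parameter t
  stays free: balancing the two terms gives the norm estimate, making the second one small gives the
  little-oh condition.\<close>

lemma sufficiency_tent:
  assumes q: "0 < q" "q < p" and s: "s = p * q / (p - q)"
    and [measurable]: "f \<in> borel_measurable borel" "G \<in> borel_measurable borel" and t: "0 < t"
  shows "km (Dn q (\<lambda>z. f z * G z)) b \<le> ennreal (t powr p) * km (En p f) b + ennreal (t powr - s) * km (Dn s G) b"
proof -
  have sp: "s > 0" unfolding s using q by simp
  have ee: "q / p + q / s = 1" unfolding s using q by (simp add: field_simps)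
  have "km (Dn q (\<lambda>z. f z * G z)) b \<le> km (\<lambda>z. ennreal (t powr p) * En p f z + ennreal (t powr - s) * Dn s G z) b"
  proof (rule kmean_mono)
    fix z :: complex assume z: "cmod z < 1"
    define F g where "F = cmod (f z)" and "g = cmod (G z) * (1 - cmod z)"
    have F: "F \<ge> 0" "g \<ge> 0" unfolding F_def g_def using z by auto
    define X Y where "X = (t * F) powr p" and "Y = (g / t) powr s"
    have XY: "X \<ge> 0" "Y \<ge> 0" unfolding X_def Y_def by auto
    have "F powr q * g powr q = (t * F) powr q * (g / t) powr q" using t by (simp add: powr_mult powr_divide)
    also have "(t * F) powr q = X powr (q/p)" unfolding X_def using q by (simp add: powr_powr)
    also have "(g / t) powr q = Y powr (q/s)" unfolding Y_def using sp by (simp add: powr_powr)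
    also have "X powr (q/p) * Y powr (q/s) \<le> max X Y powr (q/p) * max X Y powr (q/s)"
      using XY q sp by (intro mult_mono powr_mono2) auto
    also have "... = max X Y powr 1" unfolding powr_add[symmetric] ee ..
    also have "... \<le> X + Y" using XY by simp
    also have "X = t powr p * F powr p" unfolding X_def by (simp add: powr_mult)
    also have "Y = t powr - s * g powr s" unfolding Y_def using t by (simp add: powr_divide powr_minus_divide)
    finally have le: "F powr q * g powr q \<le> t powr p * F powr p + t powr - s * g powr s" .
    have "cmod (f z * G z) powr q * (1 - cmod z) powr q * W z = F powr q * g powr q * W z"
      unfolding F_def g_def by (simp add: norm_mult powr_mult)
    also have "... \<le> (t powr p * F powr p + t powr - s * g powr s) * W z" using W_pos[OF z] by (intro mult_right_mono le) auto
    also have "... = t powr p * (cmod (f z) powr p * W z) + t powr - s * (cmod (G z) powr s * (1 - cmod z) powr s * W z)"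
      unfolding F_def g_def by (simp add: distrib_right powr_mult mult.assoc)
    finally have "Dn q (\<lambda>z. f z * G z) z \<le> ennreal ..." unfolding Dn_def by (rule ennreal_leI)
    also have "... = ennreal (t powr p) * En p f z + ennreal (t powr - s) * Dn s G z"
      unfolding En_def Dn_def using W_pos[OF z] by (subst ennreal_plus) (auto simp: ennreal_mult')
    finally show "Dn q (\<lambda>z. f z * G z) z \<le> ..." .
  qed
  also have "... = km (\<lambda>z. ennreal (t powr p) * En p f z) b + km (\<lambda>z. ennreal (t powr - s) * Dn s G z) b"
    by (rule kmean_add) measurable
  also have "... = ennreal (t powr p) * km (En p f) b + ennreal (t powr - s) * km (Dn s G) b"
    by (simp only: kmean_cmult En_measurable[OF assms(4)] Dn_measurable[OF assms(5)])
  finally show ?thesis .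
qed

text \<open>
  The test functions have coefficients \<open>\<plusminus> t * h x powr (s / p)\<close>, where \<open>t\<close> is chosen through the supremum \<open>A\<close>
  of the very sums to be bounded (finite because \<open>I\<close> is); averaging over the signs bounds \<open>t powr q * A\<close>,
  and this is a bound for a positive power of \<open>A\<close>.
\<close>

lemma discrete_necessity:
  assumes q: "0 < q" "q < p" and s: "s = p * q / (p - q)"
  obtains K where "0 < K" "\<And>G B I b. hol G \<Longrightarrow> G \<in> borel_measurable borel \<Longrightarrow> 0 \<le> B \<Longrightarrow> embeds p q G B \<Longrightarrow>
    finite I \<Longrightarrow> inj_on cell I \<Longrightarrow> (\<And>x. x \<in> I \<Longrightarrow> cmod x < 1) \<Longrightarrow> cmod b < 1 \<Longrightarrow>
    (\<Sum>x\<in>I. (cmod (G x) * (1 - cmod x)) powr s * node_mass b x) \<le> K * B powr (s / q) * (1 - cmod b)"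
proof -
  have p: "0 < p" using q by simp
  have sp: "s > 0" unfolding s using q by simp
  have es: "s * (q / p) + q = s" "1 - q / p = q / s" unfolding s using q by (simp_all add: field_simps)
  obtain N \<delta> where \<delta>: "0 < \<delta>" "\<delta> < 1" and syn: "\<And>L. 1 \<le> L \<Longrightarrow> \<exists>C>0. \<forall>I c b. finite I \<longrightarrow> (\<forall>x\<in>I. cmod x < 1) \<longrightarrow>
     separated \<delta> L I \<longrightarrow> cmod b < 1 \<longrightarrow>
     km (En p (atom_sum N I c)) b \<le> ennreal (C * (\<Sum>x\<in>I. cmod (c x) powr p * node_mass b x))"
    by (fact synthesis[OF p])
  obtain L where L: "1 \<le> L" "\<And>I z. finite I \<Longrightarrow> inj_on cell I \<Longrightarrow> (\<And>x. x \<in> I \<Longrightarrow> cmod x < 1) \<Longrightarrow> cmod z < 1 \<Longrightarrow>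
    (\<Sum>x\<in>I. kap x z ^ 2 * ((1 - cmod z) / (1 - cmod x)) powr \<delta>) \<le> L"
    by (fact cell_sum_bound[OF \<delta>])
  obtain C where C: "C > 0" and syn1: "\<And>I c b. finite I \<Longrightarrow> (\<forall>x\<in>I. cmod x < 1) \<Longrightarrow>
     separated \<delta> L I \<Longrightarrow> cmod b < 1 \<Longrightarrow>
     km (En p (atom_sum N I c)) b \<le> ennreal (C * (\<Sum>x\<in>I. cmod (c x) powr p * node_mass b x))"
    using syn[OF L(1)] by auto
  define K1 where "K1 = 16 * 22 powr (1 + \<alpha>/4) * (4 powr q * KW)"
  have K1: "K1 > 0" unfolding K1_def using KW_pos by simp
  define K2 where "K2 = K1 * 250 * 11 powr (real N * q) * C powr (q/p)"
  have K2: "K2 > 0" unfolding K2_def using K1 C by simp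
  show ?thesis
  proof (rule that[of "K2 powr (s/q)"])
    show "0 < K2 powr (s/q)" using K2 by simp
    fix G B I b0
    assume G: "hol G" and [measurable]: "G \<in> borel_measurable borel" and B: "0 \<le> B" and emb: "embeds p q G B"
      and I: "finite I" "inj_on cell I" "\<And>x. x \<in> I \<Longrightarrow> cmod x < 1" and b0: "cmod b0 < 1"
    define h where "h = (\<lambda>x. cmod (G x) * (1 - cmod x))"
    define \<mu> where "\<mu> = (\<lambda>x. w (cmod x) * (1 - cmod x))"
    have h0: "h x \<ge> 0" if "x \<in> I" for x unfolding h_def using I(3)[OF that] by simp
    have \<mu>0: "\<mu> x > 0" if "x \<in> I" for x unfolding \<mu>_def using I(3)[OF that] w_pos[of "cmod x"] by simp
    define S where "S = (\<lambda>b. (\<Sum>x\<in>I. h x powr s * (\<mu> x * kap b x powr (1 + \<alpha>/4))) / (1 - cmod b))"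
    have S0: "S b \<ge> 0" if "cmod b < 1" for b
      unfolding S_def using that \<mu>0 by (intro divide_nonneg_nonneg sum_nonneg mult_nonneg_nonneg) (auto intro: less_imp_le)
    define S1 where "S1 = (\<Sum>x\<in>I. h x powr s * (\<mu> x / (1 - cmod x)))"
    have Sle: "S b \<le> S1" if b: "cmod b < 1" for b
    proof -
      have "(\<Sum>x\<in>I. h x powr s * (\<mu> x * kap b x powr (1 + \<alpha>/4))) \<le> (\<Sum>x\<in>I. h x powr s * (\<mu> x / (1 - cmod x)) * (1 - cmod b))"
      proof (rule sum_mono)
        fix x assume xI: "x \<in> I"
        note x = I(3)[OF xI]
        have "kap b x powr (1 + \<alpha>/4) \<le> (1 - cmod b) / (1 - cmod x)" using kap_power_le(2)[OF b x] x by (simp add: pos_le_divide_eq)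
        hence "h x powr s * (\<mu> x * kap b x powr (1 + \<alpha>/4)) \<le> h x powr s * (\<mu> x * ((1 - cmod b) / (1 - cmod x)))"
          using \<mu>0[OF xI] by (intro mult_left_mono) auto
        thus "h x powr s * (\<mu> x * kap b x powr (1 + \<alpha>/4)) \<le> h x powr s * (\<mu> x / (1 - cmod x)) * (1 - cmod b)" by simp
      qed
      also have "... = S1 * (1 - cmod b)" unfolding S1_def by (simp only: sum_distrib_right)
      finally show ?thesis unfolding S_def using b by (simp add: pos_divide_le_eq)
    qed
    define A where "A = (SUP b\<in>unit_disk. S b)"
    have bdd: "bdd_above (S ` unit_disk)" using Sle by (intro bdd_aboveI[of _ S1]) auto
    have SA: "S b \<le> A" if "cmod b < 1" for b unfolding A_def using that by (intro cSUP_upper bdd) auto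
    have A0: "A \<ge> 0" using SA[OF b0] S0[OF b0] by linarith
    have "A \<le> K2 powr (s/q) * B powr (s/q)"
    proof (cases "A = 0")
      case True thus ?thesis by simp
    next
      case False
      hence A: "A > 0" using A0 by simp
      define t where "t = (C * A) powr (- 1 / p)"
      have t: "t > 0" unfolding t_def using C A by simp
      have tp: "C * t powr p * A = 1"
      proof -
        have "t powr p = (C * A) powr (- 1)" unfolding t_def powr_powr using p by simp
        hence "t powr p = 1 / (C * A)" using C A by (simp add: powr_minus_divide)
        thus ?thesis using C A by simp
      qed
      define c where "c = (\<lambda>x. t * h x powr (s/p))"
      have c0: "c x \<ge> 0" for x unfolding c_def using t by simp
      define cT where "cT = (\<lambda>T x. if x \<in> T then complex_of_real (c x) else - complex_of_real (c x))"
      have cTn: "cmod (cT T x) = c x" for T x unfolding cT_def using c0 by simp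
      define f where "f = (\<lambda>T z. \<Sum>x\<in>I. cT T x * atom N x z)"
      have fh: "f T holomorphic_on unit_disk" for T unfolding f_def using I by (intro sum_atom_holomorphic) auto
      have [measurable]: "f T \<in> borel_measurable borel" for T unfolding f_def by measurable
      have E: "km (En p (f T)) b \<le> ennreal (C * (\<Sum>x\<in>I. c x powr p * node_mass b x))" if b: "cmod b < 1" for T b
        using syn1[of I b "cT T"] I L(2)[OF I] b unfolding f_def cTn by blast
      have v: "vanishing (\<lambda>b. ennreal (1 / (1 - cmod b)) * km (En p (f T)) b)" for T
        by (rule synthesis_vanishing[OF E C]) (use I in auto)
      have cp: "c x powr p = t powr p * h x powr s" for x unfolding c_def using p by (simp add: powr_mult powr_powr)
      have le: "km (En p (f T)) b \<le> ennreal (1 - cmod b)" if b: "cmod b < 1" for T b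
      proof -
        have "C * (\<Sum>x\<in>I. c x powr p * node_mass b x) = C * t powr p * (\<Sum>x\<in>I. h x powr s * (\<mu> x * kap b x powr (1 + \<alpha>/4)))"
          unfolding cp \<mu>_def by (simp add: sum_distrib_left mult.assoc)
        also have "... = C * t powr p * S b * (1 - cmod b)" unfolding S_def using b by simp
        also have "... \<le> C * t powr p * A * (1 - cmod b)" using SA[OF b] C b by (intro mult_right_mono mult_left_mono) auto
        also have "... = 1 - cmod b" unfolding tp by simp
        finally show ?thesis using E[OF b] by (meson ennreal_leI order_trans)
      qed
      have D: "km (Dn q (\<lambda>z. f T z * G z)) b \<le> ennreal (B * (1 - cmod b))" if "cmod b < 1" for T b
        using emb fh v le that \<open>\<And>T. f T \<in> borel_measurable borel\<close> unfolding embeds_def by blast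
      have tS: "t powr q * S b \<le> K1 * 250 * 11 powr (real N * q) * B" if b: "cmod b < 1" for b
      proof -
        define n where "n = card I"
        define a where "a = (\<lambda>x. c x powr q * (1 / 11 powr (real N * q)))"
        have a0: "a x \<ge> 0" for x unfolding a_def by simp
        \<comment> \<open>At a fixed z, an atom whose disc contains z has modulus at least 11^(-N)
          there, so sign averaging bounds its coefficient by the mean of |f_T(z)|^q over the signs.
          At most 125 discs contain z, and 250 = 2 * 125.\<close>
        have pt: "(\<Sum>x\<in>I. ennreal (a x) * (Dn q G z * indicator (nball x) z)) \<le> ennreal (250 / 2^n) * (\<Sum>T\<in>Pow I. Dn q (\<lambda>z. f T z * G z) z)" if z: "cmod z < 1" for z
        proof -
          define R where "R = 2 / 2^n * (\<Sum>T\<in>Pow I. cmod (f T z) powr q)"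
          have R0: "R \<ge> 0" unfolding R_def by (intro mult_nonneg_nonneg sum_nonneg) auto
          have "a x \<le> R" if x: "x \<in> I" "z \<in> nball x" for x
          proof -
            have "2 ^ card I * (cmod (complex_of_real (c x) * atom N x z) powr q) \<le> 2 * (\<Sum>T\<in>Pow I. cmod (\<Sum>y\<in>I. if y \<in> T then complex_of_real (c y) * atom N y z else - (complex_of_real (c y) * atom N y z)) powr q)"
              by (rule sign_average[OF I(1) x(1) q(1)])
            also have "(\<lambda>T. \<Sum>y\<in>I. if y \<in> T then complex_of_real (c y) * atom N y z else - (complex_of_real (c y) * atom N y z)) = (\<lambda>T. f T z)"
              unfolding f_def cT_def by (intro ext sum.cong) auto
            finally have "cmod (complex_of_real (c x) * atom N x z) powr q \<le> R" unfolding R_def n_def by (simp add: field_simps)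
            moreover have "a x \<le> cmod (complex_of_real (c x) * atom N x z) powr q"
            proof -
              have "1/11 \<le> kap x z" using nball_kap[OF I(3)[OF x(1)] x(2)] by simp
              hence "(1/11)^N \<le> kap x z ^ N" by (intro power_mono) auto
              hence "c x * (1/11)^N \<le> cmod (complex_of_real (c x) * atom N x z)"
                using c0[of x] by (simp add: norm_mult cmod_atom[OF I(3)[OF x(1)]] mult_left_mono)
              hence "(c x * (1/11)^N) powr q \<le> cmod (complex_of_real (c x) * atom N x z) powr q" using q c0[of x] by (intro powr_mono2) auto
              moreover have "(c x * (1/11)^N) powr q = a x"
                unfolding a_def by (simp add: powr_mult powr_divide power_divide powr_realpow[symmetric] powr_powr)
              ultimately show ?thesis by simp
            qed
            ultimately show ?thesis by linarith
          qed
          hence "(\<Sum>x\<in>I. ennreal (a x) * (Dn q G z * indicator (nball x) z)) \<le> (\<Sum>x\<in>I. ennreal R * Dn q G z * indicator (nball x) z)"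
            by (intro sum_mono) (auto simp: mult.assoc intro!: mult_right_mono ennreal_leI split: split_indicator)
          also have "... = ennreal R * Dn q G z * (\<Sum>x\<in>I. indicator (nball x) z)" by (simp only: sum_distrib_left)
          also have "... \<le> ennreal R * Dn q G z * 125" by (intro mult_left_mono nball_overlap I) auto
          also have "... = ennreal (250 / 2^n) * (\<Sum>T\<in>Pow I. Dn q (\<lambda>z. f T z * G z) z)"
          proof -
            define g where "g = cmod (G z) powr q * (1 - cmod z) powr q * W z"
            have g0: "g \<ge> 0" unfolding g_def using W_pos[OF z] by simp
            have "(\<Sum>T\<in>Pow I. Dn q (\<lambda>z. f T z * G z) z) = (\<Sum>T\<in>Pow I. ennreal (cmod (f T z) powr q * g))"
              unfolding Dn_def g_def by (simp add: norm_mult powr_mult mult_ac)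
            also have "... = ennreal (\<Sum>T\<in>Pow I. cmod (f T z) powr q * g)" using g0 by (intro sum_ennreal) auto
            also have "... = ennreal ((\<Sum>T\<in>Pow I. cmod (f T z) powr q) * g)" by (simp only: sum_distrib_right)
            finally have "ennreal (250 / 2^n) * (\<Sum>T\<in>Pow I. Dn q (\<lambda>z. f T z * G z) z) = ennreal (250 / 2^n * ((\<Sum>T\<in>Pow I. cmod (f T z) powr q) * g))"
              by (simp only: ennreal_mult'[of "250 / 2^n"]) (subst ennreal_mult', simp_all)
            also have "250 / 2^n * ((\<Sum>T\<in>Pow I. cmod (f T z) powr q) * g) = R * g * 125" unfolding R_def by simp
            also have "ennreal (R * g * 125) = ennreal R * ennreal g * 125" using R0 g0 by (simp add: ennreal_mult)
            finally show ?thesis unfolding Dn_def g_def by simp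
          qed
          finally show ?thesis .
        qed
        have "(\<Sum>x\<in>I. ennreal (a x) * km (\<lambda>z. Dn q G z * indicator (nball x) z) b) = km (\<lambda>z. \<Sum>x\<in>I. ennreal (a x) * (Dn q G z * indicator (nball x) z)) b"
          by (subst kmean_sum, measurable) (intro sum.cong refl kmean_cmult[symmetric], measurable)
        also have "... \<le> km (\<lambda>z. ennreal (250 / 2^n) * (\<Sum>T\<in>Pow I. Dn q (\<lambda>z. f T z * G z) z)) b"
          by (intro kmean_mono pt)
        also have "... = ennreal (250 / 2^n) * (\<Sum>T\<in>Pow I. km (Dn q (\<lambda>z. f T z * G z)) b)"
        proof -
          have m: "(\<lambda>z. \<Sum>T\<in>Pow I. Dn q (\<lambda>z. f T z * G z) z) \<in> borel_measurable borel" by measurable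
          have Dm: "Dn q (\<lambda>z. f T z * G z) \<in> borel_measurable borel" for T by measurable
          show ?thesis by (simp only: kmean_cmult[OF m] kmean_sum[OF Dm])
        qed
        also have "... \<le> ennreal (250 / 2^n) * (\<Sum>T\<in>Pow I. ennreal (B * (1 - cmod b)))"
          by (intro mult_left_mono sum_mono D b) auto
        also have "... = ennreal (250 / 2^n) * ennreal (\<Sum>T\<in>Pow I. B * (1 - cmod b))"
          using B b by (subst sum_ennreal) auto
        also have "... = ennreal (250 / 2^n * (2^n * (B * (1 - cmod b))))"
          using I(1) by (simp add: card_Pow n_def ennreal_mult'[symmetric])
        also have "250 / 2^n * (2^n * (B * (1 - cmod b))) = 250 * B * (1 - cmod b)" by simp
        finally have up: "(\<Sum>x\<in>I. ennreal (a x) * km (\<lambda>z. Dn q G z * indicator (nball x) z) b) \<le> ennreal (250 * B * (1 - cmod b))" .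
        have low: "ennreal (h x powr q * \<mu> x * kap b x powr (1 + \<alpha>/4)) \<le> ennreal K1 * km (\<lambda>z. Dn q G z * indicator (nball x) z) b" if xI: "x \<in> I" for x
        proof -
          note x = I(3)[OF xI]
          have "ennreal (kap b x powr (1 + \<alpha>/4) * cmod (G x) powr q * ((1 - cmod x) powr q * W x) * (1 - cmod x)^2)
            \<le> ennreal K1 * (\<integral>\<^sup>+z\<in>nball x. ennreal (kap b z powr (1 + \<alpha>/4)) * ennreal (cmod (G z) powr q * ((1 - cmod z) powr q * W z)) \<partial>lborel)"
            unfolding K1_def by (rule local_mean[OF G _ q(1) x b]) (use KW_pos W_pos[OF x] W_nball_power[OF q(1) x] in auto)
          also have "... \<le> ennreal K1 * km (\<lambda>z. Dn q G z * indicator (nball x) z) b"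
            unfolding kmean_def Dn_def using nball_kap(1)[OF x]
            by (intro mult_left_mono nn_integral_mono) (auto simp: mult.assoc split: split_indicator)
          also have "kap b x powr (1 + \<alpha>/4) * cmod (G x) powr q * ((1 - cmod x) powr q * W x) * (1 - cmod x)^2 = h x powr q * \<mu> x * kap b x powr (1 + \<alpha>/4)"
            unfolding W_def h_def \<mu>_def using x by (simp add: powr_mult power2_eq_square mult_ac)
          finally show ?thesis .
        qed
        have "ennreal (\<Sum>x\<in>I. a x * (h x powr q * \<mu> x * kap b x powr (1 + \<alpha>/4))) = (\<Sum>x\<in>I. ennreal (a x) * ennreal (h x powr q * \<mu> x * kap b x powr (1 + \<alpha>/4)))"
        proof -
          have "0 \<le> h x powr q * \<mu> x * kap b x powr (1 + \<alpha>/4)" if "x \<in> I" for x using \<mu>0[OF that] by simp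
          hence "(\<Sum>x\<in>I. ennreal (a x * (h x powr q * \<mu> x * kap b x powr (1 + \<alpha>/4)))) = ennreal (\<Sum>x\<in>I. a x * (h x powr q * \<mu> x * kap b x powr (1 + \<alpha>/4)))"
            by (intro sum_ennreal mult_nonneg_nonneg[OF a0])
          thus ?thesis by (simp only: ennreal_mult'[OF a0])
        qed
        also have "... \<le> (\<Sum>x\<in>I. ennreal (a x) * (ennreal K1 * km (\<lambda>z. Dn q G z * indicator (nball x) z) b))"
          by (intro sum_mono mult_left_mono low) auto
        also have "... = ennreal K1 * (\<Sum>x\<in>I. ennreal (a x) * km (\<lambda>z. Dn q G z * indicator (nball x) z) b)"
          by (simp only: sum_distrib_left mult.left_commute)
        also have "... \<le> ennreal K1 * ennreal (250 * B * (1 - cmod b))" by (intro mult_left_mono up) auto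
        also have "... = ennreal (K1 * (250 * B * (1 - cmod b)))" using K1 by (intro ennreal_mult'[symmetric]) auto
        finally have "(\<Sum>x\<in>I. a x * (h x powr q * \<mu> x * kap b x powr (1 + \<alpha>/4))) \<le> K1 * (250 * B * (1 - cmod b))"
          using K1 B b by (subst (asm) ennreal_le_iff) auto
        moreover have "(\<Sum>x\<in>I. a x * (h x powr q * \<mu> x * kap b x powr (1 + \<alpha>/4))) = t powr q / 11 powr (real N * q) * (S b * (1 - cmod b))"
        proof -
          \<comment> \<open>The exponent s/p of the coefficients is made for this: s q/p + q = s
            turns c(x)^q h(x)^q into t^q h(x)^s.\<close>
          have "a x * (h x powr q * \<mu> x * kap b x powr (1 + \<alpha>/4)) = t powr q / 11 powr (real N * q) * (h x powr s * (\<mu> x * kap b x powr (1 + \<alpha>/4)))" for x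
          proof -
            have "c x powr q = t powr q * h x powr (s * (q / p))" unfolding c_def by (simp add: powr_mult powr_powr)
            moreover have "h x powr (s * (q / p)) * h x powr q = h x powr s" unfolding powr_add[symmetric] es(1) ..
            moreover have "tt * h1 * (1 / n11) * (h2 * m * k) = tt / n11 * (h1 * h2 * (m * k))" for tt h1 n11 h2 m k :: real by simp
            ultimately show ?thesis unfolding a_def by (simp only:)
          qed
          hence "(\<Sum>x\<in>I. a x * (h x powr q * \<mu> x * kap b x powr (1 + \<alpha>/4))) = t powr q / 11 powr (real N * q) * (\<Sum>x\<in>I. h x powr s * (\<mu> x * kap b x powr (1 + \<alpha>/4)))"
            by (simp only: sum_distrib_left)
          moreover have "S b * (1 - cmod b) = (\<Sum>x\<in>I. h x powr s * (\<mu> x * kap b x powr (1 + \<alpha>/4)))" unfolding S_def using b by simp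
          ultimately show ?thesis by (simp only:)
        qed
        ultimately have "t powr q / 11 powr (real N * q) * S b * (1 - cmod b) \<le> K1 * 250 * B * (1 - cmod b)" by (simp only: mult.assoc)
        hence "t powr q / 11 powr (real N * q) * S b \<le> K1 * 250 * B" by (rule mult_right_le_imp_le) (use b in simp)
        thus ?thesis by (simp add: field_simps)
      qed
      have "A \<le> K1 * 250 * 11 powr (real N * q) * B / t powr q"
        unfolding A_def using tS t by (intro cSUP_least) (auto simp: field_simps)
      hence "t powr q * A \<le> K1 * 250 * 11 powr (real N * q) * B" using t by (simp add: field_simps)
      \<comment> \<open>The self-improvement: t^q carries A^(-q/p), which leaves A to the power 1 -
        q/p = q/s.\<close>
      moreover have "t powr q * A = A powr (q/s) / C powr (q/p)"
      proof -
        have "t powr q = 1 / (C powr (q/p) * A powr (q/p))" unfolding t_def powr_powr by (simp add: powr_minus_divide powr_mult)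
        moreover have "A powr (q/s) = A / A powr (q/p)" unfolding es(2)[symmetric] using A by (simp add: powr_diff)
        ultimately show ?thesis by simp
      qed
      ultimately have "A powr (q/s) / C powr (q/p) \<le> K1 * 250 * 11 powr (real N * q) * B" by (simp only:)
      hence "A powr (q/s) \<le> K1 * 250 * 11 powr (real N * q) * B * C powr (q/p)" using C by (subst (asm) pos_divide_le_eq) auto
      also have "... = K2 * B" unfolding K2_def by (simp only: mult_ac)
      finally have "A powr (q/s) \<le> K2 * B" .
      hence "(A powr (q/s)) powr (s/q) \<le> (K2 * B) powr (s/q)" using sp q by (intro powr_mono2) auto
      thus ?thesis using A sp q by (simp add: powr_powr powr_mult)
    qed
    hence "S b0 \<le> K2 powr (s/q) * B powr (s/q)" using SA[OF b0] by linarith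
    thus "(\<Sum>x\<in>I. (cmod (G x) * (1 - cmod x)) powr s * node_mass b0 x) \<le> K2 powr (s/q) * B powr (s / q) * (1 - cmod b0)"
      using b0 unfolding S_def h_def \<mu>_def by (simp add: pos_divide_le_eq)
  qed
qed

text \<open>The integral is cut off at 1-|z| >= 2^(-m), where only finitely many cells occur. One
  node per cell, nearly maximizing |G|(1-|z|) there, turns it into the sum of
  \<open>discrete_necessity\<close>. The bound is independent of m, and monotone convergence removes
  the cut-off.\<close>

lemma necessity_tent:
  assumes q: "0 < q" "q < p" and s: "s = p * q / (p - q)"
  obtains K where "0 < K" "\<And>G B b. hol G \<Longrightarrow> G \<in> borel_measurable borel \<Longrightarrow> 0 \<le> B \<Longrightarrow> embeds p q G B \<Longrightarrow>
    cmod b < 1 \<Longrightarrow> km (Dn s G) b \<le> ennreal (K * B powr (s / q) * (1 - cmod b))"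
proof -
  have sp: "s > 0" unfolding s using q by simp
  obtain K where K: "0 < K" "\<And>G B I b. hol G \<Longrightarrow> G \<in> borel_measurable borel \<Longrightarrow> 0 \<le> B \<Longrightarrow> embeds p q G B \<Longrightarrow>
    finite I \<Longrightarrow> inj_on cell I \<Longrightarrow> (\<And>x. x \<in> I \<Longrightarrow> cmod x < 1) \<Longrightarrow> cmod b < 1 \<Longrightarrow>
    (\<Sum>x\<in>I. (cmod (G x) * (1 - cmod x)) powr s * node_mass b x) \<le> K * B powr (s / q) * (1 - cmod b)"
    by (fact discrete_necessity[OF assms])
  define K1 where "K1 = 8 powr (1 + \<alpha>/4) * 2 powr s * (C0 * 4 powr \<beta> * 4)"
  have K1: "K1 > 0" unfolding K1_def using C0 by simp
  define K2 where "K2 = K1 * (4 * pi) * K"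
  show ?thesis
  proof (rule that[of K2])
    show "K2 > 0" unfolding K2_def using K K1 by simp
    fix G B b assume G: "hol G" and [measurable]: "G \<in> borel_measurable borel" and B: "0 \<le> B" and emb: "embeds p q G B" and b: "cmod b < 1"
    define u where "u = (\<lambda>z. ennreal (kap b z powr (1 + \<alpha>/4)) * Dn s G z * indicator unit_disk z)"
    have [measurable]: "u \<in> borel_measurable borel" unfolding u_def by measurable
    define Dm where "Dm = (\<lambda>m::nat. {z. cmod z < 1 \<and> 1 / 2^m \<le> 1 - cmod z})"
    have [measurable]: "Dm m \<in> sets borel" for m unfolding Dm_def by measurable
    have trunc: "(\<integral>\<^sup>+z. u z * indicator (Dm m) z \<partial>lborel) \<le> ennreal (K2 * B powr (s / q) * (1 - cmod b))" for m
    proof -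
      define Idx where "Idx = cell ` Dm m"
      have fin: "finite Idx"
      proof (rule finite_subset)
        show "Idx \<subseteq> {..m} \<times> {- (2^(m+1)) - 1..2^(m+1) + 1} \<times> {- (2^(m+1)) - 1..2^(m+1) + 1}"
        proof
          fix i assume "i \<in> Idx"
          then obtain z where z: "z \<in> Dm m" "i = cell z" unfolding Idx_def by auto
          have z1: "cmod z < 1" "1 / 2^m \<le> 1 - cmod z" using z unfolding Dm_def by auto
          have "(1::real) / 2^m \<le> 1 / 2^level z" using level_bounds(1)[OF z1(1)] z1 by linarith
          hence "(2::real)^level z \<le> 2^m" by (simp add: field_simps)
          hence lm: "level z \<le> m" by (simp add: power_increasing_iff)
          have P: "(2::real)^(level z + 1) \<le> 2^(m+1)" using lm by (intro power_increasing) auto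
          have B1: "\<bar>2^(level z + 1) * y\<bar> \<le> 2^(m+1)" if "\<bar>y\<bar> \<le> cmod z" for y
          proof -
            have "\<bar>2^(level z + 1) * y\<bar> = 2^(level z + 1) * \<bar>y\<bar>" by (simp add: abs_mult)
            also have "... \<le> 2^(m+1) * 1" using P that z1 by (intro mult_mono) auto
            finally show ?thesis by simp
          qed
          have fl: "\<lfloor>y\<rfloor> \<in> {- (2^(m+1)) - 1..2^(m+1) + 1}" if "\<bar>y\<bar> \<le> 2^(m+1)" for y :: real
          proof -
            have "y \<le> of_int (2^(m+1))" "of_int (- (2^(m+1))) \<le> y" using that by auto
            hence "\<lfloor>y\<rfloor> \<le> 2^(m+1)" "- (2^(m+1)) \<le> \<lfloor>y\<rfloor>" by (linarith, simp add: le_floor_iff)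
            thus ?thesis by simp
          qed
          show "i \<in> {..m} \<times> {- (2^(m+1)) - 1..2^(m+1) + 1} \<times> {- (2^(m+1)) - 1..2^(m+1) + 1}"
            unfolding z(2) cell_def using lm fl[OF B1[OF abs_Re_le_cmod]] fl[OF B1[OF abs_Im_le_cmod]] by simp
        qed
      qed auto
      define h where "h = (\<lambda>x. cmod (G x) * (1 - cmod x))"
      \<comment> \<open>A cell need not be closed, so the supremum of h over it may not be attained;
        hence the factor 2. It is finite because the cell stays in a compact disc.\<close>
      have "\<exists>x. cmod x < 1 \<and> cell x = i \<and> (\<forall>z. cmod z < 1 \<longrightarrow> cell z = i \<longrightarrow> h z \<le> 2 * h x)" if i: "i \<in> Idx" for i
      proof -
        obtain y where y: "cmod y < 1" "cell y = i" using i unfolding Idx_def Dm_def by auto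
        define Q where "Q = {z. cmod z < 1 \<and> cell z = i}"
        define n where "n = level y"
        have Qn: "z \<in> cball 0 (1 - 1 / 2^(n+1))" if "z \<in> Q" for z
        proof -
          have "level z = n" using that y unfolding Q_def n_def cell_def by auto
          thus ?thesis using level_bounds(2)[of z] that unfolding Q_def by simp
        qed
        have sub: "cball (0::complex) (1 - 1 / 2^(n+1)) \<subseteq> unit_disk"
        proof
          fix x :: complex assume "x \<in> cball 0 (1 - 1 / 2^(n+1))"
          hence "cmod x \<le> 1 - 1 / 2^(n+1)" by simp
          also have "... < 1" by simp
          finally show "x \<in> unit_disk" by simp
        qed
        have "continuous_on (cball 0 (1 - 1 / 2^(n+1))) h" unfolding h_def
          by (intro continuous_intros continuous_on_subset[OF holomorphic_on_imp_continuous_on[OF G] sub])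
        hence "bounded (h ` cball 0 (1 - 1 / 2^(n+1)))" by (intro compact_imp_bounded compact_continuous_image compact_cball)
        hence "bdd_above (h ` cball 0 (1 - 1 / 2^(n+1)))" by (rule bounded_imp_bdd_above)
        hence bdd: "bdd_above (h ` Q)" by (rule bdd_above_mono) (use Qn in blast)
        have yQ: "y \<in> Q" unfolding Q_def using y by simp
        define M where "M = (SUP z\<in>Q. h z)"
        have hM: "h z \<le> M" if "z \<in> Q" for z unfolding M_def by (rule cSUP_upper[OF that bdd])
        show ?thesis
        proof (cases "M \<le> 0")
          case True
          have "h z \<le> 2 * h y" if "z \<in> Q" for z
          proof -
            have "0 \<le> h y" unfolding h_def using y by simp
            thus ?thesis using hM[OF that] True by linarith
          qed
          thus ?thesis using y unfolding Q_def by blast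
        next
          case False
          hence "M / 2 < M" by simp
          then obtain x where x: "x \<in> Q" "M / 2 < h x" unfolding M_def using yQ bdd by (subst (asm) less_cSUP_iff) auto
          have "h z \<le> 2 * h x" if "z \<in> Q" for z using hM[OF that] x(2) by simp
          thus ?thesis using x(1) unfolding Q_def by blast
        qed
      qed
      then obtain \<zeta> where \<zeta>: "\<And>i. i \<in> Idx \<Longrightarrow> cmod (\<zeta> i) < 1 \<and> cell (\<zeta> i) = i \<and> (\<forall>z. cmod z < 1 \<longrightarrow> cell z = i \<longrightarrow> h z \<le> 2 * h (\<zeta> i))"
        by metis
      define I where "I = \<zeta> ` Idx"
      have fI: "finite I" unfolding I_def using fin by simp
      have I1: "cmod x < 1" if "x \<in> I" for x using that \<zeta> unfolding I_def by auto
      have inj: "inj_on cell I" unfolding I_def using \<zeta> by (intro inj_onI) auto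
      \<comment> \<open>A disc that contains the cell of x. Its area 4 pi (1-|x|)^2 supplies the
        factor (1-|x|)^2 that leads from W to the mass of a node.\<close>
      define B2 where "B2 = (\<lambda>x. ball x (2 * (1 - cmod x)))"
      define T where "T = (\<lambda>x. h x powr s * (W x * kap b x powr (1 + \<alpha>/4)))"
      have T0: "T x \<ge> 0" if "x \<in> I" for x unfolding T_def using W_pos[OF I1[OF that]] by simp
      have pt: "u z * indicator (Dm m) z \<le> (\<Sum>x\<in>I. ennreal (K1 * T x) * indicator (B2 x) z)" for z
      proof (cases "z \<in> Dm m")
        case True
        hence z: "cmod z < 1" unfolding Dm_def by simp
        have ci: "cell z \<in> Idx" using True unfolding Idx_def by simp
        define x where "x = \<zeta> (cell z)"
        have x: "cmod x < 1" "cell z = cell x" "h z \<le> 2 * h x" using \<zeta>[OF ci] z unfolding x_def by auto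
        have xI: "x \<in> I" unfolding I_def x_def using ci by simp
        note sc = same_cell[OF z x(1,2)]
        have sc': "1 - cmod x \<le> 2 * (1 - cmod z)" "1/4 \<le> kap z x" using same_cell[OF x(1) z x(2)[symmetric]] by auto
        have "kap b z * (1/4) \<le> kap b z * kap z x" using sc' kap_pos[OF b z] by (intro mult_left_mono) auto
        also have "... \<le> 2 * kap b x" by (intro kap_triangle x b z)
        finally have "kap b z \<le> 8 * kap b x" by simp
        hence "kap b z powr (1 + \<alpha>/4) \<le> (8 * kap b x) powr (1 + \<alpha>/4)" using kap_pos[OF b z] alpha by (intro powr_mono2) auto
        hence k: "kap b z powr (1 + \<alpha>/4) \<le> 8 powr (1 + \<alpha>/4) * kap b x powr (1 + \<alpha>/4)" by (simp add: powr_mult)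
        have h0: "0 \<le> h z" unfolding h_def using z by simp
        have "h z powr s \<le> (2 * h x) powr s" using x h0 sp by (intro powr_mono2) auto
        hence hh: "h z powr s \<le> 2 powr s * h x powr s" by (simp add: powr_mult)
        have ww: "W z \<le> C0 * 4 powr \<beta> * 4 * W x"
        proof -
          have "((1 - cmod z) / (1 - cmod x)) powr \<alpha> \<le> 2 powr \<alpha>" using sc z x alpha by (intro powr_mono2) (auto simp: pos_divide_le_eq)
          also have "... \<le> 2 powr 1" using alpha by (intro powr_mono) auto
          finally have r: "((1 - cmod z) / (1 - cmod x)) powr \<alpha> \<le> 2" by simp
          have "w (cmod z) \<le> C0 * 4 powr \<beta> * ((1 - cmod z) / (1 - cmod x)) powr \<alpha> * w (cmod x)"
            using sc x z by (intro w_compare_kap) auto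
          also have "... \<le> C0 * 4 powr \<beta> * 2 * w (cmod x)"
            using r C0 w_pos[of "cmod x"] x by (intro mult_right_mono mult_left_mono) auto
          finally have "W z \<le> C0 * 4 powr \<beta> * 2 * w (cmod x) / (1 - cmod z)" unfolding W_def using z by (intro divide_right_mono) auto
          also have "... \<le> C0 * 4 powr \<beta> * 2 * w (cmod x) / ((1 - cmod x) / 2)"
            using sc' z x C0 w_pos[of "cmod x"] by (intro divide_left_mono) auto
          finally show ?thesis unfolding W_def by (simp add: mult_ac)
        qed
        have "kap b z powr (1 + \<alpha>/4) * (h z powr s * W z) \<le> (8 powr (1 + \<alpha>/4) * kap b x powr (1 + \<alpha>/4)) * ((2 powr s * h x powr s) * (C0 * 4 powr \<beta> * 4 * W x))"
          using k hh ww W_pos[OF z] by (intro mult_mono) auto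
        also have "... = K1 * T x" unfolding K1_def T_def by (simp only: mult_ac)
        finally have le: "kap b z powr (1 + \<alpha>/4) * (h z powr s * W z) \<le> K1 * T x" .
        have "u z = ennreal (kap b z powr (1 + \<alpha>/4) * (h z powr s * W z))"
          unfolding u_def Dn_def h_def using z by (simp add: ennreal_mult' powr_mult)
        also have "... \<le> ennreal (K1 * T x) * indicator (B2 x) z"
          using le sc(2) unfolding B2_def by (simp add: dist_norm norm_minus_commute ennreal_leI)
        also have "... \<le> (\<Sum>x\<in>I. ennreal (K1 * T x) * indicator (B2 x) z)"
          by (rule member_le_sum[OF xI]) (use fI in auto)
        finally show ?thesis using True by simp
      qed simp
      have "(\<integral>\<^sup>+z. u z * indicator (Dm m) z \<partial>lborel) \<le> (\<integral>\<^sup>+z. (\<Sum>x\<in>I. ennreal (K1 * T x) * indicator (B2 x) z) \<partial>lborel)"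
        by (intro nn_integral_mono pt)
      also have "... = (\<Sum>x\<in>I. \<integral>\<^sup>+z. ennreal (K1 * T x) * indicator (B2 x) z \<partial>lborel)"
        unfolding B2_def by (rule nn_integral_sum) measurable
      also have "... = (\<Sum>x\<in>I. ennreal (K1 * T x * (4 * pi * (1 - cmod x)^2)))"
      proof (intro sum.cong refl)
        fix x assume xI: "x \<in> I"
        have "(\<integral>\<^sup>+z. ennreal (K1 * T x) * indicator (B2 x) z \<partial>lborel) = ennreal (K1 * T x) * emeasure lborel (B2 x)"
          unfolding B2_def by (subst nn_integral_cmult_indicator) auto
        also have "emeasure lborel (B2 x) = ennreal (4 * pi * (1 - cmod x)^2)"
        proof -
          define d where "d = 1 - cmod x"
          have "d \<ge> 0" unfolding d_def using I1[OF xI] by simp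
          thus ?thesis unfolding B2_def d_def[symmetric] using emeasure_ball[of "2 * d" x]
            by (simp add: eval_unit_ball_vol power_mult_distrib mult_ac)
        qed
        also have "ennreal (K1 * T x) * ... = ennreal (K1 * T x * (4 * pi * (1 - cmod x)^2))"
          using K1 T0[OF xI] by (intro ennreal_mult'[symmetric]) auto
        finally show "(\<integral>\<^sup>+z. ennreal (K1 * T x) * indicator (B2 x) z \<partial>lborel) = ..." .
      qed
      also have "... = ennreal (\<Sum>x\<in>I. K1 * T x * (4 * pi * (1 - cmod x)^2))"
        using K1 T0 by (intro sum_ennreal) (auto intro!: mult_nonneg_nonneg less_imp_le)
      also have "(\<Sum>x\<in>I. K1 * T x * (4 * pi * (1 - cmod x)^2)) = K1 * (4 * pi) * (\<Sum>x\<in>I. (cmod (G x) * (1 - cmod x)) powr s * node_mass b x)"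
        unfolding sum_distrib_left
      proof (intro sum.cong refl)
        fix x assume "x \<in> I"
        hence "W x * (1 - cmod x)^2 = w (cmod x) * (1 - cmod x)" unfolding W_def using I1[of x] by (simp add: power2_eq_square)
        moreover have "K1 * (hh * (ww * kk)) * (4 * pi * dd) = K1 * (4 * pi) * (hh * ((ww * dd) * kk))" for hh ww kk dd by (simp only: mult_ac)
        ultimately show "K1 * T x * (4 * pi * (1 - cmod x)^2) = K1 * (4 * pi) * ((cmod (G x) * (1 - cmod x)) powr s * node_mass b x)"
          unfolding T_def h_def by (simp only:)
      qed
      also have "ennreal ... \<le> ennreal (K1 * (4 * pi) * (K * B powr (s / q) * (1 - cmod b)))"
        using K1 by (intro ennreal_leI mult_left_mono K(2)[OF G _ B emb fI inj I1 b]) auto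
      finally show ?thesis unfolding K2_def by (simp add: mult.assoc)
    qed
    have "km (Dn s G) b = (\<integral>\<^sup>+z. (SUP m. u z * indicator (Dm m) z) \<partial>lborel)"
      unfolding kmean_def
    proof (intro nn_integral_cong)
      fix z
      show "ennreal (kap b z powr (1 + \<alpha>/4)) * Dn s G z * indicator unit_disk z = (SUP m. u z * indicator (Dm m) z)"
      proof (cases "cmod z < 1")
        case True
        hence "1 - cmod z > 0" by simp
        then obtain m where "(1/2::real)^m < 1 - cmod z" using real_arch_pow_inv[of "1 - cmod z" "1/2"] by auto
        hence m: "z \<in> Dm m" unfolding Dm_def using True by (simp add: power_divide)
        have "(SUP m. u z * indicator (Dm m) z) = u z"
        proof (rule antisym)
          show "(SUP m. u z * indicator (Dm m) z) \<le> u z" by (intro SUP_least) (auto split: split_indicator)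
          show "u z \<le> (SUP m. u z * indicator (Dm m) z)" by (rule SUP_upper2[of m]) (use m in auto)
        qed
        thus ?thesis unfolding u_def by simp
      qed (simp add: u_def)
    qed
    also have "... = (SUP m. \<integral>\<^sup>+z. u z * indicator (Dm m) z \<partial>lborel)"
    proof (rule nn_integral_monotone_convergence_SUP)
      have "Dm m \<subseteq> Dm n" if "m \<le> n" for m n
      proof
        fix z assume "z \<in> Dm m"
        moreover have "(1::real) / 2^n \<le> 1 / 2^m" using that by (intro divide_left_mono power_increasing) auto
        ultimately show "z \<in> Dm n" unfolding Dm_def by auto
      qed
      thus "incseq (\<lambda>m z. u z * indicator (Dm m) z)"
        by (intro monoI le_funI mult_left_mono) (auto split: split_indicator)
    qed measurable
    also have "... \<le> ennreal (K2 * B powr (s / q) * (1 - cmod b))" by (intro SUP_least trunc)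
    finally show "km (Dn s G) b \<le> ennreal (K2 * B powr (s / q) * (1 - cmod b))" .
  qed
qed

end

subsection \<open>Comparison of a weight with its averaged profile\<close>

text \<open>\<phi> is a Borel version of the weight on radii. Two facts about it are kept: the mass
  near the boundary is at most 2 pi times the tail, and the annulus in \<open>phi_inner\<close>
  carries a fixed part of the tail at r. This annulus lies strictly beyond r; \<phi> may well vanish
  near r itself.\<close>

locale tent_weight = doubling w C0 \<alpha> \<beta> for w :: "real \<Rightarrow> real" and C0 \<alpha> \<beta> :: real +
  fixes \<phi> :: "real \<Rightarrow> real" and K c :: real
  assumes phi_borel [measurable]: "\<phi> \<in> borel_measurable borel"
    and phi_nonneg: "0 \<le> \<phi> s"
    and phi_outer: "0 < t \<Longrightarrow> (\<integral>\<^sup>+z\<in>unit_disk. ennreal (\<phi> (cmod z)) * indicator {z. 1 - cmod z < t} z \<partial>lborel) \<le> ennreal (2 * pi * w (max 0 (1 - t)))"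
    and K: "1 < K" and c: "0 < c"
    and phi_inner: "0 \<le> r \<Longrightarrow> r < 1 \<Longrightarrow> ennreal (c * w r) \<le>
      (\<integral>\<^sup>+z\<in>unit_disk. ennreal (\<phi> (cmod z)) * indicator {z. 1 - (1 - r) / K \<le> cmod z \<and> cmod z < 1 - (1 - r) / K^2} z \<partial>lborel)"
begin

definition Pn :: "real \<Rightarrow> (complex \<Rightarrow> complex) \<Rightarrow> complex \<Rightarrow> ennreal"
  where "Pn q f z = ennreal (cmod (f z) powr q * \<phi> (cmod z))"

lemma Pn_measurable [measurable]:
  assumes [measurable]: "f \<in> borel_measurable borel" shows "Pn q f \<in> borel_measurable borel"
  unfolding Pn_def by measurable

text \<open>The radius 12(1-|x|) is chosen so that the ball contains all z with
  \<open>kap x z\<close> at least 1/11. Then 576 = 24 * 12 * 2, and 12^\<beta> is the growth of w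
  over this change of scale.\<close>

lemma phi_kernel_ball:
  assumes x: "cmod x < 1"
  shows "(\<integral>\<^sup>+z\<in>unit_disk. ennreal (\<phi> (cmod z)) * indicator {z. cmod (1 - cnj x * z) < 12 * (1 - cmod x)} z \<partial>lborel)
    \<le> ennreal (576 * pi * C0 * 12 powr \<beta> * (1 - cmod x) * w (cmod x))"
proof -
  define t where "t = 12 * (1 - cmod x)"
  have t: "t > 0" unfolding t_def using x by simp
  have wx: "w (cmod x) > 0" using w_pos x by simp
  have w: "w (max 0 (1 - t)) \<le> C0 * 12 powr \<beta> * w (cmod x)"
  proof -
    define r where "r = max 0 (1 - t)"
    have r: "0 \<le> r" "r \<le> cmod x" "1 - r \<le> t" unfolding r_def t_def using x by auto
    have "w r \<le> C0 * ((1 - r) / (1 - cmod x)) powr \<beta> * w (cmod x)" by (rule w_upper[OF r(1,2) x])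
    also have "... \<le> C0 * 12 powr \<beta> * w (cmod x)"
    proof (intro mult_right_mono mult_left_mono powr_mono2)
      show "(1 - r) / (1 - cmod x) \<le> 12" using r x unfolding t_def by (simp add: pos_divide_le_eq)
    qed (use r x alpha C0 wx in auto)
    finally show ?thesis unfolding r_def .
  qed
  have "(\<integral>\<^sup>+z\<in>unit_disk. (\<lambda>s. ennreal (\<phi> s)) (cmod z) * indicator {z. cmod (1 - cnj x * z) < t} z \<partial>lborel)
      \<le> ennreal (24 * t) * (\<integral>\<^sup>+z\<in>unit_disk. (\<lambda>s. ennreal (\<phi> s)) (cmod z) * indicator {z. 1 - cmod z < t} z \<partial>lborel)"
    by (rule radial_kernel_ball[OF _ x t]) measurable
  also have "... \<le> ennreal (24 * t) * ennreal (2 * pi * w (max 0 (1 - t)))"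
    by (intro mult_left_mono phi_outer t) auto
  also have "... \<le> ennreal (24 * t) * ennreal (2 * pi * (C0 * 12 powr \<beta> * w (cmod x)))"
    using w by (intro mult_left_mono ennreal_leI) auto
  also have "... = ennreal (24 * t * (2 * pi * (C0 * 12 powr \<beta> * w (cmod x))))"
    using t by (intro ennreal_mult'[symmetric]) auto
  also have "24 * t * (2 * pi * (C0 * 12 powr \<beta> * w (cmod x))) = 576 * pi * C0 * 12 powr \<beta> * (1 - cmod x) * w (cmod x)"
    unfolding t_def by simp
  finally show ?thesis unfolding t_def .
qed

text \<open>|f(z)|^q is replaced by its average over a hyperbolic disc and the integrals are
  exchanged. The mass that \<phi> gives to the points whose disc contains x is at most a constant
  times (1-|x|) w(x) = (1-|x|)^2 W(x), which matches the normalization of the averages.\<close>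

lemma weight_le_profile:
  assumes q: "0 < q"
  obtains C where "0 < C" "\<And>f a. hol f \<Longrightarrow> f \<in> borel_measurable borel \<Longrightarrow> cmod a < 1 \<Longrightarrow>
    km (Pn q f) a \<le> ennreal C * km (En q f) a"
proof -
  define M where "M = 1 + \<alpha>/4"
  have M: "M > 0" unfolding M_def using alpha by simp
  define C where "C = 22 powr M * 64 * (576 * pi * C0 * 12 powr \<beta>)"
  have C: "C > 0" unfolding C_def using C0 by simp
  show ?thesis
  proof (rule that[OF C])
    fix f a assume f: "hol f" and [measurable]: "f \<in> borel_measurable borel" and a: "cmod a < 1"
    define L where "L = (\<lambda>z x. if cmod (z - x) < 3/4 * (1 - cmod z) then ennreal (\<phi> (cmod z) * (16 / (pi * (1 - cmod z)^2)) / W x) else 0)"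
    show "km (Pn q f) a \<le> ennreal C * km (En q f) a"
    proof (rule schur_kmean)
      show "En q f \<in> borel_measurable borel" by measurable
      show "case_prod L \<in> borel_measurable (borel \<Otimes>\<^sub>M borel)" unfolding L_def by measurable
    next
      fix z :: complex assume z: "cmod z < 1"
      have c0: "0 \<le> \<phi> (cmod z) * (16 / (pi * (1 - cmod z)^2))" using phi_nonneg z by simp
      have "Pn q f z = ennreal (\<phi> (cmod z)) * ennreal (cmod (f z) powr q)" unfolding Pn_def using phi_nonneg by (simp add: ennreal_mult'[symmetric] mult.commute)
      also have "... \<le> ennreal (\<phi> (cmod z)) * avg q f z" using z by (intro mult_left_mono local_sup f q) auto
      also have "... = ennreal (\<phi> (cmod z) * (16 / (pi * (1 - cmod z)^2))) * (\<integral>\<^sup>+x\<in>ball z (3/4 * (1 - cmod z)). ennreal (cmod (f x) powr q) \<partial>lborel)"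
        unfolding avg_def using phi_nonneg by (simp only: ennreal_mult'[OF phi_nonneg] mult.assoc)
      also have "... = (\<integral>\<^sup>+x. ennreal (\<phi> (cmod z) * (16 / (pi * (1 - cmod z)^2))) * (ennreal (cmod (f x) powr q) * indicator (ball z (3/4 * (1 - cmod z))) x) \<partial>lborel)"
        by (rule nn_integral_cmult[symmetric]) measurable
      also have "... \<le> (\<integral>\<^sup>+x\<in>unit_disk. L z x * En q f x \<partial>lborel)"
      proof (intro nn_integral_mono)
        fix x
        show "ennreal (\<phi> (cmod z) * (16 / (pi * (1 - cmod z)^2))) * (ennreal (cmod (f x) powr q) * indicator (ball z (3/4 * (1 - cmod z))) x) \<le> L z x * En q f x * indicator unit_disk x"
        proof (cases "x \<in> ball z (3/4 * (1 - cmod z))")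
          case True
          hence d: "cmod (z - x) < 3/4 * (1 - cmod z)" by (simp add: dist_norm)
          have x: "cmod x < 1" using kap_local(1)[OF z less_imp_le[OF d]] .
          have "L z x * En q f x = ennreal (\<phi> (cmod z) * (16 / (pi * (1 - cmod z)^2)) / W x * (cmod (f x) powr q * W x))"
          proof -
            have "L z x = ennreal (\<phi> (cmod z) * (16 / (pi * (1 - cmod z)^2)) / W x)" unfolding L_def using d by simp
            thus ?thesis unfolding En_def using c0 W_pos[OF x] by (simp only: ennreal_mult'[OF divide_nonneg_pos])
          qed
          also have "\<phi> (cmod z) * (16 / (pi * (1 - cmod z)^2)) / W x * (cmod (f x) powr q * W x) = \<phi> (cmod z) * (16 / (pi * (1 - cmod z)^2)) * cmod (f x) powr q"
            using W_pos[OF x] by simp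
          also have "ennreal ... = ennreal (\<phi> (cmod z) * (16 / (pi * (1 - cmod z)^2))) * ennreal (cmod (f x) powr q)"
            by (rule ennreal_mult'[OF c0])
          finally show ?thesis using True x by simp
        qed simp
      qed
      finally show "Pn q f z \<le> (\<integral>\<^sup>+x\<in>unit_disk. L z x * En q f x \<partial>lborel)" .
    next
      fix x :: complex assume x: "cmod x < 1"
      define A where "A = 22 powr M * kap a x powr M * (64 / (1 - cmod x)^2) / W x"
      have A: "A \<ge> 0" unfolding A_def using W_pos[OF x] by simp
      have "(\<integral>\<^sup>+z\<in>unit_disk. ennreal (kap a z powr M) * L z x \<partial>lborel)
        \<le> (\<integral>\<^sup>+z. ennreal A * (ennreal (\<phi> (cmod z)) * indicator {z. cmod (1 - cnj x * z) < 12 * (1 - cmod x)} z * indicator unit_disk z) \<partial>lborel)"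
      proof (intro nn_integral_mono)
        fix z
        show "ennreal (kap a z powr M) * L z x * indicator unit_disk z \<le> ennreal A * (ennreal (\<phi> (cmod z)) * indicator {z. cmod (1 - cnj x * z) < 12 * (1 - cmod x)} z * indicator unit_disk z)"
        proof (cases "cmod z < 1 \<and> cmod (z - x) < 3/4 * (1 - cmod z)")
          case True
          hence z: "cmod z < 1" and d: "cmod (z - x) < 3/4 * (1 - cmod z)" by auto
          note l = kap_local[OF z less_imp_le[OF d]]
          have "kap a z * (1/11) \<le> kap a z * kap z x" using l kap_pos[OF a z] by (intro mult_left_mono) auto
          also have "... \<le> 2 * kap a x" by (intro kap_triangle x a z)
          finally have "kap a z \<le> 22 * kap a x" by simp
          hence "kap a z powr M \<le> (22 * kap a x) powr M" using M kap_pos[OF a z] by (intro powr_mono2) auto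
          hence k: "kap a z powr M \<le> 22 powr M * kap a x powr M" by (simp add: powr_mult)
          have "1 / 11 \<le> (1 - cmod x) / cmod (1 - cnj x * z)" using l(3) unfolding kap_def .
          hence ball: "cmod (1 - cnj x * z) < 12 * (1 - cmod x)" using cmod_kernel_pos[OF x z] x by (simp add: field_simps)
          have "((1 - cmod x) / 2)^2 \<le> (1 - cmod z)^2" using l x by (intro power_mono) auto
          hence "(1 - cmod x)^2 / 4 \<le> (1 - cmod z)^2" by (simp add: power_divide)
          also have "(1 - cmod z)^2 \<le> pi * (1 - cmod z)^2" using mult_right_mono[of 1 pi "(1 - cmod z)^2"] pi_gt3 by simp
          finally have "16 / (pi * (1 - cmod z)^2) \<le> 16 / ((1 - cmod x)^2 / 4)" using x z by (intro divide_left_mono mult_pos_pos) auto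
          hence e: "16 / (pi * (1 - cmod z)^2) \<le> 64 / (1 - cmod x)^2" by simp
          have "kap a z powr M * (16 / (pi * (1 - cmod z)^2)) * (\<phi> (cmod z) / W x) \<le> (22 powr M * kap a x powr M) * (64 / (1 - cmod x)^2) * (\<phi> (cmod z) / W x)"
            using k e phi_nonneg W_pos[OF x] by (intro mult_right_mono mult_mono) auto
          hence le: "kap a z powr M * (\<phi> (cmod z) * (16 / (pi * (1 - cmod z)^2)) / W x) \<le> A * \<phi> (cmod z)"
            unfolding A_def by (simp add: mult_ac)
          have "ennreal (kap a z powr M) * L z x * indicator unit_disk z = ennreal (kap a z powr M * (\<phi> (cmod z) * (16 / (pi * (1 - cmod z)^2)) / W x))"
          proof -
            have "L z x = ennreal (\<phi> (cmod z) * (16 / (pi * (1 - cmod z)^2)) / W x)" unfolding L_def using d by simp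
            thus ?thesis using z by (subst ennreal_mult') auto
          qed
          also have "... \<le> ennreal (A * \<phi> (cmod z))" by (rule ennreal_leI[OF le])
          also have "... = ennreal A * (ennreal (\<phi> (cmod z)) * indicator {z. cmod (1 - cnj x * z) < 12 * (1 - cmod x)} z * indicator unit_disk z)"
            using ball z A by (simp add: ennreal_mult')
          finally show ?thesis .
        next
          case False thus ?thesis unfolding L_def by (auto split: split_indicator)
        qed
      qed
      also have "... = ennreal A * (\<integral>\<^sup>+z\<in>unit_disk. ennreal (\<phi> (cmod z)) * indicator {z. cmod (1 - cnj x * z) < 12 * (1 - cmod x)} z \<partial>lborel)"
        by (rule nn_integral_cmult) measurable
      also have "... \<le> ennreal A * ennreal (576 * pi * C0 * 12 powr \<beta> * (1 - cmod x) * w (cmod x))"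
        by (intro mult_left_mono phi_kernel_ball x) auto
      also have "... = ennreal (A * (576 * pi * C0 * 12 powr \<beta> * (1 - cmod x) * w (cmod x)))" using A by (rule ennreal_mult'[symmetric])
      also have "A * (576 * pi * C0 * 12 powr \<beta> * (1 - cmod x) * w (cmod x)) = C * kap a x powr M"
        unfolding A_def C_def W_def using x w_pos[of "cmod x"] by (simp add: power2_eq_square)
      also have "ennreal ... = ennreal C * ennreal (kap a x powr M)" using C by (intro ennreal_mult') auto
      finally show "(\<integral>\<^sup>+z\<in>unit_disk. ennreal (kap a z powr (1 + \<alpha>/4)) * L z x \<partial>lborel) \<le> ennreal C * ennreal (kap a x powr (1 + \<alpha>/4))"
        unfolding M_def .
    qed
  qed
qed

text \<open>As \<phi> may vanish near |z|, the value |f(z)|^q is bounded by means over circles in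
  the annulus of \<open>phi_inner\<close>, which surround z. Such circles are not local; the square
  kernel atom at z, inserted as the factor k of \<open>submean_circle_nn\<close>, supplies the decay
  that makes the result a Schur kernel.\<close>

lemma profile_le_weight:
  assumes q: "0 < q"
  obtains C where "0 < C" "\<And>f a. hol f \<Longrightarrow> f \<in> borel_measurable borel \<Longrightarrow> cmod a < 1 \<Longrightarrow>
    km (En q f) a \<le> ennreal C * km (Pn q f) a"
proof -
  obtain C where C: "0 < C" "\<And>K u v a. v \<in> borel_measurable borel \<Longrightarrow> 0 \<le> K \<Longrightarrow>
     (\<And>z. cmod z < 1 \<Longrightarrow> u z \<le> (\<integral>\<^sup>+x\<in>unit_disk. ennreal (K * (kap x z ^ 2 * (1 - cmod z) powr (\<alpha>/2 - 1) * (1 - cmod x) powr (- 1 - \<alpha>/2))) * v x \<partial>lborel)) \<Longrightarrow>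
     cmod a < 1 \<Longrightarrow> km u a \<le> ennreal (C * K) * km v a" using schur_instance by blast
  define c1 where "c1 = 1 - 1 / K"
  have c1: "c1 > 0" unfolding c1_def using K by simp
  define K' where "K' = 4 / (c * c1) * K^2"
  have K': "K' > 0" unfolding K'_def using c c1 K by simp
  show ?thesis
  proof (rule that[of "C * K'"])
    show "0 < C * K'" using C K' by simp
    fix f a assume f: "hol f" and [measurable]: "f \<in> borel_measurable borel" and a: "cmod a < 1"
    show "km (En q f) a \<le> ennreal (C * K') * km (Pn q f) a"
    proof (rule C(2)[OF _ _ _ a])
      fix z :: complex assume z: "cmod z < 1"
      define r where "r = cmod z"
      have r: "0 \<le> r" "r < 1" unfolding r_def using z by auto
      define I where "I = {x::complex. 1 - (1 - r) / K \<le> cmod x \<and> cmod x < 1 - (1 - r) / K^2}"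
      have [measurable]: "I \<in> sets borel" unfolding I_def by measurable
      have Irot: "cis s * x \<in> I \<longleftrightarrow> x \<in> I" for s x unfolding I_def by (simp add: norm_mult)
      \<comment> \<open>The annulus keeps distance e from the circle through z, so the Cauchy kernel
        is at most 1/e there.\<close>
      define e where "e = c1 * (1 - r)"
      have e: "e > 0" unfolding e_def using c1 r by simp
      have xI: "cmod x < 1" "r < cmod x" "e \<le> cmod x - r" "(1 - r) / K^2 < 1 - cmod x" if "x \<in> I" for x
      proof -
        have a1: "1 - (1 - r) / K \<le> cmod x" "cmod x < 1 - (1 - r) / K^2" using that unfolding I_def by auto
        show "(1 - r) / K^2 < 1 - cmod x" using a1 by simp
        moreover have "0 < (1 - r) / K^2" using r K by simp
        ultimately show "cmod x < 1" by simp
        have "e = 1 - (1 - r) / K - r" unfolding e_def c1_def by (simp add: algebra_simps)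
        thus "e \<le> cmod x - r" using a1 by simp
        thus "r < cmod x" using e by simp
      qed
      define h where "h = (\<lambda>x. ennreal (cmod (f x) powr q * kap z x ^ 2) * (ennreal (\<phi> (cmod x)) * indicator I x * indicator unit_disk x))"
      have [measurable]: "h \<in> borel_measurable borel" unfolding h_def by measurable
      define w0 where "w0 = (\<lambda>x::complex. ennreal (\<phi> (cmod x)) * indicator I x * indicator unit_disk x)"
      have [measurable]: "w0 \<in> borel_measurable borel" unfolding w0_def by measurable
      \<comment> \<open>The quarter is a lower bound for the atom at its pole,
        \<open>kap z z\<close> being at least 1/2. The radial mass \<open>w0\<close> is unaffected
        by rotation and moves inside the circular mean.\<close>
      have circ: "ennreal (cmod (f z) powr q / 4) * w0 x \<le> ennreal (1 / e) * (\<integral>\<^sup>+t\<in>{0..1}. h (cis (2*pi*t) * x) \<partial>lborel)" for x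
      proof (cases "x \<in> I")
        case True
        note x = xI[OF True]
        have "ennreal (cmod (f z) powr q / 4) \<le> ennreal (cmod (f z) powr q * cmod (atom 2 z z))"
        proof (rule ennreal_leI)
          have "(1/2)^2 \<le> kap z z ^ 2" using kap_self[OF z] by (intro power_mono) auto
          hence "cmod (f z) powr q * (1/4) \<le> cmod (f z) powr q * kap z z ^ 2" by (intro mult_left_mono) (auto simp: power2_eq_square)
          thus "cmod (f z) powr q / 4 \<le> cmod (f z) powr q * cmod (atom 2 z z)" by (simp add: cmod_atom[OF z])
        qed
        also have "... \<le> (\<integral>\<^sup>+t\<in>{0..1}. ennreal (cmod (f (cis (2*pi*t) * x)) powr q * cmod (atom 2 z (cis (2*pi*t) * x)) * cmod x / cmod (cis (2*pi*t) * x - z)) \<partial>lborel)"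
          by (rule submean_circle_nn[OF f atom_holomorphic[OF z] _ x(1) q]) (use x in \<open>simp add: r_def\<close>)
        also have "... \<le> (\<integral>\<^sup>+t. ennreal (1 / e) * (ennreal (cmod (f (cis (2*pi*t) * x)) powr q * kap z (cis (2*pi*t) * x) ^ 2) * indicator {0..1} t) \<partial>lborel)"
        proof (intro nn_integral_mono)
          fix t :: real
          define y where "y = cis (2*pi*t) * x"
          have y: "cmod y = cmod x" unfolding y_def by (simp add: norm_mult)
          have "e \<le> cmod (y - z)" using x(3) norm_triangle_ineq2[of y z] unfolding y r_def by linarith
          hence "cmod x / cmod (y - z) \<le> 1 / e" using x(1) e by (intro frac_le) auto
          hence "cmod (f y) powr q * kap z y ^ 2 * (cmod x / cmod (y - z)) \<le> cmod (f y) powr q * kap z y ^ 2 * (1 / e)"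
            by (intro mult_left_mono) auto
          hence "ennreal (cmod (f y) powr q * cmod (atom 2 z y) * cmod x / cmod (y - z)) \<le> ennreal (1 / e) * ennreal (cmod (f y) powr q * kap z y ^ 2)"
            using e by (subst ennreal_mult'[symmetric]) (auto simp: cmod_atom[OF z] mult_ac intro!: ennreal_leI)
          thus "ennreal (cmod (f (cis (2*pi*t) * x)) powr q * cmod (atom 2 z (cis (2*pi*t) * x)) * cmod x / cmod (cis (2*pi*t) * x - z)) * indicator {0..1} t
            \<le> ennreal (1 / e) * (ennreal (cmod (f (cis (2*pi*t) * x)) powr q * kap z (cis (2*pi*t) * x) ^ 2) * indicator {0..1} t)"
            unfolding y_def[symmetric] by (auto split: split_indicator)
        qed
        finally have "ennreal (cmod (f z) powr q / 4) * w0 x \<le> (\<integral>\<^sup>+t. ennreal (1 / e) * (ennreal (cmod (f (cis (2*pi*t) * x)) powr q * kap z (cis (2*pi*t) * x) ^ 2) * indicator {0..1} t) \<partial>lborel) * w0 x"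
          by (rule mult_right_mono) simp
        also have "... = (\<integral>\<^sup>+t. ennreal (1 / e) * (ennreal (cmod (f (cis (2*pi*t) * x)) powr q * kap z (cis (2*pi*t) * x) ^ 2) * indicator {0..1} t) * w0 x \<partial>lborel)"
          by (rule nn_integral_multc[symmetric]) measurable
        also have "... = (\<integral>\<^sup>+t. ennreal (1 / e) * (h (cis (2*pi*t) * x) * indicator {0..1} t) \<partial>lborel)"
          unfolding h_def w0_def using Irot by (intro nn_integral_cong) (simp add: indicator_def norm_mult mult_ac)
        also have "... = ennreal (1 / e) * (\<integral>\<^sup>+t\<in>{0..1}. h (cis (2*pi*t) * x) \<partial>lborel)"
          by (rule nn_integral_cmult) measurable
        finally show ?thesis .
      qed (simp add: w0_def)
      have "ennreal (cmod (f z) powr q / 4) * ennreal (c * w r) \<le> ennreal (cmod (f z) powr q / 4) * (\<integral>\<^sup>+x. w0 x \<partial>lborel)"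
        using phi_inner[OF r] unfolding w0_def I_def by (intro mult_left_mono) auto
      also have "... = (\<integral>\<^sup>+x. ennreal (cmod (f z) powr q / 4) * w0 x \<partial>lborel)"
        by (rule nn_integral_cmult[symmetric]) measurable
      also have "... \<le> (\<integral>\<^sup>+x. ennreal (1 / e) * (\<integral>\<^sup>+t\<in>{0..1}. h (cis (2*pi*t) * x) \<partial>lborel) \<partial>lborel)"
        by (intro nn_integral_mono circ)
      also have "... = ennreal (1 / e) * (\<integral>\<^sup>+x. (\<integral>\<^sup>+t\<in>{0..1}. h (cis (2*pi*t) * x) \<partial>lborel) \<partial>lborel)"
        by (rule nn_integral_cmult) measurable
      also have "(\<integral>\<^sup>+x. (\<integral>\<^sup>+t\<in>{0..1}. h (cis (2*pi*t) * x) \<partial>lborel) \<partial>lborel) = emeasure lborel {0..1::real} * (\<integral>\<^sup>+x. h x \<partial>lborel)"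
        by (rule nn_integral_rotation_average) measurable
      finally have main: "ennreal (cmod (f z) powr q / 4) * ennreal (c * w r) \<le> ennreal (1 / e) * (\<integral>\<^sup>+x. h x \<partial>lborel)" by simp
      have wr: "w r > 0" using w_pos r by simp
      have "En q f z = ennreal (4 / (c * (1 - r))) * (ennreal (cmod (f z) powr q / 4) * ennreal (c * w r))"
        unfolding En_def W_def r_def[symmetric] proof -
        have "cmod (f z) powr q * (w r / (1 - r)) = 4 / (c * (1 - r)) * (cmod (f z) powr q / 4 * (c * w r))"
        proof -
          have "F * (v / d) = 4 / (c * d) * (F / 4 * (c * v))" if "d > 0" for F v d using that c by simp
          from this[of "1 - r"] r show ?thesis by simp
        qed
        thus "ennreal (cmod (f z) powr q * (w r / (1 - r))) = ennreal (4 / (c * (1 - r))) * (ennreal (cmod (f z) powr q / 4) * ennreal (c * w r))"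
          using c r wr by (simp only: ennreal_mult'[symmetric] divide_nonneg_pos mult_nonneg_nonneg) (subst ennreal_mult'[symmetric], simp, subst ennreal_mult'[symmetric], simp_all)
      qed
      also have "... \<le> ennreal (4 / (c * (1 - r))) * (ennreal (1 / e) * (\<integral>\<^sup>+x. h x \<partial>lborel))"
        by (rule mult_left_mono[OF main]) simp
      also have "... = ennreal (4 / (c * (1 - r)) * (1 / e)) * (\<integral>\<^sup>+x. h x \<partial>lborel)"
        using c r e by (subst mult.assoc[symmetric], subst ennreal_mult[symmetric]) auto
      also have "... = (\<integral>\<^sup>+x. ennreal (4 / (c * (1 - r)) * (1 / e)) * h x \<partial>lborel)"
        by (rule nn_integral_cmult[symmetric]) measurable
      also have "... \<le> (\<integral>\<^sup>+x\<in>unit_disk. ennreal (K' * (kap x z ^ 2 * (1 - cmod z) powr (\<alpha>/2 - 1) * (1 - cmod x) powr (- 1 - \<alpha>/2))) * Pn q f x \<partial>lborel)"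
      proof (intro nn_integral_mono)
        fix x
        show "ennreal (4 / (c * (1 - r)) * (1 / e)) * h x \<le> ennreal (K' * (kap x z ^ 2 * (1 - cmod z) powr (\<alpha>/2 - 1) * (1 - cmod x) powr (- 1 - \<alpha>/2))) * Pn q f x * indicator unit_disk x"
        proof (cases "x \<in> I")
          case True
          note x = xI[OF True]
          define y where "y = 1 - cmod x"
          have y: "y > 0" "(1 - r) / K^2 \<le> y" unfolding y_def using x by auto
          have s: "kap x z = y / (1 - r) * kap z x" unfolding y_def r_def by (rule kap_swap[OF z x(1)])
          \<comment> \<open>Points of the annulus have y at least (1-r)/K^2, so this power of y may
            be exchanged for the same power of 1-r at the cost of K^2.\<close>
          have "y powr (\<alpha>/2 - 1) \<le> ((1 - r) / K^2) powr (\<alpha>/2 - 1)" using y r K alpha by (intro powr_mono2') auto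
          also have "... = (1 - r) powr (\<alpha>/2 - 1) * (K^2) powr (1 - \<alpha>/2)"
            using r K by (simp add: powr_divide powr_diff)
          also have "(K^2) powr (1 - \<alpha>/2) \<le> (K^2) powr 1" using K alpha by (intro powr_mono) auto
          finally have y2: "y powr (\<alpha>/2 - 1) \<le> (1 - r) powr (\<alpha>/2 - 1) * K^2" by (simp add: mult_left_mono)
          have "4 / (c * (1 - r)) * (1 / e) * kap z x ^ 2 = 4 / (c * c1) * (kap x z ^ 2 / y^2)"
            unfolding s e_def using y r by (simp add: power_mult_distrib power_divide power2_eq_square)
          also have "kap x z ^ 2 / y^2 = kap x z ^ 2 * (y powr (\<alpha>/2 - 1) * y powr (- 1 - \<alpha>/2))"
            using y by (simp add: powr_add[symmetric] powr_minus_divide)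
          also have "4 / (c * c1) * (kap x z ^ 2 * (y powr (\<alpha>/2 - 1) * y powr (- 1 - \<alpha>/2))) \<le> 4 / (c * c1) * (kap x z ^ 2 * (((1 - r) powr (\<alpha>/2 - 1) * K^2) * y powr (- 1 - \<alpha>/2)))"
            using c c1 by (intro mult_left_mono mult_right_mono y2) auto
          also have "... = K' * (kap x z ^ 2 * (1 - r) powr (\<alpha>/2 - 1) * y powr (- 1 - \<alpha>/2))" unfolding K'_def by simp
          finally have le: "4 / (c * (1 - r)) * (1 / e) * kap z x ^ 2 \<le> K' * (kap x z ^ 2 * (1 - r) powr (\<alpha>/2 - 1) * y powr (- 1 - \<alpha>/2))" .
          have P0: "0 \<le> cmod (f x) powr q * \<phi> (cmod x)" using phi_nonneg by simp
          have "ennreal (4 / (c * (1 - r)) * (1 / e)) * h x = ennreal (4 / (c * (1 - r)) * (1 / e) * kap z x ^ 2 * (cmod (f x) powr q * \<phi> (cmod x)))"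
            unfolding h_def using True x c r e phi_nonneg by (simp add: ennreal_mult[symmetric] mult_ac)
          also have "... \<le> ennreal (K' * (kap x z ^ 2 * (1 - r) powr (\<alpha>/2 - 1) * y powr (- 1 - \<alpha>/2)) * (cmod (f x) powr q * \<phi> (cmod x)))"
            by (intro ennreal_leI mult_right_mono le P0)
          also have "... = ennreal (K' * (kap x z ^ 2 * (1 - r) powr (\<alpha>/2 - 1) * y powr (- 1 - \<alpha>/2))) * Pn q f x"
            unfolding Pn_def using K' by (intro ennreal_mult') auto
          finally show ?thesis using x unfolding y_def r_def by simp
        qed (simp add: h_def)
      qed
      finally show "En q f z \<le> ..." .
    qed (use K' in auto)
  qed
qed

end

text \<open>Besides the power forms of doubling, three things have to be secured: finiteness of the
  tail at 0, positivity of the tail everywhere, and mass in the annulus of \<open>phi_inner\<close>.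
  The first two come from upper doubling, the third from lower doubling together with the upper
  growth bound.\<close>

lemma D_class_profile:
  assumes "\<omega> \<in> D_class"
  obtains \<phi> w C0 \<alpha> \<beta> K c where "tent_weight w C0 \<alpha> \<beta> \<phi> K c"
    "AE z in lborel. z \<in> unit_disk \<longrightarrow> \<omega> z = \<phi> (cmod z)"
    "\<And>z. cmod z < 1 \<Longrightarrow> w (cmod z) = enn2real (omega_hat \<omega> z)"
proof -
  have rw: "radial_weight \<omega>" using assms unfolding D_class_def D_hat_def by auto
  obtain C1 where C1: "C1 \<ge> 1" "\<And>r. r \<in> {0..<1} \<Longrightarrow> omega_hat \<omega> (of_real r) \<le> ennreal C1 * omega_hat \<omega> (of_real ((1 + r) / 2))"
    using assms unfolding D_class_def D_hat_def by auto
  obtain K C2 where K: "K > 1" and C2: "C2 > 1" "\<And>r. r \<in> {0..<1} \<Longrightarrow> omega_hat \<omega> (of_real r) \<ge> ennreal C2 * omega_hat \<omega> (of_real (1 - (1 - r) / K))"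
    using assms unfolding D_class_def D_check_def by auto
  obtain \<phi> where [measurable]: "\<phi> \<in> borel_measurable borel" and \<phi>: "\<And>s. 0 \<le> \<phi> s"
    "AE z in lborel. z \<in> unit_disk \<longrightarrow> \<omega> z = \<phi> (cmod z)"
    "AE s in lborel. s \<in> {0<..<1} \<longrightarrow> \<omega> (of_real s) = \<phi> s"
    by (fact radial_weight_profile[OF rw])
  define \<Phi> where "\<Phi> = (\<lambda>r. \<integral>\<^sup>+s\<in>{r..<1}. ennreal (\<phi> s) \<partial>lborel)"
  have oh: "omega_hat \<omega> z = \<Phi> (cmod z)" for z
  proof -
    have "omega_hat \<omega> z = (\<integral>\<^sup>+ s \<in> {cmod z..<1}. ennreal (\<omega> (of_real s)) \<partial>lborel)"
      unfolding omega_hat_def by (rule nn_integral_completion)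
    also have "... = \<Phi> (cmod z)" unfolding \<Phi>_def
    proof (rule nn_integral_cong_AE, use \<phi>(3) AE_lborel_singleton[of "0::real"] in eventually_elim)
      case (elim s)
      show ?case
      proof (cases "s \<in> {cmod z..<1}")
        case True
        have "0 \<le> s" using True order_trans[OF norm_ge_zero[of z], of s] by simp
        thus ?thesis using elim True by simp
      qed simp
    qed
    finally show ?thesis .
  qed
  have anti: "\<Phi> t \<le> \<Phi> r" if "r \<le> t" for r t unfolding \<Phi>_def using that by (intro nn_integral_mono) (auto split: split_indicator)
  have up: "\<Phi> r \<le> ennreal C1 * \<Phi> ((1 + r) / 2)" if r: "0 \<le> r" "r < 1" for r
    using C1(2)[of r] r unfolding oh norm_of_real by (simp add: abs_of_nonneg)
  have low: "ennreal C2 * \<Phi> (1 - (1 - r) / K) \<le> \<Phi> r" if r: "0 \<le> r" "r < 1" for r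
  proof -
    have "(1 - r) / K \<le> 1" using r K by (simp add: pos_divide_le_eq)
    thus ?thesis using C2(2)[of r] r unfolding oh norm_of_real by (simp add: abs_of_nonneg)
  qed
  have mass: "(\<integral>\<^sup>+z\<in>unit_disk. ennreal (\<phi> (cmod z)) \<partial>lborel) = (\<integral>\<^sup>+s\<in>{0<..<1}. ennreal (\<phi> s) * ennreal (2 * pi * s) \<partial>lborel)"
    by (rule nn_integral_radial) measurable
  \<comment> \<open>Integrability over the disk controls s \<phi>(s) only, hence the tail from 1/2;
    upper doubling at r = 0 bounds the tail from 0 by it.\<close>
  have fin: "\<Phi> 0 < \<infinity>"
  proof -
    have "integrable (lebesgue_on unit_disk) \<omega>" using rw unfolding radial_weight_def weight_def by auto
    hence "(\<integral>\<^sup>+z. ennreal (norm (\<omega> z)) \<partial>lebesgue_on unit_disk) < \<infinity>" unfolding integrable_iff_bounded by auto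
    hence "(\<integral>\<^sup>+z\<in>unit_disk. ennreal (norm (\<omega> z)) \<partial>lebesgue) < \<infinity>" by (subst (asm) nn_integral_restrict_space) auto
    hence "(\<integral>\<^sup>+z\<in>unit_disk. ennreal (norm (\<omega> z)) \<partial>lborel) < \<infinity>" by (simp only: nn_integral_completion)
    also have "(\<integral>\<^sup>+z\<in>unit_disk. ennreal (norm (\<omega> z)) \<partial>lborel) = (\<integral>\<^sup>+z\<in>unit_disk. ennreal (\<phi> (cmod z)) \<partial>lborel)"
      by (rule nn_integral_cong_AE, use \<phi>(2) in eventually_elim) (auto simp: \<phi>(1) split: split_indicator)
    finally have m: "(\<integral>\<^sup>+s\<in>{0<..<1}. ennreal (\<phi> s) * ennreal (2 * pi * s) \<partial>lborel) < \<infinity>" unfolding mass .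
    have "\<Phi> (1/2) \<le> (\<integral>\<^sup>+s\<in>{0<..<1}. ennreal (\<phi> s) * ennreal (2 * pi * s) \<partial>lborel)" unfolding \<Phi>_def
    proof (intro nn_integral_mono)
      fix s :: real
      show "ennreal (\<phi> s) * indicator {1/2..<1} s \<le> ennreal (\<phi> s) * ennreal (2 * pi * s) * indicator {0<..<1} s"
      proof (cases "s \<in> {1/2..<1}")
        case True
        have "1 * 1 \<le> pi * (2 * s)" using True pi_gt3 by (intro mult_mono) auto
        hence "ennreal 1 \<le> ennreal (2 * pi * s)" by (intro ennreal_leI) (simp add: mult_ac)
        hence "ennreal (\<phi> s) * 1 \<le> ennreal (\<phi> s) * ennreal (2 * pi * s)" by (intro mult_left_mono) auto
        thus ?thesis using True by simp
      qed simp
    qed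
    hence "\<Phi> (1/2) < \<infinity>" using m by (rule le_less_trans)
    hence "ennreal C1 * \<Phi> (1/2) < \<infinity>" by (simp add: ennreal_mult_less_top)
    thus ?thesis using up[of 0] by (auto intro: le_less_trans)
  qed
  have finr: "\<Phi> r < \<infinity>" if "0 \<le> r" for r using anti[OF that] fin by (rule le_less_trans)
  define w where "w = (\<lambda>r. enn2real (\<Phi> (max 0 r)))"
  have wr: "ennreal (w r) = \<Phi> r" if "0 \<le> r" for r unfolding w_def using finr[OF that] that by (simp add: max_def)
  have w0: "w r \<ge> 0" for r unfolding w_def by simp
  have wanti: "w t \<le> w r" if "r \<le> t" for r t
    unfolding w_def using that finr by (intro enn2real_mono anti) auto
  have wup: "w r \<le> (C1 + 1) * w ((1 + r) / 2)" if r: "0 \<le> r" "r < 1" for r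
  proof -
    have "ennreal (w r) \<le> ennreal (C1 * w ((1 + r) / 2))"
      using up[OF r] wr[OF r(1)] wr[of "(1 + r) / 2"] r C1 by (simp add: ennreal_mult')
    hence "w r \<le> C1 * w ((1 + r) / 2)" using C1 w0 by (subst (asm) ennreal_le_iff) auto
    also have "... \<le> (C1 + 1) * w ((1 + r) / 2)" using w0 by (intro mult_right_mono) auto
    finally show ?thesis .
  qed
  have rK: "0 \<le> 1 - (1 - r) / K \<and> r \<le> 1 - (1 - r) / K \<and> 1 - (1 - r) / K < 1" if r: "0 \<le> r" "r < 1" for r
  proof -
    have "(1 - r) / K \<le> (1 - r) / 1" using r K by (intro divide_left_mono) auto
    moreover have "0 < (1 - r) / K" using r K by simp
    ultimately show ?thesis using r by simp
  qed
  have wlow: "C2 * w (1 - (1 - r) / K) \<le> w r" if r: "0 \<le> r" "r < 1" for r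
  proof -
    have "ennreal (C2 * w (1 - (1 - r) / K)) \<le> ennreal (w r)"
      using low[OF r] wr[OF r(1)] wr[of "1 - (1 - r) / K"] rK[OF r] C2 by (simp add: ennreal_mult')
    thus ?thesis using w0 by (subst (asm) ennreal_le_iff) auto
  qed
  \<comment> \<open>If the tail vanished at some radius, upper doubling would carry the zero inward
    along 1 - 2^(-n) to radius 0, and the weight would vanish almost everywhere.\<close>
  have wpos: "0 < w r" if r: "0 \<le> r" "r < 1" for r
  proof (rule ccontr)
    assume "\<not> 0 < w r"
    hence z: "w r = 0" using w0[of r] by simp
    have "w (1 - 1 / 2^n) = 0 \<Longrightarrow> w 0 = 0" for n
    proof (induction n)
      case (Suc n)
      have "1 / 2^n \<le> (1::real)" by (simp add: divide_le_eq)
      hence s: "0 \<le> 1 - 1 / (2::real)^n" "1 - 1 / 2^n < (1::real)" by auto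
      have "(1 + (1 - 1 / 2^n)) / 2 = 1 - 1 / (2::real)^Suc n" by (simp add: field_simps)
      hence "w (1 - 1 / 2^n) \<le> (C1 + 1) * 0" using wup[OF s] Suc.prems by (simp only:)
      hence "w (1 - 1 / 2^n) = 0" using w0[of "1 - 1 / 2^n"] by simp
      thus ?case by (rule Suc.IH)
    qed simp
    moreover obtain n where "(1/2::real)^n < 1 - r" using real_arch_pow_inv[of "1 - r" "1/2"] r by auto
    hence "w (1 - 1 / 2^n) \<le> w r" by (intro wanti) (simp add: power_divide)
    hence "w (1 - 1 / 2^n) = 0" using z w0[of "1 - 1 / 2^n"] by simp
    ultimately have "w 0 = 0" by blast
    hence "\<Phi> 0 = 0" using wr[of 0] by simp
    hence "AE s in lborel. ennreal (\<phi> s) * indicator {0..<1} s = 0" unfolding \<Phi>_def by (subst (asm) nn_integral_0_iff_AE) auto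
    hence "(\<integral>\<^sup>+s\<in>{0<..<1}. ennreal (\<phi> s) * ennreal (2 * pi * s) \<partial>lborel) = 0"
      by (subst nn_integral_0_iff_AE) (auto elim!: eventually_mono split: split_indicator)
    hence "(\<integral>\<^sup>+z\<in>unit_disk. ennreal (\<phi> (cmod z)) \<partial>lborel) = 0" unfolding mass .
    hence "AE z in lborel. ennreal (\<phi> (cmod z)) * indicator unit_disk z = 0" by (subst (asm) nn_integral_0_iff_AE) auto
    hence "AE z in lborel. z \<in> unit_disk \<longrightarrow> \<omega> z = 0"
      using \<phi>(2)
    proof eventually_elim
      case (elim z)
      show ?case
      proof
        assume d: "z \<in> unit_disk"
        hence "ennreal (\<phi> (cmod z)) = 0" using elim(1) by simp
        hence "\<phi> (cmod z) = 0" using \<phi>(1)[of "cmod z"] by (simp add: ennreal_eq_0_iff)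
        thus "\<omega> z = 0" using elim(2) d by simp
      qed
    qed
    hence "AE z in lebesgue. z \<in> unit_disk \<longrightarrow> \<omega> z = 0" by (rule AE_completion)
    hence "AE z in lebesgue_on unit_disk. \<omega> z = 0" by (subst AE_restrict_space_iff) auto
    thus False using rw unfolding radial_weight_def weight_def by auto
  qed
  \<comment> \<open>Lowering the constant to at most sqrt K makes \<alpha> = log_K C2' less than
    1.\<close>
  define C2' where "C2' = min C2 (sqrt K)"
  have C2': "1 < C2'" "C2' \<le> C2" "C2' < K" unfolding C2'_def using C2 K real_less_lsqrt[of K K] by (auto simp: min_less_iff_disj power2_eq_square)
  have wlow': "C2' * w (1 - (1 - r) / K) \<le> w r" if r: "0 \<le> r" "r < 1" for r
    using wlow[OF r] C2' w0 by (meson mult_right_mono order_trans)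
  define \<alpha> where "\<alpha> = log K C2'"
  have \<alpha>: "0 < \<alpha>" "\<alpha> < 1" unfolding \<alpha>_def using C2' K by (auto simp: log_less_one_cancel_iff)
  \<comment> \<open>C1 + 1 in place of C1 gives \<beta> >= 1, hence \<alpha> <= \<beta>.\<close>
  define \<beta> where "\<beta> = log 2 (C1 + 1)"
  have \<beta>: "1 \<le> \<beta>" unfolding \<beta>_def using C1 by (simp add: le_log_iff)
  define C0 where "C0 = max (C1 + 1) C2'"
  have C0: "1 \<le> C0" "C1 + 1 \<le> C0" "C2' \<le> C0" unfolding C0_def using C1 by auto
  have upper: "w r \<le> C0 * ((1 - r) / (1 - t)) powr \<beta> * w t" if "0 \<le> r" "r \<le> t" "t < 1" for r t
  proof -
    have "w r \<le> (C1 + 1) * ((1 - r) / (1 - t)) powr \<beta> * w t"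
      unfolding \<beta>_def by (rule doubling_upper_power) (use that wanti C1 w0 wup in auto)
    also have "... \<le> C0 * ((1 - r) / (1 - t)) powr \<beta> * w t" using C0 w0 by (intro mult_right_mono) auto
    finally show ?thesis .
  qed
  have lower: "w t \<le> C0 * ((1 - t) / (1 - r)) powr \<alpha> * w r" if "0 \<le> r" "r \<le> t" "t < 1" for r t
  proof -
    have "w t \<le> C2' * ((1 - t) / (1 - r)) powr \<alpha> * w r"
      unfolding \<alpha>_def by (rule doubling_lower_power) (use that wanti C2' K w0 wlow' in auto)
    also have "... \<le> C0 * ((1 - t) / (1 - r)) powr \<alpha> * w r" using C0 w0 by (intro mult_right_mono) auto
    finally show ?thesis .
  qed
  \<comment> \<open>The factors are the density 2 pi s with s at least 1 - 1/K, the part 1 - 1/C2 of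
    the tail at r1 that lies before r2, and the loss from the tail at r to the tail at r1, where r1
    and r2 are the radii of the annulus.\<close>
  define c where "c = 2 * pi * (1 - 1/K) * (1 - 1/C2) / (C0 * K powr \<beta>)"
  have c: "c > 0" unfolding c_def using K C2 C0 by (intro divide_pos_pos mult_pos_pos) auto
  have "tent_weight w C0 \<alpha> \<beta> \<phi> K c"
  proof unfold_locales
    show "w \<in> borel_measurable borel"
    proof -
      have "(\<lambda>r. - w r) \<in> borel_measurable borel" using wanti by (intro borel_measurable_mono monoI) auto
      hence "(\<lambda>r. - (- w r)) \<in> borel_measurable borel" by measurable
      thus ?thesis by simp
    qed
    show "0 < w r" if "0 \<le> r" "r < 1" for r by (rule wpos[OF that])
    show "1 \<le> C0" "0 < \<alpha>" "\<alpha> < 1" "\<alpha> \<le> \<beta>" "1 < K" "0 < c" using C0 \<alpha> \<beta> K c by auto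
    show "w r \<le> C0 * ((1 - r) / (1 - t)) powr \<beta> * w t" if "0 \<le> r" "r \<le> t" "t < 1" for r t by (rule upper[OF that])
    show "w t \<le> C0 * ((1 - t) / (1 - r)) powr \<alpha> * w r" if "0 \<le> r" "r \<le> t" "t < 1" for r t by (rule lower[OF that])
    show "\<phi> \<in> borel_measurable borel" by measurable
    show "0 \<le> \<phi> s" for s by (rule \<phi>(1))
    show "(\<integral>\<^sup>+z\<in>unit_disk. ennreal (\<phi> (cmod z)) * indicator {z. 1 - cmod z < t} z \<partial>lborel) \<le> ennreal (2 * pi * w (max 0 (1 - t)))" if t: "0 < t" for t
    proof -
      have "(\<integral>\<^sup>+z\<in>unit_disk. ennreal (\<phi> (cmod z)) * indicator {z. 1 - cmod z < t} z \<partial>lborel)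
        = (\<integral>\<^sup>+z\<in>unit_disk. (\<lambda>s. ennreal (\<phi> s) * indicator {s. 1 - s < t} s) (cmod z) \<partial>lborel)"
        by (intro nn_integral_cong) (auto split: split_indicator)
      also have "... = (\<integral>\<^sup>+s\<in>{0<..<1}. ennreal (\<phi> s) * indicator {s. 1 - s < t} s * ennreal (2 * pi * s) \<partial>lborel)"
        by (rule nn_integral_radial) measurable
      also have "... \<le> (\<integral>\<^sup>+s. ennreal (2 * pi) * (ennreal (\<phi> s) * indicator {max 0 (1 - t)..<1} s) \<partial>lborel)"
      proof (intro nn_integral_mono)
        fix s :: real
        show "ennreal (\<phi> s) * indicator {s. 1 - s < t} s * ennreal (2 * pi * s) * indicator {0<..<1} s \<le> ennreal (2 * pi) * (ennreal (\<phi> s) * indicator {max 0 (1 - t)..<1} s)"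
        proof (cases "s \<in> {0<..<1} \<and> 1 - s < t")
          case True
          hence "ennreal (2 * pi * s) \<le> ennreal (2 * pi)" by (intro ennreal_leI) auto
          hence "ennreal (\<phi> s) * ennreal (2 * pi * s) \<le> ennreal (\<phi> s) * ennreal (2 * pi)" by (intro mult_left_mono) auto
          thus ?thesis using True by (simp add: mult.commute)
        qed (auto split: split_indicator)
      qed
      also have "... = ennreal (2 * pi) * \<Phi> (max 0 (1 - t))" unfolding \<Phi>_def by (rule nn_integral_cmult) measurable
      also have "\<Phi> (max 0 (1 - t)) = ennreal (w (max 0 (1 - t)))" by (rule wr[symmetric]) simp
      also have "ennreal (2 * pi) * ... = ennreal (2 * pi * w (max 0 (1 - t)))" by (rule ennreal_mult'[symmetric]) simp
      finally show ?thesis .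
    qed
    show "ennreal (c * w r) \<le> (\<integral>\<^sup>+z\<in>unit_disk. ennreal (\<phi> (cmod z)) * indicator {z. 1 - (1 - r) / K \<le> cmod z \<and> cmod z < 1 - (1 - r) / K^2} z \<partial>lborel)"
      if r: "0 \<le> r" "r < 1" for r
    proof -
      define r1 r2 where "r1 = 1 - (1 - r) / K" and "r2 = 1 - (1 - r) / K^2"
      have r1: "0 \<le> r1" "r \<le> r1" "r1 < 1" using rK[OF r] unfolding r1_def by auto
      have r2e: "r2 = 1 - (1 - r1) / K" unfolding r1_def r2_def using K by (simp add: power2_eq_square)
      have r2: "r1 \<le> r2" "r2 < 1" using rK[OF r1(1,3)] unfolding r2e by auto
      have r1K: "1 - 1/K \<le> r1"
      proof -
        have "(1 - r) / K \<le> 1 / K" using r K by (intro divide_right_mono) auto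
        thus ?thesis unfolding r1_def by simp
      qed
      define J where "J = (\<integral>\<^sup>+s. ennreal (\<phi> s) * indicator {r1..<r2} s \<partial>lborel)"
      have sp: "\<Phi> r1 = J + \<Phi> r2"
      proof -
        have "\<Phi> r1 = (\<integral>\<^sup>+s. ennreal (\<phi> s) * indicator {r1..<r2} s + ennreal (\<phi> s) * indicator {r2..<1} s \<partial>lborel)"
          unfolding \<Phi>_def using r2 by (intro nn_integral_cong) (auto split: split_indicator)
        also have "... = J + \<Phi> r2" unfolding J_def \<Phi>_def by (rule nn_integral_add) measurable
        finally show ?thesis .
      qed
      have "J \<le> \<Phi> r1" unfolding sp using add_left_mono[of 0 "\<Phi> r2" J] by simp
      hence Jfin: "J < \<infinity>" using finr[OF r1(1)] by (rule le_less_trans)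
      define j where "j = enn2real J"
      have j: "J = ennreal j" "j \<ge> 0" unfolding j_def using Jfin by auto
      have "ennreal (w r1) = ennreal (j + w r2)" using sp wr[of r1] wr[of r2] r1 r2 j w0 by (simp add: ennreal_plus)
      hence w12: "w r1 = j + w r2" using j w0 by (subst (asm) ennreal_inj) auto
      have "C2 * w r2 \<le> w r1" using wlow[OF r1(1,3)] unfolding r2e .
      hence "w r2 \<le> w r1 / C2" using C2 by (simp add: pos_le_divide_eq mult.commute)
      hence j1: "(1 - 1/C2) * w r1 \<le> j" unfolding w12[symmetric] using w12 by (simp add: left_diff_distrib)
      have "w r \<le> C0 * ((1 - r) / (1 - r1)) powr \<beta> * w r1" by (rule upper[OF r(1) r1(2,3)])
      also have "(1 - r) / (1 - r1) = K" unfolding r1_def using r K by simp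
      finally have "w r / (C0 * K powr \<beta>) \<le> w r1" using C0 K by (simp add: pos_divide_le_eq mult.commute)
      hence "2 * pi * (1 - 1/K) * ((1 - 1/C2) * (w r / (C0 * K powr \<beta>))) \<le> 2 * pi * (1 - 1/K) * ((1 - 1/C2) * w r1)"
        using C2 K by (intro mult_left_mono) auto
      also have "... \<le> 2 * pi * (1 - 1/K) * j" using j1 K by (intro mult_left_mono) auto
      finally have "c * w r \<le> 2 * pi * (1 - 1/K) * j" unfolding c_def by (simp add: mult.assoc)
      hence "ennreal (c * w r) \<le> ennreal (2 * pi * (1 - 1/K)) * J" unfolding j(1) using K j by (subst ennreal_mult'[symmetric]) (auto intro!: ennreal_leI)
      also have "... = (\<integral>\<^sup>+s. ennreal (2 * pi * (1 - 1/K)) * (ennreal (\<phi> s) * indicator {r1..<r2} s) \<partial>lborel)"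
        unfolding J_def by (rule nn_integral_cmult[symmetric]) measurable
      also have "... \<le> (\<integral>\<^sup>+s\<in>{0<..<1}. ennreal (\<phi> s) * indicator {r1..<r2} s * ennreal (2 * pi * s) \<partial>lborel)"
      proof (intro nn_integral_mono)
        fix s :: real
        show "ennreal (2 * pi * (1 - 1/K)) * (ennreal (\<phi> s) * indicator {r1..<r2} s) \<le> ennreal (\<phi> s) * indicator {r1..<r2} s * ennreal (2 * pi * s) * indicator {0<..<1} s"
        proof (cases "s \<in> {r1..<r2}")
          case True
          have "0 < 1 - 1/K" using K by simp
          hence s: "0 < s" "s < 1" "1 - 1/K \<le> s" using True r1K r2 by auto
          hence "ennreal (2 * pi * (1 - 1/K)) \<le> ennreal (2 * pi * s)" by (intro ennreal_leI mult_left_mono) auto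
          hence "ennreal (\<phi> s) * ennreal (2 * pi * (1 - 1/K)) \<le> ennreal (\<phi> s) * ennreal (2 * pi * s)" by (intro mult_left_mono) auto
          thus ?thesis using True s by (simp add: mult.commute)
        qed simp
      qed
      also have "... = (\<integral>\<^sup>+z\<in>unit_disk. (\<lambda>s. ennreal (\<phi> s) * indicator {r1..<r2} s) (cmod z) \<partial>lborel)"
        by (rule nn_integral_radial[symmetric]) measurable
      also have "... = (\<integral>\<^sup>+z\<in>unit_disk. ennreal (\<phi> (cmod z)) * indicator {z. 1 - (1 - r) / K \<le> cmod z \<and> cmod z < 1 - (1 - r) / K^2} z \<partial>lborel)"
        unfolding r1_def r2_def by (intro nn_integral_cong) (auto split: split_indicator)
      finally show ?thesis .
    qed
  qed
  thus ?thesis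
  proof (rule that)
    show "AE z in lborel. z \<in> unit_disk \<longrightarrow> \<omega> z = \<phi> (cmod z)" by (rule \<phi>(2))
    show "w (cmod z) = enn2real (omega_hat \<omega> z)" if "cmod z < 1" for z unfolding oh w_def by (simp add: max_def)
  qed
qed

subsection \<open>Energies of holomorphic functions\<close>

text \<open>Values outside the disk are arbitrary, so a function holomorphic in the disk need not be
  Borel on the plane. Setting it to 0 outside makes it Borel and changes nothing inside.\<close>

definition cut :: "(complex \<Rightarrow> complex) \<Rightarrow> complex \<Rightarrow> complex"
  where "cut f z = indicator unit_disk z *\<^sub>R f z"

lemma cut_eq [simp]: "cmod z < 1 \<Longrightarrow> cut f z = f z"
  unfolding cut_def by simp

lemma cut_measurable:
  assumes "hol f" shows "cut f \<in> borel_measurable borel"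
  unfolding cut_def
  by (rule borel_measurable_continuous_on_indicator[OF _ holomorphic_on_imp_continuous_on[OF assms]]) simp

lemma cut_holomorphic:
  assumes "hol f" shows "hol (cut f)"
  by (rule holomorphic_transform[OF assms]) simp

lemma deriv_cut:
  assumes "hol f" "cmod z < 1" shows "deriv (cut f) z = deriv f z"
  by (rule complex_derivative_transform_within_open[OF cut_holomorphic[OF assms(1)] assms(1)]) (use assms in auto)

text \<open>On the convex disk f g' has a primitive, and the integral along the segment from 0 is
  its increment.\<close>

lemma volterra_primitive:
  assumes f: "hol f" and g: "hol g"
  shows "hol (volterra g f)" "volterra g f 0 = 0"
    "\<And>z. cmod z < 1 \<Longrightarrow> deriv (volterra g f) z = f z * deriv g z"
proof -
  have "(\<lambda>z. f z * deriv g z) holomorphic_on unit_disk" using f g by (intro holomorphic_intros) auto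
  then obtain F where F: "\<And>z. z \<in> unit_disk \<Longrightarrow> (F has_field_derivative f z * deriv g z) (at z within unit_disk)"
    using holomorphic_convex_primitive'[of unit_disk "\<lambda>z. f z * deriv g z"] convex_ball open_ball by blast
  have eq: "volterra g f z = F z - F 0" if z: "z \<in> unit_disk" for z
  proof -
    have sub: "path_image (linepath 0 z) \<subseteq> unit_disk" using closed_segment_subset[OF _ z convex_ball] by simp
    have "((\<lambda>z. f z * deriv g z) has_contour_integral (F (pathfinish (linepath 0 z)) - F (pathstart (linepath 0 z)))) (linepath 0 z)"
      by (rule contour_integral_primitive[OF F _ sub]) auto
    thus ?thesis unfolding volterra_def by (auto dest: contour_integral_unique)
  qed
  have D: "(volterra g f has_field_derivative f z * deriv g z) (at z)" if z: "z \<in> unit_disk" for z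
  proof -
    have "(F has_field_derivative f z * deriv g z) (at z)" using F[OF z] at_within_open[OF z open_ball] by simp
    hence "((\<lambda>z. F z - F 0) has_field_derivative f z * deriv g z) (at z)" by (auto intro!: derivative_eq_intros)
    thus ?thesis by (rule has_field_derivative_transform_within_open[OF _ open_ball z]) (simp add: eq)
  qed
  show "hol (volterra g f)" by (subst holomorphic_on_open) (rule open_ball, use D in blast)
  show "volterra g f 0 = 0" using eq[of 0] by simp
  show "deriv (volterra g f) z = f z * deriv g z" if "cmod z < 1" for z using D[of z] that by (simp add: DERIV_imp_deriv)
qed

lemma holomorphic_lebesgue_measurable:
  assumes "hol f" shows "f \<in> borel_measurable (lebesgue_on unit_disk)"
  by (rule continuous_imp_measurable_on_sets_lebesgue[OF holomorphic_on_imp_continuous_on[OF assms]]) simp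

lemma AT_inf_iff: "f \<in> AT_inf q \<omega> \<longleftrightarrow> hol f \<and> tent_norm q \<omega> f < \<infinity>"
  unfolding AT_inf_def T_inf_def using holomorphic_lebesgue_measurable by auto

lemma AT_zero_subset: "AT_zero q \<omega> \<subseteq> AT_inf q \<omega>"
  unfolding AT_zero_def AT_inf_def T_zero_def by auto

lemma AT_zero_iff: "f \<in> AT_zero q \<omega> \<longleftrightarrow> f \<in> AT_inf q \<omega> \<and> vanishing (tent_mean q \<omega> f)"
  unfolding AT_zero_def AT_inf_def T_zero_def vanishing_iff_tendsto by auto

lemma ennreal_powr_le_iff:
  assumes q: "0 < q" and B: "0 \<le> B"
  shows "ennreal_powr x (1 / q) \<le> ennreal B \<longleftrightarrow> x \<le> ennreal (B powr q)"
proof (cases x)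
  case (real y)
  have "y powr (1 / q) \<le> B \<longleftrightarrow> y \<le> B powr q"
  proof
    assume "y powr (1 / q) \<le> B"
    hence "(y powr (1 / q)) powr q \<le> B powr q" using q by (intro powr_mono2) auto
    thus "y \<le> B powr q" using q real by (simp add: powr_powr)
  next
    assume "y \<le> B powr q"
    hence "y powr (1 / q) \<le> (B powr q) powr (1 / q)" using q real by (intro powr_mono2) auto
    thus "y powr (1 / q) \<le> B" using q B by (simp add: powr_powr)
  qed
  thus ?thesis using real B unfolding ennreal_powr_def by simp
next
  case top thus ?thesis unfolding ennreal_powr_def by (simp add: top_unique)
qed

lemma tent_norm_le_iff:
  assumes q: "0 < q" and B: "0 \<le> B"
  shows "tent_norm q \<omega> f \<le> ennreal B \<longleftrightarrow> (\<forall>a. cmod a < 1 \<longrightarrow> tent_mean q \<omega> f a \<le> ennreal (B powr q))"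
  unfolding tent_norm_def SUP_le_iff ennreal_powr_le_iff[OF assms] by auto

lemma divide_pos_le_ennreal:
  assumes "0 < d" "0 \<le> A"
  shows "ennreal (1 / d) * x \<le> ennreal A \<longleftrightarrow> x \<le> ennreal (A * d)"
proof (cases x)
  case (real y)
  have "y / d \<le> A \<longleftrightarrow> y \<le> A * d" using assms by (simp add: pos_divide_le_eq)
  thus ?thesis using real assms by (simp add: ennreal_mult'[symmetric])
next
  case top thus ?thesis using assms by (simp add: ennreal_mult_top top_unique)
qed

section \<open>Tent norms, kernel energies and the Volterra operator\<close>

locale tent_space = tent_weight w C0 \<alpha> \<beta> \<phi> K c
  for w :: "real \<Rightarrow> real" and C0 \<alpha> \<beta> :: real and \<phi> :: "real \<Rightarrow> real" and K c :: real +
  fixes \<omega> :: "complex \<Rightarrow> real"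
  assumes weight_eq: "AE z in lborel. z \<in> unit_disk \<longrightarrow> \<omega> z = \<phi> (cmod z)"
    and omega_hat_eq: "cmod z < 1 \<Longrightarrow> w (cmod z) = enn2real (omega_hat \<omega> z)"
begin

definition energy :: "real \<Rightarrow> (complex \<Rightarrow> complex) \<Rightarrow> complex \<Rightarrow> ennreal"
  where "energy q f b = km (En q (cut f)) b"

lemma tent_mean_eq:
  assumes a: "cmod a < 1"
  shows "tent_mean q \<omega> f a = tmean (Pn q (cut f)) a"
proof -
  have "(\<integral>\<^sup>+ z \<in> carleson_square a. ennreal (cmod (f z) powr q * \<omega> z) \<partial>lebesgue) = (\<integral>\<^sup>+ z \<in> carleson_square a. ennreal (cmod (f z) powr q * \<omega> z) \<partial>lborel)"
    by (rule nn_integral_completion)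
  also have "... = (\<integral>\<^sup>+ z \<in> carleson_square a. Pn q (cut f) z \<partial>lborel)"
  proof (rule nn_integral_cong_AE, use weight_eq in eventually_elim)
    case (elim z)
    show ?case
    proof (cases "z \<in> carleson_square a")
      case True
      hence "cmod z < 1" using carleson_square_subset[OF a] by auto
      thus ?thesis using elim unfolding Pn_def by simp
    qed simp
  qed
  finally show ?thesis unfolding tent_mean_def tmean_def by simp
qed

text \<open>Two changes are composed: from squares to kernels for the weight itself
  (\<open>kmean_le_tmean\<close>), then from the weight to W
  (\<open>profile_le_weight\<close>).\<close>

lemma energy_le_of_tent_norm:
  assumes q: "0 < q"
  obtains C where "0 < C" "\<And>f B b. hol f \<Longrightarrow> 0 \<le> B \<Longrightarrow> tent_norm q \<omega> f \<le> ennreal B \<Longrightarrow> cmod b < 1 \<Longrightarrow>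
    energy q f b \<le> ennreal (C * B powr q * (1 - cmod b))"
proof -
  obtain C1 where C1: "0 < C1" "\<And>u a B. u \<in> borel_measurable borel \<Longrightarrow> (\<And>a. cmod a < 1 \<Longrightarrow> tmean u a \<le> B) \<Longrightarrow> cmod a < 1 \<Longrightarrow>
     ennreal (1 / (1 - cmod a)) * km u a \<le> ennreal C1 * B"
    using kmean_le_tmean[of "1 + \<alpha>/4"] alpha by auto
  obtain C2 where C2: "0 < C2" "\<And>f a. hol f \<Longrightarrow> f \<in> borel_measurable borel \<Longrightarrow> cmod a < 1 \<Longrightarrow>
    km (En q f) a \<le> ennreal C2 * km (Pn q f) a"
    by (fact profile_le_weight[OF q])
  show ?thesis
  proof (rule that[of "C2 * C1"])
    show "0 < C2 * C1" using C1 C2 by simp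
    fix f B b assume f: "hol f" and B: "0 \<le> B" and n: "tent_norm q \<omega> f \<le> ennreal B" and b: "cmod b < 1"
    note [measurable] = cut_measurable[OF f]
    have "tmean (Pn q (cut f)) a \<le> ennreal (B powr q)" if "cmod a < 1" for a
      using n that unfolding tent_norm_le_iff[OF q B] tent_mean_eq[OF that, symmetric] by blast
    hence "ennreal (1 / (1 - cmod b)) * km (Pn q (cut f)) b \<le> ennreal C1 * ennreal (B powr q)"
      by (intro C1 b) measurable
    also have "... = ennreal (C1 * B powr q)" using C1 by (intro ennreal_mult'[symmetric]) simp
    finally have le: "km (Pn q (cut f)) b \<le> ennreal (C1 * B powr q * (1 - cmod b))"
      using b C1 by (subst (asm) divide_pos_le_ennreal) auto
    have "energy q f b \<le> ennreal C2 * km (Pn q (cut f)) b"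
      unfolding energy_def by (intro C2 cut_holomorphic f b) measurable
    also have "... \<le> ennreal C2 * ennreal (C1 * B powr q * (1 - cmod b))" by (intro mult_left_mono le) auto
    also have "... = ennreal (C2 * C1 * B powr q * (1 - cmod b))" using C2 by (subst ennreal_mult'[symmetric]) (auto simp: mult.assoc)
    finally show "energy q f b \<le> ennreal (C2 * C1 * B powr q * (1 - cmod b))" .
  qed
qed

lemma tent_mean_le_energy:
  assumes q: "0 < q"
  obtains C where "0 < C" "\<And>f a. hol f \<Longrightarrow> cmod a < 1 \<Longrightarrow>
    tent_mean q \<omega> f a \<le> ennreal C * (ennreal (1 / (1 - cmod a)) * energy q f a)"
proof -
  define M where "M = 1 + \<alpha>/4"
  have M: "0 \<le> M" unfolding M_def using alpha by simp
  obtain C1 where C1: "0 < C1" "\<And>f a. hol f \<Longrightarrow> f \<in> borel_measurable borel \<Longrightarrow> cmod a < 1 \<Longrightarrow>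
    km (Pn q f) a \<le> ennreal C1 * km (En q f) a"
    by (fact weight_le_profile[OF q])
  show ?thesis
  proof (rule that[of "3 powr M * C1"])
    show "0 < 3 powr M * C1" using C1 by simp
    fix f a assume f: "hol f" and a: "cmod a < 1"
    note [measurable] = cut_measurable[OF f]
    have "tent_mean q \<omega> f a \<le> ennreal (3 powr M) * (ennreal (1 / (1 - cmod a)) * km (Pn q (cut f)) a)"
      unfolding tent_mean_eq[OF a] M_def[symmetric] by (rule tmean_le_kmean[OF _ a M]) measurable
    also have "... \<le> ennreal (3 powr M) * (ennreal (1 / (1 - cmod a)) * (ennreal C1 * energy q f a))"
      unfolding energy_def by (intro mult_left_mono C1 cut_holomorphic cut_measurable f a) auto
    also have "... = (ennreal (3 powr M) * ennreal C1) * (ennreal (1 / (1 - cmod a)) * energy q f a)"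
      by (simp only: mult_ac)
    also have "ennreal (3 powr M) * ennreal C1 = ennreal (3 powr M * C1)" by (rule ennreal_mult'[symmetric]) simp
    finally show "tent_mean q \<omega> f a \<le> ennreal (3 powr M * C1) * (ennreal (1 / (1 - cmod a)) * energy q f a)" .
  qed
qed

lemma tent_norm_le_of_energy:
  assumes q: "0 < q"
  obtains C where "0 < C" "\<And>f A. hol f \<Longrightarrow> 0 \<le> A \<Longrightarrow> (\<And>b. cmod b < 1 \<Longrightarrow> energy q f b \<le> ennreal (A * (1 - cmod b))) \<Longrightarrow>
    tent_norm q \<omega> f \<le> ennreal (C * A powr (1 / q))"
proof -
  obtain C where C: "0 < C" "\<And>f a. hol f \<Longrightarrow> cmod a < 1 \<Longrightarrow>
    tent_mean q \<omega> f a \<le> ennreal C * (ennreal (1 / (1 - cmod a)) * energy q f a)"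
    by (fact tent_mean_le_energy[OF q])
  show ?thesis
  proof (rule that[of "C powr (1 / q)"])
    show "0 < C powr (1 / q)" using C by simp
    fix f A assume f: "hol f" and A: "0 \<le> A" and le: "\<And>b. cmod b < 1 \<Longrightarrow> energy q f b \<le> ennreal (A * (1 - cmod b))"
    show "tent_norm q \<omega> f \<le> ennreal (C powr (1 / q) * A powr (1 / q))"
    proof (subst tent_norm_le_iff[OF q], simp, intro allI impI)
      fix a assume a: "cmod a < 1"
      have "ennreal (1 / (1 - cmod a)) * energy q f a \<le> ennreal A" using le[OF a] a A by (subst divide_pos_le_ennreal) auto
      hence "tent_mean q \<omega> f a \<le> ennreal C * ennreal A" using C(2)[OF f a] by (meson mult_left_mono order_trans zero_le)
      also have "... = ennreal (C * A)" using C by (intro ennreal_mult'[symmetric]) simp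
      also have "C * A = (C powr (1 / q) * A powr (1 / q)) powr q" using C A q by (simp add: powr_mult powr_powr)
      finally show "tent_mean q \<omega> f a \<le> ennreal ((C powr (1 / q) * A powr (1 / q)) powr q)" .
    qed
  qed
qed

lemma vanishing_energy_iff:
  assumes q: "0 < q" and f: "f \<in> AT_inf q \<omega>"
  shows "f \<in> AT_zero q \<omega> \<longleftrightarrow> vanishing (\<lambda>b. ennreal (1 / (1 - cmod b)) * energy q f b)"
proof
  have hol: "hol f" and fin: "tent_norm q \<omega> f < \<infinity>" using f AT_inf_iff by auto
  note [measurable] = cut_measurable[OF hol]
  {
    assume "f \<in> AT_zero q \<omega>"
    hence "vanishing (tent_mean q \<omega> f)" unfolding AT_zero_iff by simp
    hence v: "vanishing (tmean (Pn q (cut f)))" by (rule vanishing_mono[where K=1]) (simp_all add: tent_mean_eq)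
    obtain B where B: "0 \<le> B" "tent_norm q \<omega> f = ennreal B" using fin by (cases "tent_norm q \<omega> f") auto
    \<comment> \<open>\<open>kmean_vanishing\<close> asks for finite total mass; as the square at 0
      is the whole disk, this is the mean at 0.\<close>
    have "tent_mean q \<omega> f 0 \<le> ennreal (B powr q)" using tent_norm_le_iff[OF q B(1), of \<omega> f] B(2) by simp
    hence "tmean (Pn q (cut f)) 0 < \<infinity>" by (subst (asm) tent_mean_eq) (auto intro: le_less_trans)
    hence "(\<integral>\<^sup>+z\<in>unit_disk. Pn q (cut f) z \<partial>lborel) < \<infinity>" unfolding tmean_def carleson_square_def by simp
    hence v: "vanishing (\<lambda>b. ennreal (1 / (1 - cmod b)) * km (Pn q (cut f)) b)"
      using alpha by (intro kmean_vanishing v) auto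
    obtain C where C: "0 < C" "\<And>f a. hol f \<Longrightarrow> f \<in> borel_measurable borel \<Longrightarrow> cmod a < 1 \<Longrightarrow>
      km (En q f) a \<le> ennreal C * km (Pn q f) a"
      by (fact profile_le_weight[OF q])
    show "vanishing (\<lambda>b. ennreal (1 / (1 - cmod b)) * energy q f b)"
    proof (rule vanishing_mono[OF v])
      fix a assume a: "cmod a < 1"
      have "energy q f a \<le> ennreal C * km (Pn q (cut f)) a"
        unfolding energy_def by (intro C cut_holomorphic hol a) measurable
      thus "ennreal (1 / (1 - cmod a)) * energy q f a \<le> ennreal C * (ennreal (1 / (1 - cmod a)) * km (Pn q (cut f)) a)"
        by (subst mult.left_commute) (intro mult_left_mono, auto)
    qed (use C in simp)
  }
  assume v: "vanishing (\<lambda>b. ennreal (1 / (1 - cmod b)) * energy q f b)"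
  obtain C where C: "0 < C" "\<And>f a. hol f \<Longrightarrow> cmod a < 1 \<Longrightarrow>
    tent_mean q \<omega> f a \<le> ennreal C * (ennreal (1 / (1 - cmod a)) * energy q f a)"
    by (fact tent_mean_le_energy[OF q])
  have "vanishing (tent_mean q \<omega> f)" using C by (intro vanishing_mono[OF v, of _ C] C hol) auto
  thus "f \<in> AT_zero q \<omega>" using f unfolding AT_zero_iff by simp
qed

text \<open>The derivative ignores constants, so h(0) = 0 is required in the direction that recovers
  h. F is a stand-in for h' that can be taken Borel on the plane.\<close>

lemma energy_deriv:
  assumes q: "0 < q"
  obtains C where "0 < C" "\<And>h F b. hol h \<Longrightarrow> h 0 = 0 \<Longrightarrow> F \<in> borel_measurable borel \<Longrightarrow>
      (\<And>z. cmod z < 1 \<Longrightarrow> F z = deriv h z) \<Longrightarrow> cmod b < 1 \<Longrightarrow> energy q h b \<le> ennreal C * km (Dn q F) b"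
    "\<And>h F b. hol h \<Longrightarrow> (\<And>z. cmod z < 1 \<Longrightarrow> F z = deriv h z) \<Longrightarrow> cmod b < 1 \<Longrightarrow>
      km (Dn q F) b \<le> ennreal C * energy q h b"
proof -
  obtain C1 where C1: "0 < C1" "\<And>f F a. hol f \<Longrightarrow> f \<in> borel_measurable borel \<Longrightarrow>
    (\<And>z. cmod z < 1 \<Longrightarrow> F z = deriv f z) \<Longrightarrow> cmod a < 1 \<Longrightarrow> km (Dn q F) a \<le> ennreal C1 * km (En q f) a"
    by (fact derivative_energy[OF q])
  obtain C2 where C2: "0 < C2" "\<And>f F a. hol f \<Longrightarrow> f \<in> borel_measurable borel \<Longrightarrow>
    (\<And>z. cmod z < 1 \<Longrightarrow> F z = deriv f z) \<Longrightarrow> F \<in> borel_measurable borel \<Longrightarrow> cmod a < 1 \<Longrightarrow> km (En q (\<lambda>z. f z - f 0)) a \<le> ennreal C2 * km (Dn q F) a"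
    by (fact increment_energy[OF q])
  show ?thesis
  proof (rule that[of "max C1 C2"])
    show "0 < max C1 C2" using C1 by simp
    fix h F b assume h: "hol h" and F: "\<And>z. cmod z < 1 \<Longrightarrow> F z = deriv h z" and b: "cmod b < 1"
    have F': "F z = deriv (cut h) z" if "cmod z < 1" for z using F[OF that] deriv_cut[OF h that] by simp
    have "km (Dn q F) b \<le> ennreal C1 * energy q h b"
      unfolding energy_def by (rule C1(2)[OF cut_holomorphic[OF h] cut_measurable[OF h] F' b])
    also have "... \<le> ennreal (max C1 C2) * energy q h b" by (intro mult_right_mono ennreal_leI) auto
    finally show "km (Dn q F) b \<le> ennreal (max C1 C2) * energy q h b" .
    assume h0: "h 0 = 0" and Fb: "F \<in> borel_measurable borel"
    have "energy q h b = km (En q (\<lambda>z. cut h z - cut h 0)) b" unfolding energy_def using h0 by simp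
    also have "... \<le> ennreal C2 * km (Dn q F) b" by (rule C2(2)[OF cut_holomorphic[OF h] cut_measurable[OF h] F' Fb b])
    also have "... \<le> ennreal (max C1 C2) * km (Dn q F) b" by (intro mult_right_mono ennreal_leI) auto
    finally show "energy q h b \<le> ennreal (max C1 C2) * km (Dn q F) b" .
  qed
qed

lemma deriv_holomorphic: "hol g \<Longrightarrow> hol (deriv g)"
  by (rule holomorphic_deriv) auto

lemma volterra_energy:
  assumes q: "0 < q"
  obtains C where "0 < C" "\<And>f g b. hol f \<Longrightarrow> hol g \<Longrightarrow> cmod b < 1 \<Longrightarrow>
      energy q (volterra g f) b \<le> ennreal C * km (Dn q (\<lambda>z. cut f z * cut (deriv g) z)) b"
    "\<And>f g b. hol f \<Longrightarrow> hol g \<Longrightarrow> cmod b < 1 \<Longrightarrow>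
      km (Dn q (\<lambda>z. cut f z * cut (deriv g) z)) b \<le> ennreal C * energy q (volterra g f) b"
proof -
  obtain C where C: "0 < C" "\<And>h F b. hol h \<Longrightarrow> h 0 = 0 \<Longrightarrow> F \<in> borel_measurable borel \<Longrightarrow>
      (\<And>z. cmod z < 1 \<Longrightarrow> F z = deriv h z) \<Longrightarrow> cmod b < 1 \<Longrightarrow> energy q h b \<le> ennreal C * km (Dn q F) b"
    "\<And>h F b. hol h \<Longrightarrow> (\<And>z. cmod z < 1 \<Longrightarrow> F z = deriv h z) \<Longrightarrow> cmod b < 1 \<Longrightarrow>
      km (Dn q F) b \<le> ennreal C * energy q h b"
    by (fact energy_deriv[OF q])
  show ?thesis
  proof (rule that[OF C(1)])
    fix f g b assume f: "hol f" and g: "hol g" and b: "cmod b < 1"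
    note [measurable] = cut_measurable[OF f] cut_measurable[OF deriv_holomorphic[OF g]]
    note v = volterra_primitive[OF f g]
    show "energy q (volterra g f) b \<le> ennreal C * km (Dn q (\<lambda>z. cut f z * cut (deriv g) z)) b"
      by (rule C(2)[OF v(1,2) _ _ b]) (measurable, simp add: v(3))
    show "km (Dn q (\<lambda>z. cut f z * cut (deriv g) z)) b \<le> ennreal C * energy q (volterra g f) b"
      by (rule C(3)[OF v(1) _ b]) (simp add: v(3))
  qed
qed

lemma kmean_cong:
  assumes "\<And>z. cmod z < 1 \<Longrightarrow> u z = v z" shows "kmean M u a = kmean M v a"
  by (rule antisym; rule kmean_mono) (simp_all add: assms)

lemma energy_divide:
  assumes [measurable]: "f \<in> borel_measurable borel" and t: "0 < t"
  shows "energy q (\<lambda>z. f z / of_real t) b = ennreal (t powr - q) * km (En q f) b"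
proof -
  have "energy q (\<lambda>z. f z / of_real t) b = km (\<lambda>z. ennreal (t powr - q) * En q f z) b"
    unfolding energy_def
  proof (rule kmean_cong)
    fix z :: complex assume z: "cmod z < 1"
    have "cmod (f z / of_real t) powr q * W z = t powr - q * (cmod (f z) powr q * W z)"
      using t by (simp add: norm_divide powr_divide powr_minus_divide)
    thus "En q (cut (\<lambda>z. f z / of_real t)) z = ennreal (t powr - q) * En q f z"
      unfolding En_def using z by (simp only: cut_eq ennreal_mult'[OF powr_ge_zero])
  qed
  also have "... = ennreal (t powr - q) * km (En q f) b" by (rule kmean_cmult) measurable
  finally show ?thesis .
qed

text \<open>A function of unit energy has tent norm at most C1, so it is divided by C1 before the
  hypothesis is applied; undoing this multiplies the q-th powers by C1^q.\<close>

lemma embeds_of_volterra: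
  assumes p: "0 < p" and q: "0 < q"
  obtains C where "0 < C" "\<And>g c. hol g \<Longrightarrow> 0 \<le> c \<Longrightarrow>
    (\<And>f. f \<in> AT_zero p \<omega> \<Longrightarrow> tent_norm p \<omega> f \<le> 1 \<Longrightarrow> tent_norm q \<omega> (volterra g f) \<le> ennreal c) \<Longrightarrow>
    embeds p q (cut (deriv g)) (C * c powr q)"
proof -
  obtain C1 where C1: "0 < C1" "\<And>f A. hol f \<Longrightarrow> 0 \<le> A \<Longrightarrow> (\<And>b. cmod b < 1 \<Longrightarrow> energy p f b \<le> ennreal (A * (1 - cmod b))) \<Longrightarrow>
    tent_norm p \<omega> f \<le> ennreal (C1 * A powr (1 / p))"
    by (fact tent_norm_le_of_energy[OF p])
  obtain C2 where C2: "0 < C2" "\<And>f B b. hol f \<Longrightarrow> 0 \<le> B \<Longrightarrow> tent_norm q \<omega> f \<le> ennreal B \<Longrightarrow> cmod b < 1 \<Longrightarrow>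
    energy q f b \<le> ennreal (C2 * B powr q * (1 - cmod b))"
    by (fact energy_le_of_tent_norm[OF q])
  obtain C3 where C3: "0 < C3" "\<And>f g b. hol f \<Longrightarrow> hol g \<Longrightarrow> cmod b < 1 \<Longrightarrow>
      energy q (volterra g f) b \<le> ennreal C3 * km (Dn q (\<lambda>z. cut f z * cut (deriv g) z)) b"
    "\<And>f g b. hol f \<Longrightarrow> hol g \<Longrightarrow> cmod b < 1 \<Longrightarrow>
      km (Dn q (\<lambda>z. cut f z * cut (deriv g) z)) b \<le> ennreal C3 * energy q (volterra g f) b"
    by (fact volterra_energy[OF q])
  show ?thesis
  proof (rule that[of "C1 powr q * (C3 * C2)"])
    show "0 < C1 powr q * (C3 * C2)" using C1 C2 C3 by simp
    fix g c assume g: "hol g" and c: "0 \<le> c"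
      and bd: "\<And>f. f \<in> AT_zero p \<omega> \<Longrightarrow> tent_norm p \<omega> f \<le> 1 \<Longrightarrow> tent_norm q \<omega> (volterra g f) \<le> ennreal c"
    show "embeds p q (cut (deriv g)) (C1 powr q * (C3 * C2) * c powr q)"
      unfolding embeds_def
    proof (intro allI impI)
      fix f b assume f: "hol f" and [measurable]: "f \<in> borel_measurable borel"
        and v: "vanishing (\<lambda>b. ennreal (1 / (1 - cmod b)) * km (En p f) b)"
        and le: "\<forall>b. cmod b < 1 \<longrightarrow> km (En p f) b \<le> ennreal (1 - cmod b)" and b: "cmod b < 1"
      define h where "h = (\<lambda>z. f z / of_real C1)"
      have h: "hol h" unfolding h_def using C1 f by (intro holomorphic_intros) auto
      note [measurable] = cut_measurable[OF h] cut_measurable[OF deriv_holomorphic[OF g]]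
      have eh: "energy p h b = ennreal (C1 powr - p) * km (En p f) b" for b
        unfolding h_def by (rule energy_divide[OF _ C1(1)]) measurable
      have "tent_norm p \<omega> h \<le> ennreal (C1 * (C1 powr - p) powr (1 / p))"
      proof (rule C1(2)[OF h])
        fix b :: complex assume b: "cmod b < 1"
        have "energy p h b \<le> ennreal (C1 powr - p) * ennreal (1 - cmod b)" unfolding eh using le b by (intro mult_left_mono) auto
        thus "energy p h b \<le> ennreal (C1 powr - p * (1 - cmod b))" by (simp only: ennreal_mult'[OF powr_ge_zero])
      qed simp
      also have "C1 * (C1 powr - p) powr (1 / p) = 1" unfolding powr_powr using C1 p by (simp add: powr_neg_one)
      finally have n: "tent_norm p \<omega> h \<le> 1" by simp
      have inf: "h \<in> AT_inf p \<omega>" unfolding AT_inf_iff using h n by (auto intro: le_less_trans)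
      have "vanishing (\<lambda>b. ennreal (1 / (1 - cmod b)) * energy p h b)"
        by (rule vanishing_mono[OF v, of _ "C1 powr - p"]) (simp_all add: eh mult.left_commute)
      hence "h \<in> AT_zero p \<omega>" using vanishing_energy_iff[OF p inf] by blast
      hence J: "tent_norm q \<omega> (volterra g h) \<le> ennreal c" using n by (rule bd)
      have eJ: "energy q (volterra g h) b \<le> ennreal (C2 * c powr q * (1 - cmod b))"
        by (rule C2(2)[OF volterra_primitive(1)[OF h g] c J b])
      have "km (Dn q (\<lambda>z. f z * cut (deriv g) z)) b = km (\<lambda>z. ennreal (C1 powr q) * Dn q (\<lambda>z. cut h z * cut (deriv g) z) z) b"
      proof (rule kmean_cong)
        fix z :: complex assume z: "cmod z < 1"
        have "cmod (f z * deriv g z) powr q * (1 - cmod z) powr q * W z = C1 powr q * (cmod (h z * deriv g z) powr q * (1 - cmod z) powr q * W z)"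
          unfolding h_def using C1 by (simp add: norm_mult norm_divide powr_divide powr_mult)
        thus "Dn q (\<lambda>z. f z * cut (deriv g) z) z = ennreal (C1 powr q) * Dn q (\<lambda>z. cut h z * cut (deriv g) z) z"
          unfolding Dn_def using z by (simp only: cut_eq ennreal_mult'[OF powr_ge_zero])
      qed
      also have "... = ennreal (C1 powr q) * km (Dn q (\<lambda>z. cut h z * cut (deriv g) z)) b" by (rule kmean_cmult) measurable
      also have "... \<le> ennreal (C1 powr q) * (ennreal C3 * ennreal (C2 * c powr q * (1 - cmod b)))"
        by (intro mult_left_mono order_trans[OF C3(3)[OF h g b]] eJ) auto
      also have "... = ennreal (C1 powr q * (C3 * (C2 * c powr q * (1 - cmod b))))"
        using C3 by (simp only: ennreal_mult'[OF powr_ge_zero] ennreal_mult'[OF less_imp_le[OF C3(1)]])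
      also have "C1 powr q * (C3 * (C2 * c powr q * (1 - cmod b))) = C1 powr q * (C3 * C2) * c powr q * (1 - cmod b)" by (simp only: mult_ac)
      finally show "km (Dn q (\<lambda>z. f z * cut (deriv g) z)) b \<le> ennreal (C1 powr q * (C3 * C2) * c powr q * (1 - cmod b))" .
    qed
  qed
qed

lemma bloch_sup_le_iff:
  assumes "0 \<le> B"
  shows "bloch_sup p q \<omega> g \<le> ennreal B \<longleftrightarrow> (\<forall>z. cmod z < 1 \<longrightarrow> cmod (deriv g z) * (1 - cmod z) * w (cmod z) powr (1/q - 1/p) \<le> B)"
  unfolding bloch_sup_def SUP_le_iff using assms by (auto simp: ennreal_le_iff omega_hat_eq)

text \<open>A and B are positive finite bounds rather than the norms themselves, which keeps the
  computation within real powers; \<open>le_of_le_all_larger\<close> later returns to the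
  norms.\<close>

lemma volterra_bounded_bloch:
  assumes p: "0 < p" and pq: "p \<le> q"
  obtains C where "0 < C" "\<And>g f A B. hol g \<Longrightarrow> hol f \<Longrightarrow> 0 < A \<Longrightarrow> 0 < B \<Longrightarrow>
      bloch_sup p q \<omega> g \<le> ennreal B \<Longrightarrow> tent_norm p \<omega> f \<le> ennreal A \<Longrightarrow> tent_norm q \<omega> (volterra g f) \<le> ennreal (C * B * A)"
    "\<And>g f A B. hol g \<Longrightarrow> f \<in> AT_zero p \<omega> \<Longrightarrow> 0 < A \<Longrightarrow> 0 < B \<Longrightarrow>
      bloch_sup p q \<omega> g \<le> ennreal B \<Longrightarrow> tent_norm p \<omega> f \<le> ennreal A \<Longrightarrow>
      vanishing (\<lambda>b. ennreal (1 / (1 - cmod b)) * energy q (volterra g f) b)"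
proof -
  have q: "0 < q" using p pq by simp
  obtain C1 where C1: "0 < C1" "\<And>f B b. hol f \<Longrightarrow> 0 \<le> B \<Longrightarrow> tent_norm p \<omega> f \<le> ennreal B \<Longrightarrow> cmod b < 1 \<Longrightarrow>
    energy p f b \<le> ennreal (C1 * B powr p * (1 - cmod b))"
    by (fact energy_le_of_tent_norm[OF p])
  obtain C2 where C2: "0 < C2" "\<And>f G A B b. hol f \<Longrightarrow> f \<in> borel_measurable borel \<Longrightarrow> 0 \<le> A \<Longrightarrow> 0 \<le> B \<Longrightarrow>
    (\<And>z. cmod z < 1 \<Longrightarrow> cmod (G z) * (1 - cmod z) * w (cmod z) powr (1/q - 1/p) \<le> B) \<Longrightarrow>
    (\<And>b. cmod b < 1 \<Longrightarrow> km (En p f) b \<le> ennreal (A * (1 - cmod b))) \<Longrightarrow> cmod b < 1 \<Longrightarrow>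
    km (Dn q (\<lambda>z. f z * G z)) b \<le> ennreal (C2 * B powr q * A powr (q/p - 1)) * km (En p f) b"
    by (fact sufficiency_bloch[OF p pq])
  obtain C3 where C3: "0 < C3" "\<And>f g b. hol f \<Longrightarrow> hol g \<Longrightarrow> cmod b < 1 \<Longrightarrow>
      energy q (volterra g f) b \<le> ennreal C3 * km (Dn q (\<lambda>z. cut f z * cut (deriv g) z)) b"
    "\<And>f g b. hol f \<Longrightarrow> hol g \<Longrightarrow> cmod b < 1 \<Longrightarrow>
      km (Dn q (\<lambda>z. cut f z * cut (deriv g) z)) b \<le> ennreal C3 * energy q (volterra g f) b"
    by (fact volterra_energy[OF q])
  obtain C4 where C4: "0 < C4" "\<And>f A. hol f \<Longrightarrow> 0 \<le> A \<Longrightarrow> (\<And>b. cmod b < 1 \<Longrightarrow> energy q f b \<le> ennreal (A * (1 - cmod b))) \<Longrightarrow>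
    tent_norm q \<omega> f \<le> ennreal (C4 * A powr (1 / q))"
    by (fact tent_norm_le_of_energy[OF q])
  have main: "energy q (volterra g f) b \<le> ennreal (C3 * (C2 * B powr q * (C1 * A powr p) powr (q/p - 1))) * energy p f b"
    if g: "hol g" and f: "hol f" and A: "0 < A" and B: "0 < B"
      and gB: "bloch_sup p q \<omega> g \<le> ennreal B" and fA: "tent_norm p \<omega> f \<le> ennreal A" and b: "cmod b < 1" for g f A B b
  proof -
    have "km (Dn q (\<lambda>z. cut f z * cut (deriv g) z)) b \<le> ennreal (C2 * B powr q * (C1 * A powr p) powr (q/p - 1)) * km (En p (cut f)) b"
    proof (rule C2(2)[OF cut_holomorphic[OF f] cut_measurable[OF f] _ _ _ _ b])
      show "cmod (cut (deriv g) z) * (1 - cmod z) * w (cmod z) powr (1/q - 1/p) \<le> B" if "cmod z < 1" for z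
        using gB bloch_sup_le_iff[of B p q g] B that by simp
      show "km (En p (cut f)) b \<le> ennreal (C1 * A powr p * (1 - cmod b))" if "cmod b < 1" for b
        using C1(2)[OF f _ fA that] A unfolding energy_def by simp
    qed (use C1 B in auto)
    hence "energy q (volterra g f) b \<le> ennreal C3 * (ennreal (C2 * B powr q * (C1 * A powr p) powr (q/p - 1)) * energy p f b)"
      unfolding energy_def[of p] by (intro order_trans[OF C3(2)[OF f g b]] mult_left_mono) auto
    also have "... = ennreal (C3 * (C2 * B powr q * (C1 * A powr p) powr (q/p - 1))) * energy p f b"
      by (simp only: ennreal_mult'[OF less_imp_le[OF C3(1)]] mult.assoc)
    finally show ?thesis .
  qed
  show ?thesis
  proof (rule that[of "C4 * (C3 * C2 * C1 powr (q / p)) powr (1 / q)"])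
    show "0 < C4 * (C3 * C2 * C1 powr (q / p)) powr (1 / q)" using C1 C2 C3 C4 by simp
    fix g f A B assume g: "hol g" and A: "0 < A" and B: "0 < B"
      and gB: "bloch_sup p q \<omega> g \<le> ennreal B" and fA: "tent_norm p \<omega> f \<le> ennreal A"
    {
      assume f: "hol f"
      have "tent_norm q \<omega> (volterra g f) \<le> ennreal (C4 * (C3 * C2 * C1 powr (q / p) * (B * A) powr q) powr (1 / q))"
      proof (rule C4(2)[OF volterra_primitive(1)[OF f g]])
        fix b :: complex assume b: "cmod b < 1"
        have "energy q (volterra g f) b \<le> ennreal (C3 * (C2 * B powr q * (C1 * A powr p) powr (q/p - 1))) * ennreal (C1 * A powr p * (1 - cmod b))"
          using A by (intro order_trans[OF main[OF g f A B gB fA b]] mult_left_mono C1(2)[OF f _ fA b]) auto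
        also have "... = ennreal (C3 * (C2 * B powr q * (C1 * A powr p) powr (q/p - 1)) * (C1 * A powr p * (1 - cmod b)))"
          using C2 C3 by (intro ennreal_mult'[symmetric]) auto
        also have "C3 * (C2 * B powr q * (C1 * A powr p) powr (q/p - 1)) * (C1 * A powr p * (1 - cmod b)) = C3 * C2 * C1 powr (q / p) * (B * A) powr q * (1 - cmod b)"
        proof -
          have "X powr (q/p - 1) * X = X powr (q/p)" if "X > 0" for X :: real using that by (simp add: powr_diff)
          from this[of "C1 * A powr p"] have e: "(C1 * A powr p) powr (q/p - 1) * (C1 * A powr p) = C1 powr (q/p) * A powr q"
            using C1 A p by (simp add: powr_mult powr_powr)
          have alg: "C3 * (C2 * Bq * Y) * (X * d) = C3 * C2 * Bq * d * (Y * X)" for Bq X Y d :: real by (simp only: mult_ac)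
          show ?thesis unfolding alg e powr_mult[of B] by (simp only: mult_ac)
        qed
        finally show "energy q (volterra g f) b \<le> ennreal (C3 * C2 * C1 powr (q / p) * (B * A) powr q * (1 - cmod b))" .
      qed (use C2 C3 in simp)
      also have "C4 * (C3 * C2 * C1 powr (q / p) * (B * A) powr q) powr (1 / q) = C4 * (C3 * C2 * C1 powr (q / p)) powr (1 / q) * B * A"
      proof -
        have *: "(X * (B * A) powr q) powr (1 / q) = X powr (1 / q) * (B * A)" for X
          unfolding powr_mult[of X] powr_powr using q A B by simp
        show ?thesis unfolding * by (simp only: mult.assoc)
      qed
      finally show "tent_norm q \<omega> (volterra g f) \<le> ennreal (C4 * (C3 * C2 * C1 powr (q / p)) powr (1 / q) * B * A)" .
    }
    assume f0: "f \<in> AT_zero p \<omega>"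
    hence finf: "f \<in> AT_inf p \<omega>" using AT_zero_subset by blast
    hence f: "hol f" unfolding AT_inf_iff by simp
    have v: "vanishing (\<lambda>b. ennreal (1 / (1 - cmod b)) * energy p f b)" using vanishing_energy_iff[OF p finf] f0 by blast
    show "vanishing (\<lambda>b. ennreal (1 / (1 - cmod b)) * energy q (volterra g f) b)"
    proof (rule vanishing_mono[OF v])
      show "ennreal (1 / (1 - cmod a)) * energy q (volterra g f) a \<le> ennreal (C3 * (C2 * B powr q * (C1 * A powr p) powr (q/p - 1))) * (ennreal (1 / (1 - cmod a)) * energy p f a)"
        if a: "cmod a < 1" for a
        by (subst mult.left_commute) (intro mult_left_mono main[OF g f A B gB fA a], simp)
    qed (use C2 C3 in simp)
  qed
qed

lemma bloch_sup_le_volterra: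
  assumes p: "0 < p" and q: "0 < q"
  obtains C where "0 < C" "\<And>g c. hol g \<Longrightarrow> 0 \<le> c \<Longrightarrow>
    (\<And>f. f \<in> AT_zero p \<omega> \<Longrightarrow> tent_norm p \<omega> f \<le> 1 \<Longrightarrow> tent_norm q \<omega> (volterra g f) \<le> ennreal c) \<Longrightarrow>
    bloch_sup p q \<omega> g \<le> ennreal (C * c)"
proof -
  obtain C1 where C1: "0 < C1" "\<And>g c. hol g \<Longrightarrow> 0 \<le> c \<Longrightarrow>
    (\<And>f. f \<in> AT_zero p \<omega> \<Longrightarrow> tent_norm p \<omega> f \<le> 1 \<Longrightarrow> tent_norm q \<omega> (volterra g f) \<le> ennreal c) \<Longrightarrow>
    embeds p q (cut (deriv g)) (C1 * c powr q)"
    by (fact embeds_of_volterra[OF p q])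
  obtain C2 where C2: "0 < C2" "\<And>G B a. hol G \<Longrightarrow> G \<in> borel_measurable borel \<Longrightarrow> 0 \<le> B \<Longrightarrow> embeds p q G B \<Longrightarrow> cmod a < 1 \<Longrightarrow>
    (cmod (G a) * (1 - cmod a)) powr q * w (cmod a) powr (1 - q / p) \<le> C2 * B"
    by (fact necessity_bloch[OF p q])
  show ?thesis
  proof (rule that[of "(C2 * C1) powr (1 / q)"])
    show "0 < (C2 * C1) powr (1 / q)" using C1 C2 by simp
    fix g c assume g: "hol g" and c: "0 \<le> c"
      and bd: "\<And>f. f \<in> AT_zero p \<omega> \<Longrightarrow> tent_norm p \<omega> f \<le> 1 \<Longrightarrow> tent_norm q \<omega> (volterra g f) \<le> ennreal c"
    have e: "embeds p q (cut (deriv g)) (C1 * c powr q)" by (rule C1(2)[OF g c bd])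
    note g' = deriv_holomorphic[OF g]
    show "bloch_sup p q \<omega> g \<le> ennreal ((C2 * C1) powr (1 / q) * c)"
    proof (subst bloch_sup_le_iff, use c in simp, intro allI impI)
      fix z :: complex assume z: "cmod z < 1"
      define X where "X = cmod (deriv g z) * (1 - cmod z)"
      define Y where "Y = w (cmod z)"
      have X: "X \<ge> 0" "Y > 0" unfolding X_def Y_def using z w_pos by auto
      have "X powr q * Y powr (1 - q / p) \<le> C2 * (C1 * c powr q)"
        using C2(2)[OF cut_holomorphic[OF g'] cut_measurable[OF g'] _ e z] C1 z unfolding X_def Y_def by simp
      hence "(X powr q * Y powr (1 - q / p)) powr (1 / q) \<le> (C2 * C1 * c powr q) powr (1 / q)"
        using q by (intro powr_mono2) (auto simp: mult.assoc)
      also have "(X powr q * Y powr (1 - q / p)) powr (1 / q) = X * Y powr (1 / q - 1 / p)"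
      proof -
        have "(1 - q / p) * (1 / q) = 1 / q - 1 / p" using p q by (simp add: field_simps)
        thus ?thesis unfolding powr_mult powr_powr using q X by simp
      qed
      also have "(C2 * C1 * c powr q) powr (1 / q) = (C2 * C1) powr (1 / q) * c"
        unfolding powr_mult[of "C2 * C1"] powr_powr using q c by simp
      finally show "cmod (deriv g z) * (1 - cmod z) * w (cmod z) powr (1 / q - 1 / p) \<le> (C2 * C1) powr (1 / q) * c"
        unfolding X_def Y_def .
    qed
  qed
qed

text \<open>For situations where F controls G only up to an error that can be made arbitrarily small
  at the expense of the constant, as after Young's inequality.\<close>

lemma vanishing_approx:
  assumes v: "vanishing F" and approx: "\<And>\<eta>. 0 < \<eta> \<Longrightarrow> \<exists>K\<ge>0. \<forall>a. cmod a < 1 \<longrightarrow> G a \<le> ennreal K * F a + ennreal \<eta>"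
  shows "vanishing G"
  unfolding vanishing_def
proof (intro allI impI)
  fix \<epsilon> :: real assume \<epsilon>: "0 < \<epsilon>"
  obtain K where K: "K \<ge> 0" "\<And>a. cmod a < 1 \<Longrightarrow> G a \<le> ennreal K * F a + ennreal (\<epsilon> / 2)" using approx[of "\<epsilon> / 2"] \<epsilon> by auto
  have "vanishing (\<lambda>a. ennreal K * F a)" by (rule vanishing_mono[OF v _ K(1)]) simp
  then obtain \<delta> where \<delta>: "\<delta> > 0" "\<And>a. 1 - \<delta> < cmod a \<Longrightarrow> cmod a < 1 \<Longrightarrow> ennreal K * F a \<le> ennreal (\<epsilon> / 2)"
    using \<epsilon> unfolding vanishing_def by (metis half_gt_zero)
  show "\<exists>\<delta>>0. \<forall>a. 1 - \<delta> < cmod a \<longrightarrow> cmod a < 1 \<longrightarrow> G a \<le> ennreal \<epsilon>"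
  proof (intro exI[of _ \<delta>] conjI allI impI \<delta>(1))
    fix a assume a: "1 - \<delta> < cmod a" "cmod a < 1"
    have "G a \<le> ennreal (\<epsilon> / 2) + ennreal (\<epsilon> / 2)" by (rule order_trans[OF K(2)[OF a(2)]]) (intro add_mono \<delta>(2) a order_refl)
    also have "... = ennreal \<epsilon>" using \<epsilon> by (simp add: ennreal_plus[symmetric] del: ennreal_plus)
    finally show "G a \<le> ennreal \<epsilon>" .
  qed
qed

text \<open>In the second part the decay comes from f alone: t is chosen so that the term with g
  equals \<eta>, and the energy of f makes the other term vanish at the boundary.\<close>

lemma volterra_bounded_tent:
  assumes q: "0 < q" "q < p" and s: "s = p * q / (p - q)"
  obtains C where "0 < C" "\<And>g f A B. hol g \<Longrightarrow> hol f \<Longrightarrow> 0 < A \<Longrightarrow> 0 < B \<Longrightarrow>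
      tent_norm s \<omega> (\<lambda>z. g z - g 0) \<le> ennreal B \<Longrightarrow> tent_norm p \<omega> f \<le> ennreal A \<Longrightarrow> tent_norm q \<omega> (volterra g f) \<le> ennreal (C * B * A)"
    "\<And>g f A B. hol g \<Longrightarrow> f \<in> AT_zero p \<omega> \<Longrightarrow> 0 < A \<Longrightarrow> 0 < B \<Longrightarrow>
      tent_norm s \<omega> (\<lambda>z. g z - g 0) \<le> ennreal B \<Longrightarrow> tent_norm p \<omega> f \<le> ennreal A \<Longrightarrow>
      vanishing (\<lambda>b. ennreal (1 / (1 - cmod b)) * energy q (volterra g f) b)"
proof -
  have p: "0 < p" using q by simp
  have sp: "0 < s" unfolding s using q by simp
  obtain C1 where C1: "0 < C1" "\<And>f B b. hol f \<Longrightarrow> 0 \<le> B \<Longrightarrow> tent_norm p \<omega> f \<le> ennreal B \<Longrightarrow> cmod b < 1 \<Longrightarrow>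
    energy p f b \<le> ennreal (C1 * B powr p * (1 - cmod b))"
    by (fact energy_le_of_tent_norm[OF p])
  obtain C2 where C2: "0 < C2" "\<And>f B b. hol f \<Longrightarrow> 0 \<le> B \<Longrightarrow> tent_norm s \<omega> f \<le> ennreal B \<Longrightarrow> cmod b < 1 \<Longrightarrow>
    energy s f b \<le> ennreal (C2 * B powr s * (1 - cmod b))"
    by (fact energy_le_of_tent_norm[OF sp])
  obtain C3 where C3: "0 < C3" "\<And>f g b. hol f \<Longrightarrow> hol g \<Longrightarrow> cmod b < 1 \<Longrightarrow>
      energy q (volterra g f) b \<le> ennreal C3 * km (Dn q (\<lambda>z. cut f z * cut (deriv g) z)) b"
    "\<And>f g b. hol f \<Longrightarrow> hol g \<Longrightarrow> cmod b < 1 \<Longrightarrow>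
      km (Dn q (\<lambda>z. cut f z * cut (deriv g) z)) b \<le> ennreal C3 * energy q (volterra g f) b"
    by (fact volterra_energy[OF q(1)])
  obtain C4 where C4: "0 < C4" "\<And>f A. hol f \<Longrightarrow> 0 \<le> A \<Longrightarrow> (\<And>b. cmod b < 1 \<Longrightarrow> energy q f b \<le> ennreal (A * (1 - cmod b))) \<Longrightarrow>
    tent_norm q \<omega> f \<le> ennreal (C4 * A powr (1 / q))"
    by (fact tent_norm_le_of_energy[OF q(1)])
  obtain C5 where C5: "0 < C5" "\<And>h F b. hol h \<Longrightarrow> h 0 = 0 \<Longrightarrow> F \<in> borel_measurable borel \<Longrightarrow>
      (\<And>z. cmod z < 1 \<Longrightarrow> F z = deriv h z) \<Longrightarrow> cmod b < 1 \<Longrightarrow> energy s h b \<le> ennreal C5 * km (Dn s F) b"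
    "\<And>h F b. hol h \<Longrightarrow> (\<And>z. cmod z < 1 \<Longrightarrow> F z = deriv h z) \<Longrightarrow> cmod b < 1 \<Longrightarrow>
      km (Dn s F) b \<le> ennreal C5 * energy s h b"
    by (fact energy_deriv[OF sp])
  have main: "energy q (volterra g f) b \<le> ennreal (C3 * t powr p) * energy p f b + ennreal (C3 * C5 * C2 * (t powr - s * B powr s) * (1 - cmod b))"
    if g: "hol g" and f: "hol f" and B: "0 < B"
      and gB: "tent_norm s \<omega> (\<lambda>z. g z - g 0) \<le> ennreal B" and b: "cmod b < 1" and t: "0 < t" for g f B b t
  proof -
    note g' = deriv_holomorphic[OF g]
    have h: "(\<lambda>z. g z - g 0) holomorphic_on unit_disk" using g by (intro holomorphic_intros)
    have dh: "cut (deriv g) z = deriv (\<lambda>z. g z - g 0) z" if "cmod z < 1" for z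
    proof -
      have "g field_differentiable (at z)" using g that by (auto intro!: holomorphic_on_imp_differentiable_at[where s=unit_disk])
      thus ?thesis using that by simp
    qed
    have "km (Dn s (cut (deriv g))) b \<le> ennreal C5 * ennreal (C2 * B powr s * (1 - cmod b))"
      by (rule order_trans[OF C5(3)[OF h dh b]]) (use B in \<open>auto intro!: mult_left_mono C2(2)[OF h _ gB b]\<close>)
    hence "ennreal (t powr - s) * km (Dn s (cut (deriv g))) b \<le> ennreal (t powr - s) * (ennreal C5 * ennreal (C2 * B powr s * (1 - cmod b)))"
      by (intro mult_left_mono) auto
    hence "km (Dn q (\<lambda>z. cut f z * cut (deriv g) z)) b \<le> ennreal (t powr p) * km (En p (cut f)) b + ennreal (t powr - s) * (ennreal C5 * ennreal (C2 * B powr s * (1 - cmod b)))"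
      by (intro order_trans[OF sufficiency_tent[OF q s cut_measurable[OF f] cut_measurable[OF g'] t]] add_left_mono)
    hence "energy q (volterra g f) b \<le> ennreal C3 * (ennreal (t powr p) * energy p f b + ennreal (t powr - s) * (ennreal C5 * ennreal (C2 * B powr s * (1 - cmod b))))"
      unfolding energy_def[of p] by (intro order_trans[OF C3(2)[OF f g b]] mult_left_mono) auto
    also have "... = ennreal (C3 * t powr p) * energy p f b + ennreal (C3 * (t powr - s * (C5 * (C2 * B powr s * (1 - cmod b)))))"
      by (simp only: distrib_left ennreal_mult'[OF less_imp_le[OF C3(1)]] ennreal_mult'[OF powr_ge_zero] ennreal_mult'[OF less_imp_le[OF C5(1)]] mult.assoc)
    also have "C3 * (t powr - s * (C5 * (C2 * B powr s * (1 - cmod b)))) = C3 * C5 * C2 * (t powr - s * B powr s) * (1 - cmod b)" by (simp only: mult_ac)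
    finally show ?thesis .
  qed
  define L where "L = C3 * C1 + C3 * C5 * C2"
  have L: "L > 0" unfolding L_def using C1 C2 C3 C5 by (simp add: add_pos_pos)
  show ?thesis
  proof (rule that[of "C4 * L powr (1 / q)"])
    show "0 < C4 * L powr (1 / q)" using C4 L by simp
    fix g f A B assume g: "hol g" and A: "0 < A" and B: "0 < B"
      and gB: "tent_norm s \<omega> (\<lambda>z. g z - g 0) \<le> ennreal B" and fA: "tent_norm p \<omega> f \<le> ennreal A"
    {
      assume f: "hol f"
      have "tent_norm q \<omega> (volterra g f) \<le> ennreal (C4 * (L * (B * A) powr q) powr (1 / q))"
      proof (rule C4(2)[OF volterra_primitive(1)[OF f g]])
        fix b :: complex assume b: "cmod b < 1"
        \<comment> \<open>The choice of \<open>t\<close> that balances the two terms.\<close>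
        define t where "t = B powr (q / p) * A powr (q / p - 1)"
        have t: "0 < t" unfolding t_def using A B by simp
        have t1: "t powr p * A powr p = (B * A) powr q"
        proof -
          have "t powr p = B powr q * A powr (q - p)" unfolding t_def powr_mult powr_powr using p by (simp add: left_diff_distrib)
          thus ?thesis using A by (simp add: powr_mult powr_diff)
        qed
        have t2: "t powr - s * B powr s = (B * A) powr q"
        proof -
          have e: "q / p * s = s - q" "(q / p - 1) * s = - q" unfolding s using q by (simp_all add: field_simps)
          have "t powr s = B powr (s - q) * A powr (- q)" unfolding t_def powr_mult powr_powr e ..
          hence "t powr - s = B powr q / B powr s * A powr q" by (simp add: powr_minus_divide powr_diff)
          thus ?thesis using B by (simp add: powr_mult)
        qed
        have "energy q (volterra g f) b \<le> ennreal (C3 * t powr p) * ennreal (C1 * A powr p * (1 - cmod b)) + ennreal (C3 * C5 * C2 * (t powr - s * B powr s) * (1 - cmod b))"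
          using A by (intro order_trans[OF main[OF g f B gB b t]] add_right_mono mult_left_mono C1(2)[OF f _ fA b]) auto
        also have "... = ennreal (C3 * t powr p * (C1 * A powr p * (1 - cmod b)) + C3 * C5 * C2 * (t powr - s * B powr s) * (1 - cmod b))"
          using C1 C2 C3 C5 b by (subst ennreal_mult'[symmetric], simp, subst ennreal_plus[symmetric]) auto
        also have "C3 * t powr p * (C1 * A powr p * (1 - cmod b)) + C3 * C5 * C2 * (t powr - s * B powr s) * (1 - cmod b) = L * (B * A) powr q * (1 - cmod b)"
        proof -
          have "C3 * x * (C1 * y * d) + C3 * C5 * C2 * z * d = L * z * d" if "x * y = z" for x y z d
            unfolding L_def that[symmetric] by (simp add: algebra_simps)
          from this[OF t1] show ?thesis unfolding t2 .
        qed
        finally show "energy q (volterra g f) b \<le> ennreal (L * (B * A) powr q * (1 - cmod b))" .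
      qed (use L in simp)
      also have "C4 * (L * (B * A) powr q) powr (1 / q) = C4 * L powr (1 / q) * B * A"
        unfolding powr_mult[of L] powr_powr using q A B by simp
      finally show "tent_norm q \<omega> (volterra g f) \<le> ennreal (C4 * L powr (1 / q) * B * A)" .
    }
    assume f0: "f \<in> AT_zero p \<omega>"
    hence finf: "f \<in> AT_inf p \<omega>" using AT_zero_subset by blast
    hence f: "hol f" unfolding AT_inf_iff by simp
    have v: "vanishing (\<lambda>b. ennreal (1 / (1 - cmod b)) * energy p f b)" using vanishing_energy_iff[OF p finf] f0 by blast
    show "vanishing (\<lambda>b. ennreal (1 / (1 - cmod b)) * energy q (volterra g f) b)"
    proof (rule vanishing_approx[OF v])
      fix \<eta> :: real assume \<eta>: "0 < \<eta>"
      define D where "D = C3 * C5 * C2 * B powr s"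
      have D: "D > 0" unfolding D_def using C2 C3 C5 B by simp
      define t where "t = (\<eta> / D) powr (- (1 / s))"
      have t: "0 < t" unfolding t_def using \<eta> D by simp
      have ts: "t powr - s = \<eta> / D" unfolding t_def powr_powr using sp \<eta> D by simp
      show "\<exists>K\<ge>0. \<forall>a. cmod a < 1 \<longrightarrow> ennreal (1 / (1 - cmod a)) * energy q (volterra g f) a \<le> ennreal K * (ennreal (1 / (1 - cmod a)) * energy p f a) + ennreal \<eta>"
      proof (intro exI[of _ "C3 * t powr p"] conjI allI impI)
        show "0 \<le> C3 * t powr p" using C3 by simp
        fix a :: complex assume a: "cmod a < 1"
        have "C3 * C5 * C2 * (t powr - s * B powr s) * (1 - cmod a) = D * (t powr - s) * (1 - cmod a)" unfolding D_def by (simp only: mult_ac)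
        also have "... = \<eta> * (1 - cmod a)" unfolding ts using D by simp
        finally have e: "C3 * C5 * C2 * (t powr - s * B powr s) * (1 - cmod a) = \<eta> * (1 - cmod a)" .
        have "ennreal (1 / (1 - cmod a)) * energy q (volterra g f) a \<le> ennreal (1 / (1 - cmod a)) * (ennreal (C3 * t powr p) * energy p f a + ennreal (\<eta> * (1 - cmod a)))"
          using main[OF g f B gB a t] unfolding e by (intro mult_left_mono) auto
        also have "... = ennreal (C3 * t powr p) * (ennreal (1 / (1 - cmod a)) * energy p f a) + ennreal (1 / (1 - cmod a)) * ennreal (\<eta> * (1 - cmod a))"
          by (simp only: distrib_left mult.left_commute)
        also have "ennreal (1 / (1 - cmod a)) * ennreal (\<eta> * (1 - cmod a)) = ennreal \<eta>" using a \<eta> by (subst ennreal_mult'[symmetric]) auto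
        finally show "ennreal (1 / (1 - cmod a)) * energy q (volterra g f) a \<le> ennreal (C3 * t powr p) * (ennreal (1 / (1 - cmod a)) * energy p f a) + ennreal \<eta>" .
      qed
    qed
  qed
qed

text \<open>The exponents close up: c^q enters the embedding, its power s/q gives c^s in the energy
  of g - g(0), and the s-th root is linear in c.\<close>

lemma tent_norm_le_volterra:
  assumes q: "0 < q" "q < p" and s: "s = p * q / (p - q)"
  obtains C where "0 < C" "\<And>g c. hol g \<Longrightarrow> 0 \<le> c \<Longrightarrow>
    (\<And>f. f \<in> AT_zero p \<omega> \<Longrightarrow> tent_norm p \<omega> f \<le> 1 \<Longrightarrow> tent_norm q \<omega> (volterra g f) \<le> ennreal c) \<Longrightarrow>
    tent_norm s \<omega> (\<lambda>z. g z - g 0) \<le> ennreal (C * c)"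
proof -
  have p: "0 < p" using q by simp
  have sp: "0 < s" unfolding s using q by simp
  obtain C1 where C1: "0 < C1" "\<And>g c. hol g \<Longrightarrow> 0 \<le> c \<Longrightarrow>
    (\<And>f. f \<in> AT_zero p \<omega> \<Longrightarrow> tent_norm p \<omega> f \<le> 1 \<Longrightarrow> tent_norm q \<omega> (volterra g f) \<le> ennreal c) \<Longrightarrow>
    embeds p q (cut (deriv g)) (C1 * c powr q)"
    by (fact embeds_of_volterra[OF p q(1)])
  obtain C2 where C2: "0 < C2" "\<And>G B b. hol G \<Longrightarrow> G \<in> borel_measurable borel \<Longrightarrow> 0 \<le> B \<Longrightarrow> embeds p q G B \<Longrightarrow>
    cmod b < 1 \<Longrightarrow> km (Dn s G) b \<le> ennreal (C2 * B powr (s / q) * (1 - cmod b))"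
    by (fact necessity_tent[OF q s])
  obtain C3 where C3: "0 < C3" "\<And>h F b. hol h \<Longrightarrow> h 0 = 0 \<Longrightarrow> F \<in> borel_measurable borel \<Longrightarrow>
      (\<And>z. cmod z < 1 \<Longrightarrow> F z = deriv h z) \<Longrightarrow> cmod b < 1 \<Longrightarrow> energy s h b \<le> ennreal C3 * km (Dn s F) b"
    "\<And>h F b. hol h \<Longrightarrow> (\<And>z. cmod z < 1 \<Longrightarrow> F z = deriv h z) \<Longrightarrow> cmod b < 1 \<Longrightarrow>
      km (Dn s F) b \<le> ennreal C3 * energy s h b"
    by (fact energy_deriv[OF sp])
  obtain C4 where C4: "0 < C4" "\<And>f A. hol f \<Longrightarrow> 0 \<le> A \<Longrightarrow> (\<And>b. cmod b < 1 \<Longrightarrow> energy s f b \<le> ennreal (A * (1 - cmod b))) \<Longrightarrow>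
    tent_norm s \<omega> f \<le> ennreal (C4 * A powr (1 / s))"
    by (fact tent_norm_le_of_energy[OF sp])
  define L where "L = C3 * (C2 * C1 powr (s / q))"
  have L: "L > 0" unfolding L_def using C1 C2 C3 by simp
  show ?thesis
  proof (rule that[of "C4 * L powr (1 / s)"])
    show "0 < C4 * L powr (1 / s)" using C4 L by simp
    fix g c assume g: "hol g" and c: "0 \<le> c"
      and bd: "\<And>f. f \<in> AT_zero p \<omega> \<Longrightarrow> tent_norm p \<omega> f \<le> 1 \<Longrightarrow> tent_norm q \<omega> (volterra g f) \<le> ennreal c"
    have e: "embeds p q (cut (deriv g)) (C1 * c powr q)" by (rule C1(2)[OF g c bd])
    note g' = deriv_holomorphic[OF g]
    have h: "(\<lambda>z. g z - g 0) holomorphic_on unit_disk" using g by (intro holomorphic_intros)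
    have dh: "cut (deriv g) z = deriv (\<lambda>z. g z - g 0) z" if "cmod z < 1" for z
    proof -
      have "g field_differentiable (at z)" using g that by (auto intro!: holomorphic_on_imp_differentiable_at[where s=unit_disk])
      thus ?thesis using that by simp
    qed
    have "tent_norm s \<omega> (\<lambda>z. g z - g 0) \<le> ennreal (C4 * (L * c powr s) powr (1 / s))"
    proof (rule C4(2)[OF h])
      fix b :: complex assume b: "cmod b < 1"
      have "energy s (\<lambda>z. g z - g 0) b \<le> ennreal C3 * km (Dn s (cut (deriv g))) b"
        by (rule C3(2)[OF h _ cut_measurable[OF g'] dh b]) simp
      also have "... \<le> ennreal C3 * ennreal (C2 * (C1 * c powr q) powr (s / q) * (1 - cmod b))"
        using C1 by (intro mult_left_mono C2(2)[OF cut_holomorphic[OF g'] cut_measurable[OF g'] _ e b]) auto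
      also have "... = ennreal (C3 * (C2 * (C1 * c powr q) powr (s / q) * (1 - cmod b)))" using C3 by (intro ennreal_mult'[symmetric]) simp
      also have "(C1 * c powr q) powr (s / q) = C1 powr (s / q) * c powr s" unfolding powr_mult powr_powr using q by simp
      also have "C3 * (C2 * (C1 powr (s / q) * c powr s) * (1 - cmod b)) = L * c powr s * (1 - cmod b)" unfolding L_def by (simp only: mult_ac)
      finally show "energy s (\<lambda>z. g z - g 0) b \<le> ennreal (L * c powr s * (1 - cmod b))" .
    qed (use L in simp)
    also have "C4 * (L * c powr s) powr (1 / s) = C4 * L powr (1 / s) * c"
      unfolding powr_mult[of L] powr_powr using sp c by simp
    finally show "tent_norm s \<omega> (\<lambda>z. g z - g 0) \<le> ennreal (C4 * L powr (1 / s) * c)" .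
  qed
qed

text \<open>The square at a has weighted mass at most a constant times (1-|a|) w(|a|), and w is
  bounded by a multiple of its value at 0.\<close>

lemma tent_mean_const:
  assumes a: "cmod a < 1"
  shows "tent_mean s \<omega> (\<lambda>z. d) a \<le> ennreal (cmod d powr s * (576 * pi * C0 * 12 powr \<beta> * (C0 * w 0)))"
proof -
  have "w (cmod a) \<le> C0 * ((1 - cmod a) / (1 - 0)) powr \<alpha> * w 0" using a by (intro w_lower) auto
  also have "... \<le> C0 * 1 * w 0" using C0 w_pos[of 0] alpha a by (intro mult_right_mono mult_left_mono powr_le1) auto
  finally have wa: "w (cmod a) \<le> C0 * w 0" by simp
  have "(\<integral>\<^sup>+z\<in>carleson_square a. Pn s (cut (\<lambda>z. d)) z \<partial>lborel)
      \<le> (\<integral>\<^sup>+z. ennreal (cmod d powr s) * (ennreal (\<phi> (cmod z)) * indicator {z. cmod (1 - cnj a * z) < 12 * (1 - cmod a)} z * indicator unit_disk z) \<partial>lborel)"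
  proof (intro nn_integral_mono)
    fix z
    show "Pn s (cut (\<lambda>z. d)) z * indicator (carleson_square a) z \<le> ennreal (cmod d powr s) * (ennreal (\<phi> (cmod z)) * indicator {z. cmod (1 - cnj a * z) < 12 * (1 - cmod a)} z * indicator unit_disk z)"
    proof (cases "z \<in> carleson_square a")
      case True
      note z = carleson_square_subset[OF a True]
      have "cmod (1 - cnj a * z) < 12 * (1 - cmod a)" using a by (intro le_less_trans[OF z(2)]) simp
      thus ?thesis using True z(1) unfolding Pn_def by (simp add: ennreal_mult')
    qed simp
  qed
  also have "... = ennreal (cmod d powr s) * (\<integral>\<^sup>+z\<in>unit_disk. ennreal (\<phi> (cmod z)) * indicator {z. cmod (1 - cnj a * z) < 12 * (1 - cmod a)} z \<partial>lborel)"
    by (rule nn_integral_cmult) measurable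
  also have "... \<le> ennreal (cmod d powr s) * ennreal (576 * pi * C0 * 12 powr \<beta> * (1 - cmod a) * w (cmod a))"
    by (intro mult_left_mono phi_kernel_ball a) auto
  also have "... = ennreal (cmod d powr s * (576 * pi * C0 * 12 powr \<beta> * (1 - cmod a) * w (cmod a)))" by (rule ennreal_mult'[symmetric]) simp
  also have "... \<le> ennreal (cmod d powr s * (576 * pi * C0 * 12 powr \<beta> * (1 - cmod a) * (C0 * w 0)))"
    using wa C0 a by (intro ennreal_leI mult_left_mono) auto
  also have "cmod d powr s * (576 * pi * C0 * 12 powr \<beta> * (1 - cmod a) * (C0 * w 0)) = cmod d powr s * (576 * pi * C0 * 12 powr \<beta> * (C0 * w 0)) * (1 - cmod a)"
    by (simp only: mult_ac)
  finally show ?thesis unfolding tent_mean_eq[OF a] tmean_def using a C0 w_pos[of 0] by (subst divide_pos_le_ennreal) auto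
qed

text \<open>The estimates concern g - g(0), membership concerns g; a constant makes the difference.
  To cover s < 1 as well, |x + y|^s is bounded by (2 max(|x|, |y|))^s.\<close>

lemma tent_norm_shift_finite:
  assumes s: "0 < s" and f: "hol f" and fin: "tent_norm s \<omega> f < \<infinity>"
  shows "tent_norm s \<omega> (\<lambda>z. f z + d) < \<infinity>"
proof -
  obtain B where B: "0 \<le> B" "tent_norm s \<omega> f \<le> ennreal B" using fin by (cases "tent_norm s \<omega> f") auto
  define D where "D = cmod d powr s * (576 * pi * C0 * 12 powr \<beta> * (C0 * w 0))"
  have D: "D \<ge> 0" unfolding D_def using C0 w_pos[of 0] by simp
  define E where "E = 2 powr s * (B powr s + D)"
  have E: "E \<ge> 0" unfolding E_def using D by simp
  have c: "(\<lambda>z. d) holomorphic_on unit_disk" by simp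
  note [measurable] = cut_measurable[OF f] cut_measurable[OF c]
  have "tent_norm s \<omega> (\<lambda>z. f z + d) \<le> ennreal (E powr (1 / s))"
  proof (subst tent_norm_le_iff[OF s], simp, intro allI impI)
    fix a assume a: "cmod a < 1"
    have "(\<integral>\<^sup>+z\<in>carleson_square a. Pn s (cut (\<lambda>z. f z + d)) z \<partial>lborel)
      \<le> (\<integral>\<^sup>+z. ennreal (2 powr s) * (Pn s (cut f) z * indicator (carleson_square a) z + Pn s (cut (\<lambda>z. d)) z * indicator (carleson_square a) z) \<partial>lborel)"
    proof (intro nn_integral_mono)
      fix z
      show "Pn s (cut (\<lambda>z. f z + d)) z * indicator (carleson_square a) z \<le> ennreal (2 powr s) * (Pn s (cut f) z * indicator (carleson_square a) z + Pn s (cut (\<lambda>z. d)) z * indicator (carleson_square a) z)"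
      proof (cases "z \<in> carleson_square a")
        case True
        note z = carleson_square_subset(1)[OF a True]
        define x y where "x = cmod (f z)" and "y = cmod d"
        have xy: "x \<ge> 0" "y \<ge> 0" unfolding x_def y_def by auto
        have "cmod (f z + d) powr s \<le> (2 * max x y) powr s"
          using norm_triangle_ineq[of "f z" d] s unfolding x_def y_def by (intro powr_mono2) auto
        also have "... = 2 powr s * max x y powr s" by (rule powr_mult)
        also have "... \<le> 2 powr s * (x powr s + y powr s)" by (intro mult_left_mono) (auto simp: max_def)
        finally have "cmod (f z + d) powr s * \<phi> (cmod z) \<le> 2 powr s * (x powr s + y powr s) * \<phi> (cmod z)"
          using phi_nonneg by (intro mult_right_mono) auto
        also have "... = 2 powr s * (x powr s * \<phi> (cmod z) + y powr s * \<phi> (cmod z))" by (simp add: algebra_simps)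
        finally have "Pn s (cut (\<lambda>z. f z + d)) z \<le> ennreal ..." unfolding Pn_def using z by (simp add: ennreal_leI)
        also have "... = ennreal (2 powr s) * (ennreal (x powr s * \<phi> (cmod z)) + ennreal (y powr s * \<phi> (cmod z)))"
          using phi_nonneg by (simp add: ennreal_mult' ennreal_plus)
        finally show ?thesis using True z unfolding Pn_def x_def y_def by simp
      qed simp
    qed
    also have "... = ennreal (2 powr s) * ((\<integral>\<^sup>+z\<in>carleson_square a. Pn s (cut f) z \<partial>lborel) + (\<integral>\<^sup>+z\<in>carleson_square a. Pn s (cut (\<lambda>z. d)) z \<partial>lborel))"
    proof -
      have "(\<integral>\<^sup>+z. ennreal (2 powr s) * (Pn s (cut f) z * indicator (carleson_square a) z + Pn s (cut (\<lambda>z. d)) z * indicator (carleson_square a) z) \<partial>lborel)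
        = ennreal (2 powr s) * (\<integral>\<^sup>+z. (Pn s (cut f) z * indicator (carleson_square a) z + Pn s (cut (\<lambda>z. d)) z * indicator (carleson_square a) z) \<partial>lborel)"
        by (rule nn_integral_cmult) measurable
      also have "(\<integral>\<^sup>+z. (Pn s (cut f) z * indicator (carleson_square a) z + Pn s (cut (\<lambda>z. d)) z * indicator (carleson_square a) z) \<partial>lborel)
        = (\<integral>\<^sup>+z\<in>carleson_square a. Pn s (cut f) z \<partial>lborel) + (\<integral>\<^sup>+z\<in>carleson_square a. Pn s (cut (\<lambda>z. d)) z \<partial>lborel)"
        by (rule nn_integral_add) measurable
      finally show ?thesis .
    qed
    finally have "tmean (Pn s (cut (\<lambda>z. f z + d))) a \<le> ennreal (1 / (1 - cmod a)) * ..."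
      unfolding tmean_def by (rule mult_left_mono) simp
    also have "... = ennreal (2 powr s) * (tent_mean s \<omega> f a + tent_mean s \<omega> (\<lambda>z. d) a)"
      unfolding tent_mean_eq[OF a] tmean_def by (simp only: distrib_left mult.left_commute)
    also have "... \<le> ennreal (2 powr s) * (ennreal (B powr s) + ennreal D)"
      using B a tent_norm_le_iff[OF s B(1), of \<omega> f] unfolding D_def by (intro mult_left_mono add_mono tent_mean_const) auto
    also have "... = ennreal E" unfolding E_def using D by (simp add: ennreal_mult')
    also have "E = (E powr (1 / s)) powr s" using E s by (simp add: powr_powr)
    finally show "tent_mean s \<omega> (\<lambda>z. f z + d) a \<le> ennreal ((E powr (1 / s)) powr s)" unfolding tent_mean_eq[OF a] .
  qed
  thus ?thesis by (auto intro: le_less_trans)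
qed

lemma AT_inf_iff_increment:
  assumes s: "0 < s" and g: "hol g"
  shows "g \<in> AT_inf s \<omega> \<longleftrightarrow> tent_norm s \<omega> (\<lambda>z. g z - g 0) < \<infinity>"
proof -
  have h: "(\<lambda>z. g z - g 0) holomorphic_on unit_disk" using g by (intro holomorphic_intros)
  show ?thesis
    using tent_norm_shift_finite[OF s g, of "- g 0"] tent_norm_shift_finite[OF s h, of "g 0"] g
    by (auto simp: AT_inf_iff)
qed

text \<open>The quantitative lemmas take positive finite bounds. This turns them into a linear
  inequality in the norm y itself, which may be 0 or infinite.\<close>

lemma le_of_le_all_larger:
  assumes K: "0 < k" and le: "\<And>b. 0 < b \<Longrightarrow> y \<le> ennreal b \<Longrightarrow> x \<le> ennreal (k * b)"
  shows "x \<le> ennreal k * y"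
proof (rule ennreal_le_epsilon)
  fix e :: real assume y: "ennreal k * y < top" and e: "0 < e"
  have "y \<noteq> top" using y K by (auto simp: ennreal_mult_top)
  then obtain r where r: "0 \<le> r" "y = ennreal r" by (cases y) auto
  have "x \<le> ennreal (k * (r + e / k))" by (rule le) (use r e K in \<open>auto intro!: add_nonneg_pos ennreal_leI\<close>)
  also have "k * (r + e / k) = k * r + e" using K by (simp add: field_simps)
  also have "ennreal (k * r + e) = ennreal k * y + ennreal e" using r e K by (simp add: ennreal_mult')
  finally show "x \<le> ennreal k * y + ennreal e" .
qed

section \<open>The characterization of bounded Volterra operators\<close>

abbreviation (input) bounded_inf :: "real \<Rightarrow> real \<Rightarrow> (complex \<Rightarrow> complex) \<Rightarrow> bool"
  where "bounded_inf p q g \<equiv> bounded_operator (AT_inf p \<omega>) (tent_norm p \<omega>) (AT_inf q \<omega>) (tent_norm q \<omega>) (volterra g)"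

abbreviation (input) bounded_zero :: "real \<Rightarrow> real \<Rightarrow> (complex \<Rightarrow> complex) \<Rightarrow> bool"
  where "bounded_zero p q g \<equiv> bounded_operator (AT_zero p \<omega>) (tent_norm p \<omega>) (AT_zero q \<omega>) (tent_norm q \<omega>) (volterra g)"

abbreviation (input) volterra_norm :: "real \<Rightarrow> real \<Rightarrow> (complex \<Rightarrow> complex) \<Rightarrow> ennreal"
  where "volterra_norm p q g \<equiv> operator_norm (AT_inf p \<omega>) (tent_norm p \<omega>) (tent_norm q \<omega>) (volterra g)"

text \<open>
  The quantity \<open>Q g\<close> stands for either of the two function-theoretic conditions on the symbol.
\<close>

lemma volterra_characterization:
  fixes Q :: "(complex \<Rightarrow> complex) \<Rightarrow> ennreal"
  assumes q: "0 < q" and K: "0 < K1" "0 < K2"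
    and bound: "\<And>g f A B. hol g \<Longrightarrow> hol f \<Longrightarrow> 0 < A \<Longrightarrow> 0 < B \<Longrightarrow>
      Q g \<le> ennreal B \<Longrightarrow> tent_norm p \<omega> f \<le> ennreal A \<Longrightarrow> tent_norm q \<omega> (volterra g f) \<le> ennreal (K1 * B * A)"
    and zero: "\<And>g f A B. hol g \<Longrightarrow> f \<in> AT_zero p \<omega> \<Longrightarrow> 0 < A \<Longrightarrow> 0 < B \<Longrightarrow>
      Q g \<le> ennreal B \<Longrightarrow> tent_norm p \<omega> f \<le> ennreal A \<Longrightarrow> vanishing (\<lambda>b. ennreal (1 / (1 - cmod b)) * energy q (volterra g f) b)"
    and nec: "\<And>g c. hol g \<Longrightarrow> 0 \<le> c \<Longrightarrow>
      (\<And>f. f \<in> AT_zero p \<omega> \<Longrightarrow> tent_norm p \<omega> f \<le> 1 \<Longrightarrow> tent_norm q \<omega> (volterra g f) \<le> ennreal c) \<Longrightarrow> Q g \<le> ennreal (K2 * c)"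
  shows "(\<forall>g. hol g \<longrightarrow> (bounded_inf p q g \<longleftrightarrow> bounded_zero p q g) \<and> (bounded_inf p q g \<longleftrightarrow> Q g < \<infinity>))"
    and "\<exists>C>0. \<forall>g. hol g \<longrightarrow> bounded_inf p q g \<longrightarrow>
      comparable_within C (volterra_norm p q g) (Q g)"
proof -
  have bound': "tent_norm q \<omega> (volterra g f) \<le> ennreal (K1 * B) * tent_norm p \<omega> f"
    if g: "hol g" and f: "f \<in> AT_inf p \<omega>" and B: "0 < B" "Q g \<le> ennreal B" for g f B
    using bound[OF g _ _ B] f K B unfolding AT_inf_iff by (intro le_of_le_all_larger) auto
  have fin: "\<exists>A>0. tent_norm p \<omega> f \<le> ennreal A" if "f \<in> AT_inf p \<omega>" for f
  proof -
    have "tent_norm p \<omega> f < \<infinity>" using that AT_inf_iff by blast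
    then obtain r where r: "0 \<le> r" "tent_norm p \<omega> f = ennreal r" by (cases "tent_norm p \<omega> f") auto
    have "tent_norm p \<omega> f \<le> ennreal (r + 1)" unfolding r(2) by (rule ennreal_leI) simp
    thus ?thesis using r(1) by (intro exI[of _ "r + 1"]) simp
  qed
  have suff: "bounded_inf p q g \<and> bounded_zero p q g" if g: "hol g" and Q: "Q g < \<infinity>" for g
  proof -
    obtain r where r: "0 \<le> r" "Q g = ennreal r" using Q by (cases "Q g") auto
    \<comment> \<open>One is added because the bounds ask for B > 0, while Q g may be 0.\<close>
    define B where "B = r + 1"
    have B: "0 < B" "Q g \<le> ennreal B" unfolding B_def r(2) using r(1) by (auto intro!: ennreal_leI)
    note bd = bound'[OF g _ B]
    have inf: "volterra g f \<in> AT_inf q \<omega>" if f: "f \<in> AT_inf p \<omega>" for f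
    proof -
      have fh: "hol f" using f unfolding AT_inf_iff by simp
      have "ennreal (K1 * B) * tent_norm p \<omega> f < \<infinity>" using f unfolding AT_inf_iff by (simp add: ennreal_mult_less_top)
      thus ?thesis unfolding AT_inf_iff using volterra_primitive(1)[OF fh g] le_less_trans[OF bd[OF f]] by blast
    qed
    have zer: "volterra g f \<in> AT_zero q \<omega>" if f: "f \<in> AT_zero p \<omega>" for f
    proof -
      have fi: "f \<in> AT_inf p \<omega>" using f AT_zero_subset by blast
      obtain A where "0 < A" "tent_norm p \<omega> f \<le> ennreal A" using fin[OF fi] by blast
      hence "vanishing (\<lambda>b. ennreal (1 / (1 - cmod b)) * energy q (volterra g f) b)" by (intro zero[OF g f _ B])
      thus ?thesis using vanishing_energy_iff[OF q inf[OF fi]] by blast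
    qed
    show ?thesis unfolding bounded_operator_def using bd inf zer AT_zero_subset by blast
  qed
  have neces: "Q g < \<infinity>" if g: "hol g" and b: "bounded_inf p q g \<or> bounded_zero p q g" for g
  proof -
    \<comment> \<open>Either kind of boundedness gives the norm inequality on the little space,
      which is contained in the large one.\<close>
    have "\<exists>C. \<forall>f\<in>AT_zero p \<omega>. tent_norm q \<omega> (volterra g f) \<le> ennreal C * tent_norm p \<omega> f"
      using b AT_zero_subset unfolding bounded_operator_def by (meson subsetD)
    then obtain C where C: "\<And>f. f \<in> AT_zero p \<omega> \<Longrightarrow> tent_norm q \<omega> (volterra g f) \<le> ennreal C * tent_norm p \<omega> f" by blast
    \<comment> \<open>The constant of a bounded operator is an arbitrary real; a negative one counts
      as 0 in \<open>ennreal\<close>.\<close>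
    have "Q g \<le> ennreal (K2 * max C 0)"
    proof (rule nec[OF g])
      fix f assume f: "f \<in> AT_zero p \<omega>" "tent_norm p \<omega> f \<le> 1"
      have "tent_norm q \<omega> (volterra g f) \<le> ennreal C * 1" by (rule order_trans[OF C[OF f(1)] mult_left_mono[OF f(2)]]) simp
      also have "... \<le> ennreal (max C 0)" by (simp add: ennreal_leI)
      finally show "tent_norm q \<omega> (volterra g f) \<le> ennreal (max C 0)" .
    qed simp
    thus ?thesis by (auto intro: le_less_trans)
  qed
  show "(\<forall>g. hol g \<longrightarrow> (bounded_inf p q g \<longleftrightarrow> bounded_zero p q g) \<and> (bounded_inf p q g \<longleftrightarrow> Q g < \<infinity>))"
    using suff neces by blast
  define C where "C = max K1 K2"
  have C: "0 < C" "K1 \<le> C" "K2 \<le> C" unfolding C_def using K by auto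
  show "\<exists>C>0. \<forall>g. hol g \<longrightarrow> bounded_inf p q g \<longrightarrow>
      comparable_within C (volterra_norm p q g) (Q g)"
  proof (intro exI[of _ C] conjI allI impI C(1))
    fix g assume g: "hol g" and b: "bounded_inf p q g"
    define N where "N = volterra_norm p q g"
    have le_N: "tent_norm q \<omega> (volterra g f) \<le> N" if "f \<in> AT_inf p \<omega>" "tent_norm p \<omega> f \<le> 1" for f
      unfolding N_def operator_norm_def using that by (intro SUP_upper) auto
    have N_le: "N \<le> ennreal K1 * Q g"
      unfolding N_def operator_norm_def
    proof (rule SUP_least)
      fix f assume f: "f \<in> {f \<in> AT_inf p \<omega>. tent_norm p \<omega> f \<le> 1}"
      show "tent_norm q \<omega> (volterra g f) \<le> ennreal K1 * Q g"
      proof (rule le_of_le_all_larger[OF K(1)])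
        fix B assume B: "0 < B" "Q g \<le> ennreal B"
        show "tent_norm q \<omega> (volterra g f) \<le> ennreal (K1 * B)" using bound[OF g _ _ B, of f 1] f unfolding AT_inf_iff by simp
      qed
    qed
    have "N < \<infinity>" using N_le neces[OF g] b by (auto simp: ennreal_mult_less_top intro: le_less_trans)
    then obtain r where r: "0 \<le> r" "N = ennreal r" by (cases N) auto
    \<comment> \<open>Functions of the little space are admissible in the supremum that defines the
      norm on the large one.\<close>
    have "Q g \<le> ennreal (K2 * r)" by (rule nec[OF g r(1)]) (use le_N AT_zero_subset r in blast)
    also have "... \<le> ennreal (C * r)" using C r by (intro ennreal_leI mult_right_mono) auto
    also have "... = ennreal C * N" unfolding r(2) using C by (intro ennreal_mult') simp
    finally have 1: "Q g \<le> ennreal C * N" .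
    have "N \<le> ennreal C * Q g" by (rule order_trans[OF N_le]) (intro mult_right_mono ennreal_leI C, simp)
    hence "ennreal (1 / C) * N \<le> ennreal (1 / C) * (ennreal C * Q g)" by (rule mult_left_mono) simp
    also have "... = ennreal (1 / C * C) * Q g" using C by (subst ennreal_mult') (auto simp: mult.assoc)
    also have "... = Q g" using C by simp
    finally show "comparable_within C (volterra_norm p q g) (Q g)"
      using 1 unfolding comparable_within_def N_def by blast
  qed
qed

lemma volterra_bloch:
  assumes p: "0 < p" and pq: "p \<le> q"
  shows "(\<forall>g. hol g \<longrightarrow>
          (bounded_inf p q g \<longleftrightarrow> bounded_zero p q g) \<and>
          (bounded_inf p q g \<longleftrightarrow> bloch_sup p q \<omega> g < \<infinity>))"
    and "\<exists>C>0. \<forall>g. hol g \<longrightarrow>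
          bounded_inf p q g \<longrightarrow>
          comparable_within C (volterra_norm p q g) (bloch_sup p q \<omega> g)"
proof -
  have q: "0 < q" using p pq by simp
  obtain K1 where K1: "0 < K1" "\<And>g f A B. hol g \<Longrightarrow> hol f \<Longrightarrow> 0 < A \<Longrightarrow> 0 < B \<Longrightarrow>
      bloch_sup p q \<omega> g \<le> ennreal B \<Longrightarrow> tent_norm p \<omega> f \<le> ennreal A \<Longrightarrow> tent_norm q \<omega> (volterra g f) \<le> ennreal (K1 * B * A)"
    "\<And>g f A B. hol g \<Longrightarrow> f \<in> AT_zero p \<omega> \<Longrightarrow> 0 < A \<Longrightarrow> 0 < B \<Longrightarrow>
      bloch_sup p q \<omega> g \<le> ennreal B \<Longrightarrow> tent_norm p \<omega> f \<le> ennreal A \<Longrightarrow>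
      vanishing (\<lambda>b. ennreal (1 / (1 - cmod b)) * energy q (volterra g f) b)"
    by (fact volterra_bounded_bloch[OF p pq])
  obtain K2 where K2: "0 < K2" "\<And>g c. hol g \<Longrightarrow> 0 \<le> c \<Longrightarrow>
    (\<And>f. f \<in> AT_zero p \<omega> \<Longrightarrow> tent_norm p \<omega> f \<le> 1 \<Longrightarrow> tent_norm q \<omega> (volterra g f) \<le> ennreal c) \<Longrightarrow>
    bloch_sup p q \<omega> g \<le> ennreal (K2 * c)"
    by (fact bloch_sup_le_volterra[OF p q])
  note * = volterra_characterization[where q=q and p=p and Q="bloch_sup p q \<omega>" and ?K1.0=K1 and ?K2.0=K2, OF q K1(1) K2(1)]
  show "(\<forall>g. hol g \<longrightarrow>
          (bounded_inf p q g \<longleftrightarrow> bounded_zero p q g) \<and>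
          (bounded_inf p q g \<longleftrightarrow> bloch_sup p q \<omega> g < \<infinity>))"
    by (rule *(1)) (fact K1 K2)+
  show "\<exists>C>0. \<forall>g. hol g \<longrightarrow>
          bounded_inf p q g \<longrightarrow>
          comparable_within C (volterra_norm p q g) (bloch_sup p q \<omega> g)"
    by (rule *(2)) (fact K1 K2)+
qed

lemma volterra_tent:
  assumes q: "0 < q" "q < p" and s: "s = p * q / (p - q)"
  shows "(\<forall>g. hol g \<longrightarrow>
          (bounded_inf p q g \<longleftrightarrow> bounded_zero p q g) \<and>
          (bounded_inf p q g \<longleftrightarrow> g \<in> AT_inf s \<omega>))"
    and "\<exists>C>0. \<forall>g. hol g \<longrightarrow>
          bounded_inf p q g \<longrightarrow>
          comparable_within C (volterra_norm p q g) (tent_norm s \<omega> (\<lambda>z. g z - g 0))"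
proof -
  have sp: "0 < s" unfolding s using q by simp
  obtain K1 where K1: "0 < K1" "\<And>g f A B. hol g \<Longrightarrow> hol f \<Longrightarrow> 0 < A \<Longrightarrow> 0 < B \<Longrightarrow>
      tent_norm s \<omega> (\<lambda>z. g z - g 0) \<le> ennreal B \<Longrightarrow> tent_norm p \<omega> f \<le> ennreal A \<Longrightarrow> tent_norm q \<omega> (volterra g f) \<le> ennreal (K1 * B * A)"
    "\<And>g f A B. hol g \<Longrightarrow> f \<in> AT_zero p \<omega> \<Longrightarrow> 0 < A \<Longrightarrow> 0 < B \<Longrightarrow>
      tent_norm s \<omega> (\<lambda>z. g z - g 0) \<le> ennreal B \<Longrightarrow> tent_norm p \<omega> f \<le> ennreal A \<Longrightarrow>
      vanishing (\<lambda>b. ennreal (1 / (1 - cmod b)) * energy q (volterra g f) b)"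
    by (fact volterra_bounded_tent[OF q s])
  obtain K2 where K2: "0 < K2" "\<And>g c. hol g \<Longrightarrow> 0 \<le> c \<Longrightarrow>
    (\<And>f. f \<in> AT_zero p \<omega> \<Longrightarrow> tent_norm p \<omega> f \<le> 1 \<Longrightarrow> tent_norm q \<omega> (volterra g f) \<le> ennreal c) \<Longrightarrow>
    tent_norm s \<omega> (\<lambda>z. g z - g 0) \<le> ennreal (K2 * c)"
    by (fact tent_norm_le_volterra[OF q s])
  note * = volterra_characterization[where q=q and p=p and Q="\<lambda>g. tent_norm s \<omega> (\<lambda>z. g z - g 0)" and ?K1.0=K1 and ?K2.0=K2, OF q(1) K1(1) K2(1)]
  show "(\<forall>g. hol g \<longrightarrow>
          (bounded_inf p q g \<longleftrightarrow> bounded_zero p q g) \<and>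
          (bounded_inf p q g \<longleftrightarrow> g \<in> AT_inf s \<omega>))"
  proof -
    have "\<forall>g. hol g \<longrightarrow>
          (bounded_inf p q g \<longleftrightarrow> bounded_zero p q g) \<and>
          (bounded_inf p q g \<longleftrightarrow> tent_norm s \<omega> (\<lambda>z. g z - g 0) < \<infinity>)"
      by (rule *(1)) (fact K1 K2)+
    thus ?thesis using AT_inf_iff_increment[OF sp] by blast
  qed
  show "\<exists>C>0. \<forall>g. hol g \<longrightarrow>
          bounded_inf p q g \<longrightarrow>
          comparable_within C (volterra_norm p q g) (tent_norm s \<omega> (\<lambda>z. g z - g 0))"
    by (rule *(2)) (fact K1 K2)+
qed

end

theorem theorem1p3:
  fixes p q :: real and \<omega> :: "complex \<Rightarrow> real"
  assumes "0 < p" and "0 < q" and "\<omega> \<in> D_class"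
  shows
    "(p \<le> q \<longrightarrow>
       (\<forall>g. g holomorphic_on unit_disk \<longrightarrow>
          (bounded_operator (AT_inf p \<omega>) (tent_norm p \<omega>) (AT_inf q \<omega>) (tent_norm q \<omega>) (volterra g)
             \<longleftrightarrow> bounded_operator (AT_zero p \<omega>) (tent_norm p \<omega>) (AT_zero q \<omega>) (tent_norm q \<omega>) (volterra g)) \<and>
          (bounded_operator (AT_inf p \<omega>) (tent_norm p \<omega>) (AT_inf q \<omega>) (tent_norm q \<omega>) (volterra g)
             \<longleftrightarrow> bloch_sup p q \<omega> g < \<infinity>)) \<and>
       (\<exists>C>0. \<forall>g. g holomorphic_on unit_disk \<longrightarrow>
          bounded_operator (AT_inf p \<omega>) (tent_norm p \<omega>) (AT_inf q \<omega>) (tent_norm q \<omega>) (volterra g) \<longrightarrow>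
          comparable_within C
            (operator_norm (AT_inf p \<omega>) (tent_norm p \<omega>) (tent_norm q \<omega>) (volterra g))
            (bloch_sup p q \<omega> g)))
     \<and>
     (p > q \<longrightarrow>
       (\<forall>g. g holomorphic_on unit_disk \<longrightarrow>
          (bounded_operator (AT_inf p \<omega>) (tent_norm p \<omega>) (AT_inf q \<omega>) (tent_norm q \<omega>) (volterra g)
             \<longleftrightarrow> bounded_operator (AT_zero p \<omega>) (tent_norm p \<omega>) (AT_zero q \<omega>) (tent_norm q \<omega>) (volterra g)) \<and>
          (bounded_operator (AT_inf p \<omega>) (tent_norm p \<omega>) (AT_inf q \<omega>) (tent_norm q \<omega>) (volterra g)
             \<longleftrightarrow> g \<in> AT_inf (p * q / (p - q)) \<omega>)) \<and>
       (\<exists>C>0. \<forall>g. g holomorphic_on unit_disk \<longrightarrow>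
          bounded_operator (AT_inf p \<omega>) (tent_norm p \<omega>) (AT_inf q \<omega>) (tent_norm q \<omega>) (volterra g) \<longrightarrow>
          comparable_within C
            (operator_norm (AT_inf p \<omega>) (tent_norm p \<omega>) (tent_norm q \<omega>) (volterra g))
            (tent_norm (p * q / (p - q)) \<omega> (\<lambda>z. g z - g 0))))"
proof (rule D_class_profile[OF assms(3)])
  fix \<phi> w C0 \<alpha> \<beta> K c assume tw: "tent_weight w C0 \<alpha> \<beta> \<phi> K c"
    and ae: "AE z in lborel. z \<in> unit_disk \<longrightarrow> \<omega> z = \<phi> (cmod z)"
    and hat: "\<And>z. cmod z < 1 \<Longrightarrow> w (cmod z) = enn2real (omega_hat \<omega> z)"
  interpret tent_space w C0 \<alpha> \<beta> \<phi> K c \<omega>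
    using tw ae hat unfolding tent_space_def tent_space_axioms_def by blast
  show ?thesis
    using volterra_bloch[OF assms(1), of q] volterra_tent[OF assms(2) _ refl, of p] by auto
qed

end
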